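(* Let $(\mathcal{P},\mathcal{N})$ be a Beurling number system with $N_{\mathcal{P}}(x)=Ax+O(x^\theta)$ for some $A>0$, $\theta\in[0,1)$, and suppose that for some $0<B<1/2$, \[ \zeta_{\mathcal{P}}\Bigl(\tfrac{1+\theta}{2}+\mathrm{i}t\Bigr)\ll_B|t|^{B}\quad(|t|\ge1). \] Then, for $T\ge2$, uniformly for $\alpha\ge\frac{1+\theta}{2}$, \[ N(\zeta_{\mathcal{P}};\alpha,T)\ll_B T^{\frac{2(1+2B)(1-\alpha)}{1-\theta}}(\log T)^{9}, \] and uniformly for $\alpha\ge\frac{3+\theta}{4}$, \[ N(\zeta_{\mathcal{P}};\alpha,T)\ll_B T^{\frac{8B(3\alpha-2-\theta)(1-\alpha)}{(2\alpha-1-\theta)(4\alpha-3-\theta)}}(\log T)^{O_B(1)}. \]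
   Context: A Beurling number system $(\mathcal{P},\mathcal{N})$: generalized primes $1<p_1\le p_2\le\dots$, $p_j\to\infty$, and generalized integers $(n_j)$ = all finite products of generalized primes (including $1$), non-decreasing, with multiplicity; $N_{\mathcal{P}}(x)=\#\{j:n_j\le x\}$. $\zeta_{\mathcal{P}}(s)=\sum_j n_j^{-s}$ for $\Re s>1$, continued meromorphically to $\Re s>\theta$ (only a simple pole at $s=1$). $N(\zeta_{\mathcal{P}};\alpha,T)$ is the number of zeros $\beta+\mathrm{i}\gamma$ of $\zeta_{\mathcal{P}}$ with $\beta\ge\alpha$, $|\gamma|\le T$, counted with multiplicity. Implied constants may depend on the system and on $B$. *)

theory Defs
  imports
    "HOL-Complex_Analysis.Complex_Analysis"
    "HOL-Library.Multiset"
    "HOL-Library.Landau_Symbols"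
begin

definition beurling_primes :: "(nat \<Rightarrow> real) \<Rightarrow> bool" where
  "beurling_primes p \<longleftrightarrow> 1 < p 0 \<and> incseq p \<and> filterlim p at_top sequentially"

text \<open>
  Generalized integers are indexed by finite multisets of prime indices (the empty multiset
  giving 1). Distinct multisets count as distinct generalized integers even if the real values
  coincide, which is the counting with multiplicity.
\<close>

definition gen_int :: "(nat \<Rightarrow> real) \<Rightarrow> nat multiset \<Rightarrow> real" where
  "gen_int p M = (\<Prod>j\<in>#M. p j)"

definition gen_int_count :: "(nat \<Rightarrow> real) \<Rightarrow> real \<Rightarrow> nat" where
  "gen_int_count p x = card {M. gen_int p M \<le> x}"

text \<open>
  The series is absolutely convergent for \<open>Re s > 1\<close> when \<open>gen_int_count p x = O(x)\<close>, so the
  unordered sum agrees with the sum along the non-decreasing enumeration.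
\<close>

definition zeta_series :: "(nat \<Rightarrow> real) \<Rightarrow> complex \<Rightarrow> complex" where
  "zeta_series p s = (\<Sum>\<^sub>\<infinity>M. complex_of_real (gen_int p M) powr (- s))"

definition zeta_continuation :: "(nat \<Rightarrow> real) \<Rightarrow> real \<Rightarrow> (complex \<Rightarrow> complex) \<Rightarrow> bool" where
  "zeta_continuation p \<theta> f \<longleftrightarrow>
     f holomorphic_on ({s. \<theta> < Re s} - {1}) \<and> is_pole f 1 \<and> zorder f 1 = -1 \<and>
     (\<forall>s. 1 < Re s \<longrightarrow> f s = zeta_series p s)"

lemma zeta_continuation_unique:
  assumes "zeta_continuation p \<theta> f" "zeta_continuation p \<theta> g"
    and "\<theta> < 1" "\<theta> < Re s" "s \<noteq> 1"
  shows "f s = g s"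
proof -
  let ?D = "{s. \<theta> < Re s} - {1::complex}"
  have D: "open ?D"
    by (rule open_Diff[OF open_halfspace_Re_gt closed_singleton])
  have "connected {s. \<theta> < Re s}"
    by (rule convex_connected[OF convex_halfspace_Re_gt])
  then have conn: "connected ?D"
    by (intro connected_open_delete[OF open_halfspace_Re_gt]) simp_all
  have "open {s. 1 < Re s}"
    by (rule open_halfspace_Re_gt)
  moreover have "{s. 1 < Re s} \<noteq> {}"
    by (metis (mono_tags) complex.sel(1) empty_iff less_add_one mem_Collect_eq)
  moreover have "{s. 1 < Re s} \<subseteq> ?D"
    using \<open>\<theta> < 1\<close> by auto
  moreover have "f holomorphic_on ?D" "g holomorphic_on ?D"
    using assms(1,2) by (simp_all add: zeta_continuation_def)
  moreover have "f z = g z" if "z \<in> {s. 1 < Re s}" for z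
    using assms(1,2) that by (simp add: zeta_continuation_def)
  moreover have "s \<in> ?D"
    using assms(4,5) by simp
  ultimately show ?thesis
    using D conn analytic_continuation_open[of "{s. 1 < Re s}" ?D f g s] by blast
qed

text \<open>
  By the lemma above, the values on \<open>\<theta> < Re s\<close>, \<open>s \<noteq> 1\<close> do not depend on the choice;
  a continuation exists when \<open>gen_int_count p x = A x + O(x powr \<theta>)\<close> with \<open>A > 0\<close> and \<open>\<theta> < 1\<close>.
  The value at the pole \<open>s = 1\<close> and the values on \<open>Re s \<le> \<theta>\<close> are meaningless.
\<close>

definition beurling_zeta :: "(nat \<Rightarrow> real) \<Rightarrow> real \<Rightarrow> complex \<Rightarrow> complex" where
  "beurling_zeta p \<theta> = (SOME f. zeta_continuation p \<theta> f)"

text \<open>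
  The point 1 is excluded since it is the pole, where the value of the HOL function carries no
  information. Only \<open>\<alpha> > \<theta>\<close> is meaningful.
\<close>

definition zeta_zeros :: "(nat \<Rightarrow> real) \<Rightarrow> real \<Rightarrow> real \<Rightarrow> real \<Rightarrow> complex set" where
  "zeta_zeros p \<theta> \<alpha> T =
     {\<rho>. \<rho> \<noteq> 1 \<and> beurling_zeta p \<theta> \<rho> = 0 \<and> \<alpha> \<le> Re \<rho> \<and> \<bar>Im \<rho>\<bar> \<le> T}"

definition zeta_zero_count :: "(nat \<Rightarrow> real) \<Rightarrow> real \<Rightarrow> real \<Rightarrow> real \<Rightarrow> nat" where
  "zeta_zero_count p \<theta> \<alpha> T = (\<Sum>\<rho>\<in>zeta_zeros p \<theta> \<alpha> T. nat (zorder (beurling_zeta p \<theta>) \<rho>))"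

end

theory Submission imports Defs "HOL-Probability.Probability"
begin

text \<open>
  Zeros are detected with a mollifier. Let $M(s)$ be the Dirichlet polynomial of the Moebius function
  over generalized integers up to $X$. Then $\zeta M - 1$ equals $-1$ at a zero $\rho$ and is a Dirichlet
  series supported on $n > X$ for $\mathrm{Re}\, s > 1$. Integrating it against
  $Y^{s-\rho} e^{(s-\rho)^2}/(s-\rho)$ over the two sides of a vertical strip shows that it must be large
  near $\rho$ on the critical line $\mathrm{Re}\, s = (1+\theta)/2$ or on a line to the right of $1$.
  Jensen's inequality bounds the zeros in a short window, so it suffices to count well spaced zeros.

  For the first estimate both possibilities are controlled in mean square. The only input is the
  distribution of the generalized integers: a Gaussian weight and the bound for $N(x) - Ax$ replace
  the spacing of the integers in the classical mean value theorem.

  For the second estimate the part of $\zeta M - 1$ with $X < n \le Y$ is subtracted as well. Each zero then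
  makes one of four Dirichlet polynomials large: on the critical line, at the zero, or on
  $\mathrm{Re}\, s = 3$. The number of such points is bounded by the Halasz--Montgomery method; its
  off-diagonal terms are values of $\zeta$ on the critical line, reached by a contour shift,
  and hence of size $T^B$. The parameters $X$ and $Y$ are chosen so that these terms are absorbed.
\<close>

subsection \<open>Generalized integers\<close>

text \<open>Two features of the setting shape the proof. Generalized integers may coincide or lie
  arbitrarily close together, so mean values carry the weight
  \<open>g M + T * g M powr \<theta>\<close>: the second term dominates below T^(1 / (1 - \<theta>))
  and the first above, and this crossover is X in the first estimate. Off the critical line only
  linear growth of zeta is available, so horizontal sides of contours are discarded with a factor
  beating every power of T: the Gaussian at distance ln T gives exp (- (ln T)^2). Hence windows of
  half-height ln T, zeros spaced by 4 ln T, and a trivial count of the zeros below height ln T + 2,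
  whose windows come near the pole. The power 9 is 2 for passing to spaced zeros, 4 for the mean
  square of the divisor function, 2 for the distance 1 / ln T between the right line and 1, and 1
  for Cauchy-Schwarz over a window. Both arguments degenerate at the left end of their range. Near
  the critical line the detection kernel is unbounded, but the trivial count suffices; near (3 +
  \<theta>) / 4 the parameters of the second argument blow up, but there the first estimate is
  stronger.\<close>

lemma beurling_primes_gt_1: "beurling_primes p \<Longrightarrow> 1 < p j"
  unfolding beurling_primes_def by (meson incseq_def le0 less_le_trans)

lemma gen_int_empty [simp]: "gen_int p {#} = 1"
  by (simp add: gen_int_def)

lemma gen_int_add: "gen_int p (M + N) = gen_int p M * gen_int p N"
  by (simp add: gen_int_def)

lemma gen_int_ge_1: "beurling_primes p \<Longrightarrow> 1 \<le> gen_int p M"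
proof (induction M)
  case (add j M)
  have "1 * 1 \<le> p j * gen_int p M"
    by (rule mult_mono) (use add beurling_primes_gt_1[of p j] in auto)
  then show ?case
    by (simp add: gen_int_def)
qed simp

lemma gen_int_mono:
  assumes "beurling_primes p" "N \<subseteq># M"
  shows "gen_int p N \<le> gen_int p M"
proof -
  have "gen_int p N * 1 \<le> gen_int p N * gen_int p (M - N)"
    using gen_int_ge_1[OF assms(1), of "M - N"] gen_int_ge_1[OF assms(1), of N]
    by (intro mult_left_mono) auto
  also have "\<dots> = gen_int p M"
    using assms(2) by (simp flip: gen_int_add)
  finally show ?thesis by simp
qed

lemma power_size_le_gen_int:
  assumes "beurling_primes p"
  shows "p 0 ^ size M \<le> gen_int p M"
proof (induction M)
  case (add j M)
  have "p 0 \<le> p j"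
    using assms by (auto simp: beurling_primes_def incseq_def)
  then have "p 0 * p 0 ^ size M \<le> p j * gen_int p M"
    using add beurling_primes_gt_1[OF assms, of j] beurling_primes_gt_1[OF assms, of 0]
    by (intro mult_mono) auto
  then show ?case by (simp add: gen_int_def)
qed simp

text \<open>Two bounds confine the multiset: every index is below some J because the primes tend to
  infinity, and the size is at most K because each factor is at least \<open>p 0\<close>, which
  exceeds 1.\<close>

lemma finite_gen_int_le:
  assumes p: "beurling_primes p"
  shows "finite {M. gen_int p M \<le> x}"
proof -
  obtain J where J: "\<And>j. j \<ge> J \<Longrightarrow> x < p j"
    using p unfolding beurling_primes_def filterlim_at_top_dense eventually_sequentially by blast
  obtain K where K: "x < p 0 ^ K"
    using real_arch_pow[OF beurling_primes_gt_1[OF p]] by blast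
  have "{M. gen_int p M \<le> x} \<subseteq> (\<Union>n\<le>K. multisets_of_size {..<J} n)"
  proof
    fix M assume "M \<in> {M. gen_int p M \<le> x}"
    then have M: "gen_int p M \<le> x" by simp
    have "j < J" if "j \<in># M" for j
    proof -
      have "gen_int p {#j#} \<le> gen_int p M"
        using that by (intro gen_int_mono[OF p]) simp
      then show ?thesis
        using J[of j] M by (auto simp: gen_int_def not_le[symmetric])
    qed
    moreover have "size M \<le> K"
    proof (rule ccontr)
      assume "\<not> size M \<le> K"
      then have "p 0 ^ K \<le> p 0 ^ size M"
        using beurling_primes_gt_1[OF p, of 0] by (intro power_increasing) auto
      then show False
        using power_size_le_gen_int[OF p, of M] M K by linarith
    qed
    ultimately show "M \<in> (\<Union>n\<le>K. multisets_of_size {..<J} n)"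
      by (auto simp: multisets_of_size_def)
  qed
  then show ?thesis
    by (rule finite_subset) auto
qed

lemma gen_int_count_mono:
  "beurling_primes p \<Longrightarrow> x \<le> y \<Longrightarrow> gen_int_count p x \<le> gen_int_count p y"
  unfolding gen_int_count_def by (intro card_mono finite_gen_int_le) auto

text \<open>The asymptotic formula becomes a bound at every positive x, since later it is evaluated
  at points that may lie below 1. There the count is 0 and x is at most
  \<open>x powr \<theta>\<close>; between 1 and x0 both terms are bounded.\<close>

lemma gen_int_count_bound_all:
  assumes p: "beurling_primes p" and A: "0 < A" and th: "0 \<le> \<theta>" "\<theta> < 1"
    and O: "(\<lambda>x. real (gen_int_count p x) - A * x) \<in> O[at_top](\<lambda>x. x powr \<theta>)"
  obtains C0 where "0 < C0"
    "\<And>x. 0 < x \<Longrightarrow> \<bar>real (gen_int_count p x) - A * x\<bar> \<le> C0 * x powr \<theta>"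
proof -
  from O obtain c where c: "c > 0"
      "\<forall>\<^sub>F x in at_top. norm (real (gen_int_count p x) - A * x) \<le> c * norm (x powr \<theta>)"
    by (rule landau_o.bigE)
  then obtain x0 where x0: "\<And>x. x \<ge> x0 \<Longrightarrow> \<bar>real (gen_int_count p x) - A * x\<bar> \<le> c * x powr \<theta>"
    unfolding eventually_at_top_linorder by auto
  define x1 where "x1 = \<bar>x0\<bar>"
  define C0 where "C0 = c + A + real (gen_int_count p x0) + A * x1"
  show ?thesis
  proof
    show "0 < C0" using c A by (auto simp: C0_def x1_def intro!: add_pos_nonneg)
    fix x :: real assume x: "0 < x"
    consider "x \<ge> x0" | "x < x0" "x < 1" | "x < x0" "x \<ge> 1" by linarith
    then show "\<bar>real (gen_int_count p x) - A * x\<bar> \<le> C0 * x powr \<theta>"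
    proof cases
      case 1
      have "c * x powr \<theta> \<le> C0 * x powr \<theta>"
        using A by (intro mult_right_mono) (auto simp: C0_def x1_def)
      then show ?thesis using x0[OF 1] by linarith
    next
      case 2
      have "{M. gen_int p M \<le> x} = {}"
        using gen_int_ge_1[OF p] 2 by (force simp: not_le intro: less_le_trans)
      then have "gen_int_count p x = 0" by (simp add: gen_int_count_def)
      moreover have "x powr 1 \<le> x powr \<theta>"
        using 2 x th by (intro powr_mono') auto
      moreover have "A * x powr \<theta> \<le> C0 * x powr \<theta>"
        using A c by (intro mult_right_mono) (auto simp: C0_def x1_def)
      moreover have "A * x \<le> A * x powr \<theta>"
        using calculation(2) A x by (intro mult_left_mono) auto
      ultimately have "gen_int_count p x = 0" "A * x \<le> C0 * x powr \<theta>"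
        by linarith+
      then show ?thesis
        using A x by (simp add: abs_mult)
    next
      case 3
      have "real (gen_int_count p x) \<le> real (gen_int_count p x0)"
        using 3 by (intro of_nat_mono gen_int_count_mono[OF p]) auto
      moreover have "A * x \<le> A * x1" "0 \<le> A * x" using 3 A by (auto simp: x1_def)
      ultimately have "\<bar>real (gen_int_count p x) - A * x\<bar> \<le> C0 * 1"
        using c(1) A x of_nat_0_le_iff[of "gen_int_count p x", where 'a = real]
        unfolding C0_def mult_1_right abs_le_iff by (intro conjI; linarith)
      also have "\<dots> \<le> C0 * x powr \<theta>"
        using 3 th c A by (intro mult_left_mono) (auto simp: C0_def x1_def ge_one_powr_ge_zero)
      finally show ?thesis .
    qed
  qed
qed

locale beurling_system =
  fixes p :: "nat \<Rightarrow> real" and A \<theta> C0 :: real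
  assumes primes: "beurling_primes p" and A_pos: "0 < A" and C0_pos: "0 < C0"
    and theta_nonneg: "0 \<le> \<theta>" and theta_less_1: "\<theta> < 1"
    and count_bound: "0 < x \<Longrightarrow> \<bar>real (gen_int_count p x) - A * x\<bar> \<le> C0 * x powr \<theta>"
begin

abbreviation g :: "nat multiset \<Rightarrow> real" where "g \<equiv> gen_int p"

abbreviation \<sigma>\<^sub>0 :: real where "\<sigma>\<^sub>0 \<equiv> (1 + \<theta>) / 2"

definition dterm :: "nat multiset \<Rightarrow> complex \<Rightarrow> complex" where
  "dterm M s = complex_of_real (g M) powr (- s)"

lemma g_ge_1: "1 \<le> g M"
  by (rule gen_int_ge_1[OF primes])

lemma g_pos [simp]: "0 < g M"
  using g_ge_1[of M] by linarith

lemma g_nonneg [simp]: "0 \<le> g M"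
  using g_ge_1[of M] by linarith

lemma g_nonzero [simp]: "g M \<noteq> 0"
  using g_ge_1[of M] by linarith

lemma dterm_empty [simp]: "dterm {#} s = 1"
  by (simp add: dterm_def)

lemma dterm_add: "dterm (M + N) s = dterm M s * dterm N s"
  by (simp add: dterm_def gen_int_add powr_times_real)

lemma norm_dterm: "norm (dterm M s) = g M powr - Re s"
  by (simp add: dterm_def norm_powr_real_powr)

lemma dterm_exp: "dterm M s = exp (- s * complex_of_real (ln (g M)))"
  by (simp add: dterm_def powr_def Ln_of_real)

lemma dterm_add_exponent: "dterm M (s + z) = dterm M s * dterm M z"
  by (simp add: dterm_exp exp_add[symmetric] algebra_simps)

lemma dterm_holomorphic [holomorphic_intros]: "(\<lambda>s. dterm M s) holomorphic_on S"
  unfolding dterm_exp by (intro holomorphic_intros)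

lemma dterm_continuous [continuous_intros]:
  "continuous_on S f \<Longrightarrow> continuous_on S (\<lambda>x. dterm M (f x))"
  unfolding dterm_exp by (intro continuous_intros)

lemma finite_g_le [simp]: "finite {M. g M \<le> x}"
  by (rule finite_gen_int_le[OF primes])

lemma count_le: "1 \<le> x \<Longrightarrow> real (gen_int_count p x) \<le> (A + C0) * x"
proof -
  assume x: "1 \<le> x"
  have "x powr \<theta> \<le> x powr 1"
    using x theta_less_1 by (intro powr_mono) auto
  then have "C0 * x powr \<theta> \<le> C0 * x"
    using C0_pos x by (intro mult_left_mono) auto
  then show ?thesis
    using count_bound[of x] x by (auto simp: algebra_simps)
qed

subsection \<open>Analytic continuation\<close>

text \<open>Ties in value are broken by an injection into the naturals. This gives a strict total
  order in which every element has finitely many predecessors; the number of predecessors is then a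
  bijection onto the naturals, and its inverse lists the generalized integers in nondecreasing
  order.\<close>

lemma enumeration:
  obtains e :: "nat \<Rightarrow> nat multiset" where "bij e" "mono (\<lambda>j. g (e j))"
proof -
  have "UNIV = (\<Union>n. {M. g M \<le> real n})"
    using real_arch_simple by blast
  moreover have "countable (\<Union>n::nat. {M. g M \<le> real n})"
    by (rule countable_UN) (simp_all add: countable_finite)
  ultimately have "countable (UNIV :: nat multiset set)"
    by simp
  then obtain c :: "nat multiset \<Rightarrow> nat" where c: "inj c"
    unfolding countable_def by blast
  define R where "R M N \<longleftrightarrow> g M < g N \<or> (g M = g N \<and> c M < c N)" for M N
  have total: "R M N \<or> R N M" if "M \<noteq> N" for M N
    using injD[OF c, of M N] that unfolding R_def by linarith
  have irrefl: "\<not> R M M" for M by (auto simp: R_def)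
  have trans: "R M K" if "R M N" "R N K" for M N K
    using that unfolding R_def by auto
  have fin: "finite {N. R N M}" for M
    by (rule finite_subset[OF _ finite_g_le[of "g M"]]) (auto simp: R_def)
  define r where "r M = card {N. R N M}" for M
  have r_less: "r M < r N" if "R M N" for M N
    unfolding r_def using that trans irrefl by (intro psubset_card_mono fin) blast
  have inj: "inj r"
    using r_less total by (intro injI) (metis less_irrefl)
  \<comment> \<open>The rank maps the predecessors of M injectively into \<open>{..<r M}\<close>,
    and both sets have \<open>r M\<close> elements. Since ranks are unbounded, every number is a
    rank.\<close>
  have image: "r ` {N. R N M} = {..<r M}" for M
  proof (rule card_subset_eq)
    show "card (r ` {N. R N M}) = card {..<r M}"
      using inj by (subst card_image) (auto simp: r_def inj_on_def)
  qed (auto intro: r_less)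
  have "surj r"
  proof -
    have "infinite (UNIV :: nat multiset set)"
    proof
      assume "finite (UNIV :: nat multiset set)"
      then have "finite (range (\<lambda>n::nat. {#n#}))" by (rule finite_subset[rotated]) auto
      moreover have "inj (\<lambda>n::nat. {#n#})" by (auto intro: injI)
      ultimately show False using finite_imageD by blast
    qed
    then have "infinite (range r)"
      using inj finite_imageD by blast
    have "\<exists>x. n = r x" for n
    proof -
      obtain M where "n < r M"
        using \<open>infinite (range r)\<close> unfolding infinite_nat_iff_unbounded by blast
      then show ?thesis
        using image[of M] by (metis imageE lessThan_iff)
    qed
    then show ?thesis unfolding surj_def by blast
  qed
  then have b: "bij r" using inj by (simp add: bij_def)
  show ?thesis
  proof (rule that[of "inv r"])
    show "bij (inv r)" using b by (rule bij_imp_bij_inv)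
    show "mono (\<lambda>j. g (inv r j))"
    proof (rule monoI, rule ccontr)
      fix i j :: nat assume ij: "i \<le> j" "\<not> g (inv r i) \<le> g (inv r j)"
      then have "R (inv r j) (inv r i)" by (auto simp: R_def)
      from r_less[OF this] show False
        using ij \<open>surj r\<close> by (simp add: surj_f_inv_f)
    qed
  qed
qed

end

text \<open>On the ray from m the derivative -s z^(-s - 1) has norm at most |s| m^(-Re s - 1), and
  the ray is convex, so the mean value inequality applies.\<close>

lemma powr_real_diff_bound:
  assumes m: "0 < m" "m \<le> a" "m \<le> b" and s: "0 \<le> Re s"
  shows "norm (complex_of_real a powr - s - complex_of_real b powr - s)
           \<le> norm s * m powr (- Re s - 1) * \<bar>a - b\<bar>"
proof -
  let ?S = "complex_of_real ` {m..}"
  have conv: "convex ?S"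
    by (intro convex_linear_image bounded_linear.linear bounded_linear_of_real) auto
  have "norm (complex_of_real a powr - s - complex_of_real b powr - s)
          \<le> norm s * m powr (- Re s - 1) * norm (complex_of_real a - complex_of_real b)"
  proof (rule field_differentiable_bound[OF conv, where f' = "\<lambda>z. - s * z powr (- s - 1)"])
    fix z assume "z \<in> ?S"
    then obtain x where x: "z = complex_of_real x" "m \<le> x" by auto
    then have "z \<notin> \<real>\<^sub>\<le>\<^sub>0"
      using m by (simp add: complex_nonpos_Reals_iff)
    then show "((\<lambda>z. z powr - s) has_field_derivative - s * z powr (- s - 1)) (at z within ?S)"
      by (rule has_field_derivative_at_within[OF has_field_derivative_powr])
    have "norm (- s * z powr (- s - 1)) = norm s * x powr (- Re s - 1)"
      using x m by (simp add: norm_mult norm_powr_real_powr)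
    also have "\<dots> \<le> norm s * m powr (- Re s - 1)"
      using x m s by (intro mult_left_mono powr_mono2') auto
    finally show "norm (- s * z powr (- s - 1)) \<le> norm s * m powr (- Re s - 1)" .
  qed (use m in auto)
  then show ?thesis
    by (simp flip: of_real_diff)
qed

text \<open>The mean value inequality for z n^(-s) - z^(1 - s) / (1 - s), whose derivative is n^(-s)
  - z^(-s). The quotient is the integral of t^(-s) from x to y, so a value at n is compared with an
  integral without integrating.\<close>

lemma powr_integral_diff_bound:
  assumes m: "0 < m" "m \<le> n" "m \<le> x" "x \<le> y" and s: "0 \<le> Re s" "s \<noteq> 1"
    and D: "\<And>t. x \<le> t \<Longrightarrow> t \<le> y \<Longrightarrow> \<bar>n - t\<bar> \<le> D"
  shows "norm ((complex_of_real y - complex_of_real x) * complex_of_real n powr - s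
           - (complex_of_real y powr (1 - s) - complex_of_real x powr (1 - s)) / (1 - s))
         \<le> norm s * m powr (- Re s - 1) * D * (y - x)"
proof -
  let ?S = "complex_of_real ` {x..y}"
  let ?f = "\<lambda>z. z * complex_of_real n powr - s - z powr (1 - s) / (1 - s)"
  have conv: "convex ?S"
    by (intro convex_linear_image bounded_linear.linear bounded_linear_of_real) auto
  have "norm (?f y - ?f x)
          \<le> norm s * m powr (- Re s - 1) * D * norm (complex_of_real y - complex_of_real x)"
  proof (rule field_differentiable_bound[OF conv,
        where f' = "\<lambda>z. complex_of_real n powr - s - z powr - s"])
    fix z assume "z \<in> ?S"
    then obtain t where t: "z = complex_of_real t" "x \<le> t" "t \<le> y" by auto
    then have z: "z \<notin> \<real>\<^sub>\<le>\<^sub>0"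
      using m by (simp add: complex_nonpos_Reals_iff)
    have "(?f has_field_derivative 1 * complex_of_real n powr - s
             - (1 - s) * z powr (1 - s - 1) / (1 - s)) (at z)"
      by (rule DERIV_diff[OF DERIV_cmult_right[OF DERIV_ident]
            DERIV_cdivide[OF has_field_derivative_powr[OF z]]])
    from has_field_derivative_at_within[OF this, of ?S]
    show "(?f has_field_derivative complex_of_real n powr - s - z powr - s) (at z within ?S)"
      using s by simp
    have "norm (complex_of_real n powr - s - z powr - s)
            \<le> norm s * m powr (- Re s - 1) * \<bar>n - t\<bar>"
      unfolding t(1) using m t s by (intro powr_real_diff_bound) auto
    also have "\<dots> \<le> norm s * m powr (- Re s - 1) * D"
      using D t by (intro mult_left_mono) auto
    finally show "norm (complex_of_real n powr - s - z powr - s)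
                    \<le> norm s * m powr (- Re s - 1) * D" .
  qed (use m in auto)
  also have "norm (complex_of_real y - complex_of_real x) = y - x"
    using m by (simp flip: of_real_diff)
  finally show ?thesis
    by (simp add: algebra_simps diff_divide_distrib)
qed

lemma summable_Suc_powr: "s < -1 \<Longrightarrow> summable (\<lambda>j. real (Suc j) powr s)"
  using summable_real_powr_iff[of s] by (subst summable_Suc_iff) simp

section \<open>Comparison of the zeta series with an integral, term by term\<close>

context beurling_system
begin

definition enum :: "nat \<Rightarrow> nat multiset" where
  "enum = (SOME e. bij e \<and> mono (\<lambda>j. g (e j)))"

definition gint :: "nat \<Rightarrow> real" where "gint j = g (enum j)"

lemma enum: "bij enum" "mono gint"
proof -
  have "\<exists>e :: nat \<Rightarrow> nat multiset. bij e \<and> mono (\<lambda>j. g (e j))"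
    by (rule enumeration) blast
  from someI_ex[OF this] have "bij enum \<and> mono (\<lambda>j. g (enum j))"
    by (simp add: enum_def)
  then show "bij enum" "mono gint" by (simp_all add: gint_def[abs_def])
qed

lemma gint_ge_1: "1 \<le> gint j" by (simp add: gint_def g_ge_1)

lemma Suc_le_count: "real (Suc j) \<le> real (gen_int_count p (gint j))"
proof -
  have "card (enum ` {..j}) \<le> gen_int_count p (gint j)"
    unfolding gen_int_count_def using enum(2)
    by (intro card_mono) (auto simp: gint_def[symmetric] dest: monoD)
  moreover have "card (enum ` {..j}) = Suc j"
    using enum(1) by (subst card_image) (auto simp: bij_def inj_on_def)
  ultimately show ?thesis by simp
qed

text \<open>Strictness of \<open>y < gint j\<close> is what handles repeated values: at
  \<open>gint j\<close> itself the count jumps by the multiplicity and may be far above j.\<close>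

lemma count_less: "y < gint j \<Longrightarrow> real (gen_int_count p y) \<le> real j"
proof -
  assume y: "y < gint j"
  have "{M. g M \<le> y} \<subseteq> enum ` {..<j}"
  proof
    fix M assume "M \<in> {M. g M \<le> y}"
    moreover obtain i where "M = enum i" using enum(1) by (metis bij_pointE)
    ultimately show "M \<in> enum ` {..<j}"
      using y enum(2) by (auto simp: gint_def[symmetric] intro!: imageI)
        (meson linorder_not_le monoD order_trans)
  qed
  then have "gen_int_count p y \<le> card (enum ` {..<j})"
    unfolding gen_int_count_def by (intro card_mono) auto
  also have "\<dots> \<le> j" using card_image_le[of "{..<j}" enum] by simp
  finally show ?thesis by simp
qed

lemma Suc_le_gint: "real (Suc j) \<le> (A + C0) * gint j"
  using Suc_le_count[of j] count_le[OF gint_ge_1[of j]] by linarith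

text \<open>The count at \<open>gint j\<close> is at least j + 1, which bounds j from above; the
  count at any smaller point is at most j, which bounds \<open>gint j\<close> from above as the
  point increases to it. Approaching from the left avoids the jump at a repeated value.\<close>

lemma gint_approx: "\<bar>A * gint j - real j\<bar> \<le> C0 * gint j powr \<theta>"
proof -
  have "real (Suc j) \<le> A * gint j + C0 * gint j powr \<theta>"
    using Suc_le_count[of j] count_bound[of "gint j"] gint_ge_1[of j] by auto
  moreover have "gint j \<le> (real j + C0 * gint j powr \<theta>) / A"
  proof (rule dense_le_bounded)
    show "0 < gint j" using gint_ge_1[of j] by linarith
    fix y assume y: "0 < y" "y < gint j"
    have "C0 * y powr \<theta> \<le> C0 * gint j powr \<theta>"
      using y theta_nonneg C0_pos by (intro mult_left_mono powr_mono2) auto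
    then have "A * y \<le> real j + C0 * gint j powr \<theta>"
      using count_less[OF y(2)] count_bound[OF y(1)] by linarith
    then show "y \<le> (real j + C0 * gint j powr \<theta>) / A"
      using A_pos by (simp add: field_simps)
  qed
  then have "A * gint j \<le> real j + C0 * gint j powr \<theta>"
    using A_pos by (simp add: field_simps)
  ultimately show ?thesis by linarith
qed

text \<open>Either the error \<open>C0 * gint j powr \<theta>\<close> is at most half of the main
  term, and then \<open>gint j\<close> is at most 2 j / A, or \<open>gint j\<close> is bounded
  because \<theta> < 1.\<close>

lemma gint_upper: obtains C where "0 < C" "\<And>j. gint j \<le> C * real (Suc j)"
proof
  define C where "C = 2 / A + (2 * C0 / A) powr (1 / (1 - \<theta>))"
  show "0 < C" using A_pos C0_pos by (auto simp: C_def intro!: add_pos_nonneg)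
  fix j
  show "gint j \<le> C * real (Suc j)"
  proof (cases "C0 * gint j powr \<theta> \<le> A * gint j / 2")
    case True
    then have "A * gint j \<le> real j + A * gint j / 2" using gint_approx[of j] by linarith
    then have "gint j \<le> 2 / A * real j" using A_pos by (simp add: field_simps)
    also have "\<dots> \<le> C * real (Suc j)"
      using A_pos C0_pos by (intro mult_mono) (auto simp: C_def)
    finally show ?thesis .
  next
    case False
    have "gint j powr (1 - \<theta>) = gint j / gint j powr \<theta>"
      using gint_ge_1[of j] by (simp add: powr_diff)
    also have "\<dots> \<le> 2 * C0 / A"
      using False A_pos gint_ge_1[of j] by (simp add: field_simps)
    finally have "(gint j powr (1 - \<theta>)) powr (1 / (1 - \<theta>)) \<le> (2 * C0 / A) powr (1 / (1 - \<theta>))"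
      using theta_less_1 by (intro powr_mono2) auto
    then have "gint j \<le> (2 * C0 / A) powr (1 / (1 - \<theta>))"
      using gint_ge_1[of j] theta_less_1 by (simp add: powr_powr)
    also have "\<dots> \<le> C" using A_pos by (simp add: C_def)
    also have "C * 1 \<le> C * real (Suc j)"
      using \<open>0 < C\<close> by (intro mult_left_mono) auto
    finally show ?thesis by simp
  qed
qed

text \<open>Spacing 1 / A gives every cell the mass 1 under A dt, the mass of one generalized
  integer.\<close>

definition node :: "nat \<Rightarrow> real" where "node j = real (Suc j) / A"

text \<open>The subtracted term is A times the integral of t^(-s) over the cell from
  \<open>node j\<close> to \<open>node (Suc j)\<close>. The cell and \<open>gint j\<close> are
  within a constant times (j + 1)^\<theta> of each other, so the difference gains a factor (j +
  1)^(\<theta> - 1) over a single term and is summable for Re s > \<theta>.\<close>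

definition zdiff :: "nat \<Rightarrow> complex \<Rightarrow> complex" where
  "zdiff j s = complex_of_real (gint j) powr - s
     - A * ((complex_of_real (node (Suc j)) powr (1 - s) - complex_of_real (node j) powr (1 - s)) / (1 - s))"

lemma zdiff_bound: obtains K where "0 < K"
  "\<And>j s. 0 \<le> Re s \<Longrightarrow> s \<noteq> 1 \<Longrightarrow>
     norm (zdiff j s) \<le> K * (1 + A + C0) powr (Re s + 1) * norm s * real (Suc j) powr (\<theta> - Re s - 1)"
proof -
  obtain C where C: "0 < C" "\<And>j. gint j \<le> C * real (Suc j)" by (rule gint_upper) blast
  define K where "K = (C0 + 2) / A * C powr \<theta>"
  define k where "k = 1 + A + C0"
  have k: "1 \<le> k" using A_pos C0_pos by (simp add: k_def)
  show ?thesis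
  proof
    show "0 < K" using A_pos C0_pos C by (simp add: K_def)
    fix j s assume s: "0 \<le> Re s" "s \<noteq> (1 :: complex)"
    \<comment> \<open>A common lower bound for \<open>gint j\<close> and \<open>node j\<close>: the
      generalized integer and its cell both lie to the right of m.\<close>
    define m where "m = real (Suc j) / k"
    define y where "y = Re s + 1"
    have m: "0 < m" "m \<le> gint j" "m \<le> node j"
      using k A_pos C0_pos Suc_le_gint[of j] gint_ge_1[of j]
      by (auto simp: m_def node_def k_def field_simps)
    have dist: "\<bar>gint j - t\<bar> \<le> K * real (Suc j) powr \<theta>" if "node j \<le> t" "t \<le> node (Suc j)" for t
    proof -
      have t: "real (Suc j) \<le> A * t" "A * t \<le> real (Suc j) + 1"
        using that A_pos by (simp_all add: node_def field_simps)
      have "1 \<le> gint j powr \<theta>" using gint_ge_1 theta_nonneg by (simp add: ge_one_powr_ge_zero)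
      then have "\<bar>A * gint j - A * t\<bar> \<le> (C0 + 2) * gint j powr \<theta>"
        using gint_approx[of j] t by (simp add: algebra_simps)
      also have "\<dots> \<le> (C0 + 2) * (C * real (Suc j)) powr \<theta>"
        using C theta_nonneg C0_pos gint_ge_1[of j] by (intro mult_left_mono powr_mono2) auto
      also have "(C * real (Suc j)) powr \<theta> = C powr \<theta> * real (Suc j) powr \<theta>"
        using C by (simp add: powr_mult)
      finally have "\<bar>A * gint j - A * t\<bar> / A \<le> K * real (Suc j) powr \<theta>"
        using A_pos by (simp add: K_def field_simps)
      moreover have "\<bar>A * gint j - A * t\<bar> / A = \<bar>gint j - t\<bar>"
        using A_pos by (simp add: abs_mult flip: right_diff_distrib)
      ultimately show ?thesis by simp
    qed
    have "norm ((complex_of_real (node (Suc j)) - complex_of_real (node j)) * complex_of_real (gint j) powr - s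
           - (complex_of_real (node (Suc j)) powr (1 - s) - complex_of_real (node j) powr (1 - s)) / (1 - s))
         \<le> norm s * m powr (- Re s - 1) * (K * real (Suc j) powr \<theta>) * (node (Suc j) - node j)"
      using m s A_pos dist by (intro powr_integral_diff_bound) (auto simp: node_def field_simps)
    moreover have d: "node (Suc j) - node j = 1 / A" by (simp add: node_def diff_divide_distrib[symmetric])
    moreover have "zdiff j s = A * ((complex_of_real (node (Suc j)) - complex_of_real (node j)) * complex_of_real (gint j) powr - s
           - (complex_of_real (node (Suc j)) powr (1 - s) - complex_of_real (node j) powr (1 - s)) / (1 - s))"
      unfolding of_real_diff[symmetric] d using A_pos by (simp add: zdiff_def right_diff_distrib)
    ultimately have "norm (zdiff j s)
        \<le> A * (norm s * m powr (- Re s - 1) * (K * real (Suc j) powr \<theta>) * (1 / A))"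
      using A_pos by (simp only: norm_mult norm_of_real) (simp add: field_simps)
    also have "\<dots> = norm s * m powr (- Re s - 1) * (K * real (Suc j) powr \<theta>)"
      using A_pos by simp
    also have "\<dots> = K * norm s * (real (Suc j) powr \<theta> * m powr (- Re s - 1))"
      by (simp only: mult_ac)
    also have "- Re s - 1 = - (Re s + 1)" by simp
    also have "m powr - (Re s + 1) = real (Suc j) powr - (Re s + 1) * k powr (Re s + 1)"
      using k unfolding y_def[symmetric] by (simp add: m_def powr_divide powr_minus field_simps)
    also have "real (Suc j) powr \<theta> * (real (Suc j) powr - (Re s + 1) * k powr (Re s + 1))
        = k powr (Re s + 1) * real (Suc j) powr (\<theta> - Re s - 1)"
      by (simp add: powr_add[symmetric] mult_ac) (simp add: algebra_simps)
    finally show "norm (zdiff j s) \<le> K * (1 + A + C0) powr (Re s + 1) * norm s * real (Suc j) powr (\<theta> - Re s - 1)"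
      by (simp add: k_def mult_ac)
  qed
qed

definition zsum :: "complex \<Rightarrow> complex" where "zsum s = (\<Sum>j. zdiff j s)"

text \<open>The first summand is A times the integral of t^(-s) from \<open>node 0\<close> to
  infinity, that is, the sum of all subtracted cells for Re s > 1. It carries the pole at 1, with
  residue A.\<close>

definition zext :: "complex \<Rightarrow> complex" where
  "zext s = A * complex_of_real (node 0) powr (1 - s) / (s - 1) + zsum s"

lemma node_pos: "0 < node j" using A_pos by (simp add: node_def)

lemma zdiff_holomorphic: "zdiff j holomorphic_on - {1}"
  unfolding zdiff_def[abs_def] using gint_ge_1[of j] node_pos
  by (intro holomorphic_intros) (auto simp: complex_nonpos_Reals_iff not_le)

lemma zsum_bound:
  assumes "\<theta> < \<sigma>" "\<sigma> \<le> \<sigma>'"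
  obtains C where "0 < C"
    "\<And>s. \<sigma> \<le> Re s \<Longrightarrow> Re s \<le> \<sigma>' \<Longrightarrow> s \<noteq> 1 \<Longrightarrow> summable (\<lambda>j. norm (zdiff j s)) \<and> norm (zsum s) \<le> C * norm s"
proof -
  obtain K where K: "0 < K" "\<And>j s. 0 \<le> Re s \<Longrightarrow> s \<noteq> 1 \<Longrightarrow>
     norm (zdiff j s) \<le> K * (1 + A + C0) powr (Re s + 1) * norm s * real (Suc j) powr (\<theta> - Re s - 1)"
    by (rule zdiff_bound) blast
  define S where "S = (\<Sum>j. real (Suc j) powr (\<theta> - \<sigma> - 1))"
  define C where "C = K * (1 + A + C0) powr (\<sigma>' + 1) * S + 1"
  have summ: "summable (\<lambda>j. real (Suc j) powr (\<theta> - \<sigma> - 1))"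
    using assms by (intro summable_Suc_powr) auto
  have S: "0 \<le> S" unfolding S_def by (intro suminf_nonneg summ) auto
  show ?thesis
  proof
    show "0 < C" using S K(1) by (auto simp: C_def intro!: add_nonneg_pos)
    fix s assume s: "\<sigma> \<le> Re s" "Re s \<le> \<sigma>'" "s \<noteq> (1 :: complex)"
    define c where "c = K * (1 + A + C0) powr (\<sigma>' + 1) * norm s"
    have le: "norm (zdiff j s) \<le> c * real (Suc j) powr (\<theta> - \<sigma> - 1)" for j
    proof -
      have "norm (zdiff j s)
          \<le> K * (1 + A + C0) powr (Re s + 1) * norm s * real (Suc j) powr (\<theta> - Re s - 1)"
        using s assms theta_nonneg by (intro K) auto
      also have "\<dots> \<le> c * real (Suc j) powr (\<theta> - \<sigma> - 1)"
        unfolding c_def using s K(1) A_pos C0_pos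
        by (intro mult_mono mult_nonneg_nonneg powr_mono) auto
      finally show ?thesis .
    qed
    have *: "summable (\<lambda>j. norm (zdiff j s))"
      by (rule summable_comparison_test'[OF summable_mult[OF summ, of c], of 0]) (use le in auto)
    have "norm (zsum s) \<le> (\<Sum>j. norm (zdiff j s))"
      unfolding zsum_def by (rule summable_norm[OF *])
    also have "\<dots> \<le> (\<Sum>j. c * real (Suc j) powr (\<theta> - \<sigma> - 1))"
      by (rule suminf_le[OF le * summable_mult[OF summ]])
    also have "\<dots> = c * S" unfolding S_def by (rule suminf_mult[OF summ])
    also have "\<dots> \<le> C * norm s" by (simp add: c_def C_def algebra_simps)
    finally show "summable (\<lambda>j. norm (zdiff j s)) \<and> norm (zsum s) \<le> C * norm s" using * by blast
  qed
qed

lemma open_domain: "open ({s. \<theta> < Re s} - {1::complex})"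
  by (rule open_Diff[OF open_halfspace_Re_gt closed_singleton])

lemma zsum_holomorphic: "zsum holomorphic_on {s. \<theta> < Re s} - {1}"
proof -
  obtain K where K: "0 < K" "\<And>j s. 0 \<le> Re s \<Longrightarrow> s \<noteq> 1 \<Longrightarrow>
     norm (zdiff j s) \<le> K * (1 + A + C0) powr (Re s + 1) * norm s * real (Suc j) powr (\<theta> - Re s - 1)"
    by (rule zdiff_bound) blast
  obtain h where h: "\<forall>s \<in> {s. \<theta> < Re s} - {1}. ((\<lambda>j. zdiff j s) sums h s) \<and> h field_differentiable (at s)"
  proof (rule series_differentiable_comparison_complex[OF open_domain, of zdiff])
    fix j s assume "s \<in> {s. \<theta> < Re s} - {1 :: complex}"
    then show "zdiff j field_differentiable at s"
      using zdiff_holomorphic[of j] by (auto simp: holomorphic_on_def at_within_open[OF _ open_Compl])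
  next
    fix s assume s: "s \<in> {s. \<theta> < Re s} - {1 :: complex}"
    \<comment> \<open>On the ball of radius \<epsilon> about s the real part stays above \<theta> +
      \<epsilon>, so the summands are dominated by the convergent series of (j + 1)^(-1 -
      \<epsilon>).\<close>
    define \<epsilon> where "\<epsilon> = min 1 ((Re s - \<theta>) / 2)"
    have \<epsilon>: "0 < \<epsilon>" "\<epsilon> \<le> 1" "\<epsilon> \<le> (Re s - \<theta>) / 2" using s by (auto simp: \<epsilon>_def min_def field_simps)
    define c where "c = K * (1 + A + C0) powr (Re s + 2) * (norm s + 1)"
    show "\<exists>d h. 0 < d \<and> summable h \<and> range h \<subseteq> \<real>\<^sub>\<ge>\<^sub>0 \<and>
        (\<forall>\<^sub>F n in sequentially. \<forall>y\<in>ball s d \<inter> ({s. \<theta> < Re s} - {1}). cmod (zdiff n y) \<le> cmod (h n))"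
    proof (intro exI[of _ \<epsilon>] exI[of _ "\<lambda>j. complex_of_real (c * real (Suc j) powr (- 1 - \<epsilon>))"] conjI
        always_eventually allI ballI)
      show "summable (\<lambda>j. complex_of_real (c * real (Suc j) powr (- 1 - \<epsilon>)))"
        using \<epsilon> by (intro summable_of_real summable_mult summable_Suc_powr) auto
      show "range (\<lambda>j. complex_of_real (c * real (Suc j) powr (- 1 - \<epsilon>))) \<subseteq> \<real>\<^sub>\<ge>\<^sub>0"
        using K(1) A_pos C0_pos by (auto simp: c_def complex_nonneg_Reals_iff)
      fix j y assume y: "y \<in> ball s \<epsilon> \<inter> ({s. \<theta> < Re s} - {1})"
      then have "norm (y - s) < \<epsilon>" by (auto simp: dist_norm norm_minus_commute)
      then have d: "\<bar>Re y - Re s\<bar> < \<epsilon>" "norm y \<le> norm s + 1"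
        using abs_Re_le_cmod[of "y - s"] norm_triangle_ineq2[of y s] \<epsilon> by auto
      have "norm (zdiff j y)
          \<le> K * (1 + A + C0) powr (Re y + 1) * norm y * real (Suc j) powr (\<theta> - Re y - 1)"
        using y theta_nonneg by (intro K) auto
      also have "\<dots> \<le> c * real (Suc j) powr (- 1 - \<epsilon>)"
        unfolding c_def using d \<epsilon> K(1) A_pos C0_pos
        by (intro mult_mono mult_nonneg_nonneg powr_mono) auto
      also have "\<dots> \<le> norm (complex_of_real (c * real (Suc j) powr (- 1 - \<epsilon>)))"
        unfolding norm_of_real by simp
      finally show "norm (zdiff j y) \<le> norm (complex_of_real (c * real (Suc j) powr (- 1 - \<epsilon>)))" .
    qed (use \<epsilon> in auto)
  qed
  have "h holomorphic_on {s. \<theta> < Re s} - {1}"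
    using h by (auto simp: holomorphic_on_def field_differentiable_at_within)
  then show ?thesis
    by (rule holomorphic_transform) (use h in \<open>auto simp: zsum_def sums_iff\<close>)
qed

lemma zext_holomorphic: "zext holomorphic_on {s. \<theta> < Re s} - {1}"
  unfolding zext_def[abs_def] using node_pos
  by (intro holomorphic_intros zsum_holomorphic) (auto simp: complex_nonpos_Reals_iff not_le)

lemma summable_gint_powr:
  assumes "1 < \<sigma>"
  shows "summable (\<lambda>j. gint j powr - \<sigma>)"
proof (rule summable_comparison_test'[of "\<lambda>j. (A + C0) powr \<sigma> * real (Suc j) powr - \<sigma>" 0])
  show "summable (\<lambda>j. (A + C0) powr \<sigma> * real (Suc j) powr - \<sigma>)"
    using assms by (intro summable_mult summable_Suc_powr) auto
  fix j
  have "gint j powr - \<sigma> \<le> (real (Suc j) / (A + C0)) powr - \<sigma>"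
    using Suc_le_gint[of j] assms A_pos C0_pos by (intro powr_mono2') (auto simp: field_simps)
  also have "\<dots> = (A + C0) powr \<sigma> * real (Suc j) powr - \<sigma>"
    using A_pos C0_pos by (simp add: powr_divide powr_minus field_simps)
  finally show "norm (gint j powr - \<sigma>) \<le> (A + C0) powr \<sigma> * real (Suc j) powr - \<sigma>" by simp
qed

lemma summable_g: "1 < \<sigma> \<Longrightarrow> (\<lambda>M. g M powr - \<sigma>) summable_on UNIV"
  using summable_gint_powr[of \<sigma>] enum(1) unfolding gint_def
  by (subst summable_on_reindex_bij_betw[of enum UNIV, symmetric])
     (auto simp: summable_on_UNIV_nonneg_real_iff)

text \<open>For Re s > 1 the cell integrals telescope to the first summand of \<open>zext\<close>,
  because the powers at the nodes tend to 0. What remains is the absolutely convergent series, which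
  may be summed in any order.\<close>

lemma zext_eq_zeta_series:
  assumes s: "1 < Re s"
  shows "zext s = zeta_series p s"
proof -
  have s1: "s \<noteq> 1" using s by auto
  define f where "f j = complex_of_real (node j) powr (1 - s)" for j
  have lim: "f \<longlonglongrightarrow> 0"
  proof (rule tendsto_norm_zero_cancel)
    have "(\<lambda>j. node j powr (1 - Re s)) \<longlonglongrightarrow> 0"
    proof (rule tendsto_neg_powr)
      show "filterlim node at_top sequentially"
        unfolding node_def[abs_def] using A_pos by real_asymp
    qed (use s in auto)
    moreover have "norm (f j) = node j powr (1 - Re s)" for j
      using node_pos[of j] by (simp add: f_def norm_powr_real_powr)
    ultimately show "(\<lambda>j. norm (f j)) \<longlonglongrightarrow> 0" by simp
  qed
  have "(\<lambda>j. (f (Suc j) - f j) / (1 - s)) sums ((0 - f 0) / (1 - s))"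
    by (intro sums_divide telescope_sums lim)
  from sums_mult[OF this, of "complex_of_real A"]
  have "(\<lambda>j. complex_of_real A * ((f (Suc j) - f j) / (1 - s))) sums
     (complex_of_real A * ((0 - f 0) / (1 - s)))" .
  have tele: "(\<lambda>j. A * ((f (Suc j) - f j) / (1 - s))) sums (A * f 0 / (s - 1))"
  proof -
    have e: "1 - s = - (s - 1)" by simp
    have "complex_of_real A * ((0 - f 0) / (1 - s)) = A * f 0 / (s - 1)"
      unfolding e by (simp del: minus_diff_eq)
    then show ?thesis using \<open>_ sums (_ * ((0 - f 0) / (1 - s)))\<close> by simp
  qed
  have norm_n: "norm (complex_of_real (gint j) powr - s) = gint j powr - Re s" for j
    using gint_ge_1[of j] by (simp add: norm_powr_real_powr)
  have summ: "summable (\<lambda>j. norm (complex_of_real (gint j) powr - s))"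
    using summable_gint_powr[OF s] by (simp add: norm_n)
  then have sums: "(\<lambda>j. complex_of_real (gint j) powr - s) sums (\<Sum>j. complex_of_real (gint j) powr - s)"
    by (rule summable_sums[OF summable_norm_cancel])
  have "(\<lambda>j. zdiff j s) sums ((\<Sum>j. complex_of_real (gint j) powr - s) - A * f 0 / (s - 1))"
    unfolding zdiff_def using sums_diff[OF sums tele] by (simp add: f_def)
  then have "zext s = (\<Sum>j. complex_of_real (gint j) powr - s)"
    by (simp add: zext_def zsum_def sums_iff f_def)
  also have "\<dots> = (\<Sum>\<^sub>\<infinity>j. complex_of_real (gint j) powr - s)"
    using norm_summable_imp_has_sum[OF summ sums] by (simp add: infsumI)
  also have "\<dots> = zeta_series p s"
    unfolding zeta_series_def gint_def using enum(1) by (rule infsum_reindex_bij_betw)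
  finally show ?thesis .
qed

text \<open>The product of s - 1 and \<open>zext s\<close> tends to A at 1, since
  \<open>zsum\<close> stays bounded near 1, so the singularity is removable. The formula for
  \<open>zdiff\<close> divides by 1 - s and carries no information at s = 1, so the value there is
  set by hand.\<close>

lemma zext_pole_factor:
  obtains h' where "h' holomorphic_on {s. \<theta> < Re s}" "h' 1 \<noteq> 0"
    "\<And>s. s \<noteq> 1 \<Longrightarrow> zext s = h' s / (s - 1)"
proof -
  define h where "h s = A * complex_of_real (node 0) powr (1 - s) + (s - 1) * zsum s" for s
  have h_hol: "h holomorphic_on {s. \<theta> < Re s} - {1}"
    unfolding h_def[abs_def] using node_pos
    by (intro holomorphic_intros zsum_holomorphic) (auto simp: complex_nonpos_Reals_iff not_le)
  obtain C where C: "0 < C" "\<And>s. (1 + \<theta>) / 2 \<le> Re s \<Longrightarrow> Re s \<le> 2 \<Longrightarrow> s \<noteq> 1 \<Longrightarrow>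
      summable (\<lambda>j. norm (zdiff j s)) \<and> norm (zsum s) \<le> C * norm s"
    by (rule zsum_bound[of "(1 + \<theta>) / 2" 2]) (use theta_less_1 in auto)
  have ev: "\<forall>\<^sub>F s in at 1. norm ((s - 1) * zsum s) \<le> norm (s - 1) * (C * norm s)"
  proof -
    define d where "d = (1 - \<theta>) / 2"
    have d: "0 < d" "d \<le> 1" using theta_less_1 theta_nonneg by (auto simp: d_def)
    have "norm ((s - 1) * zsum s) \<le> norm (s - 1) * (C * norm s)" if "s \<noteq> 1" "dist s 1 < d" for s
    proof -
      have "\<bar>Re s - 1\<bar> < d" using that abs_Re_le_cmod[of "s - 1"] by (simp add: dist_norm)
      then have "(1 + \<theta>) / 2 \<le> Re s" "Re s \<le> 2"
        using d theta_less_1 theta_nonneg unfolding d_def by (simp_all only: abs_less_iff) (auto simp: field_simps)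
      then show ?thesis
        using C(2)[of s] that by (simp add: norm_mult mult_left_mono)
    qed
    then show ?thesis using d by (auto simp: eventually_at)
  qed
  have "((\<lambda>s::complex. norm (s - 1) * (C * norm s)) \<longlongrightarrow> norm (1 - 1 :: complex) * (C * norm (1 :: complex))) (at 1)"
    by (intro tendsto_intros)
  then have "((\<lambda>s. (s - 1) * zsum s) \<longlongrightarrow> 0) (at 1)"
    by (intro Lim_null_comparison[OF ev]) simp
  from tendsto_add[OF _ this] have lim: "(h \<longlongrightarrow> A) (at 1)"
    if "((\<lambda>s. A * complex_of_real (node 0) powr (1 - s)) \<longlongrightarrow> A) (at 1)"
    using that unfolding h_def[abs_def] by force
  have "((\<lambda>s. A * complex_of_real (node 0) powr (1 - s)) \<longlongrightarrow> A * complex_of_real (node 0) powr (1 - 1)) (at 1)"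
    using node_pos[of 0] by (intro tendsto_intros) (auto simp: complex_nonpos_Reals_iff not_le)
  with node_pos[of 0] have lim: "(h \<longlongrightarrow> A) (at 1)"
    by (intro lim) simp
  define h' where "h' s = (if s = 1 then complex_of_real A else h s)" for s
  have open_R: "open {s. \<theta> < Re s}" by (rule open_halfspace_Re_gt)
  have h': "h' holomorphic_on {s. \<theta> < Re s}"
    unfolding h'_def[abs_def] by (rule removable_singularity[OF h_hol open_R lim])
  have zext_eq: "zext s = h' s / (s - 1)" if "s \<noteq> 1" for s
    using that by (simp add: zext_def h'_def h_def add_divide_distrib)
  show ?thesis
    using A_pos by (intro that[OF h' _ zext_eq]) (simp add: h'_def)
qed

lemma zeta_continuation_zext: "zeta_continuation p \<theta> zext"
proof -
  from zext_pole_factor obtain h' where h': "h' holomorphic_on {s. \<theta> < Re s}" "h' 1 \<noteq> 0"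
    and zext_eq: "\<And>s. s \<noteq> 1 \<Longrightarrow> zext s = h' s / (s - 1)" by blast
  have open_R: "open {s. \<theta> < Re s}" by (rule open_halfspace_Re_gt)
  have one: "1 \<in> {s. \<theta> < Re s}" using theta_less_1 by simp
  have "is_pole (\<lambda>s. h' s / (s - 1) ^ 1) 1"
    using h'(2) by (intro is_pole_basic[OF h'(1) open_R one]) auto
  moreover have "\<forall>\<^sub>F s in at 1. h' s / (s - 1) ^ 1 = zext s"
    using zext_eq by (auto simp: eventually_at intro: exI[of _ 1])
  ultimately have "is_pole zext 1"
    using is_pole_cong[OF _ refl, of "\<lambda>s. h' s / (s - 1) ^ 1" zext 1] by blast
  moreover have "zorder zext 1 = - 1"
    by (rule zorder_eqI[OF open_R one h']) (auto simp: zext_eq power_int_minus field_simps)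
  ultimately show ?thesis
    using zext_holomorphic zext_eq_zeta_series by (simp add: zeta_continuation_def)
qed

section \<open>The continued zeta function and its growth\<close>

abbreviation Z :: "complex \<Rightarrow> complex" where "Z \<equiv> beurling_zeta p \<theta>"

lemma zeta_continuation_Z: "zeta_continuation p \<theta> Z"
  unfolding beurling_zeta_def by (rule someI[of "zeta_continuation p \<theta>", OF zeta_continuation_zext])

lemma Z_eq_zext: "\<theta> < Re s \<Longrightarrow> s \<noteq> 1 \<Longrightarrow> Z s = zext s"
  by (rule zeta_continuation_unique[OF zeta_continuation_Z zeta_continuation_zext theta_less_1])

lemma Z_holomorphic: "Z holomorphic_on {s. \<theta> < Re s} - {1}"
  using zeta_continuation_Z by (simp add: zeta_continuation_def)

lemma Z_eq_series: "1 < Re s \<Longrightarrow> Z s = (\<Sum>\<^sub>\<infinity>M. dterm M s)"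
  using zeta_continuation_Z by (simp add: zeta_continuation_def zeta_series_def dterm_def)

text \<open>Linear growth comes from the factor |s| in the mean value estimate of each summand; 1 /
  |s - 1| comes from the polar term.\<close>

lemma Z_bound:
  assumes "\<theta> < \<sigma>" "\<sigma> \<le> \<sigma>'"
  obtains C where "0 < C"
    "\<And>s. \<sigma> \<le> Re s \<Longrightarrow> Re s \<le> \<sigma>' \<Longrightarrow> s \<noteq> 1 \<Longrightarrow> norm (Z s) \<le> C * (norm s + 1 / norm (s - 1))"
proof -
  obtain C where C: "0 < C" "\<And>s. \<sigma> \<le> Re s \<Longrightarrow> Re s \<le> \<sigma>' \<Longrightarrow> s \<noteq> 1 \<Longrightarrow>
      summable (\<lambda>j. norm (zdiff j s)) \<and> norm (zsum s) \<le> C * norm s"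
    by (rule zsum_bound[OF assms]) blast
  define c where "c = (1 + A) powr \<sigma>'"
  show ?thesis
  proof
    show "0 < C + c" using C A_pos by (simp add: c_def add_pos_nonneg)
    fix s assume s: "\<sigma> \<le> Re s" "Re s \<le> \<sigma>'" "s \<noteq> (1 :: complex)"
    have "norm (A * complex_of_real (node 0) powr (1 - s)) = A * (1 / A) powr (1 - Re s)"
      using A_pos by (simp add: norm_mult norm_powr_real_powr node_def)
    also have "\<dots> = A powr Re s"
      using A_pos by (simp add: powr_divide powr_diff)
    also have "\<dots> \<le> (1 + A) powr Re s"
      using A_pos s assms theta_nonneg by (intro powr_mono2) auto
    also have "\<dots> \<le> c" unfolding c_def using A_pos s by (intro powr_mono) auto
    finally have "norm (A * complex_of_real (node 0) powr (1 - s)) / norm (s - 1) \<le> c / norm (s - 1)"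
      by (intro divide_right_mono) auto
    moreover have "norm (zext s) \<le> norm (A * complex_of_real (node 0) powr (1 - s)) / norm (s - 1) + norm (zsum s)"
      unfolding zext_def norm_divide[symmetric] by (rule norm_triangle_ineq)
    moreover have "norm (zsum s) \<le> C * norm s" using C s by blast
    moreover have "0 \<le> c * norm s" "0 \<le> C * (1 / norm (s - 1))" using C by (auto simp: c_def)
    ultimately show "norm (Z s) \<le> (C + c) * (norm s + 1 / norm (s - 1))"
      using Z_eq_zext[of s] s assms by (simp add: algebra_simps add_divide_distrib)
  qed
qed

lemma Z_linear_growth:
  assumes "\<theta> < \<sigma>" "\<sigma> \<le> \<sigma>'"
  obtains C where "0 < C"
    "\<And>s. \<sigma> \<le> Re s \<Longrightarrow> Re s \<le> \<sigma>' \<Longrightarrow> 1 \<le> \<bar>Im s\<bar> \<Longrightarrow> norm (Z s) \<le> C * \<bar>Im s\<bar>"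
proof -
  obtain C where C: "0 < C" "\<And>s. \<sigma> \<le> Re s \<Longrightarrow> Re s \<le> \<sigma>' \<Longrightarrow> s \<noteq> 1 \<Longrightarrow>
      norm (Z s) \<le> C * (norm s + 1 / norm (s - 1))"
    by (rule Z_bound[OF assms]) blast
  have s': "0 \<le> \<sigma>'" using assms theta_nonneg by linarith
  show ?thesis
  proof
    show "0 < C * (\<sigma>' + 2)" using C s' by simp
    fix s assume s: "\<sigma> \<le> Re s" "Re s \<le> \<sigma>'" "1 \<le> \<bar>Im s\<bar>"
    then have "s \<noteq> 1" by auto
    have "1 \<le> norm (s - 1)" using s(3) abs_Im_le_cmod[of "s - 1"] by simp
    then have "1 / norm (s - 1) \<le> \<bar>Im s\<bar>" using s(3) by (intro order_trans[OF _ s(3)]) (auto simp: divide_le_eq_1)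
    moreover have "norm s \<le> \<sigma>' + \<bar>Im s\<bar>"
      using cmod_le[of s] s assms theta_nonneg by linarith
    moreover have "\<sigma>' * 1 \<le> \<sigma>' * \<bar>Im s\<bar>" using s' s(3) by (intro mult_left_mono) auto
    ultimately have "norm s + 1 / norm (s - 1) \<le> (\<sigma>' + 2) * \<bar>Im s\<bar>"
      by (simp add: algebra_simps)
    then have "C * (norm s + 1 / norm (s - 1)) \<le> C * ((\<sigma>' + 2) * \<bar>Im s\<bar>)"
      using C by (intro mult_left_mono) auto
    then show "norm (Z s) \<le> C * (\<sigma>' + 2) * \<bar>Im s\<bar>"
      using C(2)[OF s(1,2) \<open>s \<noteq> 1\<close>] by (simp add: mult.assoc)
  qed
qed

definition zeta\<^sub>r :: "real \<Rightarrow> real" where "zeta\<^sub>r \<sigma> = (\<Sum>\<^sub>\<infinity>M. g M powr - \<sigma>)"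

lemma Z_of_real: "1 < \<sigma> \<Longrightarrow> Z (complex_of_real \<sigma>) = complex_of_real (zeta\<^sub>r \<sigma>)"
proof -
  assume "1 < \<sigma>"
  have "dterm M (complex_of_real \<sigma>) = complex_of_real (g M powr - \<sigma>)" for M
    by (simp add: dterm_def powr_of_real flip: of_real_minus)
  then show ?thesis
    using \<open>1 < \<sigma>\<close> has_sum_infsum[OF summable_g]
    by (simp add: Z_eq_series zeta\<^sub>r_def infsumI has_sum_of_real_iff)
qed

lemma zeta\<^sub>r_nonneg: "0 \<le> zeta\<^sub>r \<sigma>"
  unfolding zeta\<^sub>r_def by (rule infsum_nonneg) auto

lemma zeta\<^sub>r_bound: obtains C where "1 \<le> C" "\<And>\<sigma>. 1 < \<sigma> \<Longrightarrow> \<sigma> \<le> 4 \<Longrightarrow> zeta\<^sub>r \<sigma> \<le> C / (\<sigma> - 1)"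
proof -
  obtain C where C: "0 < C" "\<And>s. 1 \<le> Re s \<Longrightarrow> Re s \<le> 4 \<Longrightarrow> s \<noteq> 1 \<Longrightarrow>
      norm (Z s) \<le> C * (norm s + 1 / norm (s - 1))"
    by (rule Z_bound[of 1 4]) (use theta_less_1 in auto)
  show ?thesis
  proof
    show "1 \<le> max 1 (C * 13)" by simp
    fix \<sigma> :: real assume \<sigma>: "1 < \<sigma>" "\<sigma> \<le> 4"
    \<comment> \<open>The constant 13 is 4 * 3 + 1, from writing \<sigma> + 1 / (\<sigma> - 1) over
      the common denominator.\<close>
    have "\<sigma> - 1 \<le> 3" "\<sigma> * (\<sigma> - 1) \<le> 4 * 3" using \<sigma> by (simp, intro mult_mono) auto
    then have *: "\<sigma> + 1 / (\<sigma> - 1) \<le> 13 / (\<sigma> - 1)" using \<sigma> by (subst add_divide_eq_iff) (auto intro!: divide_right_mono)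
    have "zeta\<^sub>r \<sigma> = norm (Z (complex_of_real \<sigma>))"
      using Z_of_real[OF \<sigma>(1)] zeta\<^sub>r_nonneg by simp
    also have "\<dots> \<le> C * (norm (complex_of_real \<sigma>) + 1 / norm (complex_of_real \<sigma> - 1))"
      using \<sigma> by (intro C) auto
    also have "\<dots> = C * (\<sigma> + 1 / (\<sigma> - 1))"
      using \<sigma> norm_of_real[of "\<sigma> - 1", where 'a = complex] by simp
    also have "\<dots> \<le> C * (13 / (\<sigma> - 1))" using C * by (intro mult_left_mono) auto
    also have "\<dots> \<le> max 1 (C * 13) / (\<sigma> - 1)"
      using \<sigma> by (simp add: divide_right_mono)
    finally show "zeta\<^sub>r \<sigma> \<le> max 1 (C * 13) / (\<sigma> - 1)" .
  qed
qed

end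

subsection \<open>The mollifier\<close>

text \<open>The Moebius function of the free commutative monoid on the primes: inclusion of
  multisets plays the role of divisibility, also when distinct multisets have equal values.\<close>

definition mu :: "nat multiset \<Rightarrow> complex" where
  "mu M = (if \<forall>j. count M j \<le> 1 then (- 1) ^ size M else 0)"

definition divs :: "nat multiset \<Rightarrow> real" where
  "divs M = real (card {N. N \<subseteq># M})"

lemma finite_submultisets [simp]: "finite {N. N \<subseteq># (M :: 'a multiset)}"
proof -
  have "{N. N \<subseteq># M} \<subseteq> (\<Union>n\<le>size M. multisets_of_size (set_mset M) n)"
    by (auto simp: multisets_of_size_def size_mset_mono dest: mset_subset_eqD)
  then show ?thesis by (rule finite_subset) auto
qed

lemma has_sum_sum:
  fixes f :: "'i \<Rightarrow> 'a \<Rightarrow> 'b :: topological_comm_monoid_add"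
  assumes "finite I" "\<And>i. i \<in> I \<Longrightarrow> (f i has_sum s i) S"
  shows "((\<lambda>x. \<Sum>i\<in>I. f i x) has_sum (\<Sum>i\<in>I. s i)) S"
  using assms by (induction I rule: finite_induct) (auto intro: has_sum_add)

lemma sum_pair_product:
  "(\<Sum>u\<in>S \<times> T. f (fst u) * h (snd u)) = sum f S * (sum h T :: 'c :: comm_semiring_0)"
  by (simp add: sum_product sum.cartesian_product case_prod_unfold)

lemma norm_mu_le_1: "norm (mu M) \<le> 1"
  by (simp add: mu_def norm_power)

lemma mu_empty [simp]: "mu {#} = 1"
  by (simp add: mu_def)

lemma mu_add_mset: "mu (add_mset j M) = (if j \<in># M then 0 else - mu M)"
proof (cases "j \<in># M")
  case True
  then have "\<not> count (add_mset j M) j \<le> 1" by simp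
  then show ?thesis using True unfolding mu_def by auto
next
  case False
  then have "count M j = 0" by (simp add: count_eq_zero_iff)
  then have "count (add_mset j M) i \<le> 1 \<longleftrightarrow> count M i \<le> 1" for i
    by (cases "i = j") auto
  then show ?thesis using False by (simp add: mu_def)
qed

text \<open>Fix an element j of M. Submultisets without j pair off with those obtained by adding one
  j, with opposite signs; those containing j more than once contribute 0.\<close>

lemma sum_mu: "(\<Sum>N | N \<subseteq># M. mu N) = (if M = {#} then 1 else 0)"
proof (cases "M = {#}")
  case True
  then have "{N. N \<subseteq># M} = {{#}}" by auto
  then show ?thesis using True by simp
next
  case False
  then obtain j M' where M: "M = add_mset j M'" by (meson multiset_cases)
  let ?P = "{N. N \<subseteq># M \<and> j \<notin># N}" and ?Q = "{N. N \<subseteq># M'}"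
  have Q: "{N. N \<subseteq># M} = ?P \<union> add_mset j ` ?Q"
  proof (intro equalityI subsetI)
    fix N assume "N \<in> {N. N \<subseteq># M}"
    then have N: "N \<subseteq># M" by simp
    show "N \<in> ?P \<union> add_mset j ` ?Q"
    proof (cases "j \<in># N")
      case True
      then obtain N' where "N = add_mset j N'" by (meson mset_add)
      then show ?thesis using N M by auto
    qed (use N in auto)
  qed (auto simp: M)
  have fin: "finite ?P" "finite ?Q"
    by (auto intro: finite_subset[OF _ finite_submultisets[of M]])
  have "(\<Sum>N | N \<subseteq># M. mu N) = (\<Sum>N\<in>?P. mu N) + (\<Sum>N\<in>add_mset j ` ?Q. mu N)"
    unfolding Q using fin by (intro sum.union_disjoint) auto
  also have "(\<Sum>N\<in>add_mset j ` ?Q. mu N) = (\<Sum>N\<in>?Q. mu (add_mset j N))"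
    by (subst sum.reindex) (auto simp: inj_on_def)
  also have "\<dots> = (\<Sum>N\<in>?P. - mu N)"
  proof (rule sum.mono_neutral_cong_right)
    show "?P \<subseteq> ?Q"
    proof
      fix N assume "N \<in> ?P"
      then have "N \<subseteq># add_mset j M'" "j \<notin># N" by (auto simp: M)
      then show "N \<in> ?Q"
        by (simp add: subset_mset.le_iff_sup)
    qed
    show "\<forall>N\<in>?Q - ?P. mu (add_mset j N) = 0"
      by (auto simp: mu_add_mset M intro: subset_mset.order_trans)
  qed (auto simp: mu_add_mset fin)
  finally show ?thesis using False by (simp add: sum_negf)
qed

lemma divs_ge_1: "1 \<le> divs M"
proof -
  have "{N. N \<subseteq># M} \<noteq> {}" by blast
  then show ?thesis by (simp add: divs_def card_gt_0_iff Suc_le_eq)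
qed

lemma divs_le_square: "divs M \<le> (divs M)\<^sup>2"
  using mult_left_mono[OF divs_ge_1[of M], of "divs M"] divs_ge_1[of M] by (simp add: power2_eq_square)

context beurling_system
begin

(* Quadruples behind d^2 <= d_4: a pair (K, L) of submultisets of M splits M into
   the meet, the two differences, and the complement of the join. *)
lemma sum_divs_square_le:
  assumes \<sigma>: "1 < \<sigma>" and F: "finite F"
  shows "(\<Sum>M\<in>F. (divs M)\<^sup>2 * g M powr - \<sigma>) \<le> zeta\<^sub>r \<sigma> ^ 4"
proof -
  define H where "H = (\<Union>M\<in>F. {N. N \<subseteq># M})"
  define S where "S = (SIGMA M:F. {N. N \<subseteq># M} \<times> {N. N \<subseteq># M})"
  define w where "w M = g M powr - \<sigma>" for M
  define q where "q = (\<lambda>(M :: nat multiset, K, L). (K \<inter># L, K - L, L - K, M - (K \<union># L)))"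
  have finH: "finite H" using F by (auto simp: H_def)
  have parts: "K \<inter># L + (K - L) = K" "K \<inter># L + (L - K) = L"
    "K \<inter># L + (K - L) + (L - K) + (M - (K \<union># L)) = M" if "K \<subseteq># M" "L \<subseteq># M" for K L M :: "nat multiset"
  proof -
    show "K \<inter># L + (K - L) = K" "K \<inter># L + (L - K) = L" by (auto simp: multiset_eq_iff)
    show "K \<inter># L + (K - L) + (L - K) + (M - (K \<union># L)) = M"
    proof (rule multiset_eqI)
      fix j
      have "count K j \<le> count M j" "count L j \<le> count M j"
        using that by (auto simp: subseteq_mset_def)
      then show "count (K \<inter># L + (K - L) + (L - K) + (M - (K \<union># L))) j = count M j"
        by (auto simp: min_def max_def)
    qed
  qed
  have inj: "inj_on q S"
  proof (rule inj_onI)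
    fix u v assume uv: "u \<in> S" "v \<in> S" "q u = q v"
    obtain M K L M' K' L' where [simp]: "u = (M, K, L)" "v = (M', K', L')" by (metis surj_pair)
    show "u = v"
      using uv parts[of K M L] parts[of K' M' L'] by (simp add: q_def S_def)
  qed
  have sub: "q ` S \<subseteq> H \<times> H \<times> H \<times> H"
  proof
    fix y assume "y \<in> q ` S"
    then obtain M K L where y: "M \<in> F" "K \<subseteq># M" "L \<subseteq># M" "y = q (M, K, L)"
      by (auto simp: S_def)
    then show "y \<in> H \<times> H \<times> H \<times> H"
      by (auto simp: q_def H_def intro!: bexI[of _ M] intro: subset_mset.le_infI1 subset_mset.order_trans[OF diff_subset_eq_self])
  qed
  have w_add: "w (M + N) = w M * w N" for M N
    by (simp add: w_def gen_int_add powr_mult)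
  have "(\<Sum>M\<in>F. (divs M)\<^sup>2 * w M) = (\<Sum>M\<in>F. \<Sum>y\<in>{N. N \<subseteq># M} \<times> {N. N \<subseteq># M}. w M)"
    by (simp add: divs_def power2_eq_square)
  also have "\<dots> = (\<Sum>(M, y)\<in>S. w M)"
    unfolding S_def using F by (subst sum.Sigma) auto
  also have "\<dots> = (\<Sum>u\<in>S. (\<lambda>(P, Q, R, T). w P * (w Q * (w R * w T))) (q u))"
  proof (rule sum.cong[OF refl])
    fix u assume u: "u \<in> S"
    obtain M K L where [simp]: "u = (M, K, L)" by (metis surj_pair)
    have "w M = w (K \<inter># L + (K - L) + (L - K) + (M - (K \<union># L)))"
      using u parts(3)[of K M L] by (simp add: S_def)
    then show "(case u of (M, y) \<Rightarrow> w M) = (\<lambda>(P, Q, R, T). w P * (w Q * (w R * w T))) (q u)"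
      by (simp add: q_def w_add mult.assoc)
  qed
  also have "\<dots> = (\<Sum>(P, Q, R, T)\<in>q ` S. w P * (w Q * (w R * w T)))"
    by (subst sum.reindex[OF inj]) simp
  also have "\<dots> \<le> (\<Sum>(P, Q, R, T)\<in>H \<times> H \<times> H \<times> H. w P * (w Q * (w R * w T)))"
    using finH sub by (intro sum_mono2) (auto simp: w_def)
  also have "\<dots> = (\<Sum>u\<in>H \<times> H \<times> H \<times> H. w (fst u) *
      (\<lambda>v. w (fst v) * (\<lambda>t. w (fst t) * w (snd t)) (snd v)) (snd u))"
    by (rule sum.cong[OF refl]) (clarsimp split: prod.splits)
  also have "\<dots> = sum w H * (sum w H * (sum w H * sum w H))"
    unfolding sum_pair_product[of w "\<lambda>v. w (fst v) * (\<lambda>t. w (fst t) * w (snd t)) (snd v)" H "H \<times> H \<times> H"]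
      sum_pair_product[of w "\<lambda>t. w (fst t) * w (snd t)" H "H \<times> H"] sum_pair_product[of w w H H] ..
  also have "\<dots> = (\<Sum>P\<in>H. w P) ^ 4"
    by (simp add: power4_eq_xxxx mult.assoc)
  also have "\<dots> \<le> zeta\<^sub>r \<sigma> ^ 4"
    unfolding zeta\<^sub>r_def w_def using summable_g[OF \<sigma>] finH
    by (intro power_mono finite_sum_le_infsum sum_nonneg) auto
  finally show ?thesis by (simp add: w_def)
qed

lemma summable_divs_square:
  assumes "1 < \<sigma>"
  shows "(\<lambda>M. (divs M)\<^sup>2 * g M powr - \<sigma>) summable_on UNIV"
proof (rule nonneg_bdd_above_summable_on)
  show "bdd_above (sum (\<lambda>M. (divs M)\<^sup>2 * g M powr - \<sigma>) ` {F. F \<subseteq> UNIV \<and> finite F})"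
    by (rule bdd_aboveI2[of _ _ "zeta\<^sub>r \<sigma> ^ 4"]) (simp add: sum_divs_square_le assms)
qed simp

lemma summable_divs:
  assumes "1 < \<sigma>"
  shows "(\<lambda>M. divs M * g M powr - \<sigma>) summable_on UNIV"
proof (rule summable_on_comparison_test[OF summable_divs_square[OF assms]])
  fix M
  show "divs M * g M powr - \<sigma> \<le> (divs M)\<^sup>2 * g M powr - \<sigma>"
    by (intro mult_right_mono divs_le_square) simp
  show "0 \<le> divs M * g M powr - \<sigma>"
    using divs_ge_1[of M] by simp
qed

text \<open>A finite set that captures the sum up to \<epsilon> lies below its largest value, so
  cutting by the size of \<open>g M\<close> works as well as cutting by a finite set.\<close>

lemma tail_small:
  assumes h: "h summable_on UNIV" "\<And>M. 0 \<le> h M" and \<epsilon>: "(0::real) < \<epsilon>"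
  obtains X where "1 \<le> X" "infsum h {M. X < g M} < \<epsilon>"
proof -
  have "(h has_sum infsum h UNIV) UNIV" using h by (intro has_sum_infsum)
  then have "\<forall>\<^sub>F S in finite_subsets_at_top UNIV. dist (sum h S) (infsum h UNIV) < \<epsilon>"
    using \<epsilon> unfolding has_sum_def by (rule tendstoD)
  then obtain S where S: "finite S" "dist (sum h S) (infsum h UNIV) < \<epsilon>"
    unfolding eventually_finite_subsets_at_top by auto
  define X where "X = Max (insert 1 (g ` S))"
  have X: "1 \<le> X" "\<And>M. M \<in> S \<Longrightarrow> g M \<le> X" using S by (auto simp: X_def)
  have "sum h S \<le> sum h {M. g M \<le> X}"
    using h X by (intro sum_mono2) auto
  moreover have "infsum h UNIV = infsum h {M. g M \<le> X} + infsum h {M. X < g M}"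
  proof (subst infsum_Un_disjoint[symmetric])
    show "infsum h UNIV = infsum h ({M. g M \<le> X} \<union> {M. X < g M})"
      by (rule arg_cong[of _ _ "infsum h"]) auto
  qed (use summable_on_subset_banach[OF h(1)] in auto)
  ultimately have "infsum h {M. X < g M} < \<epsilon>"
    using S(2) by (auto simp: dist_real_def abs_less_iff)
  with X(1) show ?thesis by (rule that)
qed

definition mollifier :: "real \<Rightarrow> complex \<Rightarrow> complex" where
  "mollifier X s = (\<Sum>N | g N \<le> X. mu N * dterm N s)"

text \<open>The coefficient of M in the product of zeta and the mollifier: the Moebius sum over
  those divisors of M whose value is at most X.\<close>

definition mcoeff :: "real \<Rightarrow> nat multiset \<Rightarrow> complex" where
  "mcoeff X M = (\<Sum>N | N \<subseteq># M \<and> g N \<le> X. mu N)"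

lemma norm_mcoeff_le: "norm (mcoeff X M) \<le> divs M"
proof -
  have "norm (mcoeff X M) \<le> (\<Sum>N | N \<subseteq># M \<and> g N \<le> X. 1)"
    unfolding mcoeff_def by (intro sum_norm_le norm_mu_le_1)
  also have "\<dots> \<le> divs M"
    unfolding divs_def by (auto intro!: card_mono)
  finally show ?thesis .
qed

lemma mcoeff_below: "1 \<le> X \<Longrightarrow> g M \<le> X \<Longrightarrow> mcoeff X M = (if M = {#} then 1 else 0)"
proof -
  assume X: "1 \<le> X" "g M \<le> X"
  then have "{N. N \<subseteq># M \<and> g N \<le> X} = {N. N \<subseteq># M}"
    using gen_int_mono[OF primes, of _ M] by (auto intro: order_trans)
  then show ?thesis by (simp add: mcoeff_def sum_mu)
qed

lemma summable_dterm:
  assumes s: "1 < Re s" and c: "\<And>M. M \<in> S \<Longrightarrow> norm (c M) \<le> divs M"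
  shows "(\<lambda>M. c M * dterm M s) summable_on S"
proof -
  have "(\<lambda>M. divs M * g M powr - Re s) summable_on S"
    by (rule summable_on_subset_banach[OF summable_divs[OF s]]) auto
  then have "(\<lambda>M. norm (c M * dterm M s)) summable_on S"
    by (rule summable_on_comparison_test) (auto simp: norm_mult norm_dterm c mult_right_mono)
  then show ?thesis by (rule abs_summable_summable)
qed

lemma norm_infsum_dterm_le:
  assumes s: "1 < Re s" and c: "\<And>M. M \<in> S \<Longrightarrow> norm (c M) \<le> divs M"
  shows "norm (\<Sum>\<^sub>\<infinity>M\<in>S. c M * dterm M s) \<le> (\<Sum>\<^sub>\<infinity>M\<in>S. divs M * g M powr - Re s)"
proof (rule norm_infsum_le[OF has_sum_infsum has_sum_infsum])
  show "(\<lambda>M. c M * dterm M s) summable_on S" by (rule summable_dterm[OF s c])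
  show "(\<lambda>M. divs M * g M powr - Re s) summable_on S"
    by (rule summable_on_subset_banach[OF summable_divs[OF s]]) auto
qed (auto simp: norm_mult norm_dterm c mult_right_mono)

text \<open>Multiplying zeta by one term of the mollifier moves the summation to the multiples of N.
  Collecting terms gives the coefficients \<open>mcoeff\<close>; for values up to X every divisor is
  included, so the full Moebius sum leaves only the constant term 1.\<close>

lemma mollified_zeta:
  assumes s: "1 < Re s" and X: "1 \<le> X"
  shows "Z s * mollifier X s - 1 = (\<Sum>\<^sub>\<infinity>M\<in>{M. X < g M}. mcoeff X M * dterm M s)"
proof -
  have summ: "(\<lambda>M. dterm M s) summable_on S" for S
    using summable_dterm[OF s, of S "\<lambda>_. 1"] divs_ge_1 by simp
  have one: "mu N * dterm N s * Z s = (\<Sum>\<^sub>\<infinity>M. if N \<subseteq># M then mu N * dterm M s else 0)" for N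
  proof -
    have "mu N * dterm N s * Z s = (\<Sum>\<^sub>\<infinity>L. mu N * dterm N s * dterm L s)"
      using s summ by (simp add: Z_eq_series infsum_cmult_right)
    also have "\<dots> = (\<Sum>\<^sub>\<infinity>L. mu N * dterm (N + L) s)"
      by (simp add: dterm_add mult.assoc)
    also have "\<dots> = (\<Sum>\<^sub>\<infinity>M\<in>range (\<lambda>L. N + L). mu N * dterm M s)"
      by (subst infsum_reindex) (auto simp: inj_on_def o_def)
    also have "\<dots> = (\<Sum>\<^sub>\<infinity>M. if N \<subseteq># M then mu N * dterm M s else 0)"
      by (rule infsum_cong_neutral) (auto simp: subset_mset.le_iff_add)
    finally show ?thesis .
  qed
  have summ': "(\<lambda>M. if N \<subseteq># M then mu N * dterm M s else 0) summable_on UNIV" for N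
  proof -
    have "(\<lambda>M. (if N \<subseteq># M then mu N else 0) * dterm M s) summable_on UNIV"
    proof (rule summable_dterm[OF s])
      fix M
      show "norm (if N \<subseteq># M then mu N else 0) \<le> divs M"
        using norm_mu_le_1[of N] divs_ge_1[of M] by auto
    qed
    then show ?thesis by (simp add: if_distrib[of "\<lambda>c. c * _"] cong: if_cong)
  qed
  have "Z s * mollifier X s = (\<Sum>N | g N \<le> X. mu N * dterm N s * Z s)"
    by (simp add: mollifier_def sum_distrib_left mult_ac)
  also have "\<dots> = (\<Sum>N | g N \<le> X. \<Sum>\<^sub>\<infinity>M. if N \<subseteq># M then mu N * dterm M s else 0)"
    by (simp add: one)
  also have "\<dots> = (\<Sum>\<^sub>\<infinity>M. \<Sum>N | g N \<le> X. if N \<subseteq># M then mu N * dterm M s else 0)"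
    using infsumI[OF has_sum_sum[OF finite_g_le has_sum_infsum[OF summ']]] by simp
  also have "\<dots> = (\<Sum>\<^sub>\<infinity>M. mcoeff X M * dterm M s)"
  proof (rule infsum_cong)
    fix M
    have "{N \<in> {N. g N \<le> X}. N \<subseteq># M} = {N. N \<subseteq># M \<and> g N \<le> X}" by auto
    then show "(\<Sum>N | g N \<le> X. if N \<subseteq># M then mu N * dterm M s else 0) = mcoeff X M * dterm M s"
      by (simp add: mcoeff_def sum_distrib_right flip: sum.inter_filter)
  qed
  also have "\<dots> = (\<Sum>\<^sub>\<infinity>M\<in>{{#}} \<union> {M. X < g M}. mcoeff X M * dterm M s)"
    by (rule infsum_cong_neutral) (auto simp: mcoeff_below X not_less)
  also have "\<dots> = (\<Sum>\<^sub>\<infinity>M\<in>{{#}}. mcoeff X M * dterm M s) + (\<Sum>\<^sub>\<infinity>M\<in>{M. X < g M}. mcoeff X M * dterm M s)"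
    using X by (intro infsum_Un_disjoint summable_dterm s norm_mcoeff_le) auto
  also have "(\<Sum>\<^sub>\<infinity>M\<in>{{#}}. mcoeff X M * dterm M s) = 1"
    using X by (simp add: mcoeff_below)
  finally show ?thesis by simp
qed

text \<open>As X grows, Z times the mollifier tends to 1, while the norm of the mollifier never
  exceeds \<open>zeta\<^sub>r (Re s)\<close>. This takes the place of the Euler product: it yields
  nonvanishing to the right of 1 and the lower bound at the centre of the discs in Jensen's
  inequality.\<close>

lemma norm_Z_lower:
  assumes s: "1 < Re s"
  shows "1 \<le> norm (Z s) * zeta\<^sub>r (Re s)"
proof (rule field_le_epsilon)
  fix \<epsilon> :: real assume "0 < \<epsilon>"
  have "0 \<le> divs M * g M powr - Re s" for M
    using divs_ge_1[of M] by (intro mult_nonneg_nonneg) auto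
  from tail_small[OF summable_divs[OF s] this \<open>0 < \<epsilon>\<close>]
  obtain X where X: "1 \<le> X" "(\<Sum>\<^sub>\<infinity>M\<in>{M. X < g M}. divs M * g M powr - Re s) < \<epsilon>" .
  have "norm (Z s * mollifier X s - 1) < \<epsilon>"
    using mollified_zeta[OF s X(1)] norm_infsum_dterm_le[OF s norm_mcoeff_le[of X], where S = "{M. X < g M}"] X by simp
  then have *: "1 \<le> norm (Z s * mollifier X s) + \<epsilon>"
    using norm_triangle_ineq4[of "Z s * mollifier X s" "Z s * mollifier X s - 1"] by simp
  have "norm (mollifier X s) \<le> (\<Sum>N | g N \<le> X. g N powr - Re s)"
    unfolding mollifier_def
    by (rule sum_norm_le) (simp add: norm_mult norm_dterm norm_mu_le_1 mult_left_le_one_le)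
  also have "\<dots> \<le> zeta\<^sub>r (Re s)"
    unfolding zeta\<^sub>r_def by (rule finite_sum_le_infsum[OF summable_g[OF s]]) auto
  finally have "norm (Z s) * norm (mollifier X s) \<le> norm (Z s) * zeta\<^sub>r (Re s)"
    by (intro mult_left_mono) auto
  with * show "1 \<le> norm (Z s) * zeta\<^sub>r (Re s) + \<epsilon>"
    by (simp add: norm_mult)
qed

lemma Z_nonzero: "1 < Re s \<Longrightarrow> Z s \<noteq> 0"
  by (metis norm_Z_lower mult_zero_left norm_zero not_one_le_zero)

lemma mollifier_holomorphic: "mollifier X holomorphic_on S"
  unfolding mollifier_def[abs_def]
  by (intro holomorphic_on_sum holomorphic_on_mult holomorphic_on_const dterm_holomorphic)

lemma norm_mollifier_le:
  assumes "0 \<le> Re s" "1 \<le> X"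
  shows "norm (mollifier X s) \<le> (A + C0) * X"
proof -
  have "norm (mollifier X s) \<le> (\<Sum>N | g N \<le> X. 1)"
    unfolding mollifier_def
  proof (rule sum_norm_le)
    fix N
    have "g N powr - Re s \<le> 1"
      using g_ge_1[of N] assms by (simp add: powr_minus inverse_le_1_iff ge_one_powr_ge_zero)
    then show "norm (mu N * dterm N s) \<le> 1"
      using norm_mu_le_1[of N] by (simp add: norm_mult norm_dterm mult_le_one)
  qed
  also have "\<dots> \<le> (A + C0) * X"
    using count_le[OF assms(2)] by (simp add: gen_int_count_def)
  finally show ?thesis .
qed

end

subsection \<open>Detecting and counting zeros\<close>

lemma continuous_on_Complex_right [continuous_intros]: "continuous_on S (\<lambda>y. Complex a y)"
  unfolding Complex_eq by (intro continuous_intros)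

lemma contour_integral_rectpath:
  assumes ab: "a < b" "c < d"
    and cont: "continuous_on (path_image (rectpath (Complex a c) (Complex b d))) f"
  shows "contour_integral (rectpath (Complex a c) (Complex b d)) f =
     contour_integral (linepath (Complex a c) (Complex b c)) f
     + \<i> * integral {c..d} (\<lambda>y. f (Complex b y))
     - contour_integral (linepath (Complex a d) (Complex b d)) f
     - \<i> * integral {c..d} (\<lambda>y. f (Complex a y))"
proof -
  have img: "path_image (rectpath (Complex a c) (Complex b d)) =
      closed_segment (Complex a c) (Complex b c) \<union> closed_segment (Complex b c) (Complex b d)
      \<union> closed_segment (Complex b d) (Complex a d) \<union> closed_segment (Complex a d) (Complex a c)"
    by (simp add: rectpath_def Let_def path_image_join Un_assoc)
  have c1: "continuous_on (closed_segment (Complex a c) (Complex b c)) f"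
    and c2: "continuous_on (closed_segment (Complex b c) (Complex b d)) f"
    and c3: "continuous_on (closed_segment (Complex b d) (Complex a d)) f"
    and c4: "continuous_on (closed_segment (Complex a d) (Complex a c)) f"
    by (rule continuous_on_subset[OF cont], unfold img, blast)+
  note i = contour_integrable_continuous_linepath[OF c1] contour_integrable_continuous_linepath[OF c2]
    contour_integrable_continuous_linepath[OF c3] contour_integrable_continuous_linepath[OF c4]
  have "contour_integral (rectpath (Complex a c) (Complex b d)) f =
      contour_integral (linepath (Complex a c) (Complex b c)) f
      + (contour_integral (linepath (Complex b c) (Complex b d)) f
      + (contour_integral (linepath (Complex b d) (Complex a d)) f
      + contour_integral (linepath (Complex a d) (Complex a c)) f))"
    using i by (simp add: rectpath_def Let_def)
  also have "contour_integral (linepath (Complex b c) (Complex b d)) f = \<i> * integral {c..d} (\<lambda>y. f (Complex b y))"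
    using ab by (intro contour_integral_linepath_same_Re) auto
  also have "contour_integral (linepath (Complex b d) (Complex a d)) f = - contour_integral (linepath (Complex a d) (Complex b d)) f"
    by (rule contour_integral_reverse_linepath[OF c3])
  also have "contour_integral (linepath (Complex a d) (Complex a c)) f = - contour_integral (linepath (Complex a c) (Complex a d)) f"
    by (rule contour_integral_reverse_linepath[OF c4])
  also have "contour_integral (linepath (Complex a c) (Complex a d)) f = \<i> * integral {c..d} (\<lambda>y. f (Complex a y))"
    using ab by (intro contour_integral_linepath_same_Re) auto
  finally show ?thesis by simp
qed

lemma norm_horizontal_le:
  assumes ab: "a < b" and cont: "continuous_on (closed_segment (Complex a c) (Complex b c)) f"
    and M: "0 \<le> M" "\<And>x. a \<le> x \<Longrightarrow> x \<le> b \<Longrightarrow> norm (f (Complex x c)) \<le> M"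
  shows "norm (contour_integral (linepath (Complex a c) (Complex b c)) f) \<le> M * (b - a)"
proof -
  have "norm (contour_integral (linepath (Complex a c) (Complex b c)) f)
      \<le> M * norm (Complex b c - Complex a c)"
  proof (rule contour_integral_bound_linepath[OF contour_integrable_continuous_linepath[OF cont] M(1)])
    fix z assume "z \<in> closed_segment (Complex a c) (Complex b c)"
    then have "a \<le> Re z \<and> Re z \<le> b \<and> z = Complex (Re z) c"
      using ab by (subst (asm) closed_segment_same_Im) (auto simp: closed_segment_eq_real_ivl complex_eq_iff)
    then show "norm (f z) \<le> M" using M(2)[of "Re z"] by metis
  qed
  moreover have "Complex b c - Complex a c = complex_of_real (b - a)"
    by (simp add: complex_eq_iff)
  ultimately show ?thesis using ab by (metis abs_of_pos diff_gt_0_iff_gt norm_of_real)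
qed

lemma norm_integral_le_integral_norm:
  fixes f :: "real \<Rightarrow> complex"
  assumes "continuous_on {c..d} f" "continuous_on {c..d} h" "\<And>y. c \<le> y \<Longrightarrow> y \<le> d \<Longrightarrow> norm (f y) \<le> h y"
  shows "norm (integral {c..d} f) \<le> integral {c..d} h"
  using assms by (intro integral_norm_bound_integral integrable_continuous_interval) auto

lemma path_image_rectpath_subset:
  assumes "a < b" "c < d"
  shows "path_image (rectpath (Complex a c) (Complex b d)) \<subseteq> cbox (Complex a c) (Complex b d)"
  using assms by (intro path_image_rectpath_subset_cbox) auto

lemma vertical_shift:
  assumes ab: "a < b" "c < d"
    and hol: "f holomorphic_on S" "convex S" "cbox (Complex a c) (Complex b d) \<subseteq> S"
    and M: "0 \<le> M" "\<And>x. a \<le> x \<Longrightarrow> x \<le> b \<Longrightarrow> norm (f (Complex x c)) \<le> M"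
      "\<And>x. a \<le> x \<Longrightarrow> x \<le> b \<Longrightarrow> norm (f (Complex x d)) \<le> M"
  shows "norm (integral {c..d} (\<lambda>y. f (Complex b y)))
          \<le> norm (integral {c..d} (\<lambda>y. f (Complex a y))) + 2 * M * (b - a)"
proof -
  let ?\<gamma> = "rectpath (Complex a c) (Complex b d)"
  have sub: "path_image ?\<gamma> \<subseteq> S"
    using path_image_rectpath_subset[OF ab] hol(3) by blast
  have cont: "continuous_on S f" using hol(1) by (rule holomorphic_on_imp_continuous_on)
  have "contour_integral ?\<gamma> f = 0"
    by (rule contour_integral_unique[OF Cauchy_theorem_convex_simple[OF hol(1,2) _ sub]]) auto
  then have "\<i> * integral {c..d} (\<lambda>y. f (Complex b y)) =
      \<i> * integral {c..d} (\<lambda>y. f (Complex a y))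
      + (contour_integral (linepath (Complex a d) (Complex b d)) f
      - contour_integral (linepath (Complex a c) (Complex b c)) f)"
    using contour_integral_rectpath[OF ab continuous_on_subset[OF cont sub]] by (simp add: algebra_simps)
  then have "norm (\<i> * integral {c..d} (\<lambda>y. f (Complex b y))) \<le>
      norm (\<i> * integral {c..d} (\<lambda>y. f (Complex a y)))
      + (norm (contour_integral (linepath (Complex a d) (Complex b d)) f)
      + norm (contour_integral (linepath (Complex a c) (Complex b c)) f))"
    by (metis norm_triangle_ineq norm_triangle_ineq4 order_trans add_left_mono)
  moreover have "norm (contour_integral (linepath (Complex a d) (Complex b d)) f) \<le> M * (b - a)"
    using ab hol(3) M
    by (intro norm_horizontal_le continuous_on_subset[OF cont])
       (auto simp: closed_segment_same_Im closed_segment_eq_real_ivl in_cbox_complex_iff subset_iff)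
  moreover have "norm (contour_integral (linepath (Complex a c) (Complex b c)) f) \<le> M * (b - a)"
    using ab hol(3) M
    by (intro norm_horizontal_le continuous_on_subset[OF cont])
       (auto simp: closed_segment_same_Im closed_segment_eq_real_ivl in_cbox_complex_iff subset_iff)
  ultimately show ?thesis by (simp add: norm_mult)
qed

text \<open>Cauchy's formula at \<rho> with winding number 1. The kernel 1 / (z - \<rho>) is bounded
  by the inverse horizontal distance on the vertical sides, and by 1 on the horizontal sides because
  these are at least 1 away.\<close>

lemma Cauchy_rectangle_bound:
  assumes \<rho>: "a < Re \<rho>" "Re \<rho> < b" "c + 1 \<le> Im \<rho>" "Im \<rho> + 1 \<le> d"
    and hol: "h holomorphic_on S" "convex S" "open S" "cbox (Complex a c) (Complex b d) \<subseteq> S"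
    and M: "0 \<le> M" "\<And>x. a \<le> x \<Longrightarrow> x \<le> b \<Longrightarrow> norm (h (Complex x c)) \<le> M"
      "\<And>x. a \<le> x \<Longrightarrow> x \<le> b \<Longrightarrow> norm (h (Complex x d)) \<le> M"
  shows "2 * pi * norm (h \<rho>) \<le>
      integral {c..d} (\<lambda>y. norm (h (Complex a y))) / (Re \<rho> - a)
      + integral {c..d} (\<lambda>y. norm (h (Complex b y))) / (b - Re \<rho>) + 2 * M * (b - a)"
proof -
  let ?\<gamma> = "rectpath (Complex a c) (Complex b d)"
  define f where "f z = h z / (z - \<rho>)" for z
  have ab: "a < b" "c < d" using \<rho> by auto
  have img: "path_image ?\<gamma> = {z. Re z \<in> {a, b} \<and> Im z \<in> {c..d}} \<union> {z. Im z \<in> {c, d} \<and> Re z \<in> {a..b}}"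
    using ab by (subst path_image_rectpath) auto
  have sub: "path_image ?\<gamma> \<subseteq> S - {\<rho>}"
    using path_image_rectpath_subset[OF ab] hol(4) \<rho> by (auto simp: img)
  have conth: "continuous_on S h" using hol(1) by (rule holomorphic_on_imp_continuous_on)
  have cont: "continuous_on (S - {\<rho>}) f"
    unfolding f_def by (intro continuous_intros continuous_on_subset[OF conth]) auto
  have "\<rho> \<in> cbox (Complex a c) (Complex b d)"
    using \<rho> by (auto simp: in_cbox_complex_iff)
  then have \<rho>S: "\<rho> \<in> interior S" using hol(3,4) by (auto simp: interior_open)
  have wn: "winding_number ?\<gamma> \<rho> = 1"
    using \<rho> by (intro winding_number_rectpath) (auto simp: in_box_complex_iff)
  have "(f has_contour_integral (2 * pi * \<i> * winding_number ?\<gamma> \<rho> * h \<rho>)) ?\<gamma>"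
    unfolding f_def by (rule Cauchy_integral_formula_convex_simple[OF hol(2,1) \<rho>S _ sub]) auto
  then have eq: "2 * pi * \<i> * h \<rho> = contour_integral ?\<gamma> f"
    using wn by (simp add: contour_integral_unique)
  define I1 I2 where "I1 = contour_integral (linepath (Complex a c) (Complex b c)) f"
    and "I2 = contour_integral (linepath (Complex a d) (Complex b d)) f"
  define V1 V2 where "V1 = integral {c..d} (\<lambda>y. f (Complex a y))"
    and "V2 = integral {c..d} (\<lambda>y. f (Complex b y))"
  have "2 * pi * norm (h \<rho>) = norm (I1 + \<i> * V2 - I2 - \<i> * V1)"
    using arg_cong[OF eq, of norm]
    unfolding contour_integral_rectpath[OF ab continuous_on_subset[OF cont sub]] I1_def I2_def V1_def V2_def
    by (simp add: norm_mult)
  also have "\<dots> \<le> norm I1 + norm V2 + norm I2 + norm V1"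
    using norm_triangle_ineq4[of "I1 + \<i> * V2 - I2" "\<i> * V1"]
      norm_triangle_ineq4[of "I1 + \<i> * V2" "I2"] norm_triangle_ineq[of I1 "\<i> * V2"]
    by (simp add: norm_mult)
  also have "norm I1 \<le> M * (b - a)" unfolding I1_def
  proof (rule norm_horizontal_le[OF ab(1) continuous_on_subset[OF cont] M(1)])
    show "closed_segment (Complex a c) (Complex b c) \<subseteq> S - {\<rho>}"
      using sub ab by (auto simp: img closed_segment_same_Im closed_segment_eq_real_ivl subset_iff)
    fix x assume x: "a \<le> x" "x \<le> b"
    have "1 \<le> norm (Complex x c - \<rho>)"
      using abs_Im_le_cmod[of "Complex x c - \<rho>"] \<rho> by simp
    then have "norm (f (Complex x c)) \<le> norm (h (Complex x c)) / 1"
      unfolding f_def norm_divide by (intro divide_left_mono) auto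
    then show "norm (f (Complex x c)) \<le> M" using M(2)[OF x] by simp
  qed
  also have "norm I2 \<le> M * (b - a)" unfolding I2_def
  proof (rule norm_horizontal_le[OF ab(1) continuous_on_subset[OF cont] M(1)])
    show "closed_segment (Complex a d) (Complex b d) \<subseteq> S - {\<rho>}"
      using sub ab by (auto simp: img closed_segment_same_Im closed_segment_eq_real_ivl subset_iff)
    fix x assume x: "a \<le> x" "x \<le> b"
    have "1 \<le> norm (Complex x d - \<rho>)"
      using abs_Im_le_cmod[of "Complex x d - \<rho>"] \<rho> by simp
    then have "norm (f (Complex x d)) \<le> norm (h (Complex x d)) / 1"
      unfolding f_def norm_divide by (intro divide_left_mono) auto
    then show "norm (f (Complex x d)) \<le> M" using M(3)[OF x] by simp
  qed
  also have "norm V1 \<le> integral {c..d} (\<lambda>y. norm (h (Complex a y)) / (Re \<rho> - a))" unfolding V1_def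
  proof (rule norm_integral_le_integral_norm)
    have "Complex a y \<in> S - {\<rho>}" if "y \<in> {c..d}" for y using sub that by (auto simp: img subset_iff)
    then show "continuous_on {c..d} (\<lambda>y. f (Complex a y))"
      by (intro continuous_on_compose2[OF cont] continuous_intros) blast
    show "continuous_on {c..d} (\<lambda>y. norm (h (Complex a y)) / (Re \<rho> - a))"
      using \<open>\<And>y. y \<in> {c..d} \<Longrightarrow> Complex a y \<in> S - {\<rho>}\<close> \<rho>
      by (intro continuous_intros continuous_on_compose2[OF conth]) auto
    fix y
    have "Re \<rho> - a \<le> norm (Complex a y - \<rho>)"
      using abs_Re_le_cmod[of "Complex a y - \<rho>"] \<rho> by simp
    then show "norm (f (Complex a y)) \<le> norm (h (Complex a y)) / (Re \<rho> - a)"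
      unfolding f_def norm_divide using \<rho> by (intro divide_left_mono mult_pos_pos) auto
  qed
  also have "norm V2 \<le> integral {c..d} (\<lambda>y. norm (h (Complex b y)) / (b - Re \<rho>))" unfolding V2_def
  proof (rule norm_integral_le_integral_norm)
    have "Complex b y \<in> S - {\<rho>}" if "y \<in> {c..d}" for y using sub that by (auto simp: img subset_iff)
    then show "continuous_on {c..d} (\<lambda>y. f (Complex b y))"
      by (intro continuous_on_compose2[OF cont] continuous_intros) blast
    show "continuous_on {c..d} (\<lambda>y. norm (h (Complex b y)) / (b - Re \<rho>))"
      using \<open>\<And>y. y \<in> {c..d} \<Longrightarrow> Complex b y \<in> S - {\<rho>}\<close> \<rho>
      by (intro continuous_intros continuous_on_compose2[OF conth]) auto
    fix y
    have "b - Re \<rho> \<le> norm (Complex b y - \<rho>)"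
      using abs_Re_le_cmod[of "Complex b y - \<rho>"] \<rho> by simp
    then show "norm (f (Complex b y)) \<le> norm (h (Complex b y)) / (b - Re \<rho>)"
      unfolding f_def norm_divide using \<rho> by (intro divide_left_mono mult_pos_pos) auto
  qed
  finally show ?thesis by simp
qed

(* The factor exp ((s - rho)^2) makes the horizontal sides negligible while Y^(s - rho)
   weights the two vertical lines differently. *)
lemma two_line_bound:
  assumes \<rho>: "a < Re \<rho>" "Re \<rho> < b" "b \<le> a + 3" and H: "1 \<le> H" and Y: "1 \<le> Y"
    and hol: "f holomorphic_on S" "convex S" "open S"
      "cbox (Complex a (Im \<rho> - H)) (Complex b (Im \<rho> + H)) \<subseteq> S"
    and M: "0 \<le> M" "\<And>x. a \<le> x \<Longrightarrow> x \<le> b \<Longrightarrow> norm (f (Complex x (Im \<rho> - H))) \<le> M"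
      "\<And>x. a \<le> x \<Longrightarrow> x \<le> b \<Longrightarrow> norm (f (Complex x (Im \<rho> + H))) \<le> M"
  shows "norm (f \<rho>) \<le> exp 9 * (
      Y powr (a - Re \<rho>) / (Re \<rho> - a) * integral {Im \<rho> - H..Im \<rho> + H} (\<lambda>y. norm (f (Complex a y)))
      + Y powr (b - Re \<rho>) / (b - Re \<rho>) * integral {Im \<rho> - H..Im \<rho> + H} (\<lambda>y. norm (f (Complex b y)))
      + 6 * Y powr 3 * M * exp (- (H\<^sup>2)))"
proof -
  define c d where "c = Im \<rho> - H" and "d = Im \<rho> + H"
  define k where "k s = exp ((s - \<rho>)\<^sup>2 + (s - \<rho>) * complex_of_real (ln Y))" for s
  define h where "h s = f s * k s" for s
  have norm_k: "norm (k s) = exp ((Re s - Re \<rho>)\<^sup>2 - (Im s - Im \<rho>)\<^sup>2) * Y powr (Re s - Re \<rho>)" for s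
    using Y by (simp add: k_def norm_exp_eq_Re powr_def exp_add[symmetric] power2_eq_square algebra_simps)
  \<comment> \<open>The strip has width at most 3, whence the constant \<open>exp 9\<close> from the
    Gaussian factor.\<close>
  have sq: "(x - Re \<rho>)\<^sup>2 \<le> 9" if "a \<le> x" "x \<le> b" for x
    using that \<rho> abs_le_square_iff[of "x - Re \<rho>" 3] by auto
  have hol': "h holomorphic_on S"
    unfolding h_def[abs_def] k_def by (intro holomorphic_intros hol)
  have hor: "norm (h (Complex x y)) \<le> exp 9 * (Y powr 3 * M * exp (- (H\<^sup>2)))"
    if "a \<le> x" "x \<le> b" "norm (f (Complex x y)) \<le> M" "(y - Im \<rho>)\<^sup>2 = H\<^sup>2" for x y
  proof -
    have "norm (k (Complex x y)) = exp ((x - Re \<rho>)\<^sup>2 - H\<^sup>2) * Y powr (x - Re \<rho>)"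
      using that by (simp add: norm_k)
    also have "\<dots> \<le> exp (9 - H\<^sup>2) * Y powr 3"
      using sq[of x] that \<rho> Y by (intro mult_mono powr_mono) auto
    also have "\<dots> = exp 9 * (Y powr 3 * exp (- (H\<^sup>2)))"
      by (simp add: exp_diff exp_minus field_simps)
    finally have "norm (f (Complex x y)) * norm (k (Complex x y)) \<le> M * (exp 9 * (Y powr 3 * exp (- (H\<^sup>2))))"
      using that M by (intro mult_mono) auto
    then show ?thesis by (simp add: h_def norm_mult mult_ac)
  qed
  have vert: "integral {c..d} (\<lambda>y. norm (h (Complex x y))) \<le>
      exp 9 * Y powr (x - Re \<rho>) * integral {c..d} (\<lambda>y. norm (f (Complex x y)))"
    if x: "a \<le> x" "x \<le> b" for x
  proof -
    have S: "Complex x y \<in> S" if "y \<in> {c..d}" for y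
      using hol(4) x that by (auto simp: in_cbox_complex_iff c_def d_def subset_iff)
    have cf: "continuous_on {c..d} (\<lambda>y. norm (f (Complex x y)))"
      using S by (intro continuous_intros continuous_on_compose2[OF holomorphic_on_imp_continuous_on[OF hol(1)]]) auto
    have ch: "continuous_on {c..d} (\<lambda>y. norm (h (Complex x y)))"
      using S by (intro continuous_intros continuous_on_compose2[OF holomorphic_on_imp_continuous_on[OF hol']]) auto
    have "integral {c..d} (\<lambda>y. norm (h (Complex x y))) \<le>
        integral {c..d} (\<lambda>y. exp 9 * Y powr (x - Re \<rho>) * norm (f (Complex x y)))"
    proof (rule integral_le)
      show "(\<lambda>y. norm (h (Complex x y))) integrable_on {c..d}"
        using ch by (rule integrable_continuous_interval)
      show "(\<lambda>y. exp 9 * Y powr (x - Re \<rho>) * norm (f (Complex x y))) integrable_on {c..d}"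
        by (intro integrable_continuous_interval continuous_intros cf)
      fix y
      have "norm (k (Complex x y)) = exp ((x - Re \<rho>)\<^sup>2 - (y - Im \<rho>)\<^sup>2) * Y powr (x - Re \<rho>)"
        by (simp add: norm_k)
      also have "\<dots> \<le> exp 9 * Y powr (x - Re \<rho>)"
      proof -
        have "(x - Re \<rho>)\<^sup>2 - (y - Im \<rho>)\<^sup>2 \<le> 9"
          using sq[OF x] zero_le_power2[of "y - Im \<rho>"] by linarith
        then show ?thesis by (intro mult_right_mono) auto
      qed
      finally show "norm (h (Complex x y)) \<le> exp 9 * Y powr (x - Re \<rho>) * norm (f (Complex x y))"
        unfolding h_def norm_mult by (simp add: mult_right_mono mult.commute[of "norm (f _)"])
    qed
    then show ?thesis by simp
  qed
  have "h \<rho> = f \<rho>" by (simp add: h_def k_def)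
  have "2 * pi * norm (h \<rho>) \<le>
      integral {c..d} (\<lambda>y. norm (h (Complex a y))) / (Re \<rho> - a)
      + integral {c..d} (\<lambda>y. norm (h (Complex b y))) / (b - Re \<rho>)
      + 2 * (exp 9 * (Y powr 3 * M * exp (- (H\<^sup>2)))) * (b - a)"
  proof (rule Cauchy_rectangle_bound[OF \<rho>(1,2) _ _ hol'])
    show "cbox (Complex a c) (Complex b d) \<subseteq> S" using hol(4) by (simp add: c_def d_def)
  qed (use H M hol Y hor in \<open>auto simp: c_def d_def\<close>)
  also have "integral {c..d} (\<lambda>y. norm (h (Complex a y))) / (Re \<rho> - a) \<le>
      exp 9 * Y powr (a - Re \<rho>) * integral {c..d} (\<lambda>y. norm (f (Complex a y))) / (Re \<rho> - a)"
    using \<rho> by (intro divide_right_mono vert) auto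
  also have "integral {c..d} (\<lambda>y. norm (h (Complex b y))) / (b - Re \<rho>) \<le>
      exp 9 * Y powr (b - Re \<rho>) * integral {c..d} (\<lambda>y. norm (f (Complex b y))) / (b - Re \<rho>)"
    using \<rho> by (intro divide_right_mono vert) auto
  also have "2 * (exp 9 * (Y powr 3 * M * exp (- (H\<^sup>2)))) * (b - a)
      \<le> 2 * (exp 9 * (Y powr 3 * M * exp (- (H\<^sup>2)))) * 3"
    using \<rho> M by (intro mult_left_mono) auto
  also have "norm (h \<rho>) * 1 \<le> norm (h \<rho>) * (2 * pi)"
    using pi_gt3 by (intro mult_left_mono) auto
  ultimately show ?thesis
    unfolding \<open>h \<rho> = f \<rho>\<close> by (simp add: c_def d_def algebra_simps)
qed

section \<open>Jensen's inequality\<close>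

lemma zero_factorization:
  assumes f: "f holomorphic_on S" "open S" "connected S" "\<rho> \<in> S" and nz: "w \<in> S" "f w \<noteq> 0"
  obtains h where "h holomorphic_on S" "h \<rho> \<noteq> 0"
    "\<And>z. z \<in> S \<Longrightarrow> f z = h z * (z - \<rho>) ^ nat (zorder f \<rho>)"
proof -
  define m where "m = nat (zorder f \<rho>)"
  have "\<exists>w\<in>S. f w \<noteq> 0" using nz by blast
  from zorder_exist_zero[OF f this] obtain r where r: "0 < r" "cball \<rho> r \<subseteq> S"
      "zor_poly f \<rho> holomorphic_on cball \<rho> r"
      "\<forall>w\<in>cball \<rho> r. f w = zor_poly f \<rho> w * (w - \<rho>) ^ m \<and> zor_poly f \<rho> w \<noteq> 0"
    unfolding m_def by blast
  \<comment> \<open>Near \<rho> the cofactor is the local nonvanishing one, elsewhere the plain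
    quotient. Both agree on the punctured disc, so the glued function is holomorphic on all of
    S.\<close>
  define h where "h z = (if z \<in> ball \<rho> r then zor_poly f \<rho> z else f z / (z - \<rho>) ^ m)" for z
  have h_eq: "h z = f z / (z - \<rho>) ^ m" if "z \<in> S - {\<rho>}" for z
    using that r(4) by (auto simp: h_def)
  have "h holomorphic_on ball \<rho> r"
    by (rule holomorphic_transform[OF holomorphic_on_subset[OF r(3) ball_subset_cball]]) (simp add: h_def)
  moreover have "h holomorphic_on S - {\<rho>}"
  proof (rule holomorphic_transform)
    show "(\<lambda>z. f z / (z - \<rho>) ^ m) holomorphic_on S - {\<rho>}"
      by (intro holomorphic_intros holomorphic_on_subset[OF f(1)]) auto
  qed (simp add: h_eq)
  ultimately have "h holomorphic_on ball \<rho> r \<union> (S - {\<rho>})"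
    using f(2) by (intro holomorphic_on_Un) auto
  also have "ball \<rho> r \<union> (S - {\<rho>}) = S" using r(1,2) f(4) by (auto simp: subset_iff)
  finally have "h holomorphic_on S" .
  moreover have "h \<rho> \<noteq> 0" using r(1,4) by (simp add: h_def)
  moreover have "f z = h z * (z - \<rho>) ^ m" if "z \<in> S" for z
    using that r(1,4) h_eq[of z] by (cases "z = \<rho>") (auto simp: h_def)
  ultimately show ?thesis using that by (simp add: m_def)
qed

lemma zorder_mult_nonzero:
  assumes h: "h holomorphic_on S" "open S" "connected S" "z \<in> S" and nz: "w \<in> S" "h w \<noteq> 0"
    and b: "b holomorphic_on S" "b z \<noteq> 0"
  shows "zorder (\<lambda>u. h u * b u) z = zorder h z"
proof -
  have an: "h analytic_on {z}" "b analytic_on {z}"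
    using h b analytic_at by blast+
  have "\<forall>\<^sub>F u in at z. h u \<noteq> 0 \<and> u \<in> S"
    by (rule non_zero_neighbour_alt[OF h nz])
  moreover have "\<forall>\<^sub>F u in at z. b u \<noteq> 0 \<and> u \<in> S"
    by (rule non_zero_neighbour_alt[OF b(1) h(2,3,4) h(4) b(2)])
  ultimately have "\<forall>\<^sub>F u in at z. h u * b u \<noteq> 0"
    by eventually_elim simp
  then show ?thesis
    using zorder_times_analytic[OF an] zorder_eq_0I[OF an(2) b(2)] by simp
qed

text \<open>On the circle R^2 equals w times its conjugate, so reflecting the zero does not change
  the modulus of the linear factor there.\<close>

lemma blaschke_norm:
  assumes "norm (w :: complex) = R" "0 < R"
  shows "norm ((complex_of_real (R\<^sup>2) - cnj a * w) / R) = norm (w - a)"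
proof -
  have "complex_of_real (R\<^sup>2) = w * cnj w" using assms by (metis complex_norm_square)
  then have "complex_of_real (R\<^sup>2) - cnj a * w = w * cnj (w - a)" by (simp add: algebra_simps)
  then have "norm (complex_of_real (R\<^sup>2) - cnj a * w) = R * norm (w - a)"
    using assms by (metis complex_mod_cnj norm_mult)
  then show ?thesis using assms by (simp add: norm_divide)
qed

(* Jensen's inequality: each zero is traded for a Blaschke factor, which keeps the modulus on the
   outer circle and gains at least R / r at the centre. *)
lemma zero_count_power_bound:
  assumes "finite Zs" and f: "f holomorphic_on S" "open S" "connected S" and S: "cball z0 R \<subseteq> S"
    and r: "0 < r" "r < R" and Zs: "\<And>\<rho>. \<rho> \<in> Zs \<Longrightarrow> f \<rho> = 0 \<and> dist z0 \<rho> \<le> r"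
    and nz: "f z0 \<noteq> 0" and M: "\<And>z. dist z0 z = R \<Longrightarrow> norm (f z) \<le> M"
  shows "norm (f z0) * (R / r) ^ (\<Sum>\<rho>\<in>Zs. nat (zorder f \<rho>)) \<le> M"
  using assms
proof (induction Zs arbitrary: f rule: finite_induct)
  case empty
  have "norm (f z0) \<le> M"
  proof (rule maximum_modulus_frontier[of f "cball z0 R"])
    show "f holomorphic_on interior (cball z0 R)"
      using empty.prems(1,4) by (meson holomorphic_on_subset interior_subset)
    show "continuous_on (closure (cball z0 R)) f"
      using empty.prems(1,4) by (metis closed_cball closure_closed holomorphic_on_imp_continuous_on holomorphic_on_subset)
    show "norm (f z) \<le> M" if "z \<in> frontier (cball z0 R)" for z
      using that empty.prems r by (auto simp: frontier_cball)
  qed (use r in auto)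
  then show ?case by simp
next
  case (insert \<rho> Zs)
  note f = insert.prems(1-3)
  define a m where "a = \<rho> - z0" and "m = nat (zorder f \<rho>)"
  have R: "0 < R" using r by simp
  have z0S: "z0 \<in> S" using insert.prems(4) R by auto
  have \<rho>: "f \<rho> = 0" "norm a \<le> r" "\<rho> \<in> S"
    using insert.prems(4) insert.prems(7)[of \<rho>] r by (auto simp: a_def dist_norm norm_minus_commute)
  have a0: "a \<noteq> 0" using \<rho> insert.prems(8) by (auto simp: a_def)
  from zero_factorization[OF f \<rho>(3) z0S insert.prems(8)]
  obtain h where h: "h holomorphic_on S" "h \<rho> \<noteq> 0"
      "\<And>z. z \<in> S \<Longrightarrow> f z = h z * (z - \<rho>) ^ m"
    unfolding m_def by blast
  define b where "b z = (complex_of_real (R\<^sup>2) - cnj a * (z - z0)) / R" for z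
  define f1 where "f1 z = h z * b z ^ m" for z
  have b_hol: "b holomorphic_on S" unfolding b_def by (intro holomorphic_intros) (use R in auto)
  have h0: "h z0 \<noteq> 0" using h(3)[OF z0S] insert.prems(8) by auto
  have f1z0: "f1 z0 = h z0 * complex_of_real R ^ m"
    using R by (simp add: f1_def b_def power2_eq_square)
  have fz0: "norm (f z0) = norm (h z0) * norm a ^ m"
    using h(3)[OF z0S] by (simp add: a_def norm_mult norm_power norm_minus_commute)
  \<comment> \<open>The reflected factor \<open>b\<close> vanishes only outside the disc of radius
    R, so replacing the power of z - \<rho> by that of \<open>b\<close> leaves the order of every
    other zero unchanged.\<close>
  have zo: "zorder f1 z = zorder f z \<and> f1 z = 0" if z: "z \<in> Zs" for z
  proof -
    have z': "f z = 0" "dist z0 z \<le> r" "z \<in> S" "z \<noteq> \<rho>"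
      using z insert.prems(4) insert.prems(7)[of z] insert.hyps(2) r by (auto simp: subset_iff)
    have "norm (cnj a * (z - z0)) \<le> r * r"
      unfolding norm_mult using \<rho>(2) z'(2) r by (intro mult_mono) (auto simp: dist_norm norm_minus_commute)
    also have "\<dots> < R\<^sup>2" unfolding power2_eq_square using r by (intro mult_strict_mono) auto
    finally have "norm (cnj a * (z - z0)) < norm (complex_of_real (R\<^sup>2))"
      unfolding norm_of_real by simp
    then have "cnj a * (z - z0) \<noteq> complex_of_real (R\<^sup>2)" by auto
    then have bz: "b z ^ m \<noteq> 0" using R by (simp add: b_def)
    have "zorder (\<lambda>u. h u * b u ^ m) z = zorder h z"
      using bz by (intro zorder_mult_nonzero[OF h(1) f(2,3) z'(3) z0S h0] holomorphic_intros b_hol)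
    moreover have "zorder (\<lambda>u. h u * (u - \<rho>) ^ m) z = zorder h z"
      using z' by (intro zorder_mult_nonzero[OF h(1) f(2,3) z'(3) z0S h0] holomorphic_intros) auto
    moreover have "zorder f z = zorder (\<lambda>u. h u * (u - \<rho>) ^ m) z"
    proof (rule zorder_cong[OF _ refl])
      show "\<forall>\<^sub>F u in at z. f u = h u * (u - \<rho>) ^ m"
        using h(3) f(2) z'(3) eventually_at_topological by blast
    qed
    moreover have "h z = 0" using h(3)[OF z'(3)] z' by auto
    ultimately show ?thesis by (simp add: f1_def[abs_def])
  qed
  have "norm (f1 z0) * (R / r) ^ (\<Sum>\<rho>\<in>Zs. nat (zorder f1 \<rho>)) \<le> M"
  proof (rule insert.IH[OF _ f(2,3) insert.prems(4) r])
    show "f1 holomorphic_on S" unfolding f1_def[abs_def] by (intro holomorphic_intros h b_hol)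
    show "f1 z0 \<noteq> 0" using f1z0 h0 R by simp
    show "f1 z = 0 \<and> dist z0 z \<le> r" if "z \<in> Zs" for z
      using zo[OF that] insert.prems(7)[of z] that by simp
    show "norm (f1 z) \<le> M" if "dist z0 z = R" for z
    proof -
      have "norm (b z) = norm (z - z0 - a)"
        unfolding b_def using that R by (intro blaschke_norm) (auto simp: dist_norm norm_minus_commute)
      also have "z - z0 - a = z - \<rho>" by (simp add: a_def)
      finally have "norm (f1 z) = norm (f z)"
        using h(3)[of z] insert.prems(4) that by (auto simp: f1_def norm_mult norm_power)
      then show ?thesis using insert.prems(9)[OF that] by simp
    qed
  qed
  moreover have "(\<Sum>\<rho>\<in>Zs. nat (zorder f1 \<rho>)) = (\<Sum>\<rho>\<in>Zs. nat (zorder f \<rho>))"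
    using zo by (intro sum.cong) auto
  moreover have "norm (f z0) * (R / r) ^ m \<le> norm (f1 z0)"
  proof -
    have "norm a ^ m * (R / r) ^ m = (norm a / r * R) ^ m"
      by (simp add: power_mult_distrib[symmetric])
    also have "\<dots> \<le> R ^ m"
      using \<rho>(2) r R by (intro power_mono mult_left_le_one_le) (auto simp: divide_le_eq)
    finally have "norm (h z0) * (norm a ^ m * (R / r) ^ m) \<le> norm (h z0) * R ^ m"
      by (rule mult_left_mono) simp
    then show ?thesis using f1z0 fz0 R by (simp add: norm_mult norm_power mult.assoc)
  qed
  moreover have "(\<Sum>\<rho>\<in>insert \<rho> Zs. nat (zorder f \<rho>)) = m + (\<Sum>\<rho>\<in>Zs. nat (zorder f \<rho>))"
    using insert.hyps by (simp add: m_def)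
  moreover define q where "q = (R / r) ^ (\<Sum>\<rho>\<in>Zs. nat (zorder f \<rho>))"
  ultimately have "norm (f1 z0) * q \<le> M" "norm (f z0) * (R / r) ^ m * q \<le> norm (f1 z0) * q"
    "(R / r) ^ (\<Sum>\<rho>\<in>insert \<rho> Zs. nat (zorder f \<rho>)) = (R / r) ^ m * q"
    using r by (auto simp: power_add intro!: mult_right_mono)
  then show ?case by (simp only: mult.assoc)
qed

section \<open>Zeros of zeta in horizontal windows\<close>

context beurling_system
begin

definition mult :: "complex \<Rightarrow> nat" where "mult \<rho> = nat (zorder Z \<rho>)"

text \<open>Discs near the real axis contain the pole. Jensen's inequality is therefore applied to
  the product of s - 1 and Z, which is holomorphic on the half plane and has the same zeros and
  orders away from 1.\<close>

lemma pole_free_Z: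
  obtains f where "f holomorphic_on {s. \<theta> < Re s}"
    "\<And>s. \<theta> < Re s \<Longrightarrow> s \<noteq> 1 \<Longrightarrow> f s = (s - 1) * Z s" "f 1 \<noteq> 0"
    "\<And>\<rho>. \<theta> < Re \<rho> \<Longrightarrow> \<rho> \<noteq> 1 \<Longrightarrow> zorder f \<rho> = zorder Z \<rho>"
proof -
  from zext_pole_factor obtain f where f: "f holomorphic_on {s. \<theta> < Re s}" "f 1 \<noteq> 0"
    "\<And>s. s \<noteq> 1 \<Longrightarrow> zext s = f s / (s - 1)" by blast
  have eq: "f s = (s - 1) * Z s" if "\<theta> < Re s" "s \<noteq> 1" for s
    using f(3)[of s] Z_eq_zext[of s] that by simp
  let ?S = "{s. \<theta> < Re s} - {1::complex}"
  have conn: "connected ?S"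
    by (intro connected_open_delete[OF open_halfspace_Re_gt] convex_connected convex_halfspace_Re_gt) simp
  have two: "2 \<in> ?S" "Z 2 \<noteq> 0"
    using theta_less_1 Z_nonzero[of 2] by auto
  have "zorder f \<rho> = zorder Z \<rho>" if \<rho>: "\<theta> < Re \<rho>" "\<rho> \<noteq> 1" for \<rho>
  proof -
    have "zorder (\<lambda>s. Z s * (s - 1)) \<rho> = zorder Z \<rho>"
      using \<rho> two by (intro zorder_mult_nonzero[OF Z_holomorphic open_domain conn _ two] holomorphic_intros) auto
    moreover have "zorder f \<rho> = zorder (\<lambda>s. Z s * (s - 1)) \<rho>"
    proof (rule zorder_cong[OF _ refl])
      have "\<forall>\<^sub>F s in at \<rho>. s \<in> ?S"
        using \<rho> open_domain eventually_at_topological by blast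
      then show "\<forall>\<^sub>F s in at \<rho>. f s = Z s * (s - 1)"
        by eventually_elim (simp add: eq)
    qed
    ultimately show ?thesis by simp
  qed
  from that[OF f(1) eq f(2) this] show ?thesis .
qed

lemma zeta_zeros_subset:
  assumes "\<theta> < \<alpha>"
  shows "zeta_zeros p \<theta> \<alpha> T \<subseteq> {\<rho>. \<rho> \<noteq> 1 \<and> Z \<rho> = 0 \<and> \<alpha> \<le> Re \<rho> \<and> Re \<rho> \<le> 1 \<and> \<bar>Im \<rho>\<bar> \<le> T}"
proof
  fix \<rho> assume \<rho>: "\<rho> \<in> zeta_zeros p \<theta> \<alpha> T"
  then have "\<not> 1 < Re \<rho>" using Z_nonzero[of \<rho>] by (auto simp: zeta_zeros_def)
  with \<rho> show "\<rho> \<in> {\<rho>. \<rho> \<noteq> 1 \<and> Z \<rho> = 0 \<and> \<alpha> \<le> Re \<rho> \<and> Re \<rho> \<le> 1 \<and> \<bar>Im \<rho>\<bar> \<le> T}"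
    by (simp add: zeta_zeros_def)
qed

text \<open>The zeros are among those of the pole-free function in a compact box. They are finite in
  number unless that function is constant, and then it has no zeros, since its value at 1 is not
  0.\<close>

lemma finite_zeta_zeros:
  assumes "\<theta> < \<alpha>"
  shows "finite (zeta_zeros p \<theta> \<alpha> T)"
proof -
  obtain f where f: "f holomorphic_on {s. \<theta> < Re s}"
    "\<And>s. \<theta> < Re s \<Longrightarrow> s \<noteq> 1 \<Longrightarrow> f s = (s - 1) * Z s" "f 1 \<noteq> 0"
    by (rule pole_free_Z) (rule that)
  let ?K = "cbox (Complex \<alpha> (- T)) (Complex 1 T)"
  have sub: "zeta_zeros p \<theta> \<alpha> T \<subseteq> {z \<in> ?K. f z = 0}"
  proof
    fix z assume "z \<in> zeta_zeros p \<theta> \<alpha> T"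
    then have z: "z \<noteq> 1" "Z z = 0" "\<alpha> \<le> Re z" "Re z \<le> 1" "\<bar>Im z\<bar> \<le> T"
      using zeta_zeros_subset[OF assms, of T] by auto
    then have "f z = 0" using f(2)[of z] assms by simp
    then show "z \<in> {z \<in> ?K. f z = 0}" using z by (simp add: in_cbox_complex_iff abs_le_iff)
  qed
  show ?thesis
  proof (cases "f constant_on {s. \<theta> < Re s}")
    case True
    then obtain c where c: "\<And>s. \<theta> < Re s \<Longrightarrow> f s = c" unfolding constant_on_def by blast
    then have "c \<noteq> 0" using f(3) c[of 1] theta_less_1 by simp
    then have "{z \<in> ?K. f z = 0} = {}" using c assms by (auto simp: in_cbox_complex_iff)
    then show ?thesis using sub by (metis finite.emptyI finite_subset)
  next
    case False
    have "finite {z \<in> ?K. f z = 0}"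
      using assms
      by (intro holomorphic_compact_finite_zeros[OF f(1) open_halfspace_Re_gt _ _ _ False]
          convex_connected convex_halfspace_Re_gt compact_cbox) (auto simp: in_cbox_complex_iff)
    then show ?thesis using sub finite_subset by blast
  qed
qed

text \<open>Jensen's inequality in a disc about 2 + it: growth is polynomial on the outer circle,
  and the centre is bounded below by \<open>norm_Z_lower\<close>. A disc that reaches beyond the
  critical line but stays to the right of \<theta> covers only a short height \<eta> there, hence
  the short window.\<close>

lemma zero_count_short_window:
  obtains C \<eta> where "0 < C" "0 < \<eta>" "\<eta> \<le> 1"
    "\<And>t Zs. finite Zs \<Longrightarrow> Zs \<subseteq> {\<rho>. \<rho> \<noteq> 1 \<and> Z \<rho> = 0 \<and> \<sigma>\<^sub>0 \<le> Re \<rho> \<and> \<bar>Im \<rho> - t\<bar> \<le> \<eta>} \<Longrightarrow>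
       real (\<Sum>\<rho>\<in>Zs. mult \<rho>) \<le> C * ln (\<bar>t\<bar> + 3)"
proof -
  from pole_free_Z obtain f where f: "f holomorphic_on {s. \<theta> < Re s}"
    "\<And>s. \<theta> < Re s \<Longrightarrow> s \<noteq> 1 \<Longrightarrow> f s = (s - 1) * Z s" "f 1 \<noteq> 0"
    "\<And>\<rho>. \<theta> < Re \<rho> \<Longrightarrow> \<rho> \<noteq> 1 \<Longrightarrow> zorder f \<rho> = zorder Z \<rho>" by blast
  \<comment> \<open>The inner radius covers the zeros by the sum of horizontal and vertical
    distance. The left end 2 - R of the outer disc exceeds \<theta> by (1 - \<theta>) / 4, so the
    disc stays inside the half plane.\<close>
  define \<eta> r R where "\<eta> = (1 - \<theta>) / 8" and "r = 2 - \<sigma>\<^sub>0 + \<eta>" and "R = 2 - \<sigma>\<^sub>0 + 2 * \<eta>"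
  have \<eta>: "0 < \<eta>" "\<eta> \<le> 1" using theta_less_1 theta_nonneg by (auto simp: \<eta>_def)
  have rR: "0 < r" "r < R" "1 \<le> R" "R \<le> 3" "\<theta> < 2 - R" "2 - R \<le> 5"
    using \<eta> theta_less_1 theta_nonneg by (auto simp: r_def R_def \<eta>_def field_simps)
  obtain K where K: "0 < K" "\<And>s. 2 - R \<le> Re s \<Longrightarrow> Re s \<le> 5 \<Longrightarrow> s \<noteq> 1 \<Longrightarrow>
      norm (Z s) \<le> K * (norm s + 1 / norm (s - 1))"
    by (rule Z_bound[OF rR(5,6)]) blast
  define L where "L = max 1 (zeta\<^sub>r 2 * (K * 42) + zeta\<^sub>r 2 * norm (f 1))"
  define C where "C = (ln L + 4) / ln (R / r)"
  have lnRr: "0 < ln (R / r)" using rR by simp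
  show ?thesis
  proof (rule that[of C \<eta>])
    have "0 \<le> ln L" by (simp add: L_def)
    then show "0 < C" using lnRr by (simp add: C_def)
    fix t Zs
    assume Zs: "finite Zs" "Zs \<subseteq> {\<rho>. \<rho> \<noteq> 1 \<and> Z \<rho> = 0 \<and> \<sigma>\<^sub>0 \<le> Re \<rho> \<and> \<bar>Im \<rho> - t\<bar> \<le> \<eta>}"
    define z0 where "z0 = Complex 2 t"
    have z01: "z0 \<noteq> 1" by (auto simp: z0_def complex_eq_iff)
    have Re1: "Re \<rho> \<le> 1" if "\<rho> \<in> Zs" for \<rho>
      using Zs(2) that Z_nonzero[of \<rho>] by force
    have zeros: "f \<rho> = 0 \<and> dist z0 \<rho> \<le> r" if "\<rho> \<in> Zs" for \<rho>
    proof -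
      have \<rho>: "\<rho> \<noteq> 1" "Z \<rho> = 0" "\<sigma>\<^sub>0 \<le> Re \<rho>" "\<bar>Im \<rho> - t\<bar> \<le> \<eta>" using Zs(2) that by auto
      have "dist z0 \<rho> \<le> \<bar>Re (z0 - \<rho>)\<bar> + \<bar>Im (z0 - \<rho>)\<bar>"
        unfolding dist_norm by (rule cmod_le)
      also have "\<dots> \<le> r" using \<rho>(3,4) Re1[OF that] unfolding r_def z0_def minus_complex.sel complex.sel by linarith
      finally show ?thesis using f(2)[of \<rho>] \<rho> theta_less_1 by (auto simp: field_simps)
    qed
    have fz0: "1 \<le> norm (f z0) * zeta\<^sub>r 2"
    proof -
      have "1 \<le> norm (Z z0) * zeta\<^sub>r 2" using norm_Z_lower[of z0] by (simp add: z0_def)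
      moreover have "1 \<le> norm (z0 - 1)" using abs_Re_le_cmod[of "z0 - 1"] by (simp add: z0_def)
      ultimately show ?thesis
        using f(2)[of z0] z01 theta_less_1 mult_mono[of 1 "norm (z0 - 1)" 1 "norm (Z z0) * zeta\<^sub>r 2"]
        by (simp add: z0_def norm_mult mult.assoc)
    qed
    define M where "M = K * 42 * (\<bar>t\<bar> + 3)\<^sup>2"
    have bound: "norm (f z) \<le> K * 42 * (\<bar>t\<bar> + 3)\<^sup>2 + norm (f 1)" if z: "dist z0 z = R" for z
    proof (cases "z = 1")
      case True
      then show ?thesis using K by simp
    next
      case False
      have d: "\<bar>2 - Re z\<bar> \<le> R" "\<bar>t - Im z\<bar> \<le> R"
        using abs_Re_le_cmod[of "z0 - z"] abs_Im_le_cmod[of "z0 - z"] z by (auto simp: z0_def dist_norm)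
      then have z': "2 - R \<le> Re z" "Re z \<le> 5" "\<bar>Im z\<bar> \<le> \<bar>t\<bar> + 3" using rR by auto
      have n1: "norm z \<le> \<bar>t\<bar> + 8" using cmod_le[of z] z' rR theta_nonneg by linarith
      have n2: "norm (z - 1) \<le> \<bar>t\<bar> + 9" using norm_triangle_ineq4[of z 1] n1 by simp
      have "norm (f z) = norm (z - 1) * norm (Z z)"
        using f(2)[of z] z' rR False by (simp add: norm_mult)
      also have "\<dots> \<le> norm (z - 1) * (K * (norm z + 1 / norm (z - 1)))"
        using K(2)[OF z'(1,2) False] by (intro mult_left_mono) auto
      also have "\<dots> = K * (norm (z - 1) * norm z + 1)"
        using False by (simp add: field_simps)
      also have "\<dots> \<le> K * ((\<bar>t\<bar> + 9) * (\<bar>t\<bar> + 8) + 1)"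
        using K n1 n2 by (intro mult_left_mono add_right_mono mult_mono) auto
      also have "\<dots> \<le> K * (42 * (\<bar>t\<bar> + 3)\<^sup>2)"
        using K by (intro mult_left_mono) (auto simp: power2_eq_square algebra_simps)
      finally show ?thesis by (simp add: add_increasing2)
    qed
    have "norm (f z0) * (R / r) ^ (\<Sum>\<rho>\<in>Zs. nat (zorder f \<rho>)) \<le> K * 42 * (\<bar>t\<bar> + 3)\<^sup>2 + norm (f 1)"
    proof (rule zero_count_power_bound[OF Zs(1) f(1) open_halfspace_Re_gt _ _ rR(1,2) zeros _ bound])
      show "connected {s. \<theta> < Re s}" by (intro convex_connected convex_halfspace_Re_gt)
      show "cball z0 R \<subseteq> {s. \<theta> < Re s}"
      proof
        fix z assume "z \<in> cball z0 R"
        then have "\<bar>2 - Re z\<bar> \<le> R"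
          using abs_Re_le_cmod[of "z0 - z"] by (auto simp: z0_def dist_norm)
        then show "z \<in> {s. \<theta> < Re s}" using rR by auto
      qed
      show "f z0 \<noteq> 0" using fz0 by auto
    qed
    also have "(\<Sum>\<rho>\<in>Zs. nat (zorder f \<rho>)) = (\<Sum>\<rho>\<in>Zs. mult \<rho>)"
      unfolding mult_def using Zs(2) f(4) theta_less_1 by (intro sum.cong) (force simp: field_simps)+
    finally have *: "norm (f z0) * (R / r) ^ (\<Sum>\<rho>\<in>Zs. mult \<rho>) \<le> K * 42 * (\<bar>t\<bar> + 3)\<^sup>2 + norm (f 1)" .
    have e: "norm (f z0) * zeta\<^sub>r 2 * q = zeta\<^sub>r 2 * (norm (f z0) * q)" for q by simp
    have "norm (f z0) * zeta\<^sub>r 2 * (R / r) ^ (\<Sum>\<rho>\<in>Zs. mult \<rho>)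
        \<le> zeta\<^sub>r 2 * (K * 42 * (\<bar>t\<bar> + 3)\<^sup>2 + norm (f 1))"
      unfolding e by (rule mult_left_mono[OF * zeta\<^sub>r_nonneg])
    moreover have "1 * (R / r) ^ (\<Sum>\<rho>\<in>Zs. mult \<rho>) \<le> norm (f z0) * zeta\<^sub>r 2 * (R / r) ^ (\<Sum>\<rho>\<in>Zs. mult \<rho>)"
      using fz0 rR by (intro mult_right_mono) auto
    moreover have "zeta\<^sub>r 2 * (K * 42 * (\<bar>t\<bar> + 3)\<^sup>2 + norm (f 1)) \<le> (max 1 (zeta\<^sub>r 2 * (K * 42) + zeta\<^sub>r 2 * norm (f 1))) * (\<bar>t\<bar> + 3)\<^sup>2"
    proof -
      have "1 \<le> (\<bar>t\<bar> + 3)\<^sup>2" by (simp add: power2_eq_square algebra_simps)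
      then have "zeta\<^sub>r 2 * norm (f 1) * 1 \<le> zeta\<^sub>r 2 * norm (f 1) * (\<bar>t\<bar> + 3)\<^sup>2"
        using zeta\<^sub>r_nonneg[of 2] by (intro mult_left_mono) auto
      then have "zeta\<^sub>r 2 * (K * 42 * (\<bar>t\<bar> + 3)\<^sup>2 + norm (f 1)) \<le> (zeta\<^sub>r 2 * (K * 42) + zeta\<^sub>r 2 * norm (f 1)) * (\<bar>t\<bar> + 3)\<^sup>2"
        by (simp add: algebra_simps)
      also have "\<dots> \<le> (max 1 (zeta\<^sub>r 2 * (K * 42) + zeta\<^sub>r 2 * norm (f 1))) * (\<bar>t\<bar> + 3)\<^sup>2"
        by (intro mult_right_mono) auto
      finally show ?thesis .
    qed
    ultimately have "(R / r) ^ (\<Sum>\<rho>\<in>Zs. mult \<rho>) \<le> L * (\<bar>t\<bar> + 3)\<^sup>2"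
      unfolding L_def by linarith
    then have "ln ((R / r) ^ (\<Sum>\<rho>\<in>Zs. mult \<rho>)) \<le> ln (L * (\<bar>t\<bar> + 3)\<^sup>2)"
      using rR by (intro ln_mono) (auto intro!: mult_pos_pos simp: L_def)
    also have "\<dots> = ln L + 2 * ln (\<bar>t\<bar> + 3)"
      by (subst ln_mult_pos) (auto simp: L_def ln_realpow)
    also have "\<dots> \<le> (ln L + 4) * ln (\<bar>t\<bar> + 3)"
    proof -
      have "1 \<le> ln (\<bar>t\<bar> + 3)"
        using ln_ge_iff[of "\<bar>t\<bar> + 3" 1] exp_le by linarith
      then have "ln L * 1 \<le> ln L * ln (\<bar>t\<bar> + 3)" using \<open>0 \<le> ln L\<close> by (intro mult_left_mono) auto
      then show ?thesis using \<open>1 \<le> ln (\<bar>t\<bar> + 3)\<close> by (simp add: algebra_simps)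
    qed
    finally have "real (\<Sum>\<rho>\<in>Zs. mult \<rho>) * ln (R / r) \<le> (ln L + 4) * ln (\<bar>t\<bar> + 3)"
      using rR by (simp add: ln_realpow)
    then show "real (\<Sum>\<rho>\<in>Zs. mult \<rho>) \<le> C * ln (\<bar>t\<bar> + 3)"
      using lnRr by (simp add: C_def field_simps)
  qed (use \<eta> in auto)
qed

text \<open>The window is cut into short ones of half-height \<eta>, and their number is at most a
  constant times W. Their centres are at most |t| + 2 W in absolute value, whence the argument of
  the logarithm.\<close>

lemma zero_count_window:
  obtains C where "0 < C"
    "\<And>t W Zs. finite Zs \<Longrightarrow> 1 \<le> W \<Longrightarrow>
       Zs \<subseteq> {\<rho>. \<rho> \<noteq> 1 \<and> Z \<rho> = 0 \<and> \<sigma>\<^sub>0 \<le> Re \<rho> \<and> \<bar>Im \<rho> - t\<bar> \<le> W} \<Longrightarrow>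
       real (\<Sum>\<rho>\<in>Zs. mult \<rho>) \<le> C * W * ln (\<bar>t\<bar> + 2 * W + 3)"
proof -
  obtain C \<eta> where C: "0 < C" and \<eta>: "0 < \<eta>" "\<eta> \<le> 1"
    and short: "\<And>t Zs. finite Zs \<Longrightarrow> Zs \<subseteq> {\<rho>. \<rho> \<noteq> 1 \<and> Z \<rho> = 0 \<and> \<sigma>\<^sub>0 \<le> Re \<rho> \<and> \<bar>Im \<rho> - t\<bar> \<le> \<eta>} \<Longrightarrow>
       real (\<Sum>\<rho>\<in>Zs. mult \<rho>) \<le> C * ln (\<bar>t\<bar> + 3)"
    by (rule zero_count_short_window) (rule that)
  show ?thesis
  proof (rule that[of "C * (2 / \<eta> + 5)"])
    show "0 < C * (2 / \<eta> + 5)" using C \<eta> by (simp add: add_pos_pos)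
    fix t W Zs
    assume Zs: "finite Zs" "Zs \<subseteq> {\<rho>. \<rho> \<noteq> 1 \<and> Z \<rho> = 0 \<and> \<sigma>\<^sub>0 \<le> Re \<rho> \<and> \<bar>Im \<rho> - t\<bar> \<le> W}"
      and W: "(1::real) \<le> W"
    define \<kappa> where "\<kappa> \<rho> = \<lfloor>(Im \<rho> - t) / \<eta>\<rfloor>" for \<rho> :: complex
    define K where "K = \<lfloor>W / \<eta>\<rfloor> + 1"
    have \<kappa>: "\<bar>Im \<rho> - (t + \<kappa> \<rho> * \<eta>)\<bar> \<le> \<eta>" for \<rho>
    proof -
      have "real_of_int (\<kappa> \<rho>) \<le> (Im \<rho> - t) / \<eta>" "(Im \<rho> - t) / \<eta> \<le> \<kappa> \<rho> + 1"
        unfolding \<kappa>_def by linarith+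
      then show ?thesis using \<eta> by (simp add: field_simps abs_le_iff)
    qed
    have \<kappa>K: "\<kappa> ` Zs \<subseteq> {-K..K}"
    proof
      fix k assume "k \<in> \<kappa> ` Zs"
      then obtain \<rho> where \<rho>: "\<rho> \<in> Zs" "k = \<kappa> \<rho>" by auto
      then have "\<bar>Im \<rho> - t\<bar> \<le> W" using Zs(2) by auto
      then have "- (W / \<eta>) \<le> (Im \<rho> - t) / \<eta>" "(Im \<rho> - t) / \<eta> \<le> W / \<eta>"
        using \<eta>(1) unfolding minus_divide_left by (intro divide_right_mono; simp add: abs_le_iff)+
      moreover have "- (\<lfloor>a\<rfloor> + 1) \<le> \<lfloor>b\<rfloor> \<and> \<lfloor>b\<rfloor> \<le> \<lfloor>a\<rfloor> + 1" if "- a \<le> b" "b \<le> a" for a b :: real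
        using that by linarith
      ultimately show "k \<in> {-K..K}"
        unfolding \<rho>(2) K_def \<kappa>_def atLeastAtMost_iff by blast
    qed
    have K: "real_of_int K \<le> W / \<eta> + 1" "0 \<le> K"
      unfolding K_def using W \<eta> by (auto simp: le_floor_iff add_nonneg_nonneg)
    define B where "B = C * ln (\<bar>t\<bar> + 2 * W + 3)"
    have B: "0 \<le> B" using C W by (simp add: B_def)
    have "real (\<Sum>\<rho>\<in>Zs. mult \<rho>) = (\<Sum>k\<in>{-K..K}. real (\<Sum>\<rho>\<in>{\<rho>\<in>Zs. \<kappa> \<rho> = k}. mult \<rho>))"
      using sum.group[OF Zs(1) _ \<kappa>K, of mult] by (metis finite_atLeastAtMost_int of_nat_sum)
    also have "\<dots> \<le> (\<Sum>k\<in>{-K..K}. B)"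
    proof (rule sum_mono)
      fix k assume k: "k \<in> {-K..K}"
      have "\<bar>real_of_int k\<bar> \<le> K" using k by auto
      then have "\<bar>real_of_int k\<bar> * \<eta> \<le> (W / \<eta> + 1) * \<eta>"
        using K \<eta> by (intro mult_right_mono) auto
      also have "\<dots> \<le> W + 1" using \<eta> by (simp add: field_simps)
      finally have kb: "\<bar>t + k * \<eta>\<bar> \<le> \<bar>t\<bar> + 2 * W"
        using W \<eta> abs_triangle_ineq[of t "k * \<eta>"] by (simp add: abs_mult)
      have "real (\<Sum>\<rho>\<in>{\<rho>\<in>Zs. \<kappa> \<rho> = k}. mult \<rho>) \<le> C * ln (\<bar>t + k * \<eta>\<bar> + 3)"
        using Zs \<kappa> by (intro short) auto
      also have "\<dots> \<le> B" unfolding B_def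
        using C kb by (intro mult_left_mono ln_mono) auto
      finally show "real (\<Sum>\<rho>\<in>{\<rho>\<in>Zs. \<kappa> \<rho> = k}. mult \<rho>) \<le> B" .
    qed
    also have "\<dots> = (2 * real_of_int K + 1) * B"
      using K(2) by simp
    also have "\<dots> \<le> (2 * (W / \<eta> + 1) + 3 * W) * B"
      using K B W by (intro mult_right_mono) auto
    also have "\<dots> \<le> (2 / \<eta> + 5) * W * B"
      using W B by (intro mult_right_mono) (auto simp: field_simps)
    finally show "real (\<Sum>\<rho>\<in>Zs. mult \<rho>) \<le> C * (2 / \<eta> + 5) * W * ln (\<bar>t\<bar> + 2 * W + 3)"
      by (simp add: B_def mult_ac)
  qed
qed

end

subsection \<open>Mean values\<close>

text \<open>The characteristic function of the standard normal distribution at T v, after the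
  substitution x = t / T.\<close>

lemma gaussian_fourier:
  assumes T: "0 < T"
  shows "has_bochner_integral lborel
     (\<lambda>t. complex_of_real (exp (- t\<^sup>2 / (2 * T\<^sup>2))) * exp (\<i> * complex_of_real (v * t)))
     (complex_of_real (T * sqrt (2 * pi) * exp (- (T * v)\<^sup>2 / 2)))"
proof -
  interpret N: prob_space std_normal_distribution
    by (rule prob_space_normal_density) simp
  define f where "f \<mu> x = complex_of_real (exp (- x\<^sup>2 / 2)) * exp (\<i> * complex_of_real (\<mu> * x))" for \<mu> x :: real
  have dens: "std_normal_density x *\<^sub>R exp (\<i> * complex_of_real (\<mu> * x)) = complex_of_real (1 / sqrt (2 * pi)) * f \<mu> x" for x \<mu>
    by (simp add: normal_density_def f_def scaleR_conv_of_real)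
  have "integrable std_normal_distribution (\<lambda>x. exp (\<i> * complex_of_real (\<mu> * x)))" for \<mu>
    by (rule N.integrable_const_bound[where B = 1]) auto
  then have "integrable lborel (\<lambda>x. std_normal_density x *\<^sub>R exp (\<i> * complex_of_real (\<mu> * x)))" for \<mu>
    by (subst (asm) integrable_density) auto
  then have intc: "integrable lborel (\<lambda>x. complex_of_real (1 / sqrt (2 * pi)) * f \<mu> x)" for \<mu>
    unfolding dens .
  have int: "integrable lborel (f \<mu>)" for \<mu>
  proof -
    have "integrable lborel (\<lambda>x. complex_of_real (sqrt (2 * pi)) * (complex_of_real (1 / sqrt (2 * pi)) * f \<mu> x))"
      by (intro integrable_mult_right intc)
    also have "(\<lambda>x. complex_of_real (sqrt (2 * pi)) * (complex_of_real (1 / sqrt (2 * pi)) * f \<mu> x)) = f \<mu>"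
      by (simp add: fun_eq_iff)
    finally show ?thesis .
  qed
  have "char std_normal_distribution \<mu> = complex_of_real (1 / sqrt (2 * pi)) * (\<integral>x. f \<mu> x \<partial>lborel)" for \<mu>
  proof -
    have "char std_normal_distribution \<mu> = (\<integral>x. std_normal_density x *\<^sub>R exp (\<i> * complex_of_real (\<mu> * x)) \<partial>lborel)"
      unfolding char_def by (subst integral_density) auto
    then show ?thesis by (simp only: dens integral_mult_right_zero)
  qed
  then have "(\<integral>x. f \<mu> x \<partial>lborel) = complex_of_real (sqrt (2 * pi) * exp (- \<mu>\<^sup>2 / 2))" for \<mu>
    by (simp add: char_std_normal_distribution field_simps)
  then have "has_bochner_integral lborel (f (T * v)) (complex_of_real (sqrt (2 * pi) * exp (- (T * v)\<^sup>2 / 2)))"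
    using int has_bochner_integral_iff by blast
  then have "has_bochner_integral lborel (\<lambda>x. f (T * v) (0 + (1 / T) * x))
      (complex_of_real (sqrt (2 * pi) * exp (- (T * v)\<^sup>2 / 2)) /\<^sub>R \<bar>1 / T\<bar>)"
    using T by (subst lborel_has_bochner_integral_real_affine_iff[of "1 / T", symmetric]) auto
  moreover have "(\<lambda>x. f (T * v) (0 + (1 / T) * x)) =
      (\<lambda>t. complex_of_real (exp (- t\<^sup>2 / (2 * T\<^sup>2))) * exp (\<i> * complex_of_real (v * t)))"
    using T by (auto simp: f_def fun_eq_iff power_divide)
  ultimately show ?thesis
    using T by (simp add: scaleR_conv_of_real mult_ac)
qed

context beurling_system
begin

lemma dterm_split: "dterm M (Complex \<sigma> t) = complex_of_real (g M powr - \<sigma>) * exp (\<i> * complex_of_real (- ln (g M) * t))"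
proof -
  have "- Complex \<sigma> t * complex_of_real (ln (g M))
      = complex_of_real (- \<sigma> * ln (g M)) + \<i> * complex_of_real (- ln (g M) * t)"
    by (simp add: complex_eq_iff)
  then have "dterm M (Complex \<sigma> t) = exp (complex_of_real (- \<sigma> * ln (g M)))
      * exp (\<i> * complex_of_real (- ln (g M) * t))"
    by (simp only: dterm_exp exp_add)
  then show ?thesis
    by (simp only: exp_of_real) (simp add: powr_def)
qed

lemma count_interval:
  assumes n: "1 \<le> n" and u: "0 < u"
  shows "real (card {N. n * exp (- u) < g N \<and> g N \<le> n * exp u})
           \<le> 2 * A * n * u * exp u + 2 * C0 * n powr \<theta> * exp u"
proof -
  let ?P = "{N. g N \<le> n * exp u}" and ?Q = "{N. g N \<le> n * exp (- u)}"
  have "?Q \<subseteq> ?P"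
    using n u by (auto elim: order_trans intro!: mult_left_mono)
  moreover have "{N. n * exp (- u) < g N \<and> g N \<le> n * exp u} = ?P - ?Q" by auto
  ultimately have "real (card {N. n * exp (- u) < g N \<and> g N \<le> n * exp u})
      = real (gen_int_count p (n * exp u)) - real (gen_int_count p (n * exp (- u)))"
    unfolding gen_int_count_def by (simp add: card_Diff_subset card_mono of_nat_diff)
  also have "\<dots> \<le> A * (n * exp u) + C0 * (n * exp u) powr \<theta> - (A * (n * exp (- u)) - C0 * (n * exp (- u)) powr \<theta>)"
    using count_bound[of "n * exp u"] count_bound[of "n * exp (- u)"] n by (simp add: abs_le_iff)
  also have "\<dots> = A * n * (exp u - exp (- u)) + C0 * ((n * exp u) powr \<theta> + (n * exp (- u)) powr \<theta>)"
    by (simp add: algebra_simps)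
  also have "exp u - exp (- u) = exp u * (1 - exp (- 2 * u))"
    by (simp add: algebra_simps exp_add[symmetric])
  also have "A * n * (exp u * (1 - exp (- 2 * u))) \<le> A * n * (exp u * (2 * u))"
    using A_pos n exp_ge_add_one_self[of "- 2 * u"] by (intro mult_left_mono) auto
  also have "C0 * ((n * exp u) powr \<theta> + (n * exp (- u)) powr \<theta>) \<le> C0 * (n powr \<theta> * exp u + n powr \<theta> * exp u)"
  proof -
    have "exp u powr \<theta> \<le> exp u powr 1" using u theta_less_1 by (intro powr_mono) auto
    then have e: "(n * exp u) powr \<theta> \<le> n powr \<theta> * exp u"
      using n by (simp add: powr_mult mult_left_mono)
    have "(n * exp (- u)) powr \<theta> \<le> (n * exp u) powr \<theta>"
      using n u theta_nonneg by (intro powr_mono2 mult_left_mono) auto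
    then show ?thesis using e C0_pos by (intro mult_left_mono add_mono) auto
  qed
  finally show ?thesis by (simp add: algebra_simps)
qed

text \<open>The N are sorted by the integer part j of T |ln (g N) - ln (g M)|. Shell j lies in a
  multiplicatively short interval about \<open>g M\<close>; its count comes from the bound for N(x)
  - Ax, whose error is the source of \<open>g M powr \<theta>\<close>, and the Gaussian outweighs
  the growth of the intervals.\<close>

lemma neighbour_sum_bound:
  obtains C where "0 < C"
    "\<And>T M F. 1 \<le> T \<Longrightarrow> finite F \<Longrightarrow>
       (\<Sum>N\<in>F. exp (- (T * (ln (g N) - ln (g M)))\<^sup>2 / 2)) \<le> C * (g M / T + g M powr \<theta>)"
proof (rule that[of "4 * (A + C0) * exp 6"])
  show "0 < 4 * (A + C0) * exp 6" using A_pos C0_pos by simp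
  fix T M and F :: "nat multiset set"
  assume T: "(1::real) \<le> T" and F: "finite F"
  define n where "n = g M"
  have n: "1 \<le> n" by (simp add: n_def g_ge_1)
  define y where "y N = T * \<bar>ln (g N) - ln n\<bar>" for N
  define k where "k N = nat \<lfloor>y N\<rfloor>" for N
  have y0: "0 \<le> y N" for N using T by (simp add: y_def)
  have k: "real (k N) \<le> y N" "y N < real (k N) + 1" for N
    using y0[of N] unfolding k_def by linarith+
  define B where "B = n / T + n powr \<theta>"
  have B: "0 < B" using n T by (simp add: B_def add_pos_pos)
  define K where "K = Max (insert 0 (k ` F))"
  have kK: "k ` F \<subseteq> {..K}" using F by (auto simp: K_def)
  have shell: "(\<Sum>N\<in>{N\<in>F. k N = j}. exp (- (T * (ln (g N) - ln n))\<^sup>2 / 2))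
      \<le> 2 * (A + C0) * exp 6 * B * (1 / 2) ^ j" for j
  proof -
    define u where "u = (real j + 1) / T"
    have "(real j + 1) / T \<le> (real j + 1) / 1"
      using T by (intro divide_left_mono) auto
    then have u: "0 < u" "u \<le> real j + 1" using T by (auto simp: u_def)
    have sub: "{N\<in>F. k N = j} \<subseteq> {N. n * exp (- u) < g N \<and> g N \<le> n * exp u}"
    proof
      fix N assume "N \<in> {N\<in>F. k N = j}"
      then have "T * \<bar>ln (g N) - ln n\<bar> < real j + 1" using k(2)[of N] by (simp add: y_def)
      then have "\<bar>ln (g N) - ln n\<bar> < u" using T by (simp add: u_def field_simps)
      then have "ln n - u < ln (g N)" "ln (g N) \<le> ln n + u" by auto
      then have "exp (ln n - u) < exp (ln (g N))" "exp (ln (g N)) \<le> exp (ln n + u)"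
        by (simp_all only: exp_less_cancel_iff exp_le_cancel_iff)
      then show "N \<in> {N. n * exp (- u) < g N \<and> g N \<le> n * exp u}"
        using n by (simp add: exp_diff exp_add exp_minus field_simps)
    qed
    have fin: "finite {N. n * exp (- u) < g N \<and> g N \<le> n * exp u}"
      by simp
    have "(\<Sum>N\<in>{N\<in>F. k N = j}. exp (- (T * (ln (g N) - ln n))\<^sup>2 / 2)) \<le>
        (\<Sum>N\<in>{N\<in>F. k N = j}. exp (- (real j)\<^sup>2 / 2))"
    proof (rule sum_mono)
      fix N assume "N \<in> {N\<in>F. k N = j}"
      then have "(real j)\<^sup>2 \<le> (y N)\<^sup>2" using k(1)[of N] by (intro power_mono) auto
      also have "(y N)\<^sup>2 = (T * (ln (g N) - ln n))\<^sup>2" by (simp add: y_def power_mult_distrib)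
      finally show "exp (- (T * (ln (g N) - ln n))\<^sup>2 / 2) \<le> exp (- (real j)\<^sup>2 / 2)" by simp
    qed
    also have "\<dots> = real (card {N\<in>F. k N = j}) * exp (- (real j)\<^sup>2 / 2)" by simp
    also have "\<dots> \<le> real (card {N. n * exp (- u) < g N \<and> g N \<le> n * exp u}) * exp (- (real j)\<^sup>2 / 2)"
      using card_mono[OF fin sub] by (intro mult_right_mono) auto
    also have "\<dots> \<le> (2 * A * n * u * exp u + 2 * C0 * n powr \<theta> * exp u) * exp (- (real j)\<^sup>2 / 2)"
      by (intro mult_right_mono count_interval n u(1)) auto
    also have "2 * A * n * u * exp u + 2 * C0 * n powr \<theta> * exp u \<le> 2 * (A + C0) * B * ((real j + 1) * exp (real j + 1))"
    proof -
      have e: "exp u \<le> exp (real j + 1)" using u by simp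
      have "2 * A * n * u * exp u = 2 * A * (n / T) * ((real j + 1) * exp u)"
        using T by (simp add: u_def)
      also have "\<dots> \<le> 2 * A * (n / T) * ((real j + 1) * exp (real j + 1))"
        using e A_pos n T by (intro mult_left_mono) auto
      finally have 1: "2 * A * n * u * exp u \<le> 2 * A * (n / T) * ((real j + 1) * exp (real j + 1))" .
      have "exp u \<le> (real j + 1) * exp (real j + 1)"
      proof -
        have "1 * exp (real j + 1) \<le> (real j + 1) * exp (real j + 1)" by (rule mult_right_mono) auto
        then show ?thesis using e by linarith
      qed
      then have 2: "2 * C0 * n powr \<theta> * exp u \<le> 2 * C0 * n powr \<theta> * ((real j + 1) * exp (real j + 1))"
        using C0_pos by (intro mult_left_mono) auto
      have "2 * A * (n / T) + 2 * C0 * n powr \<theta> \<le> 2 * (A + C0) * B"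
        using A_pos C0_pos n T by (simp add: B_def algebra_simps)
      then have "(2 * A * (n / T) + 2 * C0 * n powr \<theta>) * ((real j + 1) * exp (real j + 1))
          \<le> 2 * (A + C0) * B * ((real j + 1) * exp (real j + 1))"
        by (intro mult_right_mono) auto
      then show ?thesis using 1 2 by (simp add: distrib_right)
    qed
    also have "2 * (A + C0) * B * ((real j + 1) * exp (real j + 1)) * exp (- (real j)\<^sup>2 / 2)
        = 2 * (A + C0) * B * ((real j + 1) * exp (real j + 1 - (real j)\<^sup>2 / 2))"
    proof -
      have "exp (real j + 1) * exp (- (real j)\<^sup>2 / 2) = exp (real j + 1 - (real j)\<^sup>2 / 2)"
        by (simp add: mult_exp_exp)
      then show ?thesis by (simp only: mult.assoc)
    qed
    also have "\<dots> \<le> 2 * (A + C0) * B * (exp 6 * (1 / 2) ^ j)"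
    proof -
      \<comment> \<open>Completing the square turns Gaussian decay into geometric decay: the
        exponential is at most exp (6 - 2 j), and j + 1 \<le> exp j leaves exp 6 times
        2^(-j).\<close>
      have "0 \<le> (real j - 3)\<^sup>2" by simp
      then have "real j + 1 - (real j)\<^sup>2 / 2 \<le> 6 - 2 * real j"
        by (simp add: power2_eq_square algebra_simps)
      then have "exp (real j + 1 - (real j)\<^sup>2 / 2) \<le> exp (6 - 2 * real j)" by simp
      moreover have "real j + 1 \<le> exp (real j)" using exp_ge_add_one_self[of "real j"] by (simp add: add.commute)
      ultimately have "(real j + 1) * exp (real j + 1 - (real j)\<^sup>2 / 2) \<le> exp (real j) * exp (6 - 2 * real j)"
        by (intro mult_mono) auto
      also have "\<dots> = exp 6 * exp (- real j)" by (simp add: exp_add[symmetric])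
      also have "exp (- real j) = (1 / exp 1) ^ j"
        by (simp add: exp_minus power_divide exp_of_nat_mult[symmetric] inverse_eq_divide)
      also have "(1 / exp 1) ^ j \<le> (1 / 2 :: real) ^ j"
        using exp_ge_add_one_self[of 1] by (intro power_mono divide_left_mono) auto
      finally show ?thesis using A_pos C0_pos B by (intro mult_left_mono) auto
    qed
    finally show ?thesis by (simp add: mult_ac)
  qed
  have "(\<Sum>N\<in>F. exp (- (T * (ln (g N) - ln n))\<^sup>2 / 2))
      = (\<Sum>j\<le>K. \<Sum>N\<in>{N\<in>F. k N = j}. exp (- (T * (ln (g N) - ln n))\<^sup>2 / 2))"
    by (rule sum.group[OF F _ kK, symmetric]) simp
  also have "\<dots> \<le> (\<Sum>j\<le>K. 2 * (A + C0) * exp 6 * B * (1 / 2) ^ j)"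
    by (intro sum_mono shell)
  also have "\<dots> = 2 * (A + C0) * exp 6 * B * (\<Sum>j\<le>K. (1 / 2) ^ j)"
    by (simp add: sum_distrib_left)
  also have "\<dots> \<le> 2 * (A + C0) * exp 6 * B * 2"
  proof (rule mult_left_mono)
    show "0 \<le> 2 * (A + C0) * exp 6 * B" using A_pos C0_pos B by simp
    have "(\<Sum>j\<le>K. (1 / 2 :: real) ^ j) = 2 - (1 / 2) ^ K"
      by (induction K) auto
    then show "(\<Sum>j\<le>K. (1 / 2 :: real) ^ j) \<le> 2" by simp
  qed
  also have "2 * (A + C0) * exp 6 * B * 2 = 4 * (A + C0) * exp 6 * B" by simp
  finally show "(\<Sum>N\<in>F. exp (- (T * (ln (g N) - ln (g M)))\<^sup>2 / 2)) \<le> 4 * (A + C0) * exp 6 * (g M / T + g M powr \<theta>)"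
    unfolding n_def B_def .
qed

text \<open>A Gaussian majorant of the interval turns the mean square into a double sum with the
  weights of \<open>neighbour_sum_bound\<close>. The inequality of arithmetic and geometric means
  and symmetry leave one squared coefficient times the sum over its neighbours.\<close>

lemma mean_value_finite:
  obtains C where "0 < C"
    "\<And>T F c \<sigma>. 1 \<le> T \<Longrightarrow> finite F \<Longrightarrow>
       integral {-T..T} (\<lambda>t. (norm (\<Sum>M\<in>F. c M * dterm M (Complex \<sigma> t)))\<^sup>2)
         \<le> C * (\<Sum>M\<in>F. (norm (c M))\<^sup>2 * g M powr (- 2 * \<sigma>) * (g M + T * g M powr \<theta>))"
proof -
  obtain C where C: "0 < C"
    "\<And>T M F. 1 \<le> T \<Longrightarrow> finite F \<Longrightarrow>
       (\<Sum>N\<in>F. exp (- (T * (ln (g N) - ln (g M)))\<^sup>2 / 2)) \<le> C * (g M / T + g M powr \<theta>)"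
    by (rule neighbour_sum_bound) blast
  show ?thesis
  proof (rule that[of "exp (1 / 2) * sqrt (2 * pi) * C"])
    show "0 < exp (1 / 2) * sqrt (2 * pi) * C" using C by simp
    fix T \<sigma> :: real and F :: "nat multiset set" and c :: "nat multiset \<Rightarrow> complex"
    assume T: "1 \<le> T" and F: "finite F"
    define b where "b M = c M * complex_of_real (g M powr - \<sigma>)" for M
    define D where "D t = (\<Sum>M\<in>F. c M * dterm M (Complex \<sigma> t))" for t
    define E where "E M N = exp (- (T * (ln (g N) - ln (g M)))\<^sup>2 / 2)" for M N
    define w where "w t = exp (- t\<^sup>2 / (2 * T\<^sup>2))" for t
    have D_eq: "D t = (\<Sum>M\<in>F. b M * exp (\<i> * complex_of_real (- ln (g M) * t)))" for t
      unfolding D_def dterm_split b_def by (simp add: mult.assoc)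
    have D_sq: "complex_of_real (w t * (norm (D t))\<^sup>2) =
        (\<Sum>M\<in>F. \<Sum>N\<in>F. b M * cnj (b N) * (complex_of_real (w t) * exp (\<i> * complex_of_real ((ln (g N) - ln (g M)) * t))))" for t
    proof -
      have "complex_of_real ((norm (D t))\<^sup>2) = D t * cnj (D t)"
        by (rule complex_norm_square)
      also have "cnj (D t) = (\<Sum>N\<in>F. cnj (b N) * exp (\<i> * complex_of_real (ln (g N) * t)))"
        unfolding D_eq by (simp add: exp_cnj)
      also have "D t * \<dots> = (\<Sum>M\<in>F. \<Sum>N\<in>F. b M * cnj (b N) * exp (\<i> * complex_of_real ((ln (g N) - ln (g M)) * t)))"
        unfolding D_eq sum_product
        by (intro sum.cong refl) (simp add: exp_add[symmetric] algebra_simps mult_exp_exp)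
      finally have "complex_of_real (w t * (norm (D t))\<^sup>2) = complex_of_real (w t) *
          (\<Sum>M\<in>F. \<Sum>N\<in>F. b M * cnj (b N) * exp (\<i> * complex_of_real ((ln (g N) - ln (g M)) * t)))"
        by (metis of_real_mult)
      then show ?thesis by (simp add: sum_distrib_left mult_ac)
    qed
    have "has_bochner_integral lborel (\<lambda>t. complex_of_real (w t * (norm (D t))\<^sup>2))
        (\<Sum>M\<in>F. \<Sum>N\<in>F. b M * cnj (b N) * complex_of_real (T * sqrt (2 * pi) * E M N))"
    proof -
      have "has_bochner_integral lborel
          (\<lambda>t. complex_of_real (w t) * exp (\<i> * complex_of_real ((ln (g N) - ln (g M)) * t)))
          (complex_of_real (T * sqrt (2 * pi) * E M N))" for M N
        unfolding w_def E_def using T by (intro gaussian_fourier) auto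
      then show ?thesis
        unfolding D_sq by (intro has_bochner_integral_sum has_bochner_integral_mult_right)
    qed
    then have hb: "has_bochner_integral lborel (\<lambda>t. Re (complex_of_real (w t * (norm (D t))\<^sup>2)))
        (Re (\<Sum>M\<in>F. \<Sum>N\<in>F. b M * cnj (b N) * complex_of_real (T * sqrt (2 * pi) * E M N)))"
      by (rule has_bochner_integral_bounded_linear[OF bounded_linear_Re])
    have wint: "integrable lborel (\<lambda>t. w t * (norm (D t))\<^sup>2)"
      and wval: "(\<integral>t. w t * (norm (D t))\<^sup>2 \<partial>lborel) =
        Re (\<Sum>M\<in>F. \<Sum>N\<in>F. b M * cnj (b N) * complex_of_real (T * sqrt (2 * pi) * E M N))"
      using hb by (simp_all add: has_bochner_integral_iff)
    have Dcont: "continuous_on {-T..T} (\<lambda>t. (norm (D t))\<^sup>2)"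
      unfolding D_def by (intro continuous_intros)
    have "integral {-T..T} (\<lambda>t. (norm (D t))\<^sup>2) = (\<integral>t\<in>{-T..T}. (norm (D t))\<^sup>2 \<partial>lborel)"
      using borel_integrable_atLeastAtMost'[OF Dcont] by (rule set_borel_integral_eq_integral(2)[symmetric])
    also have "\<dots> \<le> (\<integral>t. exp (1 / 2) * (w t * (norm (D t))\<^sup>2) \<partial>lborel)"
      unfolding set_lebesgue_integral_def
    proof (rule integral_mono)
      show "integrable lborel (\<lambda>t. indicator {-T..T} t *\<^sub>R (norm (D t))\<^sup>2)"
        using borel_integrable_atLeastAtMost'[OF Dcont] by (simp add: set_integrable_def)
      show "integrable lborel (\<lambda>t. exp (1 / 2) * (w t * (norm (D t))\<^sup>2))"
        using wint by (rule integrable_mult_right)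
      fix t
      show "indicator {-T..T} t *\<^sub>R (norm (D t))\<^sup>2 \<le> exp (1 / 2) * (w t * (norm (D t))\<^sup>2)"
      proof (cases "t \<in> {-T..T}")
        case True
        then have "t\<^sup>2 \<le> T\<^sup>2" by (intro abs_le_square_iff[THEN iffD1]) auto
        then have "t\<^sup>2 / (2 * T\<^sup>2) \<le> 1 / 2" using T by (simp add: field_simps)
        then have "1 \<le> exp (1 / 2) * w t" by (simp add: w_def exp_add[symmetric])
        then have "1 * (norm (D t))\<^sup>2 \<le> exp (1 / 2) * w t * (norm (D t))\<^sup>2"
          by (rule mult_right_mono) simp
        then show ?thesis using True by (simp add: mult.assoc)
      qed (simp add: w_def)
    qed
    also have "\<dots> = exp (1 / 2) * Re (\<Sum>M\<in>F. \<Sum>N\<in>F. b M * cnj (b N) * complex_of_real (T * sqrt (2 * pi) * E M N))"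
      by (simp add: wval)
    also have "Re (\<Sum>M\<in>F. \<Sum>N\<in>F. b M * cnj (b N) * complex_of_real (T * sqrt (2 * pi) * E M N))
        \<le> (\<Sum>M\<in>F. \<Sum>N\<in>F. T * sqrt (2 * pi) * (((norm (b M))\<^sup>2 + (norm (b N))\<^sup>2) / 2 * E M N))"
      unfolding Re_sum
    proof (intro sum_mono)
      fix M N
      have "Re (b M * cnj (b N)) \<le> norm (b M) * norm (b N)"
        using complex_Re_le_cmod[of "b M * cnj (b N)"] by (simp add: norm_mult)
      also have "\<dots> \<le> ((norm (b M))\<^sup>2 + (norm (b N))\<^sup>2) / 2"
        using sum_squares_bound[of "norm (b M)" "norm (b N)"] by simp
      finally have "Re (b M * cnj (b N)) * (T * sqrt (2 * pi) * E M N)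
          \<le> ((norm (b M))\<^sup>2 + (norm (b N))\<^sup>2) / 2 * (T * sqrt (2 * pi) * E M N)"
        using T by (intro mult_right_mono) (auto simp: E_def)
      moreover have "Re (z * complex_of_real q) = Re z * q" for z q by simp
      moreover have "((norm (b M))\<^sup>2 + (norm (b N))\<^sup>2) / 2 * (T * sqrt (2 * pi) * E M N)
          = T * sqrt (2 * pi) * (((norm (b M))\<^sup>2 + (norm (b N))\<^sup>2) / 2 * E M N)"
        by (simp only: mult_ac)
      ultimately show "Re (b M * cnj (b N) * complex_of_real (T * sqrt (2 * pi) * E M N))
          \<le> T * sqrt (2 * pi) * (((norm (b M))\<^sup>2 + (norm (b N))\<^sup>2) / 2 * E M N)"
        by (simp only:)
    qed
    also have "\<dots> = T * sqrt (2 * pi) * (\<Sum>M\<in>F. (norm (b M))\<^sup>2 * (\<Sum>N\<in>F. E M N))"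
    proof -
      have E_sym: "E M N = E N M" for M N by (simp add: E_def power2_eq_square algebra_simps)
      have "(\<Sum>M\<in>F. \<Sum>N\<in>F. (norm (b N))\<^sup>2 * E M N) = (\<Sum>M\<in>F. \<Sum>N\<in>F. (norm (b M))\<^sup>2 * E M N)"
        by (subst sum.swap) (simp add: E_sym)
      then have "(\<Sum>M\<in>F. \<Sum>N\<in>F. ((norm (b M))\<^sup>2 + (norm (b N))\<^sup>2) / 2 * E M N)
          = (\<Sum>M\<in>F. \<Sum>N\<in>F. (norm (b M))\<^sup>2 * E M N)"
        by (simp add: add_divide_distrib distrib_right sum.distrib sum_divide_distrib[symmetric])
      then show ?thesis by (simp only: sum_distrib_left[symmetric])
    qed
    also have "\<dots> \<le> T * sqrt (2 * pi) * (\<Sum>M\<in>F. (norm (b M))\<^sup>2 * (C * (g M / T + g M powr \<theta>)))"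
      using C(2)[OF T F] T unfolding E_def
      by (intro mult_left_mono sum_mono) auto
    also have "\<dots> = sqrt (2 * pi) * C * (\<Sum>M\<in>F. (norm (c M))\<^sup>2 * g M powr (- 2 * \<sigma>) * (g M + T * g M powr \<theta>))"
      unfolding sum_distrib_left
    proof (rule sum.cong[OF refl])
      fix M
      have "(norm (b M))\<^sup>2 = (norm (c M))\<^sup>2 * g M powr (- 2 * \<sigma>)"
        by (simp add: b_def norm_mult power_mult_distrib power2_eq_square powr_add[symmetric])
      then show "T * sqrt (2 * pi) * ((norm (b M))\<^sup>2 * (C * (g M / T + g M powr \<theta>)))
          = sqrt (2 * pi) * C * ((norm (c M))\<^sup>2 * g M powr (- 2 * \<sigma>) * (g M + T * g M powr \<theta>))"
        using T by (simp add: field_simps)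
    qed
    finally show "integral {-T..T} (\<lambda>t. (norm (\<Sum>M\<in>F. c M * dterm M (Complex \<sigma> t)))\<^sup>2)
        \<le> exp (1 / 2) * sqrt (2 * pi) * C * (\<Sum>M\<in>F. (norm (c M))\<^sup>2 * g M powr (- 2 * \<sigma>) * (g M + T * g M powr \<theta>))"
      by (simp add: D_def mult.assoc)
  qed
qed

text \<open>To the right of 1 the series is approximated uniformly by its part with
  \<open>g M \<le> X\<close>, to which the finite estimate applies. The bound B refers to finite
  subsets, so the same B serves every truncation.\<close>

lemma mean_value_infinite:
  obtains C where "0 < C"
    "\<And>T S c \<sigma> D B. 1 \<le> T \<Longrightarrow> 1 < \<sigma> \<Longrightarrow> \<forall>M\<in>S. norm (c M) \<le> divs M \<Longrightarrow>
       continuous_on {-T..T} D \<Longrightarrow>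
       \<forall>t\<in>{-T..T}. D t = (\<Sum>\<^sub>\<infinity>M\<in>S. c M * dterm M (Complex \<sigma> t)) \<Longrightarrow>
       \<forall>F\<subseteq>S. finite F \<longrightarrow> (\<Sum>M\<in>F. (divs M)\<^sup>2 * g M powr (- 2 * \<sigma>) * (g M + T * g M powr \<theta>)) \<le> B \<Longrightarrow>
       integral {-T..T} (\<lambda>t. (norm (D t))\<^sup>2) \<le> C * B"
proof -
  obtain C where C: "0 < C"
    "\<And>T F c \<sigma>. 1 \<le> T \<Longrightarrow> finite F \<Longrightarrow>
       integral {-T..T} (\<lambda>t. (norm (\<Sum>M\<in>F. c M * dterm M (Complex \<sigma> t)))\<^sup>2)
         \<le> C * (\<Sum>M\<in>F. (norm (c M))\<^sup>2 * g M powr (- 2 * \<sigma>) * (g M + T * g M powr \<theta>))"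
    by (rule mean_value_finite) blast
  show ?thesis
  proof (rule that[of "2 * C"])
    show "0 < 2 * C" using C by simp
    fix T \<sigma> B :: real and S :: "nat multiset set" and c :: "nat multiset \<Rightarrow> complex" and D
    assume T: "1 \<le> T" and \<sigma>: "1 < \<sigma>" and c': "\<forall>M\<in>S. norm (c M) \<le> divs M"
      and Dcont: "continuous_on {-T..T} D"
      and D': "\<forall>t\<in>{-T..T}. D t = (\<Sum>\<^sub>\<infinity>M\<in>S. c M * dterm M (Complex \<sigma> t))"
      and B': "\<forall>F\<subseteq>S. finite F \<longrightarrow> (\<Sum>M\<in>F. (divs M)\<^sup>2 * g M powr (- 2 * \<sigma>) * (g M + T * g M powr \<theta>)) \<le> B"
    note c = bspec[OF c'] and D = bspec[OF D'] and B = B'[rule_format, rotated]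
    show "integral {-T..T} (\<lambda>t. (norm (D t))\<^sup>2) \<le> 2 * C * B"
    proof (rule field_le_epsilon)
      fix e :: real assume e: "0 < e"
      \<comment> \<open>Chosen so that 2 \<epsilon>^2 integrated over [-T, T] equals e.\<close>
      define \<epsilon> where "\<epsilon> = sqrt (e / (4 * T))"
      have \<epsilon>: "0 < \<epsilon>" using e T by (simp add: \<epsilon>_def)
      have nn: "0 \<le> divs M * g M powr - \<sigma>" for M using divs_ge_1[of M] by simp
      from tail_small[OF summable_divs[OF \<sigma>] nn \<epsilon>]
      obtain X where X: "infsum (\<lambda>M. divs M * g M powr - \<sigma>) {M. X < g M} < \<epsilon>" by blast
      define F where "F = S \<inter> {M. g M \<le> X}"
      define R where "R = S \<inter> {M. X < g M}"
      have F: "finite F" "F \<subseteq> S" by (auto simp: F_def)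
      define DF where "DF t = (\<Sum>M\<in>F. c M * dterm M (Complex \<sigma> t))" for t
      have diff: "norm (D t - DF t) \<le> \<epsilon>" if "t \<in> {-T..T}" for t
      proof -
        have "D t = (\<Sum>\<^sub>\<infinity>M\<in>F \<union> R. c M * dterm M (Complex \<sigma> t))"
          unfolding D[OF that] by (rule arg_cong[of _ _ "infsum _"]) (auto simp: F_def R_def)
        also have "\<dots> = (\<Sum>\<^sub>\<infinity>M\<in>F. c M * dterm M (Complex \<sigma> t)) + (\<Sum>\<^sub>\<infinity>M\<in>R. c M * dterm M (Complex \<sigma> t))"
          using \<sigma> c by (intro infsum_Un_disjoint summable_dterm) (auto simp: F_def R_def)
        finally have "D t - DF t = (\<Sum>\<^sub>\<infinity>M\<in>R. c M * dterm M (Complex \<sigma> t))"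
          using F by (simp add: DF_def)
        then have "norm (D t - DF t) \<le> (\<Sum>\<^sub>\<infinity>M\<in>R. divs M * g M powr - Re (Complex \<sigma> t))"
          using norm_infsum_dterm_le[of "Complex \<sigma> t" R c] \<sigma> c by (simp add: R_def)
        also have "\<dots> \<le> infsum (\<lambda>M. divs M * g M powr - \<sigma>) {M. X < g M}"
          using nn summable_divs[OF \<sigma>] unfolding R_def complex.sel
          by (intro infsum_mono_neutral summable_on_subset_banach[OF summable_divs[OF \<sigma>]]) auto
        finally show ?thesis using X by simp
      qed
      have DFcont: "continuous_on {-T..T} DF" unfolding DF_def by (intro continuous_intros)
      have "integral {-T..T} (\<lambda>t. (norm (D t))\<^sup>2) \<le> integral {-T..T} (\<lambda>t. 2 * (norm (DF t))\<^sup>2 + 2 * \<epsilon>\<^sup>2)"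
      proof (rule integral_le)
        show "(\<lambda>t. (norm (D t))\<^sup>2) integrable_on {-T..T}"
          by (intro integrable_continuous_interval continuous_intros Dcont)
        show "(\<lambda>t. 2 * (norm (DF t))\<^sup>2 + 2 * \<epsilon>\<^sup>2) integrable_on {-T..T}"
          by (intro integrable_continuous_interval continuous_intros DFcont)
        fix t assume t: "t \<in> {-T..T}"
        have "norm (D t) \<le> norm (DF t) + \<epsilon>"
          using diff[OF t] norm_triangle_ineq[of "DF t" "D t - DF t"] by simp
        then have "(norm (D t))\<^sup>2 \<le> (norm (DF t) + \<epsilon>)\<^sup>2" by (intro power_mono) auto
        also have "\<dots> \<le> 2 * (norm (DF t))\<^sup>2 + 2 * \<epsilon>\<^sup>2"
          using sum_squares_bound[of "norm (DF t)" \<epsilon>] by (simp add: power2_sum)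
        finally show "(norm (D t))\<^sup>2 \<le> 2 * (norm (DF t))\<^sup>2 + 2 * \<epsilon>\<^sup>2" .
      qed
      also have "\<dots> = 2 * integral {-T..T} (\<lambda>t. (norm (DF t))\<^sup>2) + 2 * \<epsilon>\<^sup>2 * (2 * T)"
      proof -
        have "(\<lambda>t. (norm (DF t))\<^sup>2) integrable_on {-T..T}"
          by (intro integrable_continuous_interval continuous_intros DFcont)
        then show ?thesis
          using T by (subst integral_add) (auto intro: integrable_on_cmult_left)
      qed
      also have "2 * \<epsilon>\<^sup>2 * (2 * T) = e" using e T by (simp add: \<epsilon>_def)
      also have "integral {-T..T} (\<lambda>t. (norm (DF t))\<^sup>2) \<le>
          C * (\<Sum>M\<in>F. (norm (c M))\<^sup>2 * g M powr (- 2 * \<sigma>) * (g M + T * g M powr \<theta>))"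
        unfolding DF_def by (rule C(2)[OF T F(1)])
      also have "\<dots> \<le> C * (\<Sum>M\<in>F. (divs M)\<^sup>2 * g M powr (- 2 * \<sigma>) * (g M + T * g M powr \<theta>))"
        using C(1) c F T by (intro mult_left_mono sum_mono mult_right_mono power_mono add_nonneg_nonneg) auto
      also have "\<dots> \<le> C * B" using C(1) B[OF F] by (intro mult_left_mono) auto
      finally show "integral {-T..T} (\<lambda>t. (norm (D t))\<^sup>2) \<le> 2 * C * B + e" by simp
    qed
  qed
qed

end

text \<open>A separated subset of maximal cardinality: a point far from all its elements could be
  added to it.\<close>

lemma separated_subset:
  fixes Zs :: "complex set"
  assumes fin: "finite Zs" and h: "0 < h"
  obtains S where "S \<subseteq> Zs" "\<And>s s'. s \<in> S \<Longrightarrow> s' \<in> S \<Longrightarrow> s \<noteq> s' \<Longrightarrow> h \<le> \<bar>Im s - Im s'\<bar>"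
    "\<And>z. z \<in> Zs \<Longrightarrow> \<exists>s\<in>S. \<bar>Im z - Im s\<bar> < h"
proof -
  define sep where "sep S \<longleftrightarrow> S \<subseteq> Zs \<and> (\<forall>s\<in>S. \<forall>s'\<in>S. s \<noteq> s' \<longrightarrow> h \<le> \<bar>Im s - Im s'\<bar>)" for S
  have "finite {S. sep S}"
    by (rule finite_subset[of _ "Pow Zs"]) (use fin in \<open>auto simp: sep_def\<close>)
  then have fin': "finite (card ` {S. sep S})" by simp
  moreover have "sep {}" by (simp add: sep_def)
  ultimately have "Max (card ` {S. sep S}) \<in> card ` {S. sep S}" by (intro Max_in) auto
  then obtain S where S: "sep S" "card S = Max (card ` {S. sep S})" by auto
  have max: "card S' \<le> card S" if "sep S'" for S'
    unfolding S(2) using that by (intro Max_ge fin') auto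
  show ?thesis
  proof (rule that[of S])
    fix z assume z: "z \<in> Zs"
    show "\<exists>s\<in>S. \<bar>Im z - Im s\<bar> < h"
    proof (rule ccontr)
      assume neg: "\<not> (\<exists>s\<in>S. \<bar>Im z - Im s\<bar> < h)"
      then have "z \<notin> S" using h by auto
      have "sep (insert z S)"
        using S(1) z neg unfolding sep_def by (auto simp: not_less abs_minus_commute)
      then have "card (insert z S) \<le> card S" by (rule max)
      moreover have "finite S" using S(1) fin finite_subset unfolding sep_def by blast
      ultimately show False using \<open>z \<notin> S\<close> by simp
    qed
  qed (use S(1) in \<open>auto simp: sep_def\<close>)
qed

text \<open>Cauchy-Schwarz against a constant, read off from the nonnegative integral of (f - m)^2
  with m the mean of f.\<close>

lemma square_integral_le:
  fixes f :: "real \<Rightarrow> real"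
  assumes cd: "c < d" and f: "continuous_on {c..d} f"
  shows "(integral {c..d} f)\<^sup>2 \<le> (d - c) * integral {c..d} (\<lambda>y. (f y)\<^sup>2)"
proof -
  define m where "m = integral {c..d} f / (d - c)"
  have i1: "f integrable_on {c..d}" using f by (rule integrable_continuous_interval)
  have i2: "(\<lambda>y. (f y)\<^sup>2) integrable_on {c..d}"
    by (intro integrable_continuous_interval continuous_intros f)
  have "0 \<le> integral {c..d} (\<lambda>y. (f y - m)\<^sup>2)"
    by (intro integral_nonneg integrable_continuous_interval continuous_intros f) auto
  also have "(\<lambda>y. (f y - m)\<^sup>2) = (\<lambda>y. ((f y)\<^sup>2 - 2 * m * f y) + m\<^sup>2)"
    by (auto simp: power2_eq_square algebra_simps)
  also have "integral {c..d} \<dots> = integral {c..d} (\<lambda>y. (f y)\<^sup>2) - 2 * m * integral {c..d} f + m\<^sup>2 * (d - c)"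
  proof -
    have i3: "(\<lambda>y. 2 * m * f y) integrable_on {c..d}"
      by (intro integrable_continuous_interval continuous_intros f)
    have "integral {c..d} (\<lambda>y. ((f y)\<^sup>2 - 2 * m * f y) + m\<^sup>2)
        = integral {c..d} (\<lambda>y. (f y)\<^sup>2 - 2 * m * f y) + integral {c..d} (\<lambda>y. m\<^sup>2)"
      by (intro integral_add integrable_diff i2 i3 integrable_const_ivl)
    also have "integral {c..d} (\<lambda>y. (f y)\<^sup>2 - 2 * m * f y)
        = integral {c..d} (\<lambda>y. (f y)\<^sup>2) - integral {c..d} (\<lambda>y. 2 * m * f y)"
      by (intro integral_diff i2 i3)
    finally show ?thesis using cd by simp
  qed
  finally have *: "0 \<le> integral {c..d} (\<lambda>y. (f y)\<^sup>2) - 2 * m * integral {c..d} f + m\<^sup>2 * (d - c)" .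
  have I: "integral {c..d} f = m * (d - c)" using cd by (simp add: m_def)
  have "0 \<le> (d - c) * (integral {c..d} (\<lambda>y. (f y)\<^sup>2) - 2 * m * integral {c..d} f + m\<^sup>2 * (d - c))"
    using cd * by simp
  also have "\<dots> = (d - c) * integral {c..d} (\<lambda>y. (f y)\<^sup>2) - (integral {c..d} f)\<^sup>2"
    unfolding I by (simp add: power2_eq_square algebra_simps)
  finally show ?thesis by simp
qed

text \<open>Spacing 4 H exceeds the window length 2 H, so the windows are disjoint, and H \<le> T
  keeps them inside [-2T, 2T].\<close>

lemma sum_integral_windows_le:
  fixes f :: "real \<Rightarrow> real" and S :: "complex set"
  assumes fin: "finite S" and H: "0 < H" "H \<le> T" and S: "\<And>s. s \<in> S \<Longrightarrow> \<bar>Im s\<bar> \<le> T"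
    and sep: "\<And>s s'. s \<in> S \<Longrightarrow> s' \<in> S \<Longrightarrow> s \<noteq> s' \<Longrightarrow> 4 * H \<le> \<bar>Im s - Im s'\<bar>"
    and f: "continuous_on {-(2*T)..2*T} f" "\<And>t. 0 \<le> f t"
  shows "(\<Sum>s\<in>S. integral {Im s - H..Im s + H} f) \<le> integral {-(2*T)..2*T} f"
proof -
  let ?W = "\<lambda>s. {Im s - H..Im s + H}"
  have sub: "?W s \<subseteq> {-(2*T)..2*T}" if "s \<in> S" for s
    using S[OF that] H by auto
  have 1: "(f has_integral (\<Sum>s\<in>S. integral (?W s) f)) (\<Union>s\<in>S. ?W s)"
  proof (rule has_integral_UN[OF fin])
    fix s assume "s \<in> S"
    then show "(f has_integral integral (?W s) f) (?W s)"
      using sub by (intro integrable_integral integrable_continuous_interval continuous_on_subset[OF f(1)])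
  next
    show "pairwise (\<lambda>i i'. negligible (?W i \<inter> ?W i')) S"
    proof (rule pairwiseI)
      fix s s' assume "s \<in> S" "s' \<in> S" "s \<noteq> s'"
      from sep[OF this] have "?W s \<inter> ?W s' = {}" using H by auto
      then show "negligible (?W s \<inter> ?W s')" by simp
    qed
  qed
  have 2: "(f has_integral integral {-(2*T)..2*T} f) {-(2*T)..2*T}"
    by (intro integrable_integral integrable_continuous_interval f)
  have "(\<Union>s\<in>S. ?W s) \<subseteq> {-(2*T)..2*T}" using sub by blast
  from has_integral_subset_le[OF this 1 2] show ?thesis using f(2) by simp
qed

section \<open>Separated zeros and the two-line bound away from the pole\<close>

context beurling_system
begin

text \<open>Every zero is assigned to a chosen one at vertical distance below h. Each class sits in
  a window of half-height h and holds at most a constant times h ln T zeros with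
  multiplicity.\<close>

lemma zeros_separated:
  obtains C where "0 < C"
    "\<And>T h Zs. finite Zs \<Longrightarrow> 1 \<le> h \<Longrightarrow> h \<le> T \<Longrightarrow> 2 \<le> T \<Longrightarrow>
       Zs \<subseteq> {\<rho>. \<rho> \<noteq> 1 \<and> Z \<rho> = 0 \<and> \<sigma>\<^sub>0 \<le> Re \<rho> \<and> \<bar>Im \<rho>\<bar> \<le> T} \<Longrightarrow>
       \<exists>S\<subseteq>Zs. (\<forall>s\<in>S. \<forall>s'\<in>S. s \<noteq> s' \<longrightarrow> h \<le> \<bar>Im s - Im s'\<bar>) \<and>
         real (\<Sum>\<rho>\<in>Zs. mult \<rho>) \<le> C * h * ln T * real (card S)"
proof -
  obtain C where C: "0 < C"
    "\<And>t W Zs. finite Zs \<Longrightarrow> 1 \<le> W \<Longrightarrow>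
       Zs \<subseteq> {\<rho>. \<rho> \<noteq> 1 \<and> Z \<rho> = 0 \<and> \<sigma>\<^sub>0 \<le> Re \<rho> \<and> \<bar>Im \<rho> - t\<bar> \<le> W} \<Longrightarrow>
       real (\<Sum>\<rho>\<in>Zs. mult \<rho>) \<le> C * W * ln (\<bar>t\<bar> + 2 * W + 3)"
    by (rule zero_count_window) (rule that)
  show ?thesis
  proof (rule that[of "C * 4"])
    show "0 < C * 4" using C by simp
    fix T h :: real and Zs
    assume fin: "finite Zs" and h: "1 \<le> h" "h \<le> T" and T: "2 \<le> T"
      and Zs: "Zs \<subseteq> {\<rho>. \<rho> \<noteq> 1 \<and> Z \<rho> = 0 \<and> \<sigma>\<^sub>0 \<le> Re \<rho> \<and> \<bar>Im \<rho>\<bar> \<le> T}"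
    have h0: "0 < h" using h by simp
    obtain S where S: "S \<subseteq> Zs" "\<And>s s'. s \<in> S \<Longrightarrow> s' \<in> S \<Longrightarrow> s \<noteq> s' \<Longrightarrow> h \<le> \<bar>Im s - Im s'\<bar>"
      "\<And>z. z \<in> Zs \<Longrightarrow> \<exists>s\<in>S. \<bar>Im z - Im s\<bar> < h"
      by (rule separated_subset[OF fin h0]) (rule that)
    define \<kappa> where "\<kappa> z = (SOME s. s \<in> S \<and> \<bar>Im z - Im s\<bar> < h)" for z
    have \<kappa>: "\<kappa> z \<in> S \<and> \<bar>Im z - Im (\<kappa> z)\<bar> < h" if "z \<in> Zs" for z
      unfolding \<kappa>_def by (rule someI_ex) (use S(3)[OF that] in blast)
    have finS: "finite S" using S(1) fin by (rule finite_subset)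
    have "(\<Sum>\<rho>\<in>Zs. mult \<rho>) = (\<Sum>s\<in>S. \<Sum>\<rho>\<in>{\<rho>\<in>Zs. \<kappa> \<rho> = s}. mult \<rho>)"
      using \<kappa> by (intro sum.group[OF fin finS, symmetric]) auto
    then have "real (\<Sum>\<rho>\<in>Zs. mult \<rho>) = (\<Sum>s\<in>S. real (\<Sum>\<rho>\<in>{\<rho>\<in>Zs. \<kappa> \<rho> = s}. mult \<rho>))"
      by simp
    also have "\<dots> \<le> (\<Sum>s\<in>S. C * h * (4 * ln T))"
    proof (rule sum_mono)
      fix s assume s: "s \<in> S"
      have "{\<rho>\<in>Zs. \<kappa> \<rho> = s} \<subseteq> {\<rho>. \<rho> \<noteq> 1 \<and> Z \<rho> = 0 \<and> \<sigma>\<^sub>0 \<le> Re \<rho> \<and> \<bar>Im \<rho> - Im s\<bar> \<le> h}"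
        using \<kappa> Zs by fastforce
      then have "real (\<Sum>\<rho>\<in>{\<rho>\<in>Zs. \<kappa> \<rho> = s}. mult \<rho>) \<le> C * h * ln (\<bar>Im s\<bar> + 2 * h + 3)"
        using fin h by (intro C(2)) auto
      also have "ln (\<bar>Im s\<bar> + 2 * h + 3) \<le> ln (T ^ 4)"
      proof (rule ln_mono)
        have "\<bar>Im s\<bar> \<le> T" using s S(1) Zs by auto
        moreover have "5 * T \<le> T ^ 4"
        proof -
          have "2 ^ 3 \<le> T ^ 3" using T by (intro power_mono) auto
          then have "5 * T \<le> T ^ 3 * T" using T by (intro mult_right_mono) auto
          then show ?thesis by (simp add: power_numeral_reduce mult.commute)
        qed
        ultimately show "\<bar>Im s\<bar> + 2 * h + 3 \<le> T ^ 4" using h T by linarith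
      qed (use h in auto)
      also have "ln (T ^ 4) = 4 * ln T" using T by (simp add: ln_realpow)
      finally show "real (\<Sum>\<rho>\<in>{\<rho>\<in>Zs. \<kappa> \<rho> = s}. mult \<rho>) \<le> C * h * (4 * ln T)"
        using C(1) h by simp
    qed
    also have "\<dots> = C * 4 * h * ln T * real (card S)" by simp
    finally have "real (\<Sum>\<rho>\<in>Zs. mult \<rho>) \<le> C * 4 * h * ln T * real (card S)" .
    then show "\<exists>S\<subseteq>Zs. (\<forall>s\<in>S. \<forall>s'\<in>S. s \<noteq> s' \<longrightarrow> h \<le> \<bar>Im s - Im s'\<bar>) \<and>
         real (\<Sum>\<rho>\<in>Zs. mult \<rho>) \<le> C * 4 * h * ln T * real (card S)"
      using S(1,2) by blast
  qed
qed

text \<open>The rectangle has to avoid the pole. With half-height H and |Im \<rho>| \<ge> H + 1 it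
  lies strictly on one side of the real axis, and that side of the half plane Re s > \<theta> is
  convex and free of 1.\<close>

lemma two_line_bound_Z:
  assumes \<rho>: "\<sigma>\<^sub>0 < Re \<rho>" "Re \<rho> < b" "b \<le> \<sigma>\<^sub>0 + 3" "H + 1 \<le> \<bar>Im \<rho>\<bar>" and H: "1 \<le> H" and Y: "1 \<le> Y"
    and hol: "f holomorphic_on {s. \<theta> < Re s} - {1}"
    and M: "0 \<le> M" "\<And>s. \<sigma>\<^sub>0 \<le> Re s \<Longrightarrow> Re s \<le> b \<Longrightarrow> \<bar>Im s - Im \<rho>\<bar> = H \<Longrightarrow> norm (f s) \<le> M"
  shows "norm (f \<rho>) \<le> exp 9 * (
      Y powr (\<sigma>\<^sub>0 - Re \<rho>) / (Re \<rho> - \<sigma>\<^sub>0) * integral {Im \<rho> - H..Im \<rho> + H} (\<lambda>y. norm (f (Complex \<sigma>\<^sub>0 y)))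
      + Y powr (b - Re \<rho>) / (b - Re \<rho>) * integral {Im \<rho> - H..Im \<rho> + H} (\<lambda>y. norm (f (Complex b y)))
      + 6 * Y powr 3 * M * exp (- (H\<^sup>2)))"
proof -
  have \<theta>\<sigma>: "\<theta> < \<sigma>\<^sub>0" using theta_less_1 by simp
  define U where "U = {s. \<theta> < Re s} \<inter> (if 0 < Im \<rho> then {s. 0 < Im s} else {s. Im s < 0})"
  have U: "convex U" "open U"
    unfolding U_def
    by (auto intro!: convex_Int convex_halfspace_Re_gt convex_halfspace_Im_gt convex_halfspace_Im_lt
        open_Int open_halfspace_Re_gt open_halfspace_Im_gt open_halfspace_Im_lt)
  have "U \<subseteq> {s. \<theta> < Re s} - {1}" by (auto simp: U_def split: if_splits)
  then have hol': "f holomorphic_on U" by (rule holomorphic_on_subset[OF hol])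
  have "cbox (Complex \<sigma>\<^sub>0 (Im \<rho> - H)) (Complex b (Im \<rho> + H)) \<subseteq> U"
  proof
    fix s assume "s \<in> cbox (Complex \<sigma>\<^sub>0 (Im \<rho> - H)) (Complex b (Im \<rho> + H))"
    then have "\<sigma>\<^sub>0 \<le> Re s" "Im \<rho> - H \<le> Im s" "Im s \<le> Im \<rho> + H" by (auto simp: in_cbox_complex_iff)
    then show "s \<in> U" using \<rho>(4) \<theta>\<sigma> unfolding U_def by (simp only: Int_iff mem_Collect_eq split: if_split) auto
  qed
  from two_line_bound[OF \<rho>(1,2,3) H Y hol' U this M(1)] show ?thesis
    using M(2) H by simp
qed

end

subsection \<open>The first estimate\<close>

text \<open>Contours are cut at distance ln T from a zero, where the Gaussian is exp (- (ln T)^2).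
  Once ln T is at least 1 + |q| + |ln C|, its square dominates ln C + q ln T.\<close>

lemma gaussian_beats_power:
  fixes q C :: real
  assumes "0 < C"
  obtains T0 where "exp 1 \<le> T0" "\<And>T. T0 \<le> T \<Longrightarrow> C * T powr q * exp (- ((ln T)\<^sup>2)) \<le> 1"
proof (rule that[of "exp (1 + \<bar>q\<bar> + \<bar>ln C\<bar>)"])
  fix T :: real assume T: "exp (1 + \<bar>q\<bar> + \<bar>ln C\<bar>) \<le> T"
  define L where "L = ln T"
  have T0: "0 < T" using T exp_gt_zero less_le_trans by blast
  have L: "1 + \<bar>q\<bar> + \<bar>ln C\<bar> \<le> L" using T T0 unfolding L_def by (simp add: ln_ge_iff)
  have "\<bar>ln C\<bar> * 1 \<le> \<bar>ln C\<bar> * L" using L by (intro mult_left_mono) auto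
  moreover have "q * L \<le> \<bar>q\<bar> * L" using L by (intro mult_right_mono) auto
  moreover have "(1 + \<bar>q\<bar> + \<bar>ln C\<bar>) * L \<le> L * L" using L by (intro mult_right_mono) auto
  ultimately have "ln C + q * L - L\<^sup>2 \<le> 0"
    using L by (simp add: power2_eq_square algebra_simps)
  moreover have "C * T powr q * exp (- ((ln T)\<^sup>2)) = exp (ln C + q * L - L\<^sup>2)"
    using assms T0 by (simp add: powr_def L_def exp_add exp_diff exp_minus field_simps)
  ultimately show "C * T powr q * exp (- ((ln T)\<^sup>2)) \<le> 1" by simp
qed simp

section \<open>Mean squares on the two vertical lines\<close>

context beurling_system
begin

lemma zeta\<^sub>r_log_bound:
  obtains C where "1 \<le> C" "\<And>L c. 1 \<le> L \<Longrightarrow> 1 \<le> c \<Longrightarrow> c \<le> 3 \<Longrightarrow> zeta\<^sub>r (1 + c / L) \<le> C * L"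
proof -
  obtain C where C: "1 \<le> C" "\<And>\<sigma>. 1 < \<sigma> \<Longrightarrow> \<sigma> \<le> 4 \<Longrightarrow> zeta\<^sub>r \<sigma> \<le> C / (\<sigma> - 1)"
    by (rule zeta\<^sub>r_bound) (rule that)
  show ?thesis
  proof (rule that[OF C(1)])
    fix L c :: real assume L: "1 \<le> L" and c: "1 \<le> c" "c \<le> 3"
    have "c / L \<le> 3 / 1" using L c by (intro frac_le) auto
    then have "zeta\<^sub>r (1 + c / L) \<le> C / (1 + c / L - 1)" using L c by (intro C) auto
    also have "\<dots> = C * L / c" using L by simp
    also have "\<dots> \<le> C * L / 1" using L c C by (intro divide_left_mono) auto
    finally show "zeta\<^sub>r (1 + c / L) \<le> C * L" by simp
  qed
qed

text \<open>X is the point where g and T g^\<theta> are equal. Up to X every term of the mean value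
  on the critical line is therefore at most 3 T / g, and the sum of 1 / g is replaced by
  \<open>zeta\<^sub>r (1 + 1 / ln T)\<close> at the cost of the constant factor X^(1 / ln
  T).\<close>

lemma mollifier_mean_square:
  obtains C where "0 < C"
    "\<And>T X. exp 1 \<le> T \<Longrightarrow> X = T powr (1 / (1 - \<theta>)) \<Longrightarrow>
      integral {-(2*T)..2*T} (\<lambda>t. (norm (mollifier X (Complex \<sigma>\<^sub>0 t)))\<^sup>2) \<le> C * T * ln T"
proof -
  obtain C where C: "0 < C"
    "\<And>T F c \<sigma>. 1 \<le> T \<Longrightarrow> finite F \<Longrightarrow>
       integral {-T..T} (\<lambda>t. (norm (\<Sum>M\<in>F. c M * dterm M (Complex \<sigma> t)))\<^sup>2)
         \<le> C * (\<Sum>M\<in>F. (norm (c M))\<^sup>2 * g M powr (- 2 * \<sigma>) * (g M + T * g M powr \<theta>))"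
    by (rule mean_value_finite) (rule that)
  obtain Cz where Cz: "1 \<le> Cz" "\<And>L c. 1 \<le> L \<Longrightarrow> 1 \<le> c \<Longrightarrow> c \<le> 3 \<Longrightarrow> zeta\<^sub>r (1 + c / L) \<le> Cz * L"
    by (rule zeta\<^sub>r_log_bound) (rule that)
  define E where "E = exp (1 / (1 - \<theta>))"
  show ?thesis
  proof (rule that[of "C * (3 * E * Cz)"])
    show "0 < C * (3 * E * Cz)" using C Cz by (simp add: E_def)
    fix T X :: real assume T: "exp 1 \<le> T" and X: "X = T powr (1 / (1 - \<theta>))"
    define L where "L = ln T"
    have T1: "1 \<le> T" using T exp_ge_add_one_self[of 1] by linarith
    have L: "1 \<le> L" unfolding L_def using T T1 by (simp add: ln_ge_iff)
    have X1: "1 \<le> X" unfolding X using T1 theta_less_1 by (simp add: ge_one_powr_ge_zero)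
    have XT: "X powr (1 - \<theta>) = T" unfolding X using T1 theta_less_1 by (simp add: powr_powr)
    have XE: "X powr (1 / L) = E"
    proof -
      have "T \<noteq> 1" using L by (auto simp: L_def)
      then show ?thesis
        unfolding X E_def using T1 L theta_less_1 by (simp add: powr_powr powr_def L_def)
    qed
    have summ: "(\<lambda>M. g M powr - (1 + 1 / L)) summable_on UNIV" using L by (intro summable_g) auto
    have "integral {-(2*T)..2*T} (\<lambda>t. (norm (mollifier X (Complex \<sigma>\<^sub>0 t)))\<^sup>2)
        \<le> C * (\<Sum>M | g M \<le> X. (norm (mu M))\<^sup>2 * g M powr (- 2 * \<sigma>\<^sub>0) * (g M + 2 * T * g M powr \<theta>))"
      unfolding mollifier_def using T1 by (intro C) auto
    also have "(\<Sum>M | g M \<le> X. (norm (mu M))\<^sup>2 * g M powr (- 2 * \<sigma>\<^sub>0) * (g M + 2 * T * g M powr \<theta>))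
        \<le> (\<Sum>M | g M \<le> X. g M powr - (1 + 1 / L) * (3 * T * E))"
    proof (rule sum_mono)
      fix M assume "M \<in> {M. g M \<le> X}"
      then have M: "g M \<le> X" by simp
      have e: "g M powr (1 / L) \<le> E"
        unfolding XE[symmetric] using M L by (intro powr_mono2) auto
      have t: "g M powr (1 - \<theta>) \<le> T"
        unfolding XT[symmetric] using M theta_less_1 by (intro powr_mono2) auto
      have "(norm (mu M))\<^sup>2 \<le> 1" using norm_mu_le_1[of M] by (simp add: power_le_one)
      then have "(norm (mu M))\<^sup>2 * g M powr (- 2 * \<sigma>\<^sub>0) * (g M + 2 * T * g M powr \<theta>)
          \<le> 1 * g M powr (- 2 * \<sigma>\<^sub>0) * (g M + 2 * T * g M powr \<theta>)"
        using T1 by (intro mult_right_mono) auto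
      also have "\<dots> = g M powr - (1 + 1 / L) * (g M powr (1 / L) * (g M powr (1 - \<theta>) + 2 * T))"
      proof -
        have "g M powr (- 2 * \<sigma>\<^sub>0) * g M powr 1 = g M powr - (1 + 1 / L) * (g M powr (1 / L) * g M powr (1 - \<theta>))"
          "g M powr (- 2 * \<sigma>\<^sub>0) * g M powr \<theta> = g M powr - (1 + 1 / L) * g M powr (1 / L)"
          by (simp_all only: powr_add[symmetric]) (simp_all add: field_simps)
        then show ?thesis by (simp add: algebra_simps)
      qed
      also have "\<dots> \<le> g M powr - (1 + 1 / L) * (E * (T + 2 * T))"
        using e t T1 by (intro mult_left_mono mult_mono) (auto simp: E_def)
      finally show "(norm (mu M))\<^sup>2 * g M powr (- 2 * \<sigma>\<^sub>0) * (g M + 2 * T * g M powr \<theta>)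
          \<le> g M powr - (1 + 1 / L) * (3 * T * E)" by (simp add: mult_ac)
    qed
    also have "\<dots> = (\<Sum>M | g M \<le> X. g M powr - (1 + 1 / L)) * (3 * T * E)"
      by (simp add: sum_distrib_right)
    also have "(\<Sum>M | g M \<le> X. g M powr - (1 + 1 / L)) \<le> zeta\<^sub>r (1 + 1 / L)"
      unfolding zeta\<^sub>r_def by (rule finite_sum_le_infsum[OF summ]) auto
    also have "zeta\<^sub>r (1 + 1 / L) \<le> Cz * L" using Cz(2)[OF L, of 1] by simp
    finally have "integral {-(2*T)..2*T} (\<lambda>t. (norm (mollifier X (Complex \<sigma>\<^sub>0 t)))\<^sup>2) \<le> C * (Cz * L * (3 * T * E))"
      using C(1) T1 by (simp add: E_def mult_left_mono mult_right_mono)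
    then show "integral {-(2*T)..2*T} (\<lambda>t. (norm (mollifier X (Complex \<sigma>\<^sub>0 t)))\<^sup>2) \<le> C * (3 * E * Cz) * T * ln T"
      by (simp add: L_def mult_ac)
  qed
qed

lemma mollified_mean_square:
  obtains C where "0 < C"
    "\<And>T X. exp 1 \<le> T \<Longrightarrow> X = T powr (1 / (1 - \<theta>)) \<Longrightarrow>
      integral {-(2*T)..2*T} (\<lambda>t. (norm (Z (Complex (1 + 1 / ln T) t) * mollifier X (Complex (1 + 1 / ln T) t) - 1))\<^sup>2)
        \<le> C * ln T ^ 4"
proof -
  obtain C where C: "0 < C"
    "\<And>T S c \<sigma> D B. 1 \<le> T \<Longrightarrow> 1 < \<sigma> \<Longrightarrow> \<forall>M\<in>S. norm (c M) \<le> divs M \<Longrightarrow>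
       continuous_on {-T..T} D \<Longrightarrow>
       \<forall>t\<in>{-T..T}. D t = (\<Sum>\<^sub>\<infinity>M\<in>S. c M * dterm M (Complex \<sigma> t)) \<Longrightarrow>
       \<forall>F\<subseteq>S. finite F \<longrightarrow> (\<Sum>M\<in>F. (divs M)\<^sup>2 * g M powr (- 2 * \<sigma>) * (g M + T * g M powr \<theta>)) \<le> B \<Longrightarrow>
       integral {-T..T} (\<lambda>t. (norm (D t))\<^sup>2) \<le> C * B"
    by (rule mean_value_infinite) (rule that)
  obtain Cz where Cz: "1 \<le> Cz" "\<And>L c. 1 \<le> L \<Longrightarrow> 1 \<le> c \<Longrightarrow> c \<le> 3 \<Longrightarrow> zeta\<^sub>r (1 + c / L) \<le> Cz * L"
    by (rule zeta\<^sub>r_log_bound) (rule that)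
  show ?thesis
  proof (rule that[of "C * (3 * Cz ^ 4)"])
    show "0 < C * (3 * Cz ^ 4)" using C Cz by simp
    fix T X :: real assume T: "exp 1 \<le> T" and X: "X = T powr (1 / (1 - \<theta>))"
    define L where "L = ln T"
    define b where "b = 1 + 1 / L"
    have T1: "1 \<le> T" using T exp_ge_add_one_self[of 1] by linarith
    have L: "1 \<le> L" unfolding L_def using T T1 by (simp add: ln_ge_iff)
    have b: "1 < b" using L by (simp add: b_def)
    have X1: "1 \<le> X" unfolding X using T1 theta_less_1 by (simp add: ge_one_powr_ge_zero)
    have XT: "X powr (1 - \<theta>) = T" unfolding X using T1 theta_less_1 by (simp add: powr_powr)
    have cont: "continuous_on {- (2 * T)..2 * T} (\<lambda>t. Z (Complex b t) * mollifier X (Complex b t) - 1)"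
    proof -
      have "continuous_on {- (2 * T)..2 * T} (\<lambda>t. Z (Complex b t))"
        by (rule continuous_on_compose2[OF holomorphic_on_imp_continuous_on[OF Z_holomorphic]])
           (use b theta_less_1 in \<open>auto intro!: continuous_intros simp: complex_eq_iff\<close>)
      moreover have "continuous_on {- (2 * T)..2 * T} (\<lambda>t. mollifier X (Complex b t))"
        by (rule continuous_on_compose2[OF holomorphic_on_imp_continuous_on[OF mollifier_holomorphic[of X UNIV]]])
           (auto intro!: continuous_intros)
      ultimately show ?thesis by (intro continuous_intros)
    qed
    have bound: "(\<Sum>M\<in>F. (divs M)\<^sup>2 * g M powr (- 2 * b) * (g M + 2 * T * g M powr \<theta>)) \<le> 3 * (Cz * L) ^ 4"
      if F: "finite F" "F \<subseteq> {M. X < g M}" for F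
    proof -
      have "(\<Sum>M\<in>F. (divs M)\<^sup>2 * g M powr (- 2 * b) * (g M + 2 * T * g M powr \<theta>))
          \<le> (\<Sum>M\<in>F. 3 * ((divs M)\<^sup>2 * g M powr - (1 + 2 / L)))"
      proof (rule sum_mono)
        fix M assume "M \<in> F"
        then have "X \<le> g M" using F by auto
        then have "X powr (1 - \<theta>) \<le> g M powr (1 - \<theta>)"
          using X1 theta_less_1 by (intro powr_mono2) auto
        then have "T * g M powr \<theta> \<le> g M powr (1 - \<theta>) * g M powr \<theta>"
          unfolding XT by (intro mult_right_mono) auto
        also have "\<dots> = g M" by (simp flip: powr_add)
        finally have "g M + 2 * T * g M powr \<theta> \<le> 3 * g M powr 1" by simp
        then have "(divs M)\<^sup>2 * g M powr (- 2 * b) * (g M + 2 * T * g M powr \<theta>)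
            \<le> (divs M)\<^sup>2 * g M powr (- 2 * b) * (3 * g M powr 1)"
          by (intro mult_left_mono) auto
        also have "\<dots> = 3 * ((divs M)\<^sup>2 * (g M powr (- 2 * b) * g M powr 1))" by simp
        also have "g M powr (- 2 * b) * g M powr 1 = g M powr - (1 + 2 / L)"
          unfolding powr_add[symmetric] by (simp add: b_def)
        finally show "(divs M)\<^sup>2 * g M powr (- 2 * b) * (g M + 2 * T * g M powr \<theta>)
            \<le> 3 * ((divs M)\<^sup>2 * g M powr - (1 + 2 / L))" .
      qed
      also have "\<dots> = 3 * (\<Sum>M\<in>F. (divs M)\<^sup>2 * g M powr - (1 + 2 / L))"
        by (simp add: sum_distrib_left)
      also have "\<dots> \<le> 3 * zeta\<^sub>r (1 + 2 / L) ^ 4"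
        using L F(1) by (intro mult_left_mono sum_divs_square_le) auto
      also have "\<dots> \<le> 3 * (Cz * L) ^ 4"
        using Cz(2)[OF L, of 2] zeta\<^sub>r_nonneg by (intro mult_left_mono power_mono) auto
      finally show ?thesis .
    qed
    have "integral {-(2*T)..2*T} (\<lambda>t. (norm (Z (Complex b t) * mollifier X (Complex b t) - 1))\<^sup>2) \<le> C * (3 * (Cz * L) ^ 4)"
    proof (rule C(2)[where c = "mcoeff X" and S = "{M. X < g M}", OF _ b _ cont])
      show "\<forall>t\<in>{-(2*T)..2*T}. Z (Complex b t) * mollifier X (Complex b t) - 1
          = (\<Sum>\<^sub>\<infinity>M\<in>{M. X < g M}. mcoeff X M * dterm M (Complex b t))"
        using b X1 mollified_zeta by simp
    qed (use T1 norm_mcoeff_le bound in auto)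
    then show "integral {-(2*T)..2*T} (\<lambda>t. (norm (Z (Complex (1 + 1 / ln T) t) * mollifier X (Complex (1 + 1 / ln T) t) - 1))\<^sup>2)
        \<le> C * (3 * Cz ^ 4) * ln T ^ 4"
      by (simp add: b_def L_def power_mult_distrib mult_ac)
  qed
qed

end

locale beurling_subconvex = beurling_system +
  fixes B K0 :: real
  assumes B_pos: "0 < B" and K0_ge_1: "1 \<le> K0"
    and critical: "1 \<le> \<bar>t\<bar> \<Longrightarrow> norm (Z (Complex \<sigma>\<^sub>0 t)) \<le> K0 * \<bar>t\<bar> powr B"

text \<open>Follows from ln (sqrt T) \<le> sqrt T - 1 and sqrt T \<ge> 8. In particular 4 ln T \<le>
  T, which keeps windows of half-height ln T about heights up to T below 2 T.\<close>

lemma ln_square_large: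
  assumes "64 \<le> (T :: real)"
  shows "8 * ln T \<le> 2 * T" "1 \<le> ln T" "exp 1 \<le> T"
proof -
  have e: "exp 1 < (3 :: real)" by (rule e_less_272[THEN less_trans]) simp
  then show "exp 1 \<le> T" using assms by linarith
  then show "1 \<le> ln T" using assms by (simp add: ln_ge_iff)
  have s: "8 \<le> sqrt T" using assms real_le_rsqrt[of 8 T] by simp
  have "ln T = 2 * ln (sqrt T)" using assms by (simp add: ln_sqrt)
  also have "ln (sqrt T) \<le> sqrt T - 1" using assms by (intro ln_le_minus_one) simp
  finally have "4 * ln T \<le> 8 * sqrt T" by simp
  also have "\<dots> \<le> sqrt T * sqrt T" using s assms by (intro mult_right_mono) auto
  finally show "8 * ln T \<le> 2 * T" using assms by simp
qed

context beurling_system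
begin

lemma sigma0_props: "\<theta> < \<sigma>\<^sub>0" "\<sigma>\<^sub>0 < 1" "0 < \<sigma>\<^sub>0" "1 / 2 \<le> \<sigma>\<^sub>0"
  using theta_less_1 theta_nonneg by simp_all

lemma vertical_continuous:
  assumes "f holomorphic_on {s. \<theta> < Re s} - {1}" "\<theta> < a" "a \<noteq> 1"
  shows "continuous_on S (\<lambda>t. f (Complex a t))"
  by (rule continuous_on_compose2[OF holomorphic_on_imp_continuous_on[OF assms(1)]])
     (use assms(2,3) in \<open>auto intro!: continuous_intros simp: complex_eq_iff\<close>)

end

section \<open>From separated zeros to the first density bound\<close>

context beurling_subconvex
begin

text \<open>At each zero the two-line bound gives 1 \<le> k0 J0 + k1 J1 with local mean squares on
  the two lines. Summation over separated zeros turns these into global mean squares; on the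
  critical line Z contributes T^(2B) and the mollifier T ln T.\<close>

lemma separated_zeros_bound:
  assumes \<delta>: "0 < \<delta>"
  obtains C T0 where "0 < C" "64 \<le> T0"
    "\<And>T \<alpha> S. T0 \<le> T \<Longrightarrow> \<sigma>\<^sub>0 + \<delta> \<le> \<alpha> \<Longrightarrow> finite S \<Longrightarrow>
      S \<subseteq> {\<rho>. Z \<rho> = 0 \<and> \<alpha> \<le> Re \<rho> \<and> Re \<rho> \<le> 1 \<and> ln T + 2 \<le> \<bar>Im \<rho>\<bar> \<and> \<bar>Im \<rho>\<bar> \<le> T} \<Longrightarrow>
      \<forall>s\<in>S. \<forall>s'\<in>S. s \<noteq> s' \<longrightarrow> 4 * ln T \<le> \<bar>Im s - Im s'\<bar> \<Longrightarrow>
      real (card S) \<le> C * ln T ^ 7 * T powr (2 * (1 + 2 * B) * (1 - \<alpha>) / (1 - \<theta>))"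
proof -
  obtain K1 where K1: "0 < K1"
    "\<And>s. \<sigma>\<^sub>0 \<le> Re s \<Longrightarrow> Re s \<le> 4 \<Longrightarrow> 1 \<le> \<bar>Im s\<bar> \<Longrightarrow> norm (Z s) \<le> K1 * \<bar>Im s\<bar>"
    by (rule Z_linear_growth[of \<sigma>\<^sub>0 4]) (use sigma0_props in auto)
  obtain Cm where Cm: "0 < Cm"
    "\<And>T X. exp 1 \<le> T \<Longrightarrow> X = T powr (1 / (1 - \<theta>)) \<Longrightarrow>
      integral {-(2*T)..2*T} (\<lambda>t. (norm (mollifier X (Complex \<sigma>\<^sub>0 t)))\<^sup>2) \<le> Cm * T * ln T"
    by (rule mollifier_mean_square) (rule that)
  obtain Ct where Ct: "0 < Ct"
    "\<And>T X. exp 1 \<le> T \<Longrightarrow> X = T powr (1 / (1 - \<theta>)) \<Longrightarrow>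
      integral {-(2*T)..2*T} (\<lambda>t. (norm (Z (Complex (1 + 1 / ln T) t) * mollifier X (Complex (1 + 1 / ln T) t) - 1))\<^sup>2)
        \<le> Ct * ln T ^ 4"
    by (rule mollified_mean_square) (rule that)
  \<comment> \<open>X = T^x is the crossover of the mean values. Y = T^y makes both lines contribute
    the same power of T, since Y^(1 - \<theta>) = T^(1 + 2B).\<close>
  define x y where "x = 1 / (1 - \<theta>)" and "y = (1 + 2 * B) / (1 - \<theta>)"
  have xy: "0 < x" "0 < y" using theta_less_1 B_pos by (auto simp: x_def y_def)
  define Mc where "Mc = 2 * K1 * (A + C0) + 1"
  have Mc: "0 < Mc" using K1 A_pos C0_pos by (simp add: Mc_def add_pos_pos)
  have "0 < 12 * exp 9 * Mc" using Mc by simp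
  then obtain T1 where T1: "exp 1 \<le> T1"
    "\<And>T. T1 \<le> T \<Longrightarrow> 12 * exp 9 * Mc * T powr (3 * y + 1 + x) * exp (- ((ln T)\<^sup>2)) \<le> 1"
    by (rule gaussian_beats_power) (rule that)
  define c1 c2 where "c1 = exp 9 / \<delta>" and "c2 = exp 9 * exp y"
  define C6 where "C6 = 2 * K0\<^sup>2 * 2 powr (2 * B) * Cm + 8"
  have c: "0 < c1" "0 < c2" "0 < C6"
    using \<delta> Cm by (auto simp: c1_def c2_def C6_def intro!: add_nonneg_pos)
  show ?thesis
  proof (rule that[of "16 * c1\<^sup>2 * C6 + 16 * c2\<^sup>2 * Ct" "max 64 T1"])
    show "0 < 16 * c1\<^sup>2 * C6 + 16 * c2\<^sup>2 * Ct" using c Ct by (simp add: add_pos_pos)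
    fix T \<alpha> S
    assume T: "max 64 T1 \<le> T" and \<alpha>: "\<sigma>\<^sub>0 + \<delta> \<le> \<alpha>" and fin: "finite S"
      and S: "S \<subseteq> {\<rho>. Z \<rho> = 0 \<and> \<alpha> \<le> Re \<rho> \<and> Re \<rho> \<le> 1 \<and> ln T + 2 \<le> \<bar>Im \<rho>\<bar> \<and> \<bar>Im \<rho>\<bar> \<le> T}"
      and sep: "\<forall>s\<in>S. \<forall>s'\<in>S. s \<noteq> s' \<longrightarrow> 4 * ln T \<le> \<bar>Im s - Im s'\<bar>"
    define L X Y b where "L = ln T" and "X = T powr x" and "Y = T powr y" and "b = 1 + 1 / L"
    have T64: "64 \<le> T" "T1 \<le> T" using T by auto
    have Te: "exp 1 \<le> T" and L: "1 \<le> L" "4 * L \<le> T"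
      using ln_square_large[OF T64(1)] by (auto simp: L_def)
    have X1: "1 \<le> X" "1 \<le> Y" using T64 xy by (auto simp: X_def Y_def ge_one_powr_ge_zero)
    have b: "1 < b" "b \<le> 2" using L by (auto simp: b_def)
    define f where "f s = Z s * mollifier X s - 1" for s
    have hol: "f holomorphic_on {s. \<theta> < Re s} - {1}"
      unfolding f_def by (intro holomorphic_intros Z_holomorphic mollifier_holomorphic)
    define P Q where "P = Y powr (\<sigma>\<^sub>0 - \<alpha>)" and "Q = Y powr (1 - \<alpha>)"
    have PQ: "0 < P" "0 < Q" using X1 by (auto simp: P_def Q_def)
    \<comment> \<open>The offset 1 / L of the right line costs only a constant, because T^(1 / ln T)
      = e.\<close>
    have YL: "Y powr (1 / L) = exp y"
    proof -
      have "T \<noteq> 1" using T64 by simp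
      then show ?thesis using T64 L by (simp add: Y_def powr_powr powr_def L_def)
    qed
    have YQ: "P\<^sup>2 * T powr (1 + 2 * B) = Q\<^sup>2"
    proof -
      have "T powr (1 + 2 * B) = Y powr (1 - \<theta>)"
        using theta_less_1 T64 by (simp add: Y_def powr_powr y_def)
      then have "P\<^sup>2 * T powr (1 + 2 * B) = Y powr ((\<sigma>\<^sub>0 - \<alpha>) + (\<sigma>\<^sub>0 - \<alpha>) + (1 - \<theta>))"
        by (simp only: P_def power2_eq_square powr_add)
      also have "(\<sigma>\<^sub>0 - \<alpha>) + (\<sigma>\<^sub>0 - \<alpha>) + (1 - \<theta>) = (1 - \<alpha>) + (1 - \<alpha>)" by (simp add: field_simps)
      finally show ?thesis by (simp only: Q_def power2_eq_square powr_add)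
    qed
    define J0 J1 where "J0 s = integral {Im s - L..Im s + L} (\<lambda>t. (norm (f (Complex \<sigma>\<^sub>0 t)))\<^sup>2)"
      and "J1 s = integral {Im s - L..Im s + L} (\<lambda>t. (norm (f (Complex b t)))\<^sup>2)" for s
    have cont0: "continuous_on U (\<lambda>t. f (Complex \<sigma>\<^sub>0 t))" for U
      using sigma0_props by (intro vertical_continuous[OF hol]) auto
    have cont1: "continuous_on U (\<lambda>t. f (Complex b t))" for U
      using sigma0_props b by (intro vertical_continuous[OF hol]) auto
    define k0 k1 where "k0 = 16 * c1\<^sup>2 * P\<^sup>2 * L" and "k1 = 16 * c2\<^sup>2 * L ^ 3 * Q\<^sup>2"
    have k: "0 \<le> k0" "0 \<le> k1" using L by (auto simp: k0_def k1_def)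
    \<comment> \<open>The horizontal sides take at most 1/2, so the vertical integrals supply at
      least 1/2. Squaring and Cauchy-Schwarz over a window of length 2 L give the factor L of
      \<open>k0\<close>; on the right line the distance b - Re s may be as small as 1 / L, which
      adds L^2 to \<open>k1\<close>.\<close>
    have detect: "1 \<le> k0 * J0 s + k1 * J1 s" if s: "s \<in> S" for s
    proof -
      have \<rho>: "Z s = 0" "\<alpha> \<le> Re s" "Re s \<le> 1" "L + 2 \<le> \<bar>Im s\<bar>" "\<bar>Im s\<bar> \<le> T"
        using S s by (auto simp: L_def)
      define I0 I1 where "I0 = integral {Im s - L..Im s + L} (\<lambda>y. norm (f (Complex \<sigma>\<^sub>0 y)))"
        and "I1 = integral {Im s - L..Im s + L} (\<lambda>y. norm (f (Complex b y)))"
      have I: "0 \<le> I0" "0 \<le> I1" unfolding I0_def I1_def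
        by (intro integral_nonneg integrable_continuous_interval continuous_intros cont0 cont1; simp)+
      define M where "M = Mc * T powr (1 + x)"
      have M: "norm (f u) \<le> M" if u: "\<sigma>\<^sub>0 \<le> Re u" "Re u \<le> b" "\<bar>Im u - Im s\<bar> = L" for u
      proof -
        have Imu: "1 \<le> \<bar>Im u\<bar>" "\<bar>Im u\<bar> \<le> 2 * T" using u(3) \<rho>(4,5) L by auto
        have "norm (Z u) \<le> K1 * \<bar>Im u\<bar>" using u b Imu by (intro K1) auto
        also have "\<dots> \<le> K1 * (2 * T)" using K1 Imu by (intro mult_left_mono) auto
        finally have "norm (Z u) * norm (mollifier X u) \<le> K1 * (2 * T) * ((A + C0) * X)"
          using u sigma0_props X1 K1 T64 by (intro mult_mono norm_mollifier_le) auto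
        moreover have "norm (f u) \<le> norm (Z u) * norm (mollifier X u) + 1"
          unfolding f_def using norm_triangle_ineq4[of "Z u * mollifier X u" 1] by (simp add: norm_mult)
        moreover have TX: "T powr (1 + x) = T * X" using T64 by (simp add: X_def powr_add)
        moreover have "1 \<le> T powr (1 + x)" using T64 xy by (intro ge_one_powr_ge_zero) auto
        ultimately show ?thesis unfolding M_def Mc_def TX by (simp add: algebra_simps)
      qed
      have "norm (f s) \<le> exp 9 * (
          Y powr (\<sigma>\<^sub>0 - Re s) / (Re s - \<sigma>\<^sub>0) * I0 + Y powr (b - Re s) / (b - Re s) * I1
          + 6 * Y powr 3 * M * exp (- (L\<^sup>2)))"
        unfolding I0_def I1_def
      proof (rule two_line_bound_Z[OF _ _ _ _ L(1) X1(2) hol])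
        show "0 \<le> M" using Mc by (simp add: M_def)
        show "\<sigma>\<^sub>0 < Re s" "Re s < b" "b \<le> \<sigma>\<^sub>0 + 3" "L + 1 \<le> \<bar>Im s\<bar>"
          using \<rho> \<alpha> \<delta> b sigma0_props by linarith+
      qed (rule M)
      moreover have "norm (f s) = 1" using \<rho> by (simp add: f_def)
      moreover have "exp 9 * (6 * Y powr 3 * M * exp (- (L\<^sup>2))) \<le> 1 / 2"
      proof -
        have "Y powr 3 * T powr (1 + x) = T powr (3 * y + 1 + x)"
          using T64 by (simp add: Y_def powr_powr powr_add[symmetric] algebra_simps)
        then have YM: "Y powr 3 * M = Mc * T powr (3 * y + 1 + x)" by (simp add: M_def)
        have "2 * (exp 9 * (6 * Y powr 3 * M * exp (- (L\<^sup>2))))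
            = 12 * exp 9 * (Y powr 3 * M) * exp (- (L\<^sup>2))" by simp
        also have "\<dots> = 12 * exp 9 * Mc * T powr (3 * y + 1 + x) * exp (- (L\<^sup>2))"
          unfolding YM by simp
        also have "\<dots> \<le> 1" using T1(2)[OF T64(2)] by (simp add: L_def)
        finally show ?thesis by simp
      qed
      moreover have "Y powr (\<sigma>\<^sub>0 - Re s) / (Re s - \<sigma>\<^sub>0) * I0 \<le> P / \<delta> * I0"
        unfolding P_def using \<rho> \<alpha> \<delta> X1 I by (intro mult_right_mono frac_le powr_mono) auto
      moreover have "Y powr (b - Re s) / (b - Re s) * I1 \<le> Q * exp y * L * I1"
      proof (rule mult_right_mono[OF _ I(2)])
        have "Y powr (b - Re s) \<le> Y powr ((1 - \<alpha>) + 1 / L)"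
          using \<rho> X1 by (intro powr_mono) (auto simp: b_def)
        also have "\<dots> = Q * exp y" unfolding powr_add YL Q_def ..
        finally have "Y powr (b - Re s) / (b - Re s) \<le> Q * exp y / (1 / L)"
          using \<rho> L PQ by (intro frac_le) (auto simp: b_def)
        then show "Y powr (b - Re s) / (b - Re s) \<le> Q * exp y * L" using L by simp
      qed
      ultimately have "1 \<le> exp 9 * (P / \<delta> * I0 + Q * exp y * L * I1) + 1 / 2"
        by (smt (verit) distrib_left exp_ge_zero mult_left_mono)
      moreover have "exp 9 * (P / \<delta> * I0 + Q * exp y * L * I1) = c1 * P * I0 + c2 * L * Q * I1"
        by (simp add: c1_def c2_def algebra_simps)
      ultimately have "1 / 2 \<le> c1 * P * I0 + c2 * L * Q * I1" by linarith
      then have "(1 / 2)\<^sup>2 \<le> (c1 * P * I0 + c2 * L * Q * I1)\<^sup>2"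
        by (intro power_mono) auto
      also have "\<dots> \<le> 2 * (c1 * P * I0)\<^sup>2 + 2 * (c2 * L * Q * I1)\<^sup>2"
        using sum_squares_bound[of "c1 * P * I0" "c2 * L * Q * I1"] by (simp add: power2_sum)
      finally have "1 \<le> 8 * (c1\<^sup>2 * P\<^sup>2 * I0\<^sup>2) + 8 * (c2\<^sup>2 * L\<^sup>2 * Q\<^sup>2 * I1\<^sup>2)"
        by (simp add: power_mult_distrib power2_eq_square[of "1/2"])
      moreover have "I0\<^sup>2 \<le> (2 * L) * J0 s"
      proof -
        have "I0\<^sup>2 \<le> (Im s + L - (Im s - L)) * J0 s"
          unfolding I0_def J0_def using L by (intro square_integral_le continuous_intros cont0) auto
        then show ?thesis by simp
      qed
      then have "c1\<^sup>2 * P\<^sup>2 * I0\<^sup>2 \<le> c1\<^sup>2 * P\<^sup>2 * ((2 * L) * J0 s)" by (intro mult_left_mono) auto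
      moreover have "I1\<^sup>2 \<le> (2 * L) * J1 s"
      proof -
        have "I1\<^sup>2 \<le> (Im s + L - (Im s - L)) * J1 s"
          unfolding I1_def J1_def using L by (intro square_integral_le continuous_intros cont1) auto
        then show ?thesis by simp
      qed
      then have "c2\<^sup>2 * L\<^sup>2 * Q\<^sup>2 * I1\<^sup>2 \<le> c2\<^sup>2 * L\<^sup>2 * Q\<^sup>2 * ((2 * L) * J1 s)" by (intro mult_left_mono) auto
      ultimately show ?thesis
        by (simp add: k0_def k1_def power2_eq_square power3_eq_cube mult_ac)
    qed
    have ImS: "\<bar>Im s\<bar> \<le> T" if "s \<in> S" for s using S that by auto
    have sep': "4 * L \<le> \<bar>Im s - Im s'\<bar>" if "s \<in> S" "s' \<in> S" "s \<noteq> s'" for s s'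
      using sep that by (simp add: L_def)
    have L': "0 < L" "L \<le> T" using L by auto
    have J1: "(\<Sum>s\<in>S. J1 s) \<le> Ct * L ^ 4"
    proof -
      have "(\<Sum>s\<in>S. J1 s) \<le> integral {-(2*T)..2*T} (\<lambda>t. (norm (f (Complex b t)))\<^sup>2)"
        unfolding J1_def
        by (intro sum_integral_windows_le[OF fin L' ImS sep'] continuous_intros cont1) auto
      also have "\<dots> \<le> Ct * L ^ 4"
        using Ct(2)[OF Te, of X] by (simp add: f_def b_def L_def X_def x_def)
      finally show ?thesis .
    qed
    \<comment> \<open>Here |f|^2 is at most twice the square of |Z| times the mollifier, plus 2. The
      critical-line bound takes Z out of the integral as (2 T)^(2B).\<close>
    have J0: "(\<Sum>s\<in>S. J0 s) \<le> C6 * T powr (1 + 2 * B) * L"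
    proof -
      define c3 where "c3 = 2 * K0\<^sup>2 * (2 * T) powr (2 * B)"
      define m where "m t = (norm (mollifier X (Complex \<sigma>\<^sub>0 t)))\<^sup>2" for t
      have contm: "continuous_on U m" for U
        unfolding m_def
        by (intro continuous_intros vertical_continuous[OF mollifier_holomorphic]) (use sigma0_props in auto)
      have "J0 s \<le> integral {Im s - L..Im s + L} (\<lambda>t. c3 * m t + 2)" if s: "s \<in> S" for s
        unfolding J0_def
      proof (rule integral_le)
        show "(\<lambda>t. (norm (f (Complex \<sigma>\<^sub>0 t)))\<^sup>2) integrable_on {Im s - L..Im s + L}"
          by (intro integrable_continuous_interval continuous_intros cont0)
        show "(\<lambda>t. c3 * m t + 2) integrable_on {Im s - L..Im s + L}"
          by (intro integrable_continuous_interval continuous_intros contm)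
        fix t assume t: "t \<in> {Im s - L..Im s + L}"
        have "L + 2 \<le> \<bar>Im s\<bar>" "\<bar>Im s\<bar> \<le> T" using S s by (auto simp: L_def)
        then have t': "1 \<le> \<bar>t\<bar>" "\<bar>t\<bar> \<le> 2 * T" using t L by auto
        have "norm (Z (Complex \<sigma>\<^sub>0 t)) \<le> K0 * \<bar>t\<bar> powr B" by (rule critical[OF t'(1)])
        also have "\<dots> \<le> K0 * (2 * T) powr B"
          using K0_ge_1 B_pos t' by (intro mult_left_mono powr_mono2) auto
        finally have "(norm (Z (Complex \<sigma>\<^sub>0 t)))\<^sup>2 \<le> (K0 * (2 * T) powr B)\<^sup>2"
          by (intro power_mono) auto
        also have "\<dots> = K0\<^sup>2 * (2 * T) powr (2 * B)"
          by (simp add: power_mult_distrib power2_eq_square powr_add[symmetric])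
        finally have "(norm (Z (Complex \<sigma>\<^sub>0 t)))\<^sup>2 * m t \<le> K0\<^sup>2 * (2 * T) powr (2 * B) * m t"
          by (intro mult_right_mono) (auto simp: m_def)
        moreover have "(norm (f (Complex \<sigma>\<^sub>0 t)))\<^sup>2 \<le> 2 * ((norm (Z (Complex \<sigma>\<^sub>0 t)))\<^sup>2 * m t) + 2"
        proof -
          let ?u = "Z (Complex \<sigma>\<^sub>0 t) * mollifier X (Complex \<sigma>\<^sub>0 t)"
          have "norm (f (Complex \<sigma>\<^sub>0 t)) \<le> norm ?u + 1"
            unfolding f_def using norm_triangle_ineq4[of ?u 1] by simp
          then have "(norm (f (Complex \<sigma>\<^sub>0 t)))\<^sup>2 \<le> (norm ?u + 1)\<^sup>2" by (intro power_mono) auto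
          also have "\<dots> \<le> 2 * (norm ?u)\<^sup>2 + 2"
            using sum_squares_bound[of "norm ?u" 1] by (simp add: power2_sum)
          finally show ?thesis by (simp add: m_def norm_mult power_mult_distrib)
        qed
        ultimately show "(norm (f (Complex \<sigma>\<^sub>0 t)))\<^sup>2 \<le> c3 * m t + 2" by (simp add: c3_def)
      qed
      then have "(\<Sum>s\<in>S. J0 s) \<le> (\<Sum>s\<in>S. integral {Im s - L..Im s + L} (\<lambda>t. c3 * m t + 2))"
        by (rule sum_mono)
      also have "\<dots> \<le> integral {-(2*T)..2*T} (\<lambda>t. c3 * m t + 2)"
        using T64 by (intro sum_integral_windows_le[OF fin L' ImS sep'] continuous_intros contm)
          (auto simp: c3_def m_def)
      also have "\<dots> = c3 * integral {-(2*T)..2*T} m + 8 * T"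
      proof -
        have "m integrable_on {-(2*T)..2*T}" by (intro integrable_continuous_interval contm)
        moreover have "(\<lambda>t. c3 * m t) integrable_on {-(2*T)..2*T}"
          by (intro integrable_continuous_interval continuous_intros contm)
        ultimately show ?thesis using T64 by (subst integral_add) auto
      qed
      also have "\<dots> \<le> c3 * (Cm * T * L) + 8 * T"
        using Cm(2)[OF Te, of X] by (intro add_right_mono mult_left_mono) (auto simp: m_def[abs_def] c3_def L_def X_def x_def)
      also have "\<dots> \<le> C6 * T powr (1 + 2 * B) * L"
      proof -
        have e: "T powr (1 + 2 * B) = T * T powr (2 * B)" using T64 by (simp add: powr_add)
        have "c3 * (Cm * T * L) = 2 * K0\<^sup>2 * 2 powr (2 * B) * Cm * T powr (1 + 2 * B) * L"
          unfolding e c3_def using T64 by (simp add: powr_mult)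
        moreover have "T * 1 \<le> T powr (1 + 2 * B) * L"
          unfolding e using T64 L B_pos mult_left_mono[of 1 "T powr (2 * B)" T]
          by (intro mult_mono) (auto simp: ge_one_powr_ge_zero)
        moreover have "C6 * T powr (1 + 2 * B) * L = 2 * K0\<^sup>2 * 2 powr (2 * B) * Cm * T powr (1 + 2 * B) * L
            + 8 * (T powr (1 + 2 * B) * L)" by (simp add: C6_def distrib_right)
        ultimately show ?thesis by linarith
      qed
      finally show ?thesis .
    qed
    have "real (card S) = (\<Sum>s\<in>S. 1)" by simp
    also have "\<dots> \<le> (\<Sum>s\<in>S. k0 * J0 s + k1 * J1 s)" by (intro sum_mono detect)
    also have "\<dots> = k0 * (\<Sum>s\<in>S. J0 s) + k1 * (\<Sum>s\<in>S. J1 s)"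
      by (simp add: sum.distrib sum_distrib_left)
    also have "\<dots> \<le> k0 * (C6 * T powr (1 + 2 * B) * L) + k1 * (Ct * L ^ 4)"
      using k J0 J1 by (intro add_mono mult_left_mono)
    also have "k0 * (C6 * T powr (1 + 2 * B) * L) = 16 * c1\<^sup>2 * C6 * L ^ 2 * Q\<^sup>2"
      unfolding k0_def YQ[symmetric] by (simp add: power2_eq_square mult_ac)
    also have "k1 * (Ct * L ^ 4) = 16 * c2\<^sup>2 * Ct * L ^ 7 * Q\<^sup>2"
      unfolding k1_def by (simp add: mult_ac power_add[symmetric])
    \<comment> \<open>The critical line costs L^2 and the right line L^7; the larger power covers
      both.\<close>
    also have "16 * c1\<^sup>2 * C6 * L ^ 2 * Q\<^sup>2 + 16 * c2\<^sup>2 * Ct * L ^ 7 * Q\<^sup>2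
        \<le> 16 * c1\<^sup>2 * C6 * L ^ 7 * Q\<^sup>2 + 16 * c2\<^sup>2 * Ct * L ^ 7 * Q\<^sup>2"
      using c L by (intro add_right_mono mult_right_mono mult_left_mono power_increasing) auto
    also have "\<dots> = (16 * c1\<^sup>2 * C6 + 16 * c2\<^sup>2 * Ct) * L ^ 7 * Q\<^sup>2" by (simp add: algebra_simps)
    also have "Q\<^sup>2 = T powr (2 * (1 + 2 * B) * (1 - \<alpha>) / (1 - \<theta>))"
    proof -
      have "Q\<^sup>2 = T powr (y * (1 - \<alpha>) + y * (1 - \<alpha>))"
        unfolding Q_def Y_def power2_eq_square powr_powr powr_add ..
      also have "y * (1 - \<alpha>) + y * (1 - \<alpha>) = 2 * (1 + 2 * B) * (1 - \<alpha>) / (1 - \<theta>)"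
        by (simp add: y_def)
      finally show ?thesis .
    qed
    finally show "real (card S) \<le> (16 * c1\<^sup>2 * C6 + 16 * c2\<^sup>2 * Ct) * ln T ^ 7
        * T powr (2 * (1 + 2 * B) * (1 - \<alpha>) / (1 - \<theta>))"
      by (simp add: L_def)
  qed simp
qed

text \<open>Zeros of height below ln T + 2 are kept out of the detection because their windows come
  too close to the pole. They number at most a constant times (ln T)^2, which is the 1 in the bound;
  the others are thinned out to spacing 4 ln T.\<close>

lemma zero_count_split:
  obtains C where "0 < C"
    "\<And>T \<alpha>. 64 \<le> T \<Longrightarrow> \<sigma>\<^sub>0 \<le> \<alpha> \<Longrightarrow> \<exists>S. finite S \<and>
      S \<subseteq> {\<rho>. Z \<rho> = 0 \<and> \<alpha> \<le> Re \<rho> \<and> Re \<rho> \<le> 1 \<and> ln T + 2 \<le> \<bar>Im \<rho>\<bar> \<and> \<bar>Im \<rho>\<bar> \<le> T} \<and>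
      (\<forall>s\<in>S. \<forall>s'\<in>S. s \<noteq> s' \<longrightarrow> 4 * ln T \<le> \<bar>Im s - Im s'\<bar>) \<and>
      real (\<Sum>\<rho>\<in>zeta_zeros p \<theta> \<alpha> T. mult \<rho>) \<le> C * (ln T)\<^sup>2 * (1 + real (card S))"
proof -
  obtain Cw where Cw: "0 < Cw"
    "\<And>t W Zs. finite Zs \<Longrightarrow> 1 \<le> W \<Longrightarrow>
       Zs \<subseteq> {\<rho>. \<rho> \<noteq> 1 \<and> Z \<rho> = 0 \<and> \<sigma>\<^sub>0 \<le> Re \<rho> \<and> \<bar>Im \<rho> - t\<bar> \<le> W} \<Longrightarrow>
       real (\<Sum>\<rho>\<in>Zs. mult \<rho>) \<le> Cw * W * ln (\<bar>t\<bar> + 2 * W + 3)"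
    by (rule zero_count_window) (rule that)
  obtain Cs where Cs: "0 < Cs"
    "\<And>T h Zs. finite Zs \<Longrightarrow> 1 \<le> h \<Longrightarrow> h \<le> T \<Longrightarrow> 2 \<le> T \<Longrightarrow>
       Zs \<subseteq> {\<rho>. \<rho> \<noteq> 1 \<and> Z \<rho> = 0 \<and> \<sigma>\<^sub>0 \<le> Re \<rho> \<and> \<bar>Im \<rho>\<bar> \<le> T} \<Longrightarrow>
       \<exists>S\<subseteq>Zs. (\<forall>s\<in>S. \<forall>s'\<in>S. s \<noteq> s' \<longrightarrow> h \<le> \<bar>Im s - Im s'\<bar>) \<and>
         real (\<Sum>\<rho>\<in>Zs. mult \<rho>) \<le> Cs * h * ln T * real (card S)"
    by (rule zeros_separated) (rule that)
  show ?thesis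
  proof (rule that[of "12 * Cw + 4 * Cs"])
    show "0 < 12 * Cw + 4 * Cs" using Cw Cs by (simp add: add_pos_pos)
    fix T \<alpha> :: real assume T64: "64 \<le> T" and \<alpha>: "\<sigma>\<^sub>0 \<le> \<alpha>"
    have fin: "finite (zeta_zeros p \<theta> \<alpha> T)"
      using \<alpha> sigma0_props by (intro finite_zeta_zeros) linarith
    have sub: "zeta_zeros p \<theta> \<alpha> T \<subseteq> {\<rho>. \<rho> \<noteq> 1 \<and> Z \<rho> = 0 \<and> \<alpha> \<le> Re \<rho> \<and> Re \<rho> \<le> 1 \<and> \<bar>Im \<rho>\<bar> \<le> T}"
      using \<alpha> sigma0_props by (intro zeta_zeros_subset) linarith
    define L where "L = ln T"
    have L: "1 \<le> L" "4 * L \<le> T" using ln_square_large[OF T64] by (auto simp: L_def)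
    define lo hi where "lo = {\<rho> \<in> zeta_zeros p \<theta> \<alpha> T. \<bar>Im \<rho>\<bar> < L + 2}"
      and "hi = {\<rho> \<in> zeta_zeros p \<theta> \<alpha> T. L + 2 \<le> \<bar>Im \<rho>\<bar>}"
    have part: "zeta_zeros p \<theta> \<alpha> T = lo \<union> hi" "lo \<inter> hi = {}" "finite lo" "finite hi"
      using fin by (auto simp: lo_def hi_def)
    have "real (\<Sum>\<rho>\<in>lo. mult \<rho>) \<le> Cw * (L + 2) * ln (\<bar>0\<bar> + 2 * (L + 2) + 3)"
      using sub \<alpha> L by (intro Cw(2) part) (auto simp: lo_def)
    also have "ln (\<bar>0\<bar> + 2 * (L + 2) + 3) \<le> ln (T ^ 4)"
    proof (rule ln_mono)
      have "T \<le> T ^ 4" using T64 power_increasing[of 1 4 T] by simp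
      then show "\<bar>0\<bar> + 2 * (L + 2) + 3 \<le> T ^ 4" using L T64 by simp
    qed (use L in auto)
    also have "ln (T ^ 4) = 4 * L" using T64 by (simp add: ln_realpow L_def)
    finally have "real (\<Sum>\<rho>\<in>lo. mult \<rho>) \<le> Cw * (L + 2) * (4 * L)" using Cw(1) L by simp
    also have "\<dots> \<le> Cw * (3 * L) * (4 * L)" using Cw(1) L by (intro mult_right_mono mult_left_mono) auto
    also have "\<dots> = 12 * Cw * L\<^sup>2" by (simp add: power2_eq_square)
    finally have lo: "real (\<Sum>\<rho>\<in>lo. mult \<rho>) \<le> 12 * Cw * L\<^sup>2" .
    have "\<exists>S\<subseteq>hi. (\<forall>s\<in>S. \<forall>s'\<in>S. s \<noteq> s' \<longrightarrow> 4 * L \<le> \<bar>Im s - Im s'\<bar>) \<and>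
       real (\<Sum>\<rho>\<in>hi. mult \<rho>) \<le> Cs * (4 * L) * ln T * real (card S)"
      using sub \<alpha> L T64 by (intro Cs(2) part) (auto simp: hi_def)
    then obtain S where S: "S \<subseteq> hi" "\<forall>s\<in>S. \<forall>s'\<in>S. s \<noteq> s' \<longrightarrow> 4 * L \<le> \<bar>Im s - Im s'\<bar>"
      "real (\<Sum>\<rho>\<in>hi. mult \<rho>) \<le> Cs * (4 * L) * L * real (card S)" unfolding L_def by blast
    have "real (\<Sum>\<rho>\<in>zeta_zeros p \<theta> \<alpha> T. mult \<rho>) = real (\<Sum>\<rho>\<in>lo. mult \<rho>) + real (\<Sum>\<rho>\<in>hi. mult \<rho>)"
      unfolding part(1) using part by (subst sum.union_disjoint) auto
    also have "\<dots> \<le> 12 * Cw * L\<^sup>2 * 1 + 4 * Cs * L\<^sup>2 * real (card S)"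
      using lo S(3) by (simp add: power2_eq_square mult_ac)
    also have "\<dots> \<le> 12 * Cw * L\<^sup>2 * (1 + real (card S)) + 4 * Cs * L\<^sup>2 * (1 + real (card S))"
      using Cw(1) Cs(1) by (intro add_mono mult_left_mono) auto
    also have "\<dots> = (12 * Cw + 4 * Cs) * L\<^sup>2 * (1 + real (card S))" by (simp add: algebra_simps)
    finally have N: "real (\<Sum>\<rho>\<in>zeta_zeros p \<theta> \<alpha> T. mult \<rho>) \<le> (12 * Cw + 4 * Cs) * L\<^sup>2 * (1 + real (card S))" .
    have "finite S" "S \<subseteq> {\<rho>. Z \<rho> = 0 \<and> \<alpha> \<le> Re \<rho> \<and> Re \<rho> \<le> 1 \<and> L + 2 \<le> \<bar>Im \<rho>\<bar> \<and> \<bar>Im \<rho>\<bar> \<le> T}"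
      using S(1) part(4) sub by (auto simp: hi_def intro: finite_subset)
    then show "\<exists>S. finite S \<and>
      S \<subseteq> {\<rho>. Z \<rho> = 0 \<and> \<alpha> \<le> Re \<rho> \<and> Re \<rho> \<le> 1 \<and> ln T + 2 \<le> \<bar>Im \<rho>\<bar> \<and> \<bar>Im \<rho>\<bar> \<le> T} \<and>
      (\<forall>s\<in>S. \<forall>s'\<in>S. s \<noteq> s' \<longrightarrow> 4 * ln T \<le> \<bar>Im s - Im s'\<bar>) \<and>
      real (\<Sum>\<rho>\<in>zeta_zeros p \<theta> \<alpha> T. mult \<rho>) \<le> (12 * Cw + 4 * Cs) * (ln T)\<^sup>2 * (1 + real (card S))"
      using S(2) N unfolding L_def by blast
  qed
qed

text \<open>Close to the critical line the exponent is at least 1 and the trivial count T ln T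
  suffices, so detection is used only at a fixed distance from that line, where its kernel is
  bounded. To the right of 1 there are no zeros, and small T goes into the constant.\<close>

lemma zero_density_1:
  obtains C where "0 < C"
    "\<And>T \<alpha>. 2 \<le> T \<Longrightarrow> \<sigma>\<^sub>0 \<le> \<alpha> \<Longrightarrow> real (\<Sum>\<rho>\<in>zeta_zeros p \<theta> \<alpha> T. mult \<rho>)
        \<le> C * T powr (2 * (1 + 2 * B) * (1 - \<alpha>) / (1 - \<theta>)) * ln T ^ 9"
proof -
  define E where "E \<alpha> = 2 * (1 + 2 * B) * (1 - \<alpha>) / (1 - \<theta>)" for \<alpha>
  \<comment> \<open>The exponent \<open>E\<close> equals 1 exactly at
    \<open>\<sigma>\<^sub>0 + \<delta>\<close>.\<close>
  define \<delta> where "\<delta> = (1 - \<theta>) * B / (1 + 2 * B)"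
  have \<delta>: "0 < \<delta>" using theta_less_1 B_pos by (simp add: \<delta>_def)
  have E1: "1 \<le> E \<alpha>" if "\<alpha> < \<sigma>\<^sub>0 + \<delta>" for \<alpha>
  proof -
    have "1 - \<sigma>\<^sub>0 - \<delta> = (1 - \<theta>) / (2 * (1 + 2 * B))"
      using B_pos by (simp add: \<delta>_def field_simps)
    then have "(1 - \<theta>) / (2 * (1 + 2 * B)) \<le> 1 - \<alpha>" using that by linarith
    then have "1 - \<theta> \<le> 2 * (1 + 2 * B) * (1 - \<alpha>)"
      using B_pos by (simp add: divide_le_eq mult_ac)
    then show ?thesis using theta_less_1 by (simp add: E_def)
  qed
  have E0: "0 \<le> E \<alpha>" if "\<alpha> \<le> 1" for \<alpha>
    using that B_pos theta_less_1 by (simp add: E_def)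
  obtain Cw where Cw: "0 < Cw"
    "\<And>t W Zs. finite Zs \<Longrightarrow> 1 \<le> W \<Longrightarrow>
       Zs \<subseteq> {\<rho>. \<rho> \<noteq> 1 \<and> Z \<rho> = 0 \<and> \<sigma>\<^sub>0 \<le> Re \<rho> \<and> \<bar>Im \<rho> - t\<bar> \<le> W} \<Longrightarrow>
       real (\<Sum>\<rho>\<in>Zs. mult \<rho>) \<le> Cw * W * ln (\<bar>t\<bar> + 2 * W + 3)"
    by (rule zero_count_window) (rule that)
  obtain C2 where C2: "0 < C2"
    "\<And>T \<alpha>. 64 \<le> T \<Longrightarrow> \<sigma>\<^sub>0 \<le> \<alpha> \<Longrightarrow> \<exists>S. finite S \<and>
      S \<subseteq> {\<rho>. Z \<rho> = 0 \<and> \<alpha> \<le> Re \<rho> \<and> Re \<rho> \<le> 1 \<and> ln T + 2 \<le> \<bar>Im \<rho>\<bar> \<and> \<bar>Im \<rho>\<bar> \<le> T} \<and>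
      (\<forall>s\<in>S. \<forall>s'\<in>S. s \<noteq> s' \<longrightarrow> 4 * ln T \<le> \<bar>Im s - Im s'\<bar>) \<and>
      real (\<Sum>\<rho>\<in>zeta_zeros p \<theta> \<alpha> T. mult \<rho>) \<le> C2 * (ln T)\<^sup>2 * (1 + real (card S))"
    by (rule zero_count_split) (rule that)
  obtain Ch T0 where Ch: "0 < Ch" "64 \<le> T0"
    "\<And>T \<alpha> S. T0 \<le> T \<Longrightarrow> \<sigma>\<^sub>0 + \<delta> \<le> \<alpha> \<Longrightarrow> finite S \<Longrightarrow>
      S \<subseteq> {\<rho>. Z \<rho> = 0 \<and> \<alpha> \<le> Re \<rho> \<and> Re \<rho> \<le> 1 \<and> ln T + 2 \<le> \<bar>Im \<rho>\<bar> \<and> \<bar>Im \<rho>\<bar> \<le> T} \<Longrightarrow>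
      \<forall>s\<in>S. \<forall>s'\<in>S. s \<noteq> s' \<longrightarrow> 4 * ln T \<le> \<bar>Im s - Im s'\<bar> \<Longrightarrow>
      real (card S) \<le> Ch * ln T ^ 7 * T powr (2 * (1 + 2 * B) * (1 - \<alpha>) / (1 - \<theta>))"
    by (rule separated_zeros_bound[OF \<delta>]) (rule that)
  define N where "N \<alpha> T = real (\<Sum>\<rho>\<in>zeta_zeros p \<theta> \<alpha> T. mult \<rho>)" for \<alpha> T
  have fin: "finite (zeta_zeros p \<theta> \<alpha> T)" if "\<sigma>\<^sub>0 \<le> \<alpha>" for \<alpha> T
    using that sigma0_props by (intro finite_zeta_zeros) linarith
  \<comment> \<open>For T below the threshold all zeros are among those counted at
    \<open>\<sigma>\<^sub>0\<close> and \<open>T0\<close>. The exponent is nonnegative for \<alpha>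
    \<le> 1, so the right-hand side is at least its constant times ln 2 to the power 9.\<close>
  define C1 where "C1 = N \<sigma>\<^sub>0 T0 / ln 2 ^ 9"
  define C where "C = C1 + 4 * Cw + C2 * (1 + Ch)"
  have C1: "0 \<le> C1" by (simp add: C1_def N_def sum_nonneg)
  have C2h: "0 < C2 * (1 + Ch)" using C2 Ch by simp
  have C: "0 < C" "C1 \<le> C" "4 * Cw \<le> C" "C2 * (1 + Ch) \<le> C"
    using C1 Cw C2h by (auto simp: C_def intro!: add_nonneg_pos add_nonneg_nonneg)
  show ?thesis
  proof (rule that[OF C(1)])
    fix T \<alpha> :: real assume T: "2 \<le> T" and \<alpha>: "\<sigma>\<^sub>0 \<le> \<alpha>"
    have ln2: "0 < ln (2 :: real) ^ 9" "ln 2 ^ 9 \<le> ln T ^ 9" using T by (auto intro!: power_mono ln_mono)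
    have sub: "zeta_zeros p \<theta> \<alpha> T \<subseteq> {\<rho>. \<rho> \<noteq> 1 \<and> Z \<rho> = 0 \<and> \<alpha> \<le> Re \<rho> \<and> Re \<rho> \<le> 1 \<and> \<bar>Im \<rho>\<bar> \<le> T}"
      using \<alpha> sigma0_props by (intro zeta_zeros_subset) linarith
    consider "1 < \<alpha>" | "\<alpha> \<le> 1" "T < T0" | "\<alpha> \<le> 1" "T0 \<le> T" "\<alpha> < \<sigma>\<^sub>0 + \<delta>"
      | "\<alpha> \<le> 1" "T0 \<le> T" "\<sigma>\<^sub>0 + \<delta> \<le> \<alpha>" by linarith
    then have "N \<alpha> T \<le> C * T powr E \<alpha> * ln T ^ 9"
    proof cases
      case 1
      then have "zeta_zeros p \<theta> \<alpha> T = {}" using sub by force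
      then show ?thesis using C(1) T by (simp add: N_def)
    next
      case 2
      have "zeta_zeros p \<theta> \<alpha> T \<subseteq> zeta_zeros p \<theta> \<sigma>\<^sub>0 T0"
        using \<alpha> 2 unfolding zeta_zeros_def by auto
      then have "N \<alpha> T \<le> N \<sigma>\<^sub>0 T0"
        unfolding N_def by (intro of_nat_mono sum_mono2 fin) auto
      also have "\<dots> = C1 * 1 * ln 2 ^ 9" by (simp add: C1_def)
      also have "\<dots> \<le> C * T powr E \<alpha> * ln T ^ 9"
        using C C1 ln2 T E0[OF 2(1)] by (intro mult_mono) (auto simp: ge_one_powr_ge_zero)
      finally show ?thesis .
    next
      case 3
      have T64: "64 \<le> T" using 3 Ch(2) by simp
      note L = ln_square_large[OF T64]
      have "N \<alpha> T \<le> Cw * T * ln (\<bar>0\<bar> + 2 * T + 3)"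
        unfolding N_def using sub \<alpha> T by (intro Cw(2) fin) auto
      also have "ln (\<bar>0\<bar> + 2 * T + 3) \<le> ln (T ^ 4)"
      proof (rule ln_mono)
        have "64 * T \<le> T * T" using T64 by (intro mult_right_mono) auto
        also have "\<dots> \<le> T ^ 4" using T64 power_increasing[of 2 4 T] by (simp add: power2_eq_square)
        finally show "\<bar>0\<bar> + 2 * T + 3 \<le> T ^ 4" using T64 by simp
      qed (use T64 in auto)
      also have "ln (T ^ 4) = 4 * ln T" using T64 by (simp add: ln_realpow)
      finally have "N \<alpha> T \<le> 4 * Cw * T * ln T" using Cw(1) T64 by simp
      also have "\<dots> \<le> C * T powr E \<alpha> * ln T ^ 9"
      proof (intro mult_mono C)
        show "T \<le> T powr E \<alpha>" using powr_mono[OF E1[OF 3(3)], of T] T64 by simp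
        show "ln T \<le> ln T ^ 9" using L power_increasing[of 1 9 "ln T"] by simp
      qed (use Cw C T64 L in auto)
      finally show ?thesis .
    next
      case 4
      have T64: "64 \<le> T" using 4 Ch(2) by simp
      define L where "L = ln T"
      have L: "1 \<le> L" using ln_square_large[OF T64] by (simp add: L_def)
      obtain S where S: "finite S"
        "S \<subseteq> {\<rho>. Z \<rho> = 0 \<and> \<alpha> \<le> Re \<rho> \<and> Re \<rho> \<le> 1 \<and> ln T + 2 \<le> \<bar>Im \<rho>\<bar> \<and> \<bar>Im \<rho>\<bar> \<le> T}"
        "\<forall>s\<in>S. \<forall>s'\<in>S. s \<noteq> s' \<longrightarrow> 4 * ln T \<le> \<bar>Im s - Im s'\<bar>"
        "real (\<Sum>\<rho>\<in>zeta_zeros p \<theta> \<alpha> T. mult \<rho>) \<le> C2 * (ln T)\<^sup>2 * (1 + real (card S))"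
        using C2(2)[OF T64 \<alpha>] by (elim exE conjE)
      have S3: "real (card S) \<le> Ch * (L ^ 7 * T powr E \<alpha>)"
        using Ch(3)[OF 4(2,3) S(1-3)] by (simp add: E_def L_def mult.assoc)
      have "1 * 1 \<le> L ^ 7 * T powr E \<alpha>"
        using L T E0[OF 4(1)] by (intro mult_mono) (auto simp: ge_one_powr_ge_zero)
      then have "1 + real (card S) \<le> (1 + Ch) * (L ^ 7 * T powr E \<alpha>)"
        using S3 by (simp add: distrib_right)
      then have "C2 * L\<^sup>2 * (1 + real (card S)) \<le> C2 * L\<^sup>2 * ((1 + Ch) * (L ^ 7 * T powr E \<alpha>))"
        using C2(1) by (intro mult_left_mono) auto
      then have "N \<alpha> T \<le> C2 * L\<^sup>2 * ((1 + Ch) * (L ^ 7 * T powr E \<alpha>))"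
        using S(4) unfolding N_def L_def by linarith
      also have "\<dots> = C2 * (1 + Ch) * T powr E \<alpha> * (L\<^sup>2 * L ^ 7)" by (simp only: mult_ac)
      also have "L\<^sup>2 * L ^ 7 = L ^ 9" by (simp flip: power_add)
      also have "C2 * (1 + Ch) * T powr E \<alpha> * L ^ 9 \<le> C * T powr E \<alpha> * L ^ 9"
        using C L by (intro mult_right_mono) auto
      finally show ?thesis by (simp add: L_def)
    qed
    then show "real (\<Sum>\<rho>\<in>zeta_zeros p \<theta> \<alpha> T. mult \<rho>)
        \<le> C * T powr (2 * (1 + 2 * B) * (1 - \<alpha>) / (1 - \<theta>)) * ln T ^ 9"
      by (simp add: N_def E_def)
  qed
qed

end

subsection \<open>Large values\<close>

text \<open>After completing the square, the line Re s = \<kappa> and the shift z both drop out of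
  the value. A Dirichlet polynomial integrated against this kernel therefore acquires log-normal
  weights.\<close>

lemma gaussian_mellin:
  "has_bochner_integral lborel
     (\<lambda>y. exp ((Complex \<kappa> y - z)\<^sup>2 + (Complex \<kappa> y - z) * complex_of_real a))
     (complex_of_real (sqrt pi * exp (- a\<^sup>2 / 4)))"
proof -
  \<comment> \<open>With v = y - t the exponent is r^2 + r a - v^2 + i (2 r + a) v, so the integral
    is the Fourier transform of a Gaussian at 2 r + a.\<close>
  define r t where "r = \<kappa> - Re z" and "t = Im z"
  define h where "h v = complex_of_real (exp (- v\<^sup>2)) * exp (\<i> * complex_of_real ((2 * r + a) * v))" for v
  have e: "- v\<^sup>2 / (2 * (1 / sqrt 2)\<^sup>2) = - v\<^sup>2" for v :: real by (simp add: power_divide)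
  have "0 < 1 / sqrt 2" by simp
  from gaussian_fourier[OF this, of "2 * r + a"] have "has_bochner_integral lborel h
      (complex_of_real (1 / sqrt 2 * sqrt (2 * pi) * exp (- (1 / sqrt 2 * (2 * r + a))\<^sup>2 / 2)))"
    by (simp only: h_def[abs_def] e)
  also have "1 / sqrt 2 * sqrt (2 * pi) * exp (- (1 / sqrt 2 * (2 * r + a))\<^sup>2 / 2) = sqrt pi * exp (- (2 * r + a)\<^sup>2 / 4)"
    by (simp add: real_sqrt_mult power_mult_distrib power_divide)
  finally have "has_bochner_integral lborel (\<lambda>y. h (- t + 1 * y))
      (complex_of_real (sqrt pi * exp (- (2 * r + a)\<^sup>2 / 4)) /\<^sub>R \<bar>1\<bar>)"
    by (subst lborel_has_bochner_integral_real_affine_iff[of 1, symmetric]) auto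
  then have "has_bochner_integral lborel (\<lambda>y. complex_of_real (exp (r\<^sup>2 + r * a)) * h (- t + 1 * y))
      (complex_of_real (exp (r\<^sup>2 + r * a)) * complex_of_real (sqrt pi * exp (- (2 * r + a)\<^sup>2 / 4)))"
    by (intro has_bochner_integral_mult_right) simp
  also have "complex_of_real (exp (r\<^sup>2 + r * a)) * complex_of_real (sqrt pi * exp (- (2 * r + a)\<^sup>2 / 4))
      = complex_of_real (sqrt pi * exp (- a\<^sup>2 / 4))"
  proof -
    have "r\<^sup>2 + r * a + - (2 * r + a)\<^sup>2 / 4 = - a\<^sup>2 / 4" by (simp add: power2_eq_square field_simps)
    then have "exp (r\<^sup>2 + r * a) * exp (- (2 * r + a)\<^sup>2 / 4) = exp (- a\<^sup>2 / 4)"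
      by (simp only: exp_add[symmetric])
    then show ?thesis by (metis mult.left_commute of_real_mult)
  qed
  also have "(\<lambda>y. complex_of_real (exp (r\<^sup>2 + r * a)) * h (- t + 1 * y)) =
      (\<lambda>y. exp ((Complex \<kappa> y - z)\<^sup>2 + (Complex \<kappa> y - z) * complex_of_real a))"
  proof
    fix y
    have "Complex \<kappa> y - z = complex_of_real r + \<i> * complex_of_real (- t + 1 * y)"
      by (simp add: r_def t_def complex_eq_iff)
    then have "(Complex \<kappa> y - z)\<^sup>2 + (Complex \<kappa> y - z) * complex_of_real a
        = complex_of_real (r\<^sup>2 + r * a) + (complex_of_real (- (- t + 1 * y)\<^sup>2)
          + \<i> * complex_of_real ((2 * r + a) * (- t + 1 * y)))"
      by (simp add: complex_eq_iff power2_eq_square algebra_simps)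
    then show "complex_of_real (exp (r\<^sup>2 + r * a)) * h (- t + 1 * y) =
        exp ((Complex \<kappa> y - z)\<^sup>2 + (Complex \<kappa> y - z) * complex_of_real a)"
      unfolding h_def by (simp only: exp_add exp_of_real)
  qed
  finally show ?thesis .
qed

lemma gaussian_shift_integral:
  "has_bochner_integral lborel (\<lambda>y. exp (- (y - t)\<^sup>2 / 2)) (sqrt (2 * pi))"
proof -
  have "has_bochner_integral lborel (\<lambda>y. Re (complex_of_real (exp (- y\<^sup>2 / 2)))) (Re (complex_of_real (sqrt (2 * pi))))"
    using gaussian_fourier[of 1 0] by (intro has_bochner_integral_bounded_linear[OF bounded_linear_Re]) simp
  then have "has_bochner_integral lborel (\<lambda>y. exp (- (- t + 1 * y)\<^sup>2 / 2)) (sqrt (2 * pi) /\<^sub>R \<bar>1\<bar>)"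
    by (subst lborel_has_bochner_integral_real_affine_iff[of 1, symmetric]) auto
  then show ?thesis by simp
qed

context beurling_system
begin

text \<open>A log-normal bump at U, bounded below on the block from U to e U. Up to the factor sqrt
  pi it is the value in \<open>gaussian_mellin\<close> for a = ln U - ln (g M).\<close>

definition weight :: "real \<Rightarrow> nat multiset \<Rightarrow> real" where
  "weight U M = exp (- (ln U - ln (g M))\<^sup>2 / 4)"

definition kernel_sum :: "nat multiset set \<Rightarrow> real \<Rightarrow> complex \<Rightarrow> complex" where
  "kernel_sum F U z = (\<Sum>M\<in>F. complex_of_real (weight U M) * dterm M z)"

lemma weight_pos [simp]: "0 < weight U M" "0 \<le> weight U M"
  by (simp_all add: weight_def)

text \<open>The weights are traded for an integral over Re s = 3. There the finite sum can be
  exchanged for zeta itself at the cost of an absolutely convergent tail.\<close>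

lemma kernel_sum_integral:
  assumes "finite F"
  shows "has_bochner_integral lborel
     (\<lambda>y. exp ((Complex 3 y - z)\<^sup>2 + (Complex 3 y - z) * complex_of_real (ln U)) * (\<Sum>M\<in>F. dterm M (Complex 3 y)))
     (complex_of_real (sqrt pi) * kernel_sum F U z)"
proof -
  have "has_bochner_integral lborel
     (\<lambda>y. exp ((Complex 3 y - z)\<^sup>2 + (Complex 3 y - z) * complex_of_real (ln U)) * dterm M (Complex 3 y))
     (complex_of_real (sqrt pi) * (complex_of_real (weight U M) * dterm M z))" for M
  proof -
    have "has_bochner_integral lborel
        (\<lambda>y. exp ((Complex 3 y - z)\<^sup>2 + (Complex 3 y - z) * complex_of_real (ln U - ln (g M))) * dterm M z)
        (complex_of_real (sqrt pi * exp (- (ln U - ln (g M))\<^sup>2 / 4)) * dterm M z)"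
      by (intro has_bochner_integral_mult_left gaussian_mellin)
    also have "complex_of_real (sqrt pi * exp (- (ln U - ln (g M))\<^sup>2 / 4)) * dterm M z
        = complex_of_real (sqrt pi) * (complex_of_real (weight U M) * dterm M z)"
      by (simp add: weight_def)
    also have "(\<lambda>y. exp ((Complex 3 y - z)\<^sup>2 + (Complex 3 y - z) * complex_of_real (ln U - ln (g M))) * dterm M z)
        = (\<lambda>y. exp ((Complex 3 y - z)\<^sup>2 + (Complex 3 y - z) * complex_of_real (ln U)) * dterm M (Complex 3 y))"
      by (simp add: dterm_exp fun_eq_iff mult_exp_exp algebra_simps)
    finally show ?thesis .
  qed
  then show ?thesis
    unfolding kernel_sum_def sum_distrib_left
    by (intro has_bochner_integral_sum)
qed

text \<open>Rankin's trick: the square of (ln U - ln (g M)) / 2 + c is nonnegative, which bounds the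
  weight by exp (c^2) times (U / g M)^c, and c \<le> 2 gives \<open>exp 4\<close>. It serves on the
  diagonal, with c slightly above 1.\<close>

lemma kernel_sum_trivial:
  assumes F: "finite F" and z: "0 \<le> Re z" and U: "1 \<le> U" and c: "1 < c" "c \<le> 2"
  shows "norm (kernel_sum F U z) \<le> exp 4 * U powr c * zeta\<^sub>r c"
proof -
  have "norm (kernel_sum F U z) \<le> (\<Sum>M\<in>F. exp 4 * U powr c * g M powr - c)"
    unfolding kernel_sum_def
  proof (rule sum_norm_le)
    fix M
    have "0 \<le> ((ln U - ln (g M)) / 2 + c)\<^sup>2" by simp
    then have "- (ln U - ln (g M))\<^sup>2 / 4 \<le> c\<^sup>2 + c * (ln U - ln (g M))"
      by (simp add: power2_eq_square field_simps)
    also have "c\<^sup>2 \<le> 2\<^sup>2" using c by (intro power_mono) auto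
    finally have "weight U M \<le> exp (4 + c * (ln U - ln (g M)))" by (simp add: weight_def)
    also have "\<dots> = exp 4 * U powr c * g M powr - c"
      using U by (simp add: powr_def exp_add exp_diff exp_minus field_simps)
    finally have w: "weight U M \<le> exp 4 * U powr c * g M powr - c" .
    have "g M powr - Re z \<le> 1"
      using g_ge_1[of M] z by (simp add: powr_minus inverse_le_1_iff ge_one_powr_ge_zero)
    then have "weight U M * g M powr - Re z \<le> weight U M" by (simp add: mult_left_le)
    moreover have "norm (complex_of_real (weight U M) * dterm M z) = weight U M * g M powr - Re z"
      by (simp add: norm_mult norm_dterm)
    ultimately show "norm (complex_of_real (weight U M) * dterm M z) \<le> exp 4 * U powr c * g M powr - c"
      using w by linarith
  qed
  also have "\<dots> = exp 4 * U powr c * (\<Sum>M\<in>F. g M powr - c)" by (simp add: sum_distrib_left)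
  also have "\<dots> \<le> exp 4 * U powr c * zeta\<^sub>r c"
    unfolding zeta\<^sub>r_def using F by (intro mult_left_mono finite_sum_le_infsum[OF summable_g[OF c(1)]]) auto
  finally show ?thesis .
qed

end

context beurling_subconvex
begin

text \<open>On Re s = 3 the finite sum is replaced by Z up to the assumed tail, the integral is cut
  to the window of half-height ln T about Im z, and the line is moved to the critical one, where Z
  is at most a constant times T^B. Since |Im z| is at least 2 ln T, the pole stays outside and no
  residue appears.\<close>

lemma kernel_sum_off_diagonal:
  assumes \<kappa>: "0 \<le> \<kappa>"
  obtains C T0 where "0 < C" "64 \<le> T0"
    "\<And>T U F z. T0 \<le> T \<Longrightarrow> 1 \<le> U \<Longrightarrow> U \<le> T powr \<kappa> \<Longrightarrow> finite F \<Longrightarrow>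
      infsum (\<lambda>M. g M powr - 3) (- F) \<le> 1 / (ln T * U powr 3) \<Longrightarrow>
      0 \<le> Re z \<Longrightarrow> Re z \<le> 1 \<Longrightarrow> 2 * ln T \<le> \<bar>Im z\<bar> \<Longrightarrow> \<bar>Im z\<bar> \<le> 4 * T \<Longrightarrow>
      norm (kernel_sum F U z) \<le> C * ln T * U powr \<sigma>\<^sub>0 * T powr B"
proof -
  obtain K1 where K1: "0 < K1"
    "\<And>s. \<sigma>\<^sub>0 \<le> Re s \<Longrightarrow> Re s \<le> 4 \<Longrightarrow> 1 \<le> \<bar>Im s\<bar> \<Longrightarrow> norm (Z s) \<le> K1 * \<bar>Im s\<bar>"
    by (rule Z_linear_growth[of \<sigma>\<^sub>0 4]) (use sigma0_props in auto)
  \<comment> \<open>The factor 30 is 2 * 3 * 5: two horizontal sides, of length at most 3, at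
    heights up to 5 T.\<close>
  define c1 where "c1 = 30 * exp 9 * K1"
  \<comment> \<open>Outside the window half of the Gaussian exponent is kept for integrability, so
    only exp (- L^2 / 2) is gained. The estimate is squared to fit
    \<open>gaussian_beats_power\<close>, whence the square of \<open>c2\<close> and the power 6
    \<kappa>.\<close>
  define c2 where "c2 = exp 9 * zeta\<^sub>r 3 * sqrt (2 * pi) + 1"
  have "0 < c2" using zeta\<^sub>r_nonneg[of 3] by (simp add: c2_def add_nonneg_pos)
  then have c: "0 < c1" "0 < c2\<^sup>2"
    using K1 by (simp_all add: c1_def)
  obtain T1 where T1: "exp 1 \<le> T1" "\<And>T. T1 \<le> T \<Longrightarrow> c1 * T powr (3 * \<kappa> + 1) * exp (- ((ln T)\<^sup>2)) \<le> 1"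
    using c(1) by (rule gaussian_beats_power) (rule that)
  obtain T2 where T2: "exp 1 \<le> T2" "\<And>T. T2 \<le> T \<Longrightarrow> c2\<^sup>2 * T powr (6 * \<kappa>) * exp (- ((ln T)\<^sup>2)) \<le> 1"
    using c(2) by (rule gaussian_beats_power) (rule that)
  define C where "C = 2 * exp 1 * K0 * 5 powr B + 2 * exp 9 + 2"
  show ?thesis
  proof (rule that[of C "max 64 (max T1 T2)"])
    show "0 < C" using K0_ge_1 by (auto simp: C_def intro!: add_nonneg_pos)
    fix T U F z
    assume T: "max 64 (max T1 T2) \<le> T" and U: "1 \<le> U" "U \<le> T powr \<kappa>" and F: "finite F"
      and tail: "infsum (\<lambda>M. g M powr - 3) (- F) \<le> 1 / (ln T * U powr 3)"
      and z: "0 \<le> Re z" "Re z \<le> 1" "2 * ln T \<le> \<bar>Im z\<bar>" "\<bar>Im z\<bar> \<le> 4 * T"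
    define L t where "L = ln T" and "t = Im z"
    have T': "64 \<le> T" "T1 \<le> T" "T2 \<le> T" using T by auto
    have L: "1 \<le> L" "4 * L \<le> T" using ln_square_large[OF T'(1)] by (auto simp: L_def)
    define k where "k u = exp ((u - z)\<^sup>2 + (u - z) * complex_of_real (ln U))" for u
    define ZF where "ZF u = (\<Sum>M\<in>F. dterm M u)" for u
    have norm_k: "norm (k (Complex a y)) = exp ((a - Re z)\<^sup>2 - (y - t)\<^sup>2) * U powr (a - Re z)" for a y
      using U by (simp add: k_def norm_exp_eq_Re powr_def exp_add[symmetric] power2_eq_square algebra_simps t_def)
    have U3: "U powr 3 \<le> T powr (3 * \<kappa>)"
    proof -
      have "U powr 3 \<le> (T powr \<kappa>) powr 3" using U by (intro powr_mono2) auto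
      then show ?thesis by (simp add: powr_powr mult.commute)
    qed
    have k_le: "norm (k (Complex a y)) \<le> exp 9 * U powr 3 * exp (- (y - t)\<^sup>2)" if a: "\<sigma>\<^sub>0 \<le> a" "a \<le> 3" for a y
    proof -
      have "\<bar>a - Re z\<bar> \<le> 3" using a z sigma0_props by linarith
      then have "(a - Re z)\<^sup>2 \<le> 9" using abs_le_square_iff[of "a - Re z" 3] by simp
      then have "exp ((a - Re z)\<^sup>2 - (y - t)\<^sup>2) * U powr (a - Re z) \<le> exp (9 - (y - t)\<^sup>2) * U powr 3"
        using a z U by (intro mult_mono powr_mono) auto
      then show ?thesis unfolding norm_k by (simp add: exp_diff exp_minus field_simps)
    qed
    define I where "I = {t - L..t + L}"
    define h where "h y = k (Complex 3 y) * ZF (Complex 3 y)" for y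
    have k_cont: "continuous_on W (\<lambda>y. k (Complex a y))" for a W
      unfolding k_def by (intro continuous_intros)
    have ZF_cont: "continuous_on W (\<lambda>y. ZF (Complex a y))" for a W
      unfolding ZF_def by (intro continuous_intros)
    have Z_cont: "continuous_on W (\<lambda>y. Z (Complex a y))" if "\<sigma>\<^sub>0 \<le> a" "a \<noteq> 1" for a W
      using that sigma0_props by (intro vertical_continuous[OF Z_holomorphic]) auto
    have hb: "has_bochner_integral lborel h (complex_of_real (sqrt pi) * kernel_sum F U z)"
      unfolding h_def k_def ZF_def by (rule kernel_sum_integral[OF F])
    then have h_int: "integrable lborel h" and h_val: "(\<integral>y. h y \<partial>lborel) = complex_of_real (sqrt pi) * kernel_sum F U z"
      by (simp_all add: has_bochner_integral_iff)
    have norm_ZF: "norm (ZF (Complex 3 y)) \<le> zeta\<^sub>r 3" for y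
    proof -
      have "norm (ZF (Complex 3 y)) \<le> (\<Sum>M\<in>F. g M powr - 3)"
        unfolding ZF_def by (rule sum_norm_le) (simp add: norm_dterm)
      also have "\<dots> \<le> zeta\<^sub>r 3"
        unfolding zeta\<^sub>r_def using F by (intro finite_sum_le_infsum summable_g) auto
      finally show ?thesis .
    qed
    have tail': "norm (Z (Complex 3 y) - ZF (Complex 3 y)) \<le> 1 / (L * U powr 3)" for y
    proof -
      have s3: "1 < Re (Complex 3 y)" by simp
      have one: "norm (1 :: complex) \<le> divs M" for M using divs_ge_1[of M] by simp
      have sum1: "(\<lambda>M. dterm M (Complex 3 y)) summable_on W" for W
        using summable_dterm[OF s3, of W "\<lambda>_. 1"] one by simp
      have "Z (Complex 3 y) = (\<Sum>\<^sub>\<infinity>M\<in>F \<union> - F. dterm M (Complex 3 y))"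
        using Z_eq_series[OF s3] by simp
      also have "\<dots> = ZF (Complex 3 y) + (\<Sum>\<^sub>\<infinity>M\<in>-F. dterm M (Complex 3 y))"
        using F sum1 by (subst infsum_Un_disjoint) (auto simp: ZF_def)
      finally have "norm (Z (Complex 3 y) - ZF (Complex 3 y)) = norm (\<Sum>\<^sub>\<infinity>M\<in>-F. dterm M (Complex 3 y))" by simp
      also have "\<dots> \<le> infsum (\<lambda>M. g M powr - 3) (- F)"
        by (rule norm_infsum_le[OF has_sum_infsum[OF sum1] has_sum_infsum])
           (auto simp: norm_dterm intro: summable_on_subset_banach[OF summable_g[of 3]])
      finally show ?thesis using tail by (simp add: L_def)
    qed
    have set_split: "(\<integral>y. h y \<partial>lborel) = (\<integral>y\<in>I. h y \<partial>lborel) + (\<integral>y\<in>-I. h y \<partial>lborel)"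
    proof -
      have "set_integrable lborel I h" "set_integrable lborel (- I) h"
        using h_int unfolding set_integrable_def I_def
        by (auto intro!: integrable_mult_indicator)
      then have "(\<integral>y\<in>I \<union> - I. h y \<partial>lborel) = (\<integral>y\<in>I. h y \<partial>lborel) + (\<integral>y\<in>-I. h y \<partial>lborel)"
        by (intro set_integral_Un) auto
      then show ?thesis by (simp add: set_lebesgue_integral_def)
    qed
    have out: "norm (\<integral>y\<in>-I. h y \<partial>lborel) \<le> 1"
    proof -
      have "norm (\<integral>y\<in>-I. h y \<partial>lborel) \<le> (\<integral>y. norm (indicator (- I) y *\<^sub>R h y) \<partial>lborel)"
        unfolding set_lebesgue_integral_def by (rule integral_norm_bound)
      also have "\<dots> \<le> (\<integral>y. exp 9 * U powr 3 * zeta\<^sub>r 3 * exp (- L\<^sup>2 / 2) * exp (- (y - t)\<^sup>2 / 2) \<partial>lborel)"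
      proof (rule integral_mono)
        show "integrable lborel (\<lambda>y. norm (indicator (- I) y *\<^sub>R h y))"
          using h_int by (intro integrable_norm integrable_mult_indicator) (auto simp: I_def)
        show "integrable lborel (\<lambda>y. exp 9 * U powr 3 * zeta\<^sub>r 3 * exp (- L\<^sup>2 / 2) * exp (- (y - t)\<^sup>2 / 2))"
          using gaussian_shift_integral[of t] by (intro integrable_mult_right) (simp add: has_bochner_integral_iff)
        fix y
        show "norm (indicator (- I) y *\<^sub>R h y) \<le> exp 9 * U powr 3 * zeta\<^sub>r 3 * exp (- L\<^sup>2 / 2) * exp (- (y - t)\<^sup>2 / 2)"
        proof (cases "y \<in> I")
          case False
          then have "L \<le> \<bar>y - t\<bar>" by (auto simp: I_def)
          then have "L\<^sup>2 \<le> (y - t)\<^sup>2" using L abs_le_square_iff[of L "y - t"] by simp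
          then have "exp (- (y - t)\<^sup>2) \<le> exp (- L\<^sup>2 / 2) * exp (- (y - t)\<^sup>2 / 2)"
            unfolding exp_add[symmetric] by simp
          then have "exp 9 * U powr 3 * exp (- (y - t)\<^sup>2) \<le> exp 9 * U powr 3 * (exp (- L\<^sup>2 / 2) * exp (- (y - t)\<^sup>2 / 2))"
            by (intro mult_left_mono) auto
          then have "norm (k (Complex 3 y)) \<le> exp 9 * U powr 3 * (exp (- L\<^sup>2 / 2) * exp (- (y - t)\<^sup>2 / 2))"
            using k_le[of 3 y] sigma0_props by linarith
          then have "norm (h y) \<le> exp 9 * U powr 3 * (exp (- L\<^sup>2 / 2) * exp (- (y - t)\<^sup>2 / 2)) * zeta\<^sub>r 3"
            unfolding h_def norm_mult using norm_ZF by (intro mult_mono) auto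
          then show ?thesis using False by (simp add: mult_ac)
        qed (use zeta\<^sub>r_nonneg in auto)
      qed
      also have "\<dots> = exp 9 * U powr 3 * zeta\<^sub>r 3 * exp (- L\<^sup>2 / 2) * sqrt (2 * pi)"
        using gaussian_shift_integral[of t] by (simp add: has_bochner_integral_iff)
      also have "\<dots> = (exp 9 * zeta\<^sub>r 3 * sqrt (2 * pi)) * U powr 3 * exp (- L\<^sup>2 / 2)" by simp
      also have "\<dots> \<le> c2 * T powr (3 * \<kappa>) * exp (- L\<^sup>2 / 2)"
        using U3 zeta\<^sub>r_nonneg[of 3] by (intro mult_right_mono mult_mono) (auto simp: c2_def)
      also have "\<dots> \<le> 1"
      proof -
        have "(c2 * T powr (3 * \<kappa>) * exp (- L\<^sup>2 / 2))\<^sup>2 = c2\<^sup>2 * T powr (6 * \<kappa>) * exp (- ((ln T)\<^sup>2))"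
          by (simp add: power_mult_distrib power2_eq_square[of "exp _"] power2_eq_square[of "_ powr _"]
              exp_add[symmetric] powr_add[symmetric] L_def)
        also have "\<dots> \<le> 1\<^sup>2" using T2(2)[OF T'(3)] by simp
        finally show ?thesis by (rule power2_le_imp_le) simp
      qed
      finally show ?thesis .
    qed
    have toHK: "(\<integral>y\<in>I. h y \<partial>lborel) = integral I h"
      unfolding I_def
      by (intro set_borel_integral_eq_integral(2) borel_integrable_atLeastAtMost' continuous_intros)
         (auto simp: h_def intro!: continuous_intros k_cont ZF_cont)
    define hz where "hz y = k (Complex 3 y) * Z (Complex 3 y)" for y
    have hz_cont: "continuous_on W hz" for W
      unfolding hz_def using sigma0_props by (intro continuous_intros k_cont Z_cont) auto
    have h_cont: "continuous_on W h" for W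
      unfolding h_def by (intro continuous_intros k_cont ZF_cont)
    \<comment> \<open>The tail 1 / (L U^3) offsets the size exp 9 U^3 of the kernel and the window
      length 2 L, which leaves the constant 2 exp 9.\<close>
    have swap: "norm (integral I h) \<le> norm (integral I hz) + 2 * exp 9"
    proof -
      have "integral I h = integral I hz - integral I (\<lambda>y. hz y - h y)"
        unfolding I_def using hz_cont h_cont
        by (subst integral_diff) (auto intro!: integrable_continuous_interval)
      then have "norm (integral I h) \<le> norm (integral I hz) + norm (integral I (\<lambda>y. hz y - h y))"
        using norm_triangle_ineq4 by metis
      moreover have "norm (integral I (\<lambda>y. hz y - h y)) \<le> exp 9 / L * (t + L - (t - L))"
        unfolding I_def
      proof (rule integral_bound)
        show "continuous_on {t - L..t + L} (\<lambda>y. hz y - h y)" by (intro continuous_intros hz_cont h_cont)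
        fix y
        have "norm (k (Complex 3 y)) \<le> exp 9 * U powr 3 * exp (- (y - t)\<^sup>2)"
          using sigma0_props by (intro k_le) auto
        also have "\<dots> \<le> exp 9 * U powr 3 * 1" by (intro mult_left_mono) auto
        finally have "norm (k (Complex 3 y)) * norm (Z (Complex 3 y) - ZF (Complex 3 y))
            \<le> exp 9 * U powr 3 * 1 * (1 / (L * U powr 3))"
          using tail'[of y] by (intro mult_mono) auto
        moreover have "hz y - h y = k (Complex 3 y) * (Z (Complex 3 y) - ZF (Complex 3 y))"
          by (simp add: hz_def h_def right_diff_distrib)
        ultimately show "norm (hz y - h y) \<le> exp 9 / L" using U by (simp add: norm_mult)
      qed (use L in auto)
      moreover have "exp 9 / L * (t + L - (t - L)) = 2 * exp 9" using L by simp
      ultimately show ?thesis by linarith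
    qed
    have y_bounds: "1 \<le> \<bar>y\<bar>" "\<bar>y\<bar> \<le> 5 * T" "0 < t \<longrightarrow> 0 < y" "t < 0 \<longrightarrow> y < 0" "t \<noteq> 0" if "\<bar>y - t\<bar> \<le> L" for y
      using that z(3,4) L unfolding t_def L_def[symmetric] by linarith+
    have shift: "norm (integral I hz) \<le> norm (integral I (\<lambda>y. k (Complex \<sigma>\<^sub>0 y) * Z (Complex \<sigma>\<^sub>0 y))) + 1"
    proof -
      define W where "W = {s. \<theta> < Re s} \<inter> (if 0 < t then {s. 0 < Im s} else {s. Im s < 0})"
      define M where "M = exp 9 * U powr 3 * exp (- L\<^sup>2) * (K1 * (5 * T))"
      have W: "convex W" unfolding W_def
        by (auto intro!: convex_Int convex_halfspace_Re_gt convex_halfspace_Im_gt convex_halfspace_Im_lt)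
      have "W \<subseteq> {s. \<theta> < Re s} - {1}" by (auto simp: W_def split: if_splits)
      then have hol: "(\<lambda>s. k s * Z s) holomorphic_on W"
        unfolding k_def by (intro holomorphic_intros holomorphic_on_subset[OF Z_holomorphic])
      have box: "cbox (Complex \<sigma>\<^sub>0 (t - L)) (Complex 3 (t + L)) \<subseteq> W"
      proof
        fix s assume "s \<in> cbox (Complex \<sigma>\<^sub>0 (t - L)) (Complex 3 (t + L))"
        then have s: "\<sigma>\<^sub>0 \<le> Re s" "\<bar>Im s - t\<bar> \<le> L" by (auto simp: in_cbox_complex_iff abs_le_iff)
        then have "\<theta> < Re s" using sigma0_props by linarith
        moreover have "if 0 < t then 0 < Im s else Im s < 0"
          using y_bounds(3,4,5)[OF s(2)] by auto
        ultimately show "s \<in> W" by (simp add: W_def)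
      qed
      have M: "norm (k (Complex a y) * Z (Complex a y)) \<le> M"
        if a: "\<sigma>\<^sub>0 \<le> a" "a \<le> 3" and y: "\<bar>y - t\<bar> = L" for a y
      proof -
        have "(y - t)\<^sup>2 = L\<^sup>2" using y by (metis power2_abs)
        then have "norm (k (Complex a y)) \<le> exp 9 * U powr 3 * exp (- L\<^sup>2)" using k_le[OF a, of y] by simp
        moreover have "norm (Z (Complex a y)) \<le> K1 * (5 * T)"
        proof -
          have "norm (Z (Complex a y)) \<le> K1 * \<bar>Im (Complex a y)\<bar>"
            using a y_bounds(1)[of y] y by (intro K1) auto
          also have "\<dots> \<le> K1 * (5 * T)" using K1 y_bounds(2)[of y] y by (intro mult_left_mono) auto
          finally show ?thesis .
        qed
        ultimately show ?thesis unfolding norm_mult M_def by (intro mult_mono) auto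
      qed
      have M0: "0 \<le> M" using K1 T' by (simp add: M_def)
      have "norm (integral {t - L..t + L} (\<lambda>y. k (Complex 3 y) * Z (Complex 3 y)))
          \<le> norm (integral {t - L..t + L} (\<lambda>y. k (Complex \<sigma>\<^sub>0 y) * Z (Complex \<sigma>\<^sub>0 y))) + 2 * M * (3 - \<sigma>\<^sub>0)"
        by (rule vertical_shift[OF _ _ hol W box M0]) (use sigma0_props L M in auto)
      moreover have "2 * M * (3 - \<sigma>\<^sub>0) \<le> 2 * M * 3" using M0 sigma0_props by (intro mult_left_mono) auto
      moreover have "2 * M * 3 \<le> 1"
      proof -
        have "2 * M * 3 = c1 * (U powr 3 * T) * exp (- L\<^sup>2)" by (simp add: M_def c1_def)
        also have "\<dots> \<le> c1 * (T powr (3 * \<kappa>) * T) * exp (- L\<^sup>2)"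
          using U3 c T' by (intro mult_right_mono mult_left_mono) auto
        also have "T powr (3 * \<kappa>) * T = T powr (3 * \<kappa> + 1)" using T' by (simp add: powr_add)
        also have "c1 * T powr (3 * \<kappa> + 1) * exp (- L\<^sup>2) \<le> 1" using T1(2)[OF T'(2)] by (simp add: L_def)
        finally show ?thesis .
      qed
      ultimately show ?thesis unfolding I_def hz_def by linarith
    qed
    have left: "norm (integral I (\<lambda>y. k (Complex \<sigma>\<^sub>0 y) * Z (Complex \<sigma>\<^sub>0 y)))
        \<le> exp 1 * U powr \<sigma>\<^sub>0 * (K0 * (5 powr B * T powr B)) * (t + L - (t - L))"
      unfolding I_def
    proof (rule integral_bound)
      show "continuous_on {t - L..t + L} (\<lambda>y. k (Complex \<sigma>\<^sub>0 y) * Z (Complex \<sigma>\<^sub>0 y))"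
        using sigma0_props by (intro continuous_intros k_cont Z_cont) auto
      fix y assume "y \<in> {t - L..t + L}"
      then have y: "\<bar>y - t\<bar> \<le> L" by auto
      have "\<bar>\<sigma>\<^sub>0 - Re z\<bar> \<le> 1" using z sigma0_props by linarith
      then have "(\<sigma>\<^sub>0 - Re z)\<^sup>2 \<le> 1" using abs_le_square_iff[of "\<sigma>\<^sub>0 - Re z" 1] by simp
      moreover have "0 \<le> (y - t)\<^sup>2" by simp
      ultimately have "(\<sigma>\<^sub>0 - Re z)\<^sup>2 - (y - t)\<^sup>2 \<le> 1" by linarith
      then have "norm (k (Complex \<sigma>\<^sub>0 y)) \<le> exp 1 * U powr \<sigma>\<^sub>0"
      proof -
        have "\<sigma>\<^sub>0 - Re z \<le> \<sigma>\<^sub>0" using z(1) by linarith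
        then have "U powr (\<sigma>\<^sub>0 - Re z) \<le> U powr \<sigma>\<^sub>0" using U(1) by (rule powr_mono)
        then show ?thesis
          unfolding norm_k using \<open>(\<sigma>\<^sub>0 - Re z)\<^sup>2 - (y - t)\<^sup>2 \<le> 1\<close> by (intro mult_mono) simp_all
      qed
      moreover have "norm (Z (Complex \<sigma>\<^sub>0 y)) \<le> K0 * (5 powr B * T powr B)"
      proof -
        have "norm (Z (Complex \<sigma>\<^sub>0 y)) \<le> K0 * \<bar>y\<bar> powr B" by (rule critical[OF y_bounds(1)[OF y]])
        also have "\<dots> \<le> K0 * (5 * T) powr B"
          using K0_ge_1 B_pos y_bounds(2)[OF y] by (intro mult_left_mono powr_mono2) auto
        finally show ?thesis using T' by (simp add: powr_mult)
      qed
      ultimately show "norm (k (Complex \<sigma>\<^sub>0 y) * Z (Complex \<sigma>\<^sub>0 y)) \<le> exp 1 * U powr \<sigma>\<^sub>0 * (K0 * (5 powr B * T powr B))"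
        unfolding norm_mult using U by (intro mult_mono) auto
    qed (use L in auto)
    have "norm (kernel_sum F U z) * 1 \<le> norm (kernel_sum F U z) * sqrt pi"
      using pi_gt3 by (intro mult_left_mono) auto
    also have "\<dots> = norm (\<integral>y. h y \<partial>lborel)" by (simp add: h_val norm_mult)
    also have "\<dots> \<le> norm (integral I h) + 1"
      unfolding set_split toHK using norm_triangle_ineq[of "integral I h" "\<integral>y\<in>-I. h y \<partial>lborel"] out by linarith
    also have "\<dots> \<le> exp 1 * U powr \<sigma>\<^sub>0 * (K0 * (5 powr B * T powr B)) * (2 * L) + (2 * exp 9 + 2) * 1"
      using swap shift left by simp
    also have "\<dots> \<le> exp 1 * U powr \<sigma>\<^sub>0 * (K0 * (5 powr B * T powr B)) * (2 * L) + (2 * exp 9 + 2) * (L * U powr \<sigma>\<^sub>0 * T powr B)"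
    proof -
      have "1 \<le> U powr \<sigma>\<^sub>0" "1 \<le> T powr B" using U T' B_pos sigma0_props by (auto intro!: ge_one_powr_ge_zero)
      then have "1 * 1 * 1 \<le> L * U powr \<sigma>\<^sub>0 * T powr B" using L by (intro mult_mono) auto
      then show ?thesis by (intro add_left_mono mult_left_mono) (auto simp: add_nonneg_nonneg)
    qed
    also have "\<dots> = C * L * U powr \<sigma>\<^sub>0 * T powr B" by (simp add: C_def algebra_simps)
    finally show "norm (kernel_sum F U z) \<le> C * ln T * U powr \<sigma>\<^sub>0 * T powr B" by (simp add: L_def)
  qed simp
qed

end

section \<open>Duality and large values of Dirichlet polynomials\<close>

context beurling_system
begin

lemma cnj_dterm: "cnj (dterm M s) = dterm M (cnj s)"
  by (simp add: dterm_exp exp_cnj)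

text \<open>Opening the square, each pair s, s' produces a kernel sum at height Im s - Im s'.
  Spacing of the points thus keeps all off-diagonal terms away from the real axis.\<close>

lemma weighted_square_sum:
  assumes "finite S" "finite F"
  shows "complex_of_real (\<Sum>M\<in>F. weight U M * (norm (\<Sum>s\<in>S. e s * dterm M (s - \<sigma>)))\<^sup>2) =
     (\<Sum>s\<in>S. \<Sum>s'\<in>S. e s * cnj (e s') * kernel_sum F U (s - \<sigma> + cnj (s' - \<sigma>)))"
proof -
  have "complex_of_real (weight U M * (norm (\<Sum>s\<in>S. e s * dterm M (s - \<sigma>)))\<^sup>2) =
      (\<Sum>s\<in>S. \<Sum>s'\<in>S. e s * cnj (e s') * (complex_of_real (weight U M) * dterm M (s - \<sigma> + cnj (s' - \<sigma>))))" for M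
  proof -
    let ?b = "\<Sum>s\<in>S. e s * dterm M (s - \<sigma>)"
    have "complex_of_real ((norm ?b)\<^sup>2) = ?b * cnj ?b" by (rule complex_norm_square)
    also have "\<dots> = (\<Sum>s\<in>S. \<Sum>s'\<in>S. e s * cnj (e s') * dterm M (s - \<sigma> + cnj (s' - \<sigma>)))"
      by (simp add: sum_product cnj_dterm dterm_add_exponent mult_ac)
    finally have sq: "complex_of_real ((norm ?b)\<^sup>2) =
        (\<Sum>s\<in>S. \<Sum>s'\<in>S. e s * cnj (e s') * dterm M (s - \<sigma> + cnj (s' - \<sigma>)))" .
    show ?thesis
      unfolding of_real_mult sq by (simp only: sum_distrib_left mult_ac)
  qed
  then have "complex_of_real (\<Sum>M\<in>F. weight U M * (norm (\<Sum>s\<in>S. e s * dterm M (s - \<sigma>)))\<^sup>2) =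
      (\<Sum>M\<in>F. \<Sum>s\<in>S. \<Sum>s'\<in>S. e s * cnj (e s') * (complex_of_real (weight U M) * dterm M (s - \<sigma> + cnj (s' - \<sigma>))))"
    by (simp only: of_real_sum)
  also have "\<dots> = (\<Sum>s\<in>S. \<Sum>M\<in>F. \<Sum>s'\<in>S. e s * cnj (e s') * (complex_of_real (weight U M) * dterm M (s - \<sigma> + cnj (s' - \<sigma>))))"
    by (rule sum.swap)
  also have "\<dots> = (\<Sum>s\<in>S. \<Sum>s'\<in>S. \<Sum>M\<in>F. e s * cnj (e s') * (complex_of_real (weight U M) * dterm M (s - \<sigma> + cnj (s' - \<sigma>))))"
    by (intro sum.cong refl sum.swap)
  finally show ?thesis by (simp only: kernel_sum_def sum_distrib_left)
qed

end

context beurling_subconvex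
begin

(* Halasz--Montgomery: duality reduces large values to the kernel sums, whose off-diagonal size
   is governed by Z on the critical line. *)
lemma large_values:
  assumes \<kappa>: "0 \<le> \<kappa>"
  obtains C T0 where "0 < C" "64 \<le> T0"
    "\<And>T U V \<sigma> S F c. T0 \<le> T \<Longrightarrow> 1 \<le> U \<Longrightarrow> U \<le> T powr \<kappa> \<Longrightarrow> 0 \<le> \<sigma> \<Longrightarrow> \<sigma> \<le> 3 \<Longrightarrow>
      finite S \<Longrightarrow> \<forall>s\<in>S. \<sigma> \<le> Re s \<and> Re s \<le> \<sigma> + 1 / 2 \<and> \<bar>Im s\<bar> \<le> 2 * T \<Longrightarrow>
      \<forall>s\<in>S. \<forall>s'\<in>S. s \<noteq> s' \<longrightarrow> 2 * ln T \<le> \<bar>Im s - Im s'\<bar> \<Longrightarrow>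
      F \<subseteq> {M. U \<le> g M \<and> g M \<le> exp 1 * U} \<Longrightarrow> \<forall>M\<in>F. norm (c M) \<le> divs M \<Longrightarrow>
      0 \<le> V \<Longrightarrow> \<forall>s\<in>S. V \<le> norm (\<Sum>M\<in>F. c M * dterm M s) \<Longrightarrow>
      real (card S) * V\<^sup>2 \<le> C * ln T ^ 5 * U powr (1 - 2 * \<sigma>) * (U + real (card S) * (U powr \<sigma>\<^sub>0 * T powr B))"
proof -
  obtain C1 T1 where C1: "0 < C1" "64 \<le> T1"
    "\<And>T U F z. T1 \<le> T \<Longrightarrow> 1 \<le> U \<Longrightarrow> U \<le> T powr \<kappa> \<Longrightarrow> finite F \<Longrightarrow>
      infsum (\<lambda>M. g M powr - 3) (- F) \<le> 1 / (ln T * U powr 3) \<Longrightarrow>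
      0 \<le> Re z \<Longrightarrow> Re z \<le> 1 \<Longrightarrow> 2 * ln T \<le> \<bar>Im z\<bar> \<Longrightarrow> \<bar>Im z\<bar> \<le> 4 * T \<Longrightarrow>
      norm (kernel_sum F U z) \<le> C1 * ln T * U powr \<sigma>\<^sub>0 * T powr B"
    by (rule kernel_sum_off_diagonal[OF \<kappa>]) (rule that)
  obtain Cz where Cz: "1 \<le> Cz" "\<And>L c. 1 \<le> L \<Longrightarrow> 1 \<le> c \<Longrightarrow> c \<le> 3 \<Longrightarrow> zeta\<^sub>r (1 + c / L) \<le> Cz * L"
    by (rule zeta\<^sub>r_log_bound) (rule that)
  define c2 where "c2 = exp 4 * exp \<kappa> * Cz"
  define c3 where "c3 = exp 2 * exp \<kappa> * Cz ^ 4"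
  define C where "C = 2 * c3 * (c2 + C1)"
  have c: "0 < c2" "0 < c3" using Cz by (auto simp: c2_def c3_def)
  show ?thesis
  proof (rule that[OF _ C1(2)])
    show "0 < C" using c C1 by (simp add: C_def add_pos_pos)
    fix T U V \<sigma> :: real and S F and c :: "nat multiset \<Rightarrow> complex"
    assume T: "T1 \<le> T" and U: "1 \<le> U" "U \<le> T powr \<kappa>" and \<sigma>: "0 \<le> \<sigma>" "\<sigma> \<le> 3"
      and finS: "finite S" and S: "\<forall>s\<in>S. \<sigma> \<le> Re s \<and> Re s \<le> \<sigma> + 1 / 2 \<and> \<bar>Im s\<bar> \<le> 2 * T"
      and sep: "\<forall>s\<in>S. \<forall>s'\<in>S. s \<noteq> s' \<longrightarrow> 2 * ln T \<le> \<bar>Im s - Im s'\<bar>"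
      and F: "F \<subseteq> {M. U \<le> g M \<and> g M \<le> exp 1 * U}" and cM: "\<forall>M\<in>F. norm (c M) \<le> divs M"
      and V: "0 \<le> V" "\<forall>s\<in>S. V \<le> norm (\<Sum>M\<in>F. c M * dterm M s)"
    define L where "L = ln T"
    have T64: "64 \<le> T" using T C1(2) by simp
    have L: "1 \<le> L" "4 * L \<le> T" using ln_square_large[OF T64] by (auto simp: L_def)
    have finF: "finite F" by (rule finite_subset[OF F finite_subset[OF _ finite_g_le[of "exp 1 * U"]]]) auto
    have UL: "U powr (1 / L) \<le> exp \<kappa>"
    proof -
      have "U powr (1 / L) \<le> (T powr \<kappa>) powr (1 / L)" using U L by (intro powr_mono2) auto
      also have "\<dots> = exp \<kappa>"
      proof -
        have "T \<noteq> 1" using T64 by simp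
        then show ?thesis using T64 L by (simp add: powr_powr powr_def L_def)
      qed
      finally show ?thesis .
    qed
    define Off Diag where "Off = C1 * L * U powr \<sigma>\<^sub>0 * T powr B" and "Diag = c2 * L * U"
    have "0 < 1 / (L * U powr 3)" using L U by simp
    moreover have "0 \<le> g M powr - 3" for M by simp
    moreover have "(\<lambda>M. g M powr - 3) summable_on UNIV" by (rule summable_g) simp
    ultimately obtain X where X: "infsum (\<lambda>M. g M powr - 3) {M. X < g M} < 1 / (L * U powr 3)"
      using tail_small by blast
    \<comment> \<open>Large enough to contain the block and to leave a tail that meets the
      hypothesis of the kernel bound. The weighted squares are nonnegative, so summing over more
      terms only increases the sum.\<close>
    define F' where "F' = {M. g M \<le> max X (exp 1 * U)}"
    have F': "finite F'" "F \<subseteq> F'" using F by (auto simp: F'_def)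
    have "infsum (\<lambda>M. g M powr - 3) (- F') \<le> infsum (\<lambda>M. g M powr - 3) {M. X < g M}"
      by (intro infsum_mono_neutral summable_on_subset_banach[OF summable_g[of 3]]) (auto simp: F'_def)
    then have tail: "infsum (\<lambda>M. g M powr - 3) (- F') \<le> 1 / (ln T * U powr 3)"
      using X by (simp add: L_def)
    \<comment> \<open>Both points lie at most 1/2 to the right of \<sigma>, so the two real parts
      add up to at most 1, and the spacing 2 ln T is the height required for the kernel
      bound.\<close>
    have off: "norm (kernel_sum F' U (s - \<sigma> + cnj (s' - \<sigma>))) \<le> Off" if s: "s \<in> S" "s' \<in> S" "s \<noteq> s'" for s s'
      unfolding Off_def L_def
    proof (rule C1(3)[OF T U F'(1) tail])
      have "\<sigma> \<le> Re s" "Re s \<le> \<sigma> + 1 / 2" "\<bar>Im s\<bar> \<le> 2 * T" "\<sigma> \<le> Re s'" "Re s' \<le> \<sigma> + 1 / 2" "\<bar>Im s'\<bar> \<le> 2 * T"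
        using S s by auto
      moreover have "2 * ln T \<le> \<bar>Im s - Im s'\<bar>" using sep s by blast
      ultimately show "0 \<le> Re (s - \<sigma> + cnj (s' - \<sigma>))" "Re (s - \<sigma> + cnj (s' - \<sigma>)) \<le> 1"
        "2 * ln T \<le> \<bar>Im (s - \<sigma> + cnj (s' - \<sigma>))\<bar>" "\<bar>Im (s - \<sigma> + cnj (s' - \<sigma>))\<bar> \<le> 4 * T"
        by auto
    qed
    have diag: "norm (kernel_sum F' U (s - \<sigma> + cnj (s - \<sigma>))) \<le> Diag" if s: "s \<in> S" for s
    proof -
      have "\<sigma> \<le> Re s" using S s by auto
      then have "norm (kernel_sum F' U (s - \<sigma> + cnj (s - \<sigma>))) \<le> exp 4 * U powr (1 + 1 / L) * zeta\<^sub>r (1 + 1 / L)"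
        using U L by (intro kernel_sum_trivial F') auto
      also have "U powr (1 + 1 / L) = U * U powr (1 / L)" using U by (simp add: powr_add)
      also have "exp 4 * (U * U powr (1 / L)) * zeta\<^sub>r (1 + 1 / L) \<le> exp 4 * (U * exp \<kappa>) * (Cz * L)"
        using U UL Cz(2)[OF L(1), of 1] zeta\<^sub>r_nonneg by (intro mult_mono mult_nonneg_nonneg) auto
      also have "\<dots> = Diag" by (simp add: Diag_def c2_def)
      finally show ?thesis .
    qed
    \<comment> \<open>Phases that make every value of the polynomial nonnegative. Summing over s and
      exchanging the sums passes to the dual sums \<open>b M\<close>.\<close>
    define e where "e s = cnj (sgn (\<Sum>M\<in>F. c M * dterm M s))" for s
    have e1: "norm (e s) \<le> 1" for s by (simp add: e_def norm_sgn)
    have e2: "e s * (\<Sum>M\<in>F. c M * dterm M s) = complex_of_real (norm (\<Sum>M\<in>F. c M * dterm M s))" for s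
    proof -
      have "cnj (sgn u) * u = complex_of_real (norm u)" for u :: complex
        by (cases "u = 0") (simp_all add: sgn_eq complex_norm_square[symmetric] power2_eq_square mult.commute[of "cnj u"])
      then show ?thesis by (simp add: e_def)
    qed
    define b where "b M = (\<Sum>s\<in>S. e s * dterm M (s - \<sigma>))" for M
    define n where "n = real (card S)"
    have sumb: "(\<Sum>M\<in>F. (norm (b M))\<^sup>2) \<le> 2 * (n * (Diag + n * Off))"
    proof -
      \<comment> \<open>On the block |ln U - ln (g M)| is at most 1, so the weight is at least exp
        (-1/4), hence at least 1/2.\<close>
      have w: "1 \<le> 2 * weight U M" if "M \<in> F" for M
      proof -
        have "U \<le> g M" "g M \<le> exp 1 * U" using F that by auto
        then have "ln U \<le> ln (g M)" "ln (g M) \<le> ln (exp 1 * U)" using U by (auto intro!: ln_mono)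
        then have "\<bar>ln U - ln (g M)\<bar> \<le> 1" using U by (simp add: ln_mult_pos)
        then have "(ln U - ln (g M))\<^sup>2 \<le> 1" using abs_le_square_iff[of "ln U - ln (g M)" 1] by simp
        then have "exp (- 1 / 4) \<le> weight U M" by (simp add: weight_def)
        moreover have "1 + (- 1 / 4) \<le> exp (- 1 / 4 :: real)" by (rule exp_ge_add_one_self)
        ultimately show ?thesis by linarith
      qed
      have "(\<Sum>M\<in>F. (norm (b M))\<^sup>2) \<le> (\<Sum>M\<in>F. 2 * (weight U M * (norm (b M))\<^sup>2))"
      proof (rule sum_mono)
        fix M assume "M \<in> F"
        from mult_right_mono[OF w[OF this], of "(norm (b M))\<^sup>2"]
        show "(norm (b M))\<^sup>2 \<le> 2 * (weight U M * (norm (b M))\<^sup>2)" by simp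
      qed
      also have "\<dots> \<le> (\<Sum>M\<in>F'. 2 * (weight U M * (norm (b M))\<^sup>2))"
        using F' by (intro sum_mono2) auto
      also have "\<dots> = 2 * (\<Sum>M\<in>F'. weight U M * (norm (b M))\<^sup>2)" by (simp add: sum_distrib_left)
      also have "(\<Sum>M\<in>F'. weight U M * (norm (b M))\<^sup>2) = norm (complex_of_real (\<Sum>M\<in>F'. weight U M * (norm (b M))\<^sup>2))"
        unfolding norm_of_real by (intro abs_of_nonneg[symmetric] sum_nonneg) simp
      also have "\<dots> \<le> (\<Sum>s\<in>S. \<Sum>s'\<in>S. norm (e s * cnj (e s') * kernel_sum F' U (s - \<sigma> + cnj (s' - \<sigma>))))"
        unfolding b_def weighted_square_sum[OF finS F'(1)]
        by (intro order_trans[OF norm_sum] sum_mono norm_sum)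
      also have "\<dots> \<le> (\<Sum>s\<in>S. \<Sum>s'\<in>S. if s' = s then Diag else Off)"
      proof (intro sum_mono)
        fix s s' assume s: "s \<in> S" "s' \<in> S"
        have "norm (e s * cnj (e s')) \<le> 1 * 1"
          unfolding norm_mult using e1 by (intro mult_mono) auto
        then have "norm (e s * cnj (e s')) * norm (kernel_sum F' U (s - \<sigma> + cnj (s' - \<sigma>)))
            \<le> 1 * norm (kernel_sum F' U (s - \<sigma> + cnj (s' - \<sigma>)))"
          by (intro mult_right_mono) auto
        also have "\<dots> \<le> (if s' = s then Diag else Off)"
          using diag[OF s(1)] off[OF s] by (cases "s' = s") auto
        finally show "norm (e s * cnj (e s') * kernel_sum F' U (s - \<sigma> + cnj (s' - \<sigma>))) \<le> (if s' = s then Diag else Off)"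
          by (simp add: norm_mult)
      qed
      also have "\<dots> \<le> (\<Sum>s\<in>S. Diag + n * Off)"
      proof (rule sum_mono)
        fix s assume s: "s \<in> S"
        have "0 \<le> Off" using C1 L by (simp add: Off_def)
        then have "(\<Sum>s'\<in>S. if s' = s then Diag else Off) \<le> (\<Sum>s'\<in>S. (if s' = s then Diag else 0) + Off)"
          by (intro sum_mono) auto
        also have "\<dots> = Diag + n * Off" using finS s by (simp add: sum.distrib n_def)
        finally show "(\<Sum>s'\<in>S. if s' = s then Diag else Off) \<le> Diag + n * Off" .
      qed
      also have "\<dots> = n * (Diag + n * Off)" by (simp add: n_def)
      finally show ?thesis by simp
    qed
    have sumc: "(\<Sum>M\<in>F. (norm (c M) * g M powr - \<sigma>)\<^sup>2) \<le> c3 * L ^ 4 * U powr (1 - 2 * \<sigma>)"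
    proof -
      have "(\<Sum>M\<in>F. (norm (c M) * g M powr - \<sigma>)\<^sup>2) \<le>
          (\<Sum>M\<in>F. exp 2 * exp \<kappa> * U powr (1 - 2 * \<sigma>) * ((divs M)\<^sup>2 * g M powr - (1 + 1 / L)))"
      proof (rule sum_mono)
        fix M assume M: "M \<in> F"
        then have Mg: "U \<le> g M" "g M \<le> exp 1 * U" using F by auto
        \<comment> \<open>Splits the summable power -(1 + 1 / L) off from g^(-2 \<sigma>). What
          remains is at most a constant times U^(1 - 2 \<sigma>), because g lies between U and e
          U.\<close>
        define q where "q = 1 + 1 / L - 2 * \<sigma>"
        have "1 / L \<le> 1" using L by simp
        then have q: "q \<le> 2" using \<sigma>(1) unfolding q_def by linarith
        have "g M powr q \<le> exp 2 * U powr q"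
        proof (cases "0 \<le> q")
          case True
          then have "g M powr q \<le> (exp 1 * U) powr q" using Mg by (intro powr_mono2) auto
          also have "\<dots> = exp q * U powr q" using U by (simp add: powr_mult exp_powr_real)
          also have "\<dots> \<le> exp 2 * U powr q" using q by (intro mult_right_mono) auto
          finally show ?thesis .
        next
          case False
          then have "g M powr q \<le> 1 * U powr q" using Mg U by (simp add: powr_mono2')
          also have "\<dots> \<le> exp 2 * U powr q" by (intro mult_right_mono) auto
          finally show ?thesis .
        qed
        also have "U powr q = U powr (1 / L) * U powr (1 - 2 * \<sigma>)"
          by (simp add: q_def powr_add[symmetric] algebra_simps)
        also have "exp 2 * (U powr (1 / L) * U powr (1 - 2 * \<sigma>)) \<le> exp 2 * (exp \<kappa> * U powr (1 - 2 * \<sigma>))"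
          using UL by (intro mult_left_mono mult_right_mono) auto
        finally have gq: "g M powr q \<le> exp 2 * exp \<kappa> * U powr (1 - 2 * \<sigma>)" by simp
        have "(norm (c M) * g M powr - \<sigma>)\<^sup>2 = (norm (c M))\<^sup>2 * (g M powr - (1 + 1 / L) * g M powr q)"
          by (simp add: power_mult_distrib power2_eq_square[of "_ powr _"] powr_add[symmetric] q_def)
        also have "\<dots> \<le> (divs M)\<^sup>2 * (g M powr - (1 + 1 / L) * (exp 2 * exp \<kappa> * U powr (1 - 2 * \<sigma>)))"
          using cM M gq by (intro mult_mono mult_left_mono power_mono) auto
        finally show "(norm (c M) * g M powr - \<sigma>)\<^sup>2
            \<le> exp 2 * exp \<kappa> * U powr (1 - 2 * \<sigma>) * ((divs M)\<^sup>2 * g M powr - (1 + 1 / L))"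
          by (simp add: mult_ac)
      qed
      also have "\<dots> = exp 2 * exp \<kappa> * U powr (1 - 2 * \<sigma>) * (\<Sum>M\<in>F. (divs M)\<^sup>2 * g M powr - (1 + 1 / L))"
        by (simp add: sum_distrib_left)
      also have "\<dots> \<le> exp 2 * exp \<kappa> * U powr (1 - 2 * \<sigma>) * zeta\<^sub>r (1 + 1 / L) ^ 4"
        using L finF by (intro mult_left_mono sum_divs_square_le) auto
      also have "\<dots> \<le> exp 2 * exp \<kappa> * U powr (1 - 2 * \<sigma>) * (Cz * L) ^ 4"
        using Cz(2)[OF L(1), of 1] zeta\<^sub>r_nonneg by (intro mult_left_mono power_mono) auto
      finally show ?thesis by (simp add: c3_def power_mult_distrib mult_ac)
    qed
    have "n * V \<le> (\<Sum>s\<in>S. norm (\<Sum>M\<in>F. c M * dterm M s))"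
      unfolding n_def using V(2) sum_mono[of S "\<lambda>_. V"] by simp
    also have "\<dots> = norm (\<Sum>s\<in>S. e s * (\<Sum>M\<in>F. c M * dterm M s))"
      unfolding e2 of_real_sum[symmetric] norm_of_real by (intro abs_of_nonneg[symmetric] sum_nonneg) simp
    also have "(\<Sum>s\<in>S. e s * (\<Sum>M\<in>F. c M * dterm M s)) = (\<Sum>M\<in>F. c M * dterm M \<sigma> * b M)"
    proof -
      have eq: "dterm M s = dterm M \<sigma> * dterm M (s - \<sigma>)" for M s
        by (simp flip: dterm_add_exponent)
      have "e s * (c M * dterm M s) = c M * dterm M \<sigma> * (e s * dterm M (s - \<sigma>))" for M s
        by (simp only: eq[of M s] mult_ac)
      then have "(\<Sum>s\<in>S. e s * (\<Sum>M\<in>F. c M * dterm M s)) = (\<Sum>s\<in>S. \<Sum>M\<in>F. c M * dterm M \<sigma> * (e s * dterm M (s - \<sigma>)))"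
        by (simp only: sum_distrib_left)
      also have "\<dots> = (\<Sum>M\<in>F. \<Sum>s\<in>S. c M * dterm M \<sigma> * (e s * dterm M (s - \<sigma>)))" by (rule sum.swap)
      finally show ?thesis by (simp only: b_def sum_distrib_left)
    qed
    also have "norm (\<Sum>M\<in>F. c M * dterm M \<sigma> * b M) \<le> (\<Sum>M\<in>F. (norm (c M) * g M powr - \<sigma>) * norm (b M))"
      by (rule sum_norm_le) (simp add: norm_mult norm_dterm)
    finally have "(n * V)\<^sup>2 \<le> (\<Sum>M\<in>F. (norm (c M) * g M powr - \<sigma>) * norm (b M))\<^sup>2"
      using V by (intro power_mono) (auto simp: n_def)
    also have "\<dots> \<le> (\<Sum>M\<in>F. (norm (c M) * g M powr - \<sigma>)\<^sup>2) * (\<Sum>M\<in>F. (norm (b M))\<^sup>2)"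
      by (rule Cauchy_Schwarz_ineq_sum)
    also have "\<dots> \<le> (c3 * L ^ 4 * U powr (1 - 2 * \<sigma>)) * (2 * (n * (Diag + n * Off)))"
      using sumb sumc c L by (intro mult_mono sum_nonneg mult_nonneg_nonneg) auto
    also have "\<dots> = n * (2 * c3 * L ^ 4 * U powr (1 - 2 * \<sigma>) * (Diag + n * Off))"
      by (simp only: mult_ac)
    also have "(n * V)\<^sup>2 = n * (n * V\<^sup>2)"
      by (simp only: power_mult_distrib power2_eq_square mult_ac)
    finally have main: "n * (n * V\<^sup>2) \<le> n * (2 * c3 * L ^ 4 * U powr (1 - 2 * \<sigma>) * (Diag + n * Off))" .
    have n0: "0 \<le> n" by (simp add: n_def)
    have "n * V\<^sup>2 \<le> 2 * c3 * L ^ 4 * U powr (1 - 2 * \<sigma>) * (Diag + n * Off)"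
    proof (cases "n = 0")
      case True
      then show ?thesis using c L U by (simp add: Diag_def)
    next
      case False
      then show ?thesis using main n0 by simp
    qed
    also have "\<dots> \<le> 2 * c3 * L ^ 4 * U powr (1 - 2 * \<sigma>) * ((c2 + C1) * L * (U + n * (U powr \<sigma>\<^sub>0 * T powr B)))"
    proof (rule mult_left_mono)
      have "0 \<le> c2 * L * (n * (U powr \<sigma>\<^sub>0 * T powr B))" "0 \<le> C1 * L * U"
        using c C1 L U n0 by auto
      then show "Diag + n * Off \<le> (c2 + C1) * L * (U + n * (U powr \<sigma>\<^sub>0 * T powr B))"
        by (simp add: Diag_def Off_def algebra_simps)
    qed (use c L in auto)
    also have "\<dots> = C * L ^ 5 * U powr (1 - 2 * \<sigma>) * (U + n * (U powr \<sigma>\<^sub>0 * T powr B))"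
    proof -
      have "L ^ 5 = L ^ 4 * L" by (simp add: numeral_eq_Suc)
      then show ?thesis unfolding C_def by (simp only: mult_ac)
    qed
    finally show "real (card S) * V\<^sup>2 \<le> C * ln T ^ 5 * U powr (1 - 2 * \<sigma>) * (U + real (card S) * (U powr \<sigma>\<^sub>0 * T powr B))"
      by (simp add: n_def L_def)
  qed
qed

text \<open>The range is cut into blocks from e^j to e^(j + 1). There are at most p = (\<kappa> + 1)
  ln T of them, so at each point some block reaches V / p. The last hypothesis makes the
  off-diagonal term at most half of the left side, which absorbs it, and lets Q V^2 bound the
  diagonal term. The factor p^2 raises (ln T)^5 to (ln T)^7, and summing over the blocks adds one
  more.\<close>

lemma large_values_dyadic:
  assumes \<kappa>: "0 \<le> \<kappa>"
  obtains C T0 where "0 < C" "64 \<le> T0"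
    "\<And>T Xl Xu V Q \<sigma> S F c. T0 \<le> T \<Longrightarrow> 1 \<le> Xl \<Longrightarrow> Xl \<le> Xu \<Longrightarrow> Xu \<le> T powr \<kappa> \<Longrightarrow> 0 \<le> \<sigma> \<Longrightarrow> \<sigma> \<le> 3 \<Longrightarrow>
      finite S \<Longrightarrow> \<forall>s\<in>S. \<sigma> \<le> Re s \<and> Re s \<le> \<sigma> + 1 / 2 \<and> \<bar>Im s\<bar> \<le> 2 * T \<Longrightarrow>
      \<forall>s\<in>S. \<forall>s'\<in>S. s \<noteq> s' \<longrightarrow> 2 * ln T \<le> \<bar>Im s - Im s'\<bar> \<Longrightarrow>
      F \<subseteq> {M. Xl \<le> g M \<and> g M \<le> Xu} \<Longrightarrow> \<forall>M\<in>F. norm (c M) \<le> divs M \<Longrightarrow>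
      0 < V \<Longrightarrow> \<forall>s\<in>S. V \<le> norm (\<Sum>M\<in>F. c M * dterm M s) \<Longrightarrow> 0 \<le> Q \<Longrightarrow>
      \<forall>U. 1 \<le> U \<and> Xl \<le> exp 1 * U \<and> U \<le> Xu \<longrightarrow>
        C * ln T ^ 7 * (U powr (1 - 2 * \<sigma> + \<sigma>\<^sub>0) * T powr B) \<le> V\<^sup>2 \<and> U powr (2 - 2 * \<sigma>) \<le> Q * V\<^sup>2 \<Longrightarrow>
      real (card S) \<le> C * ln T ^ 8 * Q"
proof -
  obtain C1 T1 where C1: "0 < C1" "64 \<le> T1"
    "\<And>T U V \<sigma> S F c. T1 \<le> T \<Longrightarrow> 1 \<le> U \<Longrightarrow> U \<le> T powr \<kappa> \<Longrightarrow> 0 \<le> \<sigma> \<Longrightarrow> \<sigma> \<le> 3 \<Longrightarrow>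
      finite S \<Longrightarrow> \<forall>s\<in>S. \<sigma> \<le> Re s \<and> Re s \<le> \<sigma> + 1 / 2 \<and> \<bar>Im s\<bar> \<le> 2 * T \<Longrightarrow>
      \<forall>s\<in>S. \<forall>s'\<in>S. s \<noteq> s' \<longrightarrow> 2 * ln T \<le> \<bar>Im s - Im s'\<bar> \<Longrightarrow>
      F \<subseteq> {M. U \<le> g M \<and> g M \<le> exp 1 * U} \<Longrightarrow> \<forall>M\<in>F. norm (c M) \<le> divs M \<Longrightarrow>
      0 \<le> V \<Longrightarrow> \<forall>s\<in>S. V \<le> norm (\<Sum>M\<in>F. c M * dterm M s) \<Longrightarrow>
      real (card S) * V\<^sup>2 \<le> C1 * ln T ^ 5 * U powr (1 - 2 * \<sigma>) * (U + real (card S) * (U powr \<sigma>\<^sub>0 * T powr B))"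
    by (rule large_values[OF \<kappa>]) (rule that)
  define C where "C = 2 * C1 * (\<kappa> + 1) ^ 3"
  show ?thesis
  proof (rule that[OF _ C1(2)])
    show "0 < C" using C1 \<kappa> by (simp add: C_def)
    fix T Xl Xu V Q \<sigma> :: real and S F and c :: "nat multiset \<Rightarrow> complex"
    assume T: "T1 \<le> T" and X: "1 \<le> Xl" "Xl \<le> Xu" "Xu \<le> T powr \<kappa>" and \<sigma>: "0 \<le> \<sigma>" "\<sigma> \<le> 3"
      and finS: "finite S" and S: "\<forall>s\<in>S. \<sigma> \<le> Re s \<and> Re s \<le> \<sigma> + 1 / 2 \<and> \<bar>Im s\<bar> \<le> 2 * T"
      and sep: "\<forall>s\<in>S. \<forall>s'\<in>S. s \<noteq> s' \<longrightarrow> 2 * ln T \<le> \<bar>Im s - Im s'\<bar>"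
      and F: "F \<subseteq> {M. Xl \<le> g M \<and> g M \<le> Xu}" and cM: "\<forall>M\<in>F. norm (c M) \<le> divs M"
      and V: "0 < V" "\<forall>s\<in>S. V \<le> norm (\<Sum>M\<in>F. c M * dterm M s)" and Q: "0 \<le> Q"
      and cond: "\<forall>U. 1 \<le> U \<and> Xl \<le> exp 1 * U \<and> U \<le> Xu \<longrightarrow>
        C * ln T ^ 7 * (U powr (1 - 2 * \<sigma> + \<sigma>\<^sub>0) * T powr B) \<le> V\<^sup>2 \<and> U powr (2 - 2 * \<sigma>) \<le> Q * V\<^sup>2"
    define L p where "L = ln T" and "p = (\<kappa> + 1) * L"
    have T64: "64 \<le> T" using T C1(2) by simp
    have L: "1 \<le> L" using ln_square_large[OF T64] by (simp add: L_def)
    have L7: "L ^ 7 = L ^ 5 * L\<^sup>2" and L8: "L ^ 8 = L * L ^ 7"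
      and k3: "(\<kappa> + 1) ^ 3 = (\<kappa> + 1) * (\<kappa> + 1)\<^sup>2" by (simp_all flip: power_add power_Suc)
    have p: "1 \<le> p" using mult_mono[of 1 "\<kappa> + 1" 1 L] \<kappa> L by (simp add: p_def)
    have finF: "finite F" by (rule finite_subset[OF F finite_subset[OF _ finite_g_le[of Xu]]]) auto
    define k where "k M = nat \<lfloor>ln (g M)\<rfloor>" for M
    define D where "D j s = (\<Sum>M\<in>{M\<in>F. k M = j}. c M * dterm M s)" for j s
    define Sj where "Sj j = {s\<in>S. V / p \<le> norm (D j s)}" for j
    have k: "exp (real (k M)) \<le> g M" "g M \<le> exp 1 * exp (real (k M))" for M
    proof -
      have "0 \<le> ln (g M)" using g_ge_1[of M] by simp
      then have "real (k M) \<le> ln (g M)" "ln (g M) \<le> 1 + real (k M)" unfolding k_def by linarith+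
      then have "exp (real (k M)) \<le> exp (ln (g M))" "exp (ln (g M)) \<le> exp (1 + real (k M))"
        by (simp_all only: exp_le_cancel_iff)
      then show "exp (real (k M)) \<le> g M" "g M \<le> exp 1 * exp (real (k M))" by (simp_all add: exp_add)
    qed
    have cardk: "real (card (k ` F)) \<le> p"
    proof -
      have lnX: "0 \<le> ln Xu" "ln Xu \<le> \<kappa> * L"
      proof -
        show "0 \<le> ln Xu" using X by simp
        have "ln Xu \<le> ln (T powr \<kappa>)" using X T64 by (intro ln_mono) auto
        then show "ln Xu \<le> \<kappa> * L" using T64 by (simp add: L_def ln_powr)
      qed
      have "k ` F \<subseteq> {..nat \<lfloor>ln Xu\<rfloor>}"
      proof
        fix j assume "j \<in> k ` F"
        then obtain M where M: "M \<in> F" "j = k M" by auto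
        then have "ln (g M) \<le> ln Xu" using F by (intro ln_mono) auto
        then show "j \<in> {..nat \<lfloor>ln Xu\<rfloor>}" unfolding M(2) k_def by (simp add: nat_mono floor_mono)
      qed
      then have "card (k ` F) \<le> card {..nat \<lfloor>ln Xu\<rfloor>}" by (intro card_mono) auto
      then have "real (card (k ` F)) \<le> real (Suc (nat \<lfloor>ln Xu\<rfloor>))" by simp
      also have "\<dots> \<le> ln Xu + 1" using lnX(1) by simp
      also have "\<dots> \<le> p" using lnX L by (simp add: p_def algebra_simps)
      finally show ?thesis .
    qed
    have cover: "S \<subseteq> (\<Union>j\<in>k ` F. Sj j)"
    proof
      fix s assume s: "s \<in> S"
      show "s \<in> (\<Union>j\<in>k ` F. Sj j)"
      proof (rule ccontr)
        assume "s \<notin> (\<Union>j\<in>k ` F. Sj j)"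
        then have small: "norm (D j s) \<le> V / p" "norm (D j s) \<noteq> V / p" if "j \<in> k ` F" for j
          using s that by (auto simp: Sj_def not_le less_imp_le)
        have Veq: "(\<Sum>M\<in>F. c M * dterm M s) = (\<Sum>j\<in>k ` F. D j s)"
          unfolding D_def using finF by (intro sum.group[symmetric]) auto
        have "F \<noteq> {}" using V s by force
        then have "(\<Sum>j\<in>k ` F. norm (D j s)) < (\<Sum>j\<in>k ` F. V / p)"
          using finF small by (intro sum_strict_mono) (auto simp: order_le_less)
        also have "\<dots> = real (card (k ` F)) * (V / p)" by simp
        also have "\<dots> \<le> p * (V / p)" using cardk V p by (intro mult_right_mono) auto
        also have "\<dots> = V" using p by simp
        finally have "norm (\<Sum>M\<in>F. c M * dterm M s) < V"
          unfolding Veq using norm_sum[of "\<lambda>j. D j s" "k ` F"] by linarith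
        then show False using V s by force
      qed
    qed
    have piece: "real (card (Sj j)) \<le> 2 * C1 * (\<kappa> + 1)\<^sup>2 * L ^ 7 * Q" if j: "j \<in> k ` F" for j
    proof -
      define U where "U = exp (real j)"
      obtain M where M: "M \<in> F" "j = k M" using j by auto
      \<comment> \<open>The lowest block may start below \<open>Xl\<close>, but by at most a factor
        e; this is why the hypothesis ranges over \<open>Xl \<le> exp 1 * U\<close>.\<close>
      have U: "1 \<le> U" "Xl \<le> exp 1 * U" "U \<le> Xu"
        using k[of M] M F unfolding U_def by force+
      define n where "n = real (card (Sj j))"
      have n0: "0 \<le> n" by (simp add: n_def)
      have lv: "n * (V / p)\<^sup>2 \<le> C1 * ln T ^ 5 * U powr (1 - 2 * \<sigma>) * (U + n * (U powr \<sigma>\<^sub>0 * T powr B))"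
        unfolding n_def
      proof (rule C1(3)[OF T U(1) _ \<sigma>])
        show "U \<le> T powr \<kappa>" using U X by linarith
        show "finite (Sj j)" using finS by (simp add: Sj_def)
        show "\<forall>s\<in>Sj j. \<sigma> \<le> Re s \<and> Re s \<le> \<sigma> + 1 / 2 \<and> \<bar>Im s\<bar> \<le> 2 * T" using S by (auto simp: Sj_def)
        show "\<forall>s\<in>Sj j. \<forall>s'\<in>Sj j. s \<noteq> s' \<longrightarrow> 2 * ln T \<le> \<bar>Im s - Im s'\<bar>" using sep by (auto simp: Sj_def)
        show "{M\<in>F. k M = j} \<subseteq> {M. U \<le> g M \<and> g M \<le> exp 1 * U}" using k by (auto simp: U_def)
        show "\<forall>M\<in>{M\<in>F. k M = j}. norm (c M) \<le> divs M" using cM by auto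
        show "0 \<le> V / p" using V p by simp
        show "\<forall>s\<in>Sj j. V / p \<le> norm (\<Sum>M\<in>{M\<in>F. k M = j}. c M * dterm M s)" by (auto simp: Sj_def D_def)
      qed
      have co: "C * L ^ 7 * (U powr (1 - 2 * \<sigma> + \<sigma>\<^sub>0) * T powr B) \<le> V\<^sup>2" "U powr (2 - 2 * \<sigma>) \<le> Q * V\<^sup>2"
        using cond U by (auto simp: L_def)
      define a where "a = C1 * L ^ 5 * (U powr (1 - 2 * \<sigma> + \<sigma>\<^sub>0) * T powr B)"
      have pp: "p\<^sup>2 = (\<kappa> + 1)\<^sup>2 * L\<^sup>2" by (simp add: p_def power_mult_distrib)
      \<comment> \<open>Two of the three factors \<kappa> + 1 in \<open>C\<close> are used up by p^2
        here; the third pays for the sum over the blocks.\<close>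
      have a: "2 * a * p\<^sup>2 \<le> V\<^sup>2"
      proof -
        have a0: "0 \<le> a" using C1 L by (simp add: a_def)
        have "2 * a * p\<^sup>2 = 2 * C1 * (\<kappa> + 1)\<^sup>2 * L ^ 7 * (U powr (1 - 2 * \<sigma> + \<sigma>\<^sub>0) * T powr B)"
          unfolding pp a_def L7 by (simp only: mult_ac)
        also have "\<dots> \<le> C * L ^ 7 * (U powr (1 - 2 * \<sigma> + \<sigma>\<^sub>0) * T powr B)"
          unfolding C_def using C1 \<kappa> L power_increasing[of 2 3 "\<kappa> + 1"]
          by (intro mult_right_mono mult_left_mono) auto
        also have "\<dots> \<le> V\<^sup>2" by (rule co)
        finally show ?thesis .
      qed
      have "n * V\<^sup>2 = n * (V / p)\<^sup>2 * p\<^sup>2" using p by (simp add: power_divide)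
      also have "\<dots> \<le> C1 * ln T ^ 5 * U powr (1 - 2 * \<sigma>) * (U + n * (U powr \<sigma>\<^sub>0 * T powr B)) * p\<^sup>2"
        using lv by (intro mult_right_mono) auto
      also have "\<dots> = C1 * L ^ 5 * (U powr (1 - 2 * \<sigma>) * U powr 1) * p\<^sup>2
          + n * (C1 * L ^ 5 * (U powr (1 - 2 * \<sigma>) * U powr \<sigma>\<^sub>0 * T powr B)) * p\<^sup>2"
        using U by (simp add: L_def algebra_simps)
      also have "U powr (1 - 2 * \<sigma>) * U powr 1 = U powr (2 - 2 * \<sigma>)"
        unfolding powr_add[symmetric] by (simp add: algebra_simps)
      also have "U powr (1 - 2 * \<sigma>) * U powr \<sigma>\<^sub>0 = U powr (1 - 2 * \<sigma> + \<sigma>\<^sub>0)"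
        by (simp only: powr_add[symmetric])
      also have "n * (C1 * L ^ 5 * (U powr (1 - 2 * \<sigma> + \<sigma>\<^sub>0) * T powr B)) * p\<^sup>2 = n * (2 * a * p\<^sup>2) / 2"
        by (simp add: a_def)
      finally have "n * V\<^sup>2 \<le> C1 * L ^ 5 * U powr (2 - 2 * \<sigma>) * p\<^sup>2 + n * (2 * a * p\<^sup>2) / 2" .
      moreover have "n * (2 * a * p\<^sup>2) \<le> n * V\<^sup>2" using a n0 by (rule mult_left_mono)
      ultimately have "n * V\<^sup>2 \<le> 2 * (C1 * L ^ 5 * U powr (2 - 2 * \<sigma>) * p\<^sup>2)" by linarith
      also have "\<dots> \<le> 2 * (C1 * L ^ 5 * (Q * V\<^sup>2) * p\<^sup>2)"
        using co(2) C1 L by (intro mult_left_mono mult_right_mono) auto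
      also have "\<dots> = 2 * C1 * (\<kappa> + 1)\<^sup>2 * L ^ 7 * Q * V\<^sup>2"
        unfolding pp L7 by (simp only: mult_ac)
      finally show ?thesis using V by (simp add: n_def)
    qed
    have "real (card S) \<le> real (card (\<Union>j\<in>k ` F. Sj j))"
      using cover finF finS by (intro of_nat_mono card_mono) (auto simp: Sj_def)
    also have "\<dots> \<le> (\<Sum>j\<in>k ` F. real (card (Sj j)))"
      using card_UN_le[of "k ` F" Sj] finF by (simp flip: of_nat_sum)
    also have "\<dots> \<le> (\<Sum>j\<in>k ` F. 2 * C1 * (\<kappa> + 1)\<^sup>2 * L ^ 7 * Q)" by (intro sum_mono piece)
    also have "\<dots> = real (card (k ` F)) * (2 * C1 * (\<kappa> + 1)\<^sup>2 * L ^ 7 * Q)" by simp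
    also have "\<dots> \<le> p * (2 * C1 * (\<kappa> + 1)\<^sup>2 * L ^ 7 * Q)"
      using cardk C1 L Q by (intro mult_right_mono) auto
    also have "\<dots> = C * L ^ 8 * Q" unfolding C_def p_def L8 k3 by (simp only: mult_ac)
    finally show "real (card S) \<le> C * ln T ^ 8 * Q" by (simp add: L_def)
  qed
qed

subsection \<open>The second estimate\<close>

text \<open>At a zero f = Z M - 1 - P1 equals -(1 + P1). If all four polynomials were small, the
  two-line bound would give |f| \<le> 1/4 there, while |P1| < 1/2 forces |f| > 1/2. On the critical
  line Z is at most a constant times T^B, which leaves the mollifier and P1; on Re s = 3 the series
  of f starts beyond Y, and only its part up to Y^4 matters.\<close>

lemma zero_detection:
  assumes \<delta>: "0 < \<delta>"
  obtains c T0 where "0 < c" "64 \<le> T0"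
    "\<And>T \<alpha> X Y \<rho>. T0 \<le> T \<Longrightarrow> \<sigma>\<^sub>0 + \<delta> \<le> \<alpha> \<Longrightarrow> 1 \<le> X \<Longrightarrow> X \<le> Y \<Longrightarrow> Y \<le> T powr \<kappa> \<Longrightarrow>
      ln T ^ 5 \<le> Y powr (\<alpha> - \<sigma>\<^sub>0) \<Longrightarrow>
      Z \<rho> = 0 \<Longrightarrow> \<alpha> \<le> Re \<rho> \<Longrightarrow> Re \<rho> \<le> 1 \<Longrightarrow> ln T + 2 \<le> \<bar>Im \<rho>\<bar> \<Longrightarrow> \<bar>Im \<rho>\<bar> \<le> T \<Longrightarrow>
      1 / 2 \<le> norm (\<Sum>M | X < g M \<and> g M \<le> Y. mcoeff X M * dterm M \<rho>)
      \<or> (\<exists>t. \<bar>t - Im \<rho>\<bar> \<le> ln T \<and> c * Y powr (\<alpha> - \<sigma>\<^sub>0) / (ln T * T powr B)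
            \<le> norm (\<Sum>M | g M \<le> X. mu M * dterm M (Complex \<sigma>\<^sub>0 t)))
      \<or> (\<exists>t. \<bar>t - Im \<rho>\<bar> \<le> ln T \<and> c * Y powr (\<alpha> - \<sigma>\<^sub>0) / ln T
            \<le> norm (\<Sum>M | X < g M \<and> g M \<le> Y. mcoeff X M * dterm M (Complex \<sigma>\<^sub>0 t)))
      \<or> (\<exists>t. \<bar>t - Im \<rho>\<bar> \<le> ln T \<and> c * Y powr (\<alpha> - 3) / ln T
            \<le> norm (\<Sum>M | Y < g M \<and> g M \<le> Y ^ 4. mcoeff X M * dterm M (Complex 3 t)))"
proof -
  obtain K1 where K1: "0 < K1"
    "\<And>s. \<sigma>\<^sub>0 \<le> Re s \<Longrightarrow> Re s \<le> 4 \<Longrightarrow> 1 \<le> \<bar>Im s\<bar> \<Longrightarrow> norm (Z s) \<le> K1 * \<bar>Im s\<bar>"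
    by (rule Z_linear_growth[of \<sigma>\<^sub>0 4]) (use sigma0_props in auto)
  define D2 where "D2 = (\<Sum>\<^sub>\<infinity>M. divs M * g M powr - 2)"
  have sum2: "(\<lambda>M. divs M * g M powr - 2) summable_on S" for S
    by (rule summable_on_subset_banach[OF summable_divs[of 2]]) auto
  have d0: "0 \<le> divs M" for M using divs_ge_1[of M] by simp
  have D2: "0 \<le> D2" unfolding D2_def by (intro infsum_nonneg) (simp add: d0)
  have sub2: "(\<Sum>\<^sub>\<infinity>M\<in>S. divs M * g M powr - 2) \<le> D2" for S
    unfolding D2_def by (intro infsum_mono_neutral sum2) (auto simp: d0)
  define Mc where "Mc = 2 * K1 * (A + C0) + 1 + D2"
  have Mc: "0 < Mc" using K1 A_pos C0_pos D2 by (simp add: Mc_def add_pos_nonneg)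
  \<comment> \<open>The horizontal sides contribute at most 6 exp 9 Mc Y^5 T exp (- L^2); the
    further factor 8 makes this at most 1/8.\<close>
  have "0 < 48 * exp 9 * Mc" using Mc by simp
  then obtain T1 where T1: "exp 1 \<le> T1"
    "\<And>T. T1 \<le> T \<Longrightarrow> 48 * exp 9 * Mc * T powr (5 * \<kappa> + 1) * exp (- ((ln T)\<^sup>2)) \<le> 1"
    by (rule gaussian_beats_power) (rule that)
  \<comment> \<open>Makes the bound for the two vertical lines together exactly 1/8. Then
    \<open>c\<close> also divides by 4 and by the constant of the critical-line bound at heights up
    to 2 T, so that each of the three terms of f stays below a quarter of the allowance.\<close>
  define c' where "c' = 1 / (16 * exp 9 * (1 / \<delta> + 1))"
  define c where "c = c' / (4 * K0 * 2 powr B)"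
  have \<delta>1: "0 < 1 / \<delta> + 1" using \<delta> by (simp add: add_pos_pos)
  then have c': "0 < c'" by (simp add: c'_def)
  have c: "0 < c" using c' K0_ge_1 by (simp add: c_def)
  have K02: "1 \<le> K0 * 2 powr B"
    using mult_mono[of 1 K0 1 "2 powr B"] K0_ge_1 B_pos by (simp add: ge_one_powr_ge_zero)
  have cK: "K0 * 2 powr B * c = c' / 4" using K0_ge_1 by (simp add: c_def)
  have c4: "c \<le> c' / 4" using mult_right_mono[OF K02, of c] c unfolding cK by simp
  have ce: "exp 9 * (2 * c' / \<delta> + 2 * c') = 1 / 8"
  proof -
    have "exp 9 * (2 * c' / \<delta> + 2 * c') = (exp 9 * (1 / \<delta> + 1)) * 2 * c'" by (simp add: algebra_simps)
    also have "\<dots> = 1 / 8" unfolding c'_def using \<delta>1 by simp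
    finally show ?thesis .
  qed
  define R where "R = 4 / c' + 2 * D2 / c'"
  show ?thesis
  proof (rule that[of c "max (max 64 T1) (exp R)"])
    fix T \<alpha> X Y :: real and \<rho>
    assume T: "max (max 64 T1) (exp R) \<le> T" and \<alpha>: "\<sigma>\<^sub>0 + \<delta> \<le> \<alpha>" and X: "1 \<le> X" "X \<le> Y" "Y \<le> T powr \<kappa>"
      and Yw: "ln T ^ 5 \<le> Y powr (\<alpha> - \<sigma>\<^sub>0)"
      and \<rho>: "Z \<rho> = 0" "\<alpha> \<le> Re \<rho>" "Re \<rho> \<le> 1" "ln T + 2 \<le> \<bar>Im \<rho>\<bar>" "\<bar>Im \<rho>\<bar> \<le> T"
    define L where "L = ln T"
    have T64: "64 \<le> T" "T1 \<le> T" using T by auto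
    have L: "1 \<le> L" "4 * L \<le> T" using ln_square_large[OF T64(1)] by (auto simp: L_def)
    have Y: "1 \<le> Y" using X by simp
    have LR: "R \<le> L" using T T64 by (simp add: L_def ln_ge_iff)
    have L4: "4 / c' \<le> L ^ 4" "2 * D2 / c' \<le> L ^ 4"
    proof -
      have "L \<le> L ^ 4" using L power_increasing[of 1 4 L] by simp
      moreover have "0 \<le> 4 / c'" "0 \<le> 2 * D2 / c'" using c' D2 by auto
      ultimately show "4 / c' \<le> L ^ 4" "2 * D2 / c' \<le> L ^ 4" using LR unfolding R_def by linarith+
    qed
    define W where "W = Y powr (\<alpha> - \<sigma>\<^sub>0)"
    have L5: "L ^ 5 = L ^ 4 * L" by (simp add: numeral_eq_Suc)
    have W: "L ^ 4 * L \<le> W" using Yw unfolding L5[symmetric] by (simp add: W_def L_def)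
    have W0: "0 < W" using Y by (simp add: W_def)
    \<comment> \<open>The constant term -1 of f also has to be small against W / L. This is what the
      lower bound ln T ^ 5 for \<open>W\<close> provides.\<close>
    have W1: "1 \<le> c' / 4 * W / L"
    proof -
      have "4 / c' * L \<le> W" using mult_right_mono[OF L4(1), of L] L W by linarith
      then have "c' / 4 * (4 / c' * L) \<le> c' / 4 * W" using c' by (intro mult_left_mono) auto
      then show ?thesis using c' L by simp
    qed
    define P1 where "P1 s = (\<Sum>M | X < g M \<and> g M \<le> Y. mcoeff X M * dterm M s)" for s
    define P2 where "P2 s = (\<Sum>M | Y < g M \<and> g M \<le> Y ^ 4. mcoeff X M * dterm M s)" for s
    define f where "f s = Z s * mollifier X s - 1 - P1 s" for s
    have hol: "f holomorphic_on {s. \<theta> < Re s} - {1}"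
      unfolding f_def P1_def by (intro holomorphic_intros Z_holomorphic mollifier_holomorphic)
    have f3: "norm (f s) \<le> norm (P2 s) + D2 * Y powr - 4" if s: "Re s = 3" for s
    proof -
      have nm: "norm (mcoeff X M) \<le> divs M" for M by (rule norm_mcoeff_le)
      have sm: "(\<lambda>M. mcoeff X M * dterm M s) summable_on S" for S
        using s nm by (intro summable_dterm) auto
      have YY: "Y \<le> Y ^ 4" using Y power_increasing[of 1 4 Y] by simp
      have eq: "{M. X < g M} = {M. X < g M \<and> g M \<le> Y} \<union> ({M. Y < g M \<and> g M \<le> Y ^ 4} \<union> {M. Y ^ 4 < g M})"
        using X YY by auto
      have "Z s * mollifier X s - 1 = (\<Sum>\<^sub>\<infinity>M\<in>{M. X < g M}. mcoeff X M * dterm M s)"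
        using s X by (intro mollified_zeta) auto
      also have "\<dots> = P1 s + (\<Sum>\<^sub>\<infinity>M\<in>{M. Y < g M \<and> g M \<le> Y ^ 4} \<union> {M. Y ^ 4 < g M}. mcoeff X M * dterm M s)"
        unfolding eq P1_def using YY by (subst infsum_Un_disjoint[OF sm sm]) auto
      also have "\<dots> = P1 s + (P2 s + (\<Sum>\<^sub>\<infinity>M\<in>{M. Y ^ 4 < g M}. mcoeff X M * dterm M s))"
        unfolding P2_def by (subst infsum_Un_disjoint[OF sm sm]) auto
      finally have "f s = P2 s + (\<Sum>\<^sub>\<infinity>M\<in>{M. Y ^ 4 < g M}. mcoeff X M * dterm M s)"
        by (simp add: f_def)
      then have "norm (f s) \<le> norm (P2 s) + norm (\<Sum>\<^sub>\<infinity>M\<in>{M. Y ^ 4 < g M}. mcoeff X M * dterm M s)"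
        by (simp add: norm_triangle_ineq)
      also have "norm (\<Sum>\<^sub>\<infinity>M\<in>{M. Y ^ 4 < g M}. mcoeff X M * dterm M s)
          \<le> (\<Sum>\<^sub>\<infinity>M\<in>{M. Y ^ 4 < g M}. divs M * g M powr - Re s)"
        using s nm by (intro norm_infsum_dterm_le) auto
      also have "\<dots> \<le> (\<Sum>\<^sub>\<infinity>M\<in>{M. Y ^ 4 < g M}. divs M * g M powr - 2 * Y powr - 4)"
      proof (rule infsum_mono)
        show "(\<lambda>M. divs M * g M powr - Re s) summable_on {M. Y ^ 4 < g M}"
          by (rule summable_on_subset_banach[OF summable_divs]) (use s in auto)
        show "(\<lambda>M. divs M * g M powr - 2 * Y powr - 4) summable_on {M. Y ^ 4 < g M}"
          by (intro summable_on_cmult_left sum2)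
        fix M assume M: "M \<in> {M. Y ^ 4 < g M}"
        have "g M powr - Re s = g M powr - 2 * g M powr - 1"
          unfolding powr_add[symmetric] using s by simp
        also have "g M powr - 1 \<le> (Y ^ 4) powr - 1" using M Y by (intro powr_mono2') auto
        also have "(Y ^ 4) powr - 1 = Y powr - 4"
          using Y powr_powr[of Y 4 "- 1"] by simp
        finally have "g M powr - Re s \<le> g M powr - 2 * Y powr - 4" by simp
        then show "divs M * g M powr - Re s \<le> divs M * g M powr - 2 * Y powr - 4"
          using d0[of M] by (simp only: mult.assoc mult_left_mono)
      qed
      also have "\<dots> = (\<Sum>\<^sub>\<infinity>M\<in>{M. Y ^ 4 < g M}. divs M * g M powr - 2) * Y powr - 4"
        by (rule infsum_cmult_left')
      also have "\<dots> \<le> D2 * Y powr - 4" by (intro mult_right_mono sub2) simp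
      finally show ?thesis by simp
    qed
    have P1le: "norm (P1 s) \<le> D2 * Y\<^sup>2" if s: "0 \<le> Re s" for s
    proof -
      have "norm (P1 s) \<le> (\<Sum>M | X < g M \<and> g M \<le> Y. divs M * g M powr - 2 * Y\<^sup>2)"
        unfolding P1_def
      proof (rule sum_norm_le)
        fix M assume "M \<in> {M. X < g M \<and> g M \<le> Y}"
        then have M: "g M \<le> Y" by simp
        have "norm (mcoeff X M * dterm M s) \<le> divs M * 1"
          unfolding norm_mult norm_dterm
        proof (intro mult_mono norm_mcoeff_le)
          show "g M powr - Re s \<le> 1"
            using g_ge_1[of M] s by (simp add: powr_minus inverse_le_1_iff ge_one_powr_ge_zero)
        qed (auto simp: d0)
        also have "1 = g M powr - 2 * g M powr 2"
          unfolding powr_add[symmetric] using g_ge_1[of M] by simp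
        also have "g M powr 2 \<le> Y powr 2" using M g_ge_1[of M] by (intro powr_mono2) auto
        also have "Y powr 2 = Y\<^sup>2" using Y by simp
        finally show "norm (mcoeff X M * dterm M s) \<le> divs M * g M powr - 2 * Y\<^sup>2"
          using d0[of M] by (simp add: mult.assoc mult_left_mono)
      qed
      also have "\<dots> = (\<Sum>M | X < g M \<and> g M \<le> Y. divs M * g M powr - 2) * Y\<^sup>2"
        by (rule sum_distrib_right[symmetric])
      also have "\<dots> \<le> D2 * Y\<^sup>2"
        using sub2[of "{M. X < g M \<and> g M \<le> Y}"] by (intro mult_right_mono) auto
      finally show ?thesis .
    qed
    show "1 / 2 \<le> norm (\<Sum>M | X < g M \<and> g M \<le> Y. mcoeff X M * dterm M \<rho>)
      \<or> (\<exists>t. \<bar>t - Im \<rho>\<bar> \<le> ln T \<and> c * Y powr (\<alpha> - \<sigma>\<^sub>0) / (ln T * T powr B)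
            \<le> norm (\<Sum>M | g M \<le> X. mu M * dterm M (Complex \<sigma>\<^sub>0 t)))
      \<or> (\<exists>t. \<bar>t - Im \<rho>\<bar> \<le> ln T \<and> c * Y powr (\<alpha> - \<sigma>\<^sub>0) / ln T
            \<le> norm (\<Sum>M | X < g M \<and> g M \<le> Y. mcoeff X M * dterm M (Complex \<sigma>\<^sub>0 t)))
      \<or> (\<exists>t. \<bar>t - Im \<rho>\<bar> \<le> ln T \<and> c * Y powr (\<alpha> - 3) / ln T
            \<le> norm (\<Sum>M | Y < g M \<and> g M \<le> Y ^ 4. mcoeff X M * dterm M (Complex 3 t)))"
      unfolding L_def[symmetric] W_def[symmetric] P1_def[symmetric] P2_def[symmetric] mollifier_def[symmetric]
    proof (rule ccontr)
      assume "\<not> (1 / 2 \<le> norm (P1 \<rho>)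
        \<or> (\<exists>t. \<bar>t - Im \<rho>\<bar> \<le> L \<and> c * W / (L * T powr B) \<le> norm (mollifier X (Complex \<sigma>\<^sub>0 t)))
        \<or> (\<exists>t. \<bar>t - Im \<rho>\<bar> \<le> L \<and> c * W / L \<le> norm (P1 (Complex \<sigma>\<^sub>0 t)))
        \<or> (\<exists>t. \<bar>t - Im \<rho>\<bar> \<le> L \<and> c * Y powr (\<alpha> - 3) / L \<le> norm (P2 (Complex 3 t))))"
      then have no: "norm (P1 \<rho>) < 1 / 2"
        "\<And>t. \<bar>t - Im \<rho>\<bar> \<le> L \<Longrightarrow> norm (mollifier X (Complex \<sigma>\<^sub>0 t)) < c * W / (L * T powr B)"
        "\<And>t. \<bar>t - Im \<rho>\<bar> \<le> L \<Longrightarrow> norm (P1 (Complex \<sigma>\<^sub>0 t)) < c * W / L"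
        "\<And>t. \<bar>t - Im \<rho>\<bar> \<le> L \<Longrightarrow> norm (P2 (Complex 3 t)) < c * Y powr (\<alpha> - 3) / L"
        unfolding not_le[symmetric] by blast+
      have win: "1 \<le> \<bar>t\<bar> \<and> \<bar>t\<bar> \<le> 2 * T" if "\<bar>t - Im \<rho>\<bar> \<le> L" for t
        using that \<rho> L by (auto simp: L_def)
      have b0: "norm (f (Complex \<sigma>\<^sub>0 t)) \<le> c' * W / L" if t: "\<bar>t - Im \<rho>\<bar> \<le> L" for t
      proof -
        have "norm (Z (Complex \<sigma>\<^sub>0 t)) \<le> K0 * \<bar>t\<bar> powr B" using win[OF t] by (intro critical) auto
        also have "\<dots> \<le> K0 * (2 * T) powr B"
          using K0_ge_1 B_pos win[OF t] by (intro mult_left_mono powr_mono2) auto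
        also have "\<dots> = K0 * 2 powr B * T powr B" using T64 by (simp add: powr_mult)
        finally have "norm (Z (Complex \<sigma>\<^sub>0 t) * mollifier X (Complex \<sigma>\<^sub>0 t))
            \<le> (K0 * 2 powr B * T powr B) * (c * W / (L * T powr B))"
          unfolding norm_mult using no(2)[OF t] K0_ge_1 by (intro mult_mono) auto
        also have "\<dots> = (K0 * 2 powr B * c) * W / L" using T64 by simp
        also have "\<dots> = c' / 4 * W / L" unfolding cK ..
        finally have 1: "norm (Z (Complex \<sigma>\<^sub>0 t) * mollifier X (Complex \<sigma>\<^sub>0 t)) \<le> c' / 4 * W / L" .
        have 2: "c * W / L \<le> c' / 4 * W / L" using c4 W0 L by (intro divide_right_mono mult_right_mono) auto
        have "norm (f (Complex \<sigma>\<^sub>0 t)) \<le> norm (Z (Complex \<sigma>\<^sub>0 t) * mollifier X (Complex \<sigma>\<^sub>0 t)) + 1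
            + norm (P1 (Complex \<sigma>\<^sub>0 t))"
          unfolding f_def
          using norm_triangle_ineq4[of "Z (Complex \<sigma>\<^sub>0 t) * mollifier X (Complex \<sigma>\<^sub>0 t) - 1" "P1 (Complex \<sigma>\<^sub>0 t)"]
            norm_triangle_ineq4[of "Z (Complex \<sigma>\<^sub>0 t) * mollifier X (Complex \<sigma>\<^sub>0 t)" 1] by simp
        also have "\<dots> \<le> 3 * (c' / 4 * W / L)" using 1 2 W1 no(3)[OF t] by linarith
        also have "\<dots> \<le> c' * W / L"
        proof -
          define q where "q = c' * W / L"
          have "0 \<le> q" using c' W0 L by (simp add: q_def)
          have e: "c' / 4 * W / L = q / 4" by (simp add: q_def)
          show ?thesis unfolding q_def[symmetric] e using \<open>0 \<le> q\<close> by linarith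
        qed
        finally show ?thesis .
      qed
      have b3: "norm (f (Complex 3 t)) \<le> c' * Y powr (\<alpha> - 3) / L" if t: "\<bar>t - Im \<rho>\<bar> \<le> L" for t
      proof -
        define V where "V = Y powr (\<alpha> - 3)"
        have V: "0 < V" using Y by (simp add: V_def)
        have "D2 * Y powr - 4 \<le> c' / 2 * V / L"
        proof -
          have "W \<le> Y powr (\<alpha> + 1)" unfolding W_def using Y sigma0_props by (intro powr_mono) linarith+
          then have a: "L ^ 4 * L \<le> Y powr (\<alpha> + 1)" using W by linarith
          have "2 * D2 / c' * L \<le> L ^ 4 * L" using L4(2) L by (intro mult_right_mono) auto
          then have "2 * D2 / c' * L \<le> Y powr (\<alpha> + 1)" using a by linarith
          then have "2 * D2 / c' * L * Y powr - 4 \<le> Y powr (\<alpha> + 1) * Y powr - 4"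
            by (intro mult_right_mono) auto
          also have "\<dots> = V" by (simp add: V_def flip: powr_add)
          finally have "c' / 2 * (2 * D2 / c' * L * Y powr - 4) \<le> c' / 2 * V"
            using c' by (intro mult_left_mono) auto
          then show ?thesis using c' L by (simp add: le_divide_eq mult_ac)
        qed
        moreover have "c * V / L \<le> c' / 4 * V / L" using c4 V L by (intro divide_right_mono mult_right_mono) auto
        moreover have "c' / 2 * V / L + c' / 4 * V / L \<le> c' * V / L"
        proof -
          define q where "q = c' * V / L"
          have "0 \<le> q" using c' V L by (simp add: q_def)
          have e: "c' / 4 * V / L = q / 4" "c' / 2 * V / L = q / 2" by (simp_all add: q_def)
          show ?thesis unfolding q_def[symmetric] e using \<open>0 \<le> q\<close> by linarith
        qed
        ultimately show ?thesis
          using f3[of "Complex 3 t"] no(4)[OF t] unfolding V_def by (simp only: complex.sel) linarith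
      qed
      have hor: "norm (f s) \<le> Mc * T * Y\<^sup>2"
        if s: "\<sigma>\<^sub>0 \<le> Re s" "Re s \<le> 3" "\<bar>Im s - Im \<rho>\<bar> = L" for s
      proof -
        have Ims: "1 \<le> \<bar>Im s\<bar>" "\<bar>Im s\<bar> \<le> 2 * T" using win[of "Im s"] s by auto
        have Y2: "Y \<le> Y\<^sup>2" "1 \<le> Y\<^sup>2" using Y power_increasing[of 1 2 Y] by (simp_all only: power_one_right one_le_power)
        have "norm (Z s) \<le> K1 * \<bar>Im s\<bar>" using s Ims by (intro K1) auto
        also have "\<dots> \<le> K1 * (2 * T)" using K1 Ims by (intro mult_left_mono) auto
        finally have "norm (Z s) \<le> K1 * (2 * T)" .
        moreover have "norm (mollifier X s) \<le> (A + C0) * Y\<^sup>2"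
        proof -
          have "norm (mollifier X s) \<le> (A + C0) * X"
            using s sigma0_props X by (intro norm_mollifier_le) linarith+
          also have "\<dots> \<le> (A + C0) * Y\<^sup>2" using X Y2 A_pos C0_pos by (intro mult_left_mono) auto
          finally show ?thesis .
        qed
        ultimately have "norm (Z s * mollifier X s) \<le> (K1 * (2 * T)) * ((A + C0) * Y\<^sup>2)"
          unfolding norm_mult using K1 T64 by (intro mult_mono) auto
        moreover have "norm (P1 s) \<le> D2 * Y\<^sup>2" using s sigma0_props by (intro P1le) linarith
        moreover have "D2 * Y\<^sup>2 \<le> D2 * T * Y\<^sup>2"
          using D2 T64 mult_left_mono[of 1 T D2] by (intro mult_right_mono) auto
        moreover have "1 \<le> T * Y\<^sup>2" using Y2 T64 mult_mono[of 1 T 1 "Y\<^sup>2"] by simp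
        moreover have "norm (f s) \<le> norm (Z s * mollifier X s) + 1 + norm (P1 s)"
          unfolding f_def using norm_triangle_ineq4[of "Z s * mollifier X s - 1" "P1 s"]
            norm_triangle_ineq4[of "Z s * mollifier X s" 1] by simp
        moreover have "Mc * T * Y\<^sup>2 = (K1 * (2 * T)) * ((A + C0) * Y\<^sup>2) + T * Y\<^sup>2 + D2 * T * Y\<^sup>2"
          by (simp add: Mc_def algebra_simps)
        ultimately show ?thesis by linarith
      qed
      have I0: "integral {Im \<rho> - L..Im \<rho> + L} (\<lambda>y. norm (f (Complex \<sigma>\<^sub>0 y))) \<le> 2 * c' * W"
      proof -
        have "integral {Im \<rho> - L..Im \<rho> + L} (\<lambda>y. norm (f (Complex \<sigma>\<^sub>0 y)))
            \<le> integral {Im \<rho> - L..Im \<rho> + L} (\<lambda>y. c' * W / L)"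
          using b0 sigma0_props
          by (intro integral_le integrable_continuous_interval continuous_intros vertical_continuous[OF hol])
            (auto simp: abs_le_iff)
        then show ?thesis using L by simp
      qed
      have I3: "integral {Im \<rho> - L..Im \<rho> + L} (\<lambda>y. norm (f (Complex 3 y))) \<le> 2 * c' * Y powr (\<alpha> - 3)"
      proof -
        have "integral {Im \<rho> - L..Im \<rho> + L} (\<lambda>y. norm (f (Complex 3 y)))
            \<le> integral {Im \<rho> - L..Im \<rho> + L} (\<lambda>y. c' * Y powr (\<alpha> - 3) / L)"
          using b3 theta_less_1
          by (intro integral_le integrable_continuous_interval continuous_intros vertical_continuous[OF hol])
            (auto simp: abs_le_iff)
        then show ?thesis using L by simp
      qed
      have "norm (f \<rho>) \<le> exp 9 * (
          Y powr (\<sigma>\<^sub>0 - Re \<rho>) / (Re \<rho> - \<sigma>\<^sub>0) * integral {Im \<rho> - L..Im \<rho> + L} (\<lambda>y. norm (f (Complex \<sigma>\<^sub>0 y)))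
          + Y powr (3 - Re \<rho>) / (3 - Re \<rho>) * integral {Im \<rho> - L..Im \<rho> + L} (\<lambda>y. norm (f (Complex 3 y)))
          + 6 * Y powr 3 * (Mc * T * Y\<^sup>2) * exp (- (L\<^sup>2)))"
      proof (rule two_line_bound_Z[OF _ _ _ _ L(1) Y hol _ hor])
        show "\<sigma>\<^sub>0 < Re \<rho>" using \<rho> \<alpha> \<delta> by linarith
        show "L + 1 \<le> \<bar>Im \<rho>\<bar>" using \<rho> by (simp add: L_def)
        show "Re \<rho> < 3" using \<rho> by simp
        show "(3 :: real) \<le> \<sigma>\<^sub>0 + 3" using sigma0_props by linarith
        show "0 \<le> Mc * T * Y\<^sup>2" using Mc T64 by simp
      qed
      also have "\<dots> \<le> exp 9 * (2 * c' / \<delta> + 2 * c' + 6 * Y powr 3 * (Mc * T * Y\<^sup>2) * exp (- (L\<^sup>2)))"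
      proof (intro mult_left_mono add_right_mono add_mono)
        have "Y powr (\<sigma>\<^sub>0 - Re \<rho>) / (Re \<rho> - \<sigma>\<^sub>0) * integral {Im \<rho> - L..Im \<rho> + L} (\<lambda>y. norm (f (Complex \<sigma>\<^sub>0 y)))
            \<le> Y powr (\<sigma>\<^sub>0 - \<alpha>) / \<delta> * (2 * c' * W)"
          using Y \<rho>(2) \<alpha> \<delta> I0 by (intro mult_mono frac_le powr_mono integral_nonneg
            integrable_continuous_interval continuous_intros vertical_continuous[OF hol]) (use sigma0_props in auto)
        also have "\<dots> = 2 * c' / \<delta> * (Y powr (\<sigma>\<^sub>0 - \<alpha>) * W)" by simp
        also have "Y powr (\<sigma>\<^sub>0 - \<alpha>) * W = 1" unfolding W_def powr_add[symmetric] using Y by simp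
        finally show "Y powr (\<sigma>\<^sub>0 - Re \<rho>) / (Re \<rho> - \<sigma>\<^sub>0) * integral {Im \<rho> - L..Im \<rho> + L} (\<lambda>y. norm (f (Complex \<sigma>\<^sub>0 y)))
            \<le> 2 * c' / \<delta>" by simp
        have "Y powr (3 - Re \<rho>) / (3 - Re \<rho>) * integral {Im \<rho> - L..Im \<rho> + L} (\<lambda>y. norm (f (Complex 3 y)))
            \<le> Y powr (3 - \<alpha>) / 1 * (2 * c' * Y powr (\<alpha> - 3))"
          using Y \<rho>(2,3) I3 by (intro mult_mono frac_le powr_mono integral_nonneg
            integrable_continuous_interval continuous_intros vertical_continuous[OF hol]) (use theta_less_1 in auto)
        also have "\<dots> = 2 * c' * (Y powr (3 - \<alpha>) * Y powr (\<alpha> - 3))" by simp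
        also have "Y powr (3 - \<alpha>) * Y powr (\<alpha> - 3) = 1" unfolding powr_add[symmetric] using Y by simp
        finally show "Y powr (3 - Re \<rho>) / (3 - Re \<rho>) * integral {Im \<rho> - L..Im \<rho> + L} (\<lambda>y. norm (f (Complex 3 y)))
            \<le> 2 * c'" by simp
      qed simp
      also have "\<dots> = exp 9 * (2 * c' / \<delta> + 2 * c') + exp 9 * (6 * Y powr 3 * (Mc * T * Y\<^sup>2) * exp (- (L\<^sup>2)))"
        by (simp only: distrib_left)
      also have "exp 9 * (2 * c' / \<delta> + 2 * c') = 1 / 8" by (rule ce)
      also have "exp 9 * (6 * Y powr 3 * (Mc * T * Y\<^sup>2) * exp (- (L\<^sup>2)))
          = 6 * exp 9 * Mc * ((Y powr 3 * Y\<^sup>2) * T) * exp (- (L\<^sup>2))" by (simp only: mult_ac)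
      also have "\<dots> \<le> 6 * exp 9 * Mc * T powr (5 * \<kappa> + 1) * exp (- (L\<^sup>2))"
      proof (intro mult_left_mono mult_right_mono)
        have "Y\<^sup>2 = Y powr 2" using Y by simp
        then have "Y powr 3 * Y\<^sup>2 = Y powr (3 + 2)" by (simp only: powr_add)
        then have "Y powr 3 * Y\<^sup>2 = Y powr 5" by simp
        also have "\<dots> \<le> (T powr \<kappa>) powr 5" using X Y by (intro powr_mono2) auto
        finally have "(Y powr 3 * Y\<^sup>2) * T \<le> (T powr \<kappa>) powr 5 * T" using T64 by (intro mult_right_mono) auto
        also have "\<dots> = T powr (5 * \<kappa> + 1)" using T64 by (simp add: powr_powr powr_add mult_ac)
        finally show "(Y powr 3 * Y\<^sup>2) * T \<le> T powr (5 * \<kappa> + 1)" .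
      qed (use Mc in auto)
      finally have "norm (f \<rho>) \<le> 1 / 8 + 6 * exp 9 * Mc * T powr (5 * \<kappa> + 1) * exp (- (L\<^sup>2))" by simp
      then have "norm (f \<rho>) \<le> 1 / 4" using T1(2)[OF T64(2)] by (simp add: L_def)
      moreover have "f \<rho> = - (1 + P1 \<rho>)" using \<rho> by (simp add: f_def)
      then have "1 - norm (P1 \<rho>) \<le> norm (f \<rho>)"
        using norm_diff_ineq[of 1 "P1 \<rho>"] by (simp only: norm_minus_cancel norm_one)
      ultimately show False using no(1) by linarith
    qed
  qed (use c in auto)
qed

(* X and Y balance the large value estimates at the zeros, on the critical line and on Re s = 3. *)
lemma parameters:
  assumes \<eta>: "0 < \<eta>"
  obtains \<kappa> k where "0 \<le> \<kappa>" "0 \<le> k"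
    "\<And>T \<alpha>. 64 \<le> T \<Longrightarrow> (3 + \<theta> + \<eta>) / 4 \<le> \<alpha> \<Longrightarrow> \<alpha> \<le> 1 \<Longrightarrow>
      \<exists>X Y. 1 \<le> X \<and> X \<le> Y \<and> Y \<le> T powr \<kappa> \<and>
        X powr ((4 * \<alpha> - 3 - \<theta>) / 2) = T powr B * ln T ^ 10 \<and>
        Y powr (2 * \<alpha> - 1 - \<theta>) = T powr (3 * B) * X powr ((1 - \<theta>) / 2) * ln T ^ 10 \<and>
        Y powr (2 - 2 * \<alpha>) \<le> T powr (8 * B * (3 * \<alpha> - 2 - \<theta>) * (1 - \<alpha>)
            / ((2 * \<alpha> - 1 - \<theta>) * (4 * \<alpha> - 3 - \<theta>))) * ln T powr k"
proof -
  define h where "h = 1 - \<theta>"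
  have h: "0 < h" "h \<le> 1" using theta_less_1 theta_nonneg by (auto simp: h_def)
  define \<kappa>1 \<kappa> k where "\<kappa>1 = (2 * B + 20) / \<eta>" and "\<kappa> = (3 * B + h / 2 * \<kappa>1 + 10) * 2 / h"
    and "k = (10 * h / \<eta> + 10) * 2 / h"
  have \<kappa>1: "0 \<le> \<kappa>1" using \<eta> B_pos by (simp add: \<kappa>1_def)
  have \<kappa>: "0 \<le> \<kappa>" using \<kappa>1 h B_pos by (simp add: \<kappa>_def)
  have k: "0 \<le> k" using \<eta> h by (simp add: k_def)
  show ?thesis
  proof (rule that[OF \<kappa> k])
    fix T \<alpha> :: real
    assume T: "64 \<le> T" and \<alpha>: "(3 + \<theta> + \<eta>) / 4 \<le> \<alpha>" "\<alpha> \<le> 1"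
    \<comment> \<open>D measures the distance to the left end of the range; D \<ge> \<eta> is what
      makes \<kappa> and k uniform in \<alpha>. The exponents in the conditions on X and Y are D /
      2, G and h / 2, linked by G = (D + h) / 2.\<close>
    define D G where "D = 4 * \<alpha> - 3 - \<theta>" and "G = 2 * \<alpha> - 1 - \<theta>"
    have D: "\<eta> \<le> D" "D \<le> h" "0 < D" using \<alpha> \<eta> by (auto simp: D_def h_def field_simps)
    have GD: "G = (D + h) / 2" by (simp add: G_def D_def h_def field_simps)
    have G: "h / 2 \<le> G" "0 < G" using D h by (auto simp: GD)
    define L where "L = ln T"
    define l where "l = ln L"
    have L: "1 \<le> L" using ln_square_large[OF T] by (simp add: L_def)
    have l: "0 \<le> l" "l \<le> L" using L ln_le_minus_one[of L] by (auto simp: l_def)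
    \<comment> \<open>x and y are the logarithms of X and Y, so both conditions become linear: D / 2
      times x is B L + 10 l, and G times y is 3 B L + h / 2 times x + 10 l.\<close>
    define x where "x = (2 * B * L + 20 * l) / D"
    define y where "y = (3 * B * L + h / 2 * x + 10 * l) / G"
    have x: "0 \<le> x" using B_pos L l D by (simp add: x_def)
    have Gy: "G * y = 3 * B * L + h / 2 * x + 10 * l" using G by (simp add: y_def)
    have Dx: "D / 2 * x = B * L + 10 * l" using D by (simp add: x_def)
    have TL: "T = exp L" "L = exp l" using T L by (auto simp: L_def l_def)
    have Tp: "T powr a = exp (a * L)" for a unfolding TL(1) by (simp add: powr_def)
    have Lp: "L powr a = exp (a * l)" for a using L by (simp add: powr_def l_def)
    have L10: "L ^ 10 = exp (10 * l)" using L Lp[of 10] by simp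
    have ep: "exp u powr a = exp (a * u)" for a u :: real by (simp add: powr_def)
    have xy: "x \<le> y"
    proof -
      have "G * x = D / 2 * x + h / 2 * x" by (simp add: GD field_simps)
      also have "\<dots> \<le> G * y" unfolding Dx Gy using B_pos L by simp
      finally show ?thesis using G by simp
    qed
    have y: "y \<le> \<kappa> * L"
    proof -
      have "x \<le> (2 * B * L + 20 * L) / \<eta>"
        unfolding x_def using l D \<eta> B_pos L by (intro frac_le) auto
      also have "\<dots> = \<kappa>1 * L" by (simp add: \<kappa>1_def field_simps)
      finally have hx: "h / 2 * x \<le> h / 2 * (\<kappa>1 * L)" using h by (intro mult_left_mono) auto
      have "y \<le> (3 * B * L + h / 2 * (\<kappa>1 * L) + 10 * L) / (h / 2)"
        unfolding y_def
      proof (rule frac_le)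
        show "0 \<le> 3 * B * L + h / 2 * (\<kappa>1 * L) + 10 * L" using h B_pos L \<kappa>1 by simp
        show "3 * B * L + h / 2 * x + 10 * l \<le> 3 * B * L + h / 2 * (\<kappa>1 * L) + 10 * L"
          by (intro add_mono mult_left_mono[OF l(2)] hx order_refl) simp
      qed (use G h in auto)
      also have "\<dots> = \<kappa> * L" using h by (simp add: \<kappa>_def field_simps)
      finally show ?thesis .
    qed
    define E where "E = 8 * B * (3 * \<alpha> - 2 - \<theta>) * (1 - \<alpha>) / (G * D)"
    \<comment> \<open>Eliminating x, the main part of y is B (3 D + h) L / (D G). Since 3 D + h = 4
      (3 \<alpha> - 2 - \<theta>), multiplication by 2 - 2 \<alpha> yields exactly the exponent of
      the second estimate. The remainder is a multiple of l = ln (ln T) and becomes a power of ln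
      T.\<close>
    have Yexp: "(2 - 2 * \<alpha>) * y \<le> E * L + k * l"
    proof -
      have 3: "4 * (3 * \<alpha> - 2 - \<theta>) = 3 * D + h" by (simp add: D_def h_def)
      define r where "r = (2 - 2 * \<alpha>) / G"
      have r: "0 \<le> r" "r \<le> 2 / h"
      proof -
        show "0 \<le> r" using \<alpha> G by (simp add: r_def)
        have "2 - 2 * \<alpha> \<le> 1" using \<alpha> \<eta> theta_nonneg by simp
        then have "r \<le> 1 / (h / 2)" unfolding r_def using G h by (intro frac_le) auto
        then show "r \<le> 2 / h" by simp
      qed
      have EL: "E = r * (B * (3 * D + h) / D)"
        unfolding E_def r_def 3[symmetric] by (simp add: field_simps)
      have xx: "h / 2 * x = h * (B * L) / D + (10 * h / D) * l"
        by (simp add: x_def field_simps add_divide_distrib)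
      have "(2 - 2 * \<alpha>) * y = r * (3 * B * L + h / 2 * x + 10 * l)"
        by (simp add: r_def y_def)
      also have "3 * B * L + h / 2 * x + 10 * l = B * (3 * D + h) / D * L + (10 * h / D + 10) * l"
        unfolding xx using D(3) by (simp add: field_simps)
      also have "r * (B * (3 * D + h) / D * L + (10 * h / D + 10) * l) = E * L + r * (10 * h / D + 10) * l"
        unfolding EL by (simp only: distrib_left[of r "B * (3 * D + h) / D * L"] mult.assoc)
      also have "r * (10 * h / D + 10) * l \<le> 2 / h * (10 * h / \<eta> + 10) * l"
      proof (intro mult_right_mono mult_mono add_right_mono r l)
        show "10 * h / D \<le> 10 * h / \<eta>" using D \<eta> h by (intro frac_le) auto
      qed (use D h in auto)
      also have "2 / h * (10 * h / \<eta> + 10) = k" by (simp add: k_def)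
      finally show ?thesis by simp
    qed
    have "1 \<le> exp x \<and> exp x \<le> exp y \<and> exp y \<le> T powr \<kappa> \<and>
        exp x powr (D / 2) = T powr B * L ^ 10 \<and>
        exp y powr G = T powr (3 * B) * exp x powr (h / 2) * L ^ 10 \<and>
        exp y powr (2 - 2 * \<alpha>) \<le> T powr E * L powr k"
      unfolding ep Tp Lp L10 exp_add[symmetric] exp_le_cancel_iff exp_inj_iff Gy Dx
      using x xy y Yexp by (simp add: add_ac)
    then show "\<exists>X Y. 1 \<le> X \<and> X \<le> Y \<and> Y \<le> T powr \<kappa> \<and>
        X powr ((4 * \<alpha> - 3 - \<theta>) / 2) = T powr B * ln T ^ 10 \<and>
        Y powr (2 * \<alpha> - 1 - \<theta>) = T powr (3 * B) * X powr ((1 - \<theta>) / 2) * ln T ^ 10 \<and>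
        Y powr (2 - 2 * \<alpha>) \<le> T powr (8 * B * (3 * \<alpha> - 2 - \<theta>) * (1 - \<alpha>)
            / ((2 * \<alpha> - 1 - \<theta>) * (4 * \<alpha> - 3 - \<theta>))) * ln T powr k"
      unfolding E_def D_def G_def h_def L_def by (intro exI)
  qed
qed

text \<open>The zeros fall into four classes according to the polynomial that detects them. X is
  chosen so that off-diagonal terms are absorbed at the zeros themselves, and Y so that they are
  absorbed for the mollifier on the critical line; the other two classes then follow. Each class is
  bounded through the same Q, of size Y^(2 - 2 \<alpha>) up to 10 logarithms, to which the block
  decomposition adds 8.\<close>

lemma separated_zeros_bound_large_values:
  assumes \<eta>: "0 < \<eta>"
  obtains C T0 k where "0 < C" "64 \<le> T0" "0 \<le> k"
    "\<And>T \<alpha> S. T0 \<le> T \<Longrightarrow> (3 + \<theta> + \<eta>) / 4 \<le> \<alpha> \<Longrightarrow> \<alpha> \<le> 1 \<Longrightarrow> finite S \<Longrightarrow>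
      S \<subseteq> {\<rho>. Z \<rho> = 0 \<and> \<alpha> \<le> Re \<rho> \<and> Re \<rho> \<le> 1 \<and> ln T + 2 \<le> \<bar>Im \<rho>\<bar> \<and> \<bar>Im \<rho>\<bar> \<le> T} \<Longrightarrow>
      \<forall>s\<in>S. \<forall>s'\<in>S. s \<noteq> s' \<longrightarrow> 4 * ln T \<le> \<bar>Im s - Im s'\<bar> \<Longrightarrow>
      real (card S) \<le> C * T powr (8 * B * (3 * \<alpha> - 2 - \<theta>) * (1 - \<alpha>)
            / ((2 * \<alpha> - 1 - \<theta>) * (4 * \<alpha> - 3 - \<theta>))) * ln T powr k"
proof -
  obtain \<kappa> k where \<kappa>: "0 \<le> \<kappa>" "0 \<le> k"
    "\<And>T \<alpha>. 64 \<le> T \<Longrightarrow> (3 + \<theta> + \<eta>) / 4 \<le> \<alpha> \<Longrightarrow> \<alpha> \<le> 1 \<Longrightarrow>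
      \<exists>X Y. 1 \<le> X \<and> X \<le> Y \<and> Y \<le> T powr \<kappa> \<and>
        X powr ((4 * \<alpha> - 3 - \<theta>) / 2) = T powr B * ln T ^ 10 \<and>
        Y powr (2 * \<alpha> - 1 - \<theta>) = T powr (3 * B) * X powr ((1 - \<theta>) / 2) * ln T ^ 10 \<and>
        Y powr (2 - 2 * \<alpha>) \<le> T powr (8 * B * (3 * \<alpha> - 2 - \<theta>) * (1 - \<alpha>)
            / ((2 * \<alpha> - 1 - \<theta>) * (4 * \<alpha> - 3 - \<theta>))) * ln T powr k"
    by (rule parameters[OF \<eta>]) (rule that)
  have \<kappa>4: "0 \<le> 4 * \<kappa>" using \<kappa> by simp
  obtain C1 T1 where C1: "0 < C1" "64 \<le> T1"
    "\<And>T Xl Xu V Q \<sigma> S F c. T1 \<le> T \<Longrightarrow> 1 \<le> Xl \<Longrightarrow> Xl \<le> Xu \<Longrightarrow> Xu \<le> T powr (4 * \<kappa>) \<Longrightarrow> 0 \<le> \<sigma> \<Longrightarrow> \<sigma> \<le> 3 \<Longrightarrow>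
      finite S \<Longrightarrow> \<forall>s\<in>S. \<sigma> \<le> Re s \<and> Re s \<le> \<sigma> + 1 / 2 \<and> \<bar>Im s\<bar> \<le> 2 * T \<Longrightarrow>
      \<forall>s\<in>S. \<forall>s'\<in>S. s \<noteq> s' \<longrightarrow> 2 * ln T \<le> \<bar>Im s - Im s'\<bar> \<Longrightarrow>
      F \<subseteq> {M. Xl \<le> g M \<and> g M \<le> Xu} \<Longrightarrow> \<forall>M\<in>F. norm (c M) \<le> divs M \<Longrightarrow>
      0 < V \<Longrightarrow> \<forall>s\<in>S. V \<le> norm (\<Sum>M\<in>F. c M * dterm M s) \<Longrightarrow> 0 \<le> Q \<Longrightarrow>
      \<forall>U. 1 \<le> U \<and> Xl \<le> exp 1 * U \<and> U \<le> Xu \<longrightarrow>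
        C1 * ln T ^ 7 * (U powr (1 - 2 * \<sigma> + \<sigma>\<^sub>0) * T powr B) \<le> V\<^sup>2 \<and> U powr (2 - 2 * \<sigma>) \<le> Q * V\<^sup>2 \<Longrightarrow>
      real (card S) \<le> C1 * ln T ^ 8 * Q"
    by (rule large_values_dyadic[OF \<kappa>4]) (rule that)
  have \<delta>: "0 < (1 - \<theta>) / 4" using theta_less_1 by simp
  obtain c T2 where c: "0 < c" and T2: "64 \<le> T2"
    "\<And>T \<alpha> X Y \<rho>. T2 \<le> T \<Longrightarrow> \<sigma>\<^sub>0 + (1 - \<theta>) / 4 \<le> \<alpha> \<Longrightarrow> 1 \<le> X \<Longrightarrow> X \<le> Y \<Longrightarrow> Y \<le> T powr \<kappa> \<Longrightarrow>
      ln T ^ 5 \<le> Y powr (\<alpha> - \<sigma>\<^sub>0) \<Longrightarrow>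
      Z \<rho> = 0 \<Longrightarrow> \<alpha> \<le> Re \<rho> \<Longrightarrow> Re \<rho> \<le> 1 \<Longrightarrow> ln T + 2 \<le> \<bar>Im \<rho>\<bar> \<Longrightarrow> \<bar>Im \<rho>\<bar> \<le> T \<Longrightarrow>
      1 / 2 \<le> norm (\<Sum>M | X < g M \<and> g M \<le> Y. mcoeff X M * dterm M \<rho>)
      \<or> (\<exists>t. \<bar>t - Im \<rho>\<bar> \<le> ln T \<and> c * Y powr (\<alpha> - \<sigma>\<^sub>0) / (ln T * T powr B)
            \<le> norm (\<Sum>M | g M \<le> X. mu M * dterm M (Complex \<sigma>\<^sub>0 t)))
      \<or> (\<exists>t. \<bar>t - Im \<rho>\<bar> \<le> ln T \<and> c * Y powr (\<alpha> - \<sigma>\<^sub>0) / ln T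
            \<le> norm (\<Sum>M | X < g M \<and> g M \<le> Y. mcoeff X M * dterm M (Complex \<sigma>\<^sub>0 t)))
      \<or> (\<exists>t. \<bar>t - Im \<rho>\<bar> \<le> ln T \<and> c * Y powr (\<alpha> - 3) / ln T
            \<le> norm (\<Sum>M | Y < g M \<and> g M \<le> Y ^ 4. mcoeff X M * dterm M (Complex 3 t)))"
    by (rule zero_detection[OF \<delta>, of \<kappa>]) (rule that)
  define R where "R = 4 * exp 5 * C1 + C1 * exp 5 / c\<^sup>2"
  define C5 where "C5 = 4 + exp 5 / c\<^sup>2"
  have C5: "0 < C5" "4 \<le> C5" "exp 5 / c\<^sup>2 \<le> C5" using c by (auto simp: C5_def add_pos_pos)
  show ?thesis
  proof (rule that[of "4 * C1 * C5" "max (max T1 T2) (exp R)" "k + 18"])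
    fix T \<alpha> :: real and S
    assume T: "max (max T1 T2) (exp R) \<le> T" and \<alpha>: "(3 + \<theta> + \<eta>) / 4 \<le> \<alpha>" "\<alpha> \<le> 1" and finS: "finite S"
      and S: "S \<subseteq> {\<rho>. Z \<rho> = 0 \<and> \<alpha> \<le> Re \<rho> \<and> Re \<rho> \<le> 1 \<and> ln T + 2 \<le> \<bar>Im \<rho>\<bar> \<and> \<bar>Im \<rho>\<bar> \<le> T}"
      and sep: "\<forall>s\<in>S. \<forall>s'\<in>S. s \<noteq> s' \<longrightarrow> 4 * ln T \<le> \<bar>Im s - Im s'\<bar>"
    define L where "L = ln T"
    have T12: "T1 \<le> T" "T2 \<le> T" and T64: "64 \<le> T" using T C1(2) by auto
    have L: "1 \<le> L" "4 * L \<le> T" using ln_square_large[OF T64] by (auto simp: L_def)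
    have LR: "4 * exp 5 * C1 \<le> L" "C1 * exp 5 \<le> c\<^sup>2 * L" "C1 \<le> c\<^sup>2 * L"
    proof -
      have "R \<le> L" using T T64 by (simp add: L_def ln_ge_iff)
      moreover have "0 \<le> 4 * exp 5 * C1" "0 \<le> C1 * exp 5 / c\<^sup>2" using C1 by auto
      ultimately have *: "4 * exp 5 * C1 \<le> L" "C1 * exp 5 / c\<^sup>2 \<le> L" unfolding R_def by linarith+
      then show "4 * exp 5 * C1 \<le> L" by simp
      show 2: "C1 * exp 5 \<le> c\<^sup>2 * L" using *(2) c by (simp add: divide_le_eq mult.commute)
      have "C1 * 1 \<le> C1 * exp 5" using C1 by (intro mult_left_mono) auto
      then show "C1 \<le> c\<^sup>2 * L" using 2 by linarith
    qed
    define D G h where "D = 4 * \<alpha> - 3 - \<theta>" and "G = 2 * \<alpha> - 1 - \<theta>" and "h = 1 - \<theta>"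
    define E where "E = 8 * B * (3 * \<alpha> - 2 - \<theta>) * (1 - \<alpha>) / (G * D)"
    have D: "0 \<le> D" "D \<le> 2" using \<alpha> \<eta> theta_nonneg by (auto simp: D_def field_simps)
    have h: "0 \<le> h" using theta_less_1 by (simp add: h_def)
    obtain X Y where "1 \<le> X \<and> X \<le> Y \<and> Y \<le> T powr \<kappa> \<and>
        X powr ((4 * \<alpha> - 3 - \<theta>) / 2) = T powr B * ln T ^ 10 \<and>
        Y powr (2 * \<alpha> - 1 - \<theta>) = T powr (3 * B) * X powr ((1 - \<theta>) / 2) * ln T ^ 10 \<and>
        Y powr (2 - 2 * \<alpha>) \<le> T powr (8 * B * (3 * \<alpha> - 2 - \<theta>) * (1 - \<alpha>)
            / ((2 * \<alpha> - 1 - \<theta>) * (4 * \<alpha> - 3 - \<theta>))) * ln T powr k"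
      using \<kappa>(3)[OF T64 \<alpha>] by (elim exE)
    then have X: "1 \<le> X" and XY: "X \<le> Y" and Y\<kappa>: "Y \<le> T powr \<kappa>"
      and XD: "X powr (D / 2) = T powr B * L ^ 10"
      and YG: "Y powr G = T powr (3 * B) * X powr (h / 2) * L ^ 10"
      and YE: "Y powr (2 - 2 * \<alpha>) \<le> T powr E * L powr k"
      unfolding D_def G_def h_def E_def L_def by blast+
    have Y: "1 \<le> Y" using X XY by simp
    define TB Ya W where "TB = T powr B" and "Ya = Y powr (2 - 2 * \<alpha>)" and "W = Y powr (\<alpha> - \<sigma>\<^sub>0)"
    have TB: "1 \<le> TB" using T64 B_pos by (simp add: TB_def ge_one_powr_ge_zero)
    have Ya: "1 \<le> Ya" using Y \<alpha> by (simp add: Ya_def ge_one_powr_ge_zero)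
    have W: "0 < W" using Y by (simp add: W_def)
    have X1: "1 \<le> X powr (h / 2)" using X h by (simp add: ge_one_powr_ge_zero)
    have W2: "W\<^sup>2 = Y powr G"
    proof -
      have "(\<alpha> - \<sigma>\<^sub>0) + (\<alpha> - \<sigma>\<^sub>0) = G" by (simp add: G_def field_simps)
      then show ?thesis unfolding W_def power2_eq_square powr_add[symmetric] by simp
    qed
    have TB3: "T powr (3 * B) = TB * (TB * TB)"
      unfolding TB_def powr_add[symmetric] by simp
    have L10: "L ^ 10 = L ^ 8 * L\<^sup>2" "L ^ 10 = L ^ 7 * L ^ 3" "L ^ 8 = L * L ^ 7" "L ^ 10 = (L ^ 5)\<^sup>2"
      by (simp_all flip: power_add power_Suc power_mult)
    have Lp: "1 \<le> L ^ n" for n using L by simp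
    have YG': "Y powr G = TB * TB * (TB * X powr (h / 2) * L ^ 8) * L\<^sup>2"
      unfolding YG TB3 L10(1) by (simp only: mult_ac)
    have WL: "L ^ 5 \<le> W"
    proof (rule power2_le_imp_le)
      have "1 \<le> TB * (TB * TB)" using TB by (simp add: one_le_mult_iff mult_ge1_I)
      then have "1 * 1 * L ^ 10 \<le> TB * (TB * TB) * X powr (h / 2) * L ^ 10"
        using X1 L by (intro mult_mono) auto
      then show "(L ^ 5)\<^sup>2 \<le> W\<^sup>2" unfolding W2 YG TB3 L10(4)[symmetric] by simp
    qed (use W in simp)
    have YD: "TB * L ^ 10 \<le> Y powr (D / 2)"
      unfolding TB_def XD[symmetric] using X XY D by (intro powr_mono2) auto
    define Q where "Q = C5 * L ^ 10 * Ya"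
    have Q0: "0 \<le> Q" using C5 L Ya by (simp add: Q_def)
    have Q4: "4 * Ya \<le> Q"
    proof -
      have "4 * 1 * Ya \<le> C5 * L ^ 10 * Ya" using C5 L Lp[of 10] Ya by (intro mult_mono) auto
      then show ?thesis by (simp add: Q_def)
    qed
    have Q5: "exp 5 / c\<^sup>2 * L ^ 10 * Ya \<le> Q" unfolding Q_def using C5(3) L Ya by (intro mult_right_mono) auto
    have Q1: "1 / c\<^sup>2 * L ^ 10 * Ya \<le> Q"
    proof -
      have "1 / c\<^sup>2 * L ^ 10 * Ya \<le> exp 5 / c\<^sup>2 * L ^ 10 * Ya"
        using L Ya by (intro mult_right_mono divide_right_mono) auto
      then show ?thesis using Q5 by linarith
    qed
    \<comment> \<open>A block may begin up to a factor e below x. For the decreasing powers that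
      occur, with exponents at most 5 in absolute value, this costs at most
      \<open>exp 5\<close>.\<close>
    have down: "U powr - m \<le> exp 5 * x powr - m" if U: "1 \<le> U" "x \<le> exp 1 * U" "0 < x" and m: "0 \<le> m" "m \<le> 5" for U x m :: real
    proof -
      have "x powr m \<le> (exp 1 * U) powr m" using U m by (intro powr_mono2) auto
      also have "\<dots> = exp m * U powr m" using U by (simp add: powr_mult powr_def[of "exp 1"])
      also have "\<dots> \<le> exp 5 * U powr m" using m by (intro mult_right_mono) auto
      finally have "x powr m * (U powr - m * x powr - m) \<le> exp 5 * U powr m * (U powr - m * x powr - m)"
        by (intro mult_right_mono) auto
      moreover have "x powr m * x powr - m = 1" "U powr m * U powr - m = 1"
        unfolding powr_add[symmetric] using U by auto
      ultimately show ?thesis by (metis mult.assoc mult.commute mult.right_neutral)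
    qed
    \<comment> \<open>Three of the classes detect at a point of another vertical line at height
      within L of the zero. Moving each zero to such a point is injective and reduces the spacing
      from 4 L to 2 L, which is what the large value estimate asks for.\<close>
    have shifted: "real (card S') \<le> C1 * L ^ 8 * Q"
      if S': "S' \<subseteq> S" and X': "1 \<le> Xl" "Xl \<le> Xu" "Xu \<le> T powr (4 * \<kappa>)" and \<sigma>: "0 \<le> \<sigma>" "\<sigma> \<le> 3"
        and F: "F \<subseteq> {M. Xl \<le> g M \<and> g M \<le> Xu}" "\<forall>M\<in>F. norm (cc M) \<le> divs M" and V: "0 < V"
        and ex: "\<forall>s\<in>S'. \<exists>t. \<bar>t - Im s\<bar> \<le> L \<and> V \<le> norm (\<Sum>M\<in>F. cc M * dterm M (Complex \<sigma> t))"
        and cond: "\<forall>U. 1 \<le> U \<and> Xl \<le> exp 1 * U \<and> U \<le> Xu \<longrightarrow>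
          C1 * L ^ 7 * (U powr (1 - 2 * \<sigma> + \<sigma>\<^sub>0) * T powr B) \<le> V\<^sup>2 \<and> U powr (2 - 2 * \<sigma>) \<le> Q * V\<^sup>2"
      for S' Xl Xu \<sigma> F cc V
    proof -
      obtain t where t: "\<forall>s\<in>S'. \<bar>t s - Im s\<bar> \<le> L \<and> V \<le> norm (\<Sum>M\<in>F. cc M * dterm M (Complex \<sigma> (t s)))"
        using bchoice[OF ex] by blast
      define \<tau> where "\<tau> s = Complex \<sigma> (t s)" for s
      have tsep: "2 * L \<le> \<bar>t s - t s'\<bar>" if "s \<in> S'" "s' \<in> S'" "s \<noteq> s'" for s s'
      proof -
        have "4 * L \<le> \<bar>Im s - Im s'\<bar>" using sep S' that by (auto simp: L_def)
        moreover have "\<bar>t s - Im s\<bar> \<le> L" "\<bar>t s' - Im s'\<bar> \<le> L" using t that by auto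
        ultimately show ?thesis by linarith
      qed
      have inj: "inj_on \<tau> S'"
      proof (rule inj_onI, rule ccontr)
        fix s s' assume s: "s \<in> S'" "s' \<in> S'" "\<tau> s = \<tau> s'" "s \<noteq> s'"
        then have "2 * L \<le> \<bar>t s - t s'\<bar>" by (intro tsep)
        then show False using s(3) L by (simp add: \<tau>_def)
      qed
      have "real (card (\<tau> ` S')) \<le> C1 * ln T ^ 8 * Q"
      proof (rule C1(3)[OF T12(1) X' \<sigma> _ _ _ F V _ Q0 cond[unfolded L_def]])
        show "finite (\<tau> ` S')" using finS S' by (auto intro: finite_subset)
        show "\<forall>s\<in>\<tau> ` S'. \<sigma> \<le> Re s \<and> Re s \<le> \<sigma> + 1 / 2 \<and> \<bar>Im s\<bar> \<le> 2 * T"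
        proof (rule ballI, elim imageE)
          fix z s assume s: "s \<in> S'" "z = \<tau> s"
          have "\<bar>t s - Im s\<bar> \<le> L" "\<bar>Im s\<bar> \<le> T" using t s S' S by auto
          then have "\<bar>t s\<bar> \<le> 2 * T" using L by linarith
          then show "\<sigma> \<le> Re z \<and> Re z \<le> \<sigma> + 1 / 2 \<and> \<bar>Im z\<bar> \<le> 2 * T" by (simp add: s(2) \<tau>_def)
        qed
        show "\<forall>s\<in>\<tau> ` S'. \<forall>s'\<in>\<tau> ` S'. s \<noteq> s' \<longrightarrow> 2 * ln T \<le> \<bar>Im s - Im s'\<bar>"
        proof (intro ballI impI, elim imageE)
          fix z z' s s' assume s: "z \<noteq> z'" "z = \<tau> s" "s \<in> S'" "z' = \<tau> s'" "s' \<in> S'"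
          then have "2 * L \<le> \<bar>t s - t s'\<bar>" by (intro tsep) auto
          then show "2 * ln T \<le> \<bar>Im z - Im z'\<bar>" by (simp add: s \<tau>_def L_def)
        qed
        show "\<forall>s\<in>\<tau> ` S'. V \<le> norm (\<Sum>M\<in>F. cc M * dterm M s)" using t by (auto simp: \<tau>_def)
      qed
      then show ?thesis unfolding card_image[OF inj] by (simp add: L_def)
    qed
    have Y4: "Y ^ 4 \<le> T powr (4 * \<kappa>)"
    proof -
      have "Y ^ 4 \<le> (T powr \<kappa>) ^ 4" using Y\<kappa> Y by (intro power_mono) auto
      also have "\<dots> = T powr (4 * \<kappa>)"
        using T64 powr_realpow[of "T powr \<kappa>" 4] by (simp add: powr_powr mult.commute)
      finally show ?thesis .
    qed
    have YY4: "Y \<le> Y ^ 4" using Y power_increasing[of 1 4 Y] by simp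
    define F1 where "F1 = {M. X < g M \<and> g M \<le> Y}"
    define F2 where "F2 = {M. Y < g M \<and> g M \<le> Y ^ 4}"
    define F0 where "F0 = {M. g M \<le> X}"
    have nm: "\<forall>M\<in>F. norm (mcoeff X M) \<le> divs M" for F using norm_mcoeff_le by blast
    have nmu: "\<forall>M\<in>F. norm (mu M) \<le> divs M" for F
      using norm_mu_le_1 divs_ge_1 order_trans by blast
    define Sa where "Sa = {s\<in>S. 1 / 2 \<le> norm (\<Sum>M\<in>F1. mcoeff X M * dterm M s)}"
    define Sb where "Sb = {s\<in>S. \<exists>t. \<bar>t - Im s\<bar> \<le> L \<and> c * W / (L * TB)
            \<le> norm (\<Sum>M\<in>F0. mu M * dterm M (Complex \<sigma>\<^sub>0 t))}"
    define Sc where "Sc = {s\<in>S. \<exists>t. \<bar>t - Im s\<bar> \<le> L \<and> c * W / L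
            \<le> norm (\<Sum>M\<in>F1. mcoeff X M * dterm M (Complex \<sigma>\<^sub>0 t))}"
    define Sd where "Sd = {s\<in>S. \<exists>t. \<bar>t - Im s\<bar> \<le> L \<and> c * Y powr (\<alpha> - 3) / L
            \<le> norm (\<Sum>M\<in>F2. mcoeff X M * dterm M (Complex 3 t))}"
    have cover: "S \<subseteq> Sa \<union> (Sb \<union> (Sc \<union> Sd))"
    proof
      fix \<rho> assume \<rho>: "\<rho> \<in> S"
      have "\<sigma>\<^sub>0 + (1 - \<theta>) / 4 \<le> \<alpha>" using \<alpha>(1) \<eta> by (simp add: field_simps)
      from T2(2)[OF T12(2) this X XY Y\<kappa> WL[unfolded W_def L_def], of \<rho>] S \<rho>
      show "\<rho> \<in> Sa \<union> (Sb \<union> (Sc \<union> Sd))"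
        unfolding Sa_def Sb_def Sc_def Sd_def W_def L_def F0_def F1_def F2_def TB_def by blast
    qed
    have e0: "1 - 2 * \<sigma>\<^sub>0 + \<sigma>\<^sub>0 = h / 2" "2 - 2 * \<sigma>\<^sub>0 = h" by (simp_all add: h_def field_simps)
    \<comment> \<open>At the zeros the off-diagonal power of U is -D / 2, largest at the lower end
      X. The choice X^(D / 2) = T^B L^10 leaves L^(-10) against the factor L^7.\<close>
    have "real (card Sa) \<le> C1 * ln T ^ 8 * Q"
    proof (rule C1(3)[OF T12(1) X XY _ _ _ _ _ _ _ nm _ _ Q0])
      show "Y \<le> T powr (4 * \<kappa>)" using YY4 Y4 by linarith
      show "0 \<le> \<alpha>" "\<alpha> \<le> 3" using \<alpha> \<eta> theta_nonneg by (auto simp: field_simps)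
      show "finite Sa" using finS by (simp add: Sa_def)
      have "1 \<le> \<alpha> + 1 / 2" using \<alpha>(1) \<eta> theta_nonneg by (simp add: field_simps)
      then show "\<forall>s\<in>Sa. \<alpha> \<le> Re s \<and> Re s \<le> \<alpha> + 1 / 2 \<and> \<bar>Im s\<bar> \<le> 2 * T"
        using S T64 unfolding Sa_def by fastforce
      show "\<forall>s\<in>Sa. \<forall>s'\<in>Sa. s \<noteq> s' \<longrightarrow> 2 * ln T \<le> \<bar>Im s - Im s'\<bar>"
        using sep L unfolding Sa_def L_def by fastforce
      show "F1 \<subseteq> {M. X \<le> g M \<and> g M \<le> Y}" by (auto simp: F1_def)
      show "(0 :: real) < 1 / 2" by simp
      show "\<forall>s\<in>Sa. 1 / 2 \<le> norm (\<Sum>M\<in>F1. mcoeff X M * dterm M s)" by (simp add: Sa_def)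
      show "\<forall>U. 1 \<le> U \<and> X \<le> exp 1 * U \<and> U \<le> Y \<longrightarrow>
        C1 * ln T ^ 7 * (U powr (1 - 2 * \<alpha> + \<sigma>\<^sub>0) * T powr B) \<le> (1 / 2)\<^sup>2 \<and> U powr (2 - 2 * \<alpha>) \<le> Q * (1 / 2)\<^sup>2"
        unfolding L_def[symmetric] TB_def[symmetric]
      proof (intro allI impI conjI)
        fix U assume U: "1 \<le> U \<and> X \<le> exp 1 * U \<and> U \<le> Y"
        have eD: "1 - 2 * \<alpha> + \<sigma>\<^sub>0 = - (D / 2)" by (simp add: D_def field_simps)
        define u where "u = U powr - (D / 2) * TB"
        have u0: "0 \<le> u" using TB by (simp add: u_def)
        have "u * L ^ 10 = U powr - (D / 2) * X powr (D / 2)"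
          unfolding u_def XD TB_def by (simp only: mult_ac)
        also have "\<dots> \<le> (exp 5 * X powr - (D / 2)) * X powr (D / 2)"
          using U X D by (intro mult_right_mono down) auto
        also have "\<dots> = exp 5" using X by (simp add: mult.assoc flip: powr_add)
        finally have u: "u * L ^ 10 \<le> exp 5" .
        have "4 * exp 5 * C1 * (L ^ 7 * u) \<le> L * (L ^ 7 * u)"
          using LR(1) L u0 by (intro mult_right_mono) auto
        also have "\<dots> = u * L ^ 8" unfolding L10(3) by (simp only: mult_ac)
        also have "\<dots> \<le> u * L ^ 10" using u0 L by (intro mult_left_mono power_increasing) auto
        finally have "4 * exp 5 * C1 * (L ^ 7 * u) \<le> exp 5 * 1" using u by linarith
        moreover have "4 * exp 5 * C1 * (L ^ 7 * u) = exp 5 * (4 * (C1 * L ^ 7 * u))" by (simp only: mult_ac)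
        ultimately have "exp 5 * (4 * (C1 * L ^ 7 * u)) \<le> exp 5 * 1" by linarith
        then have "4 * (C1 * L ^ 7 * u) \<le> 1" by (rule mult_left_le_imp_le) simp
        then show "C1 * L ^ 7 * (U powr (1 - 2 * \<alpha> + \<sigma>\<^sub>0) * TB) \<le> (1 / 2)\<^sup>2"
          unfolding eD u_def[symmetric] by (simp add: power2_eq_square)
        have "U powr (2 - 2 * \<alpha>) \<le> Ya" unfolding Ya_def using U \<alpha> by (intro powr_mono2) auto
        then show "U powr (2 - 2 * \<alpha>) \<le> Q * (1 / 2)\<^sup>2" using Q4 by (simp add: power2_eq_square)
      qed
    qed
    then have Sa: "real (card Sa) \<le> C1 * L ^ 8 * Q" by (simp add: L_def)
    \<comment> \<open>The squared threshold is a constant times Y^G / (T^(2B) L^2), and the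
      off-diagonal term is largest at the upper end X. Their comparison is the condition that
      defines Y.\<close>
    have Sb: "real (card Sb) \<le> C1 * L ^ 8 * Q"
    proof (rule shifted[OF _ order_refl X _ _ _ _ nmu])
      show "Sb \<subseteq> S" by (auto simp: Sb_def)
      show "X \<le> T powr (4 * \<kappa>)" using XY YY4 Y4 by linarith
      show "0 \<le> \<sigma>\<^sub>0" "\<sigma>\<^sub>0 \<le> 3" using sigma0_props by linarith+
      show "F0 \<subseteq> {M. 1 \<le> g M \<and> g M \<le> X}" using g_ge_1 by (auto simp: F0_def)
      show "0 < c * W / (L * TB)" using c W L TB by simp
      show "\<forall>s\<in>Sb. \<exists>t. \<bar>t - Im s\<bar> \<le> L \<and> c * W / (L * TB)
            \<le> norm (\<Sum>M\<in>F0. mu M * dterm M (Complex \<sigma>\<^sub>0 t))" by (simp add: Sb_def)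
      have V2: "(c * W / (L * TB))\<^sup>2 = c\<^sup>2 * (TB * X powr (h / 2) * L ^ 8)"
      proof -
        have "(c * W / (L * TB))\<^sup>2 = c\<^sup>2 * Y powr G / (L\<^sup>2 * (TB * TB))"
          unfolding power_divide power_mult_distrib W2 by (simp only: power2_eq_square[of TB])
        also have "\<dots> = c\<^sup>2 * (TB * X powr (h / 2) * L ^ 8) * (L\<^sup>2 * (TB * TB)) / (L\<^sup>2 * (TB * TB))"
          unfolding YG' by (simp only: mult_ac)
        also have "\<dots> = c\<^sup>2 * (TB * X powr (h / 2) * L ^ 8)"
          using L TB by (intro nonzero_mult_div_cancel_right) auto
        finally show ?thesis .
      qed
      show "\<forall>U. 1 \<le> U \<and> 1 \<le> exp 1 * U \<and> U \<le> X \<longrightarrow>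
        C1 * L ^ 7 * (U powr (1 - 2 * \<sigma>\<^sub>0 + \<sigma>\<^sub>0) * T powr B) \<le> (c * W / (L * TB))\<^sup>2
        \<and> U powr (2 - 2 * \<sigma>\<^sub>0) \<le> Q * (c * W / (L * TB))\<^sup>2"
        unfolding TB_def[symmetric] e0 V2
      proof (intro allI impI conjI)
        fix U assume U: "1 \<le> U \<and> 1 \<le> exp 1 * U \<and> U \<le> X"
        have "C1 * (L ^ 7 * (U powr (h / 2) * TB)) \<le> (c\<^sup>2 * L) * (L ^ 7 * (X powr (h / 2) * TB))"
          using U LR(3) L TB h C1(1) by (intro mult_mono powr_mono2 order_refl) auto
        then show "C1 * L ^ 7 * (U powr (h / 2) * TB) \<le> c\<^sup>2 * (TB * X powr (h / 2) * L ^ 8)"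
          unfolding L10(3) by (simp only: mult_ac)
        have "U powr h \<le> X powr h" using U h by (intro powr_mono2) auto
        also have "X powr h = X powr (h / 2) * (TB * L ^ 10 * X powr (2 - 2 * \<alpha>))"
        proof -
          have "h / 2 + (D / 2 + (2 - 2 * \<alpha>)) = h" by (simp add: h_def D_def field_simps)
          then show ?thesis unfolding TB_def XD[symmetric] powr_add[symmetric] by simp
        qed
        also have "\<dots> \<le> X powr (h / 2) * (TB * L ^ 10 * Ya)"
          unfolding Ya_def using X XY \<alpha> L TB by (intro mult_left_mono powr_mono2) auto
        also have "\<dots> = 1 * (X powr (h / 2) * (TB * L ^ 10 * Ya))" by simp
        also have "\<dots> \<le> L ^ 8 * (X powr (h / 2) * (TB * L ^ 10 * Ya))"
          using Lp[of 8] L TB Ya by (intro mult_right_mono) auto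
        also have "\<dots> = 1 / c\<^sup>2 * L ^ 10 * Ya * (c\<^sup>2 * (TB * X powr (h / 2) * L ^ 8))"
          using c by simp
        also have "\<dots> \<le> Q * (c\<^sup>2 * (TB * X powr (h / 2) * L ^ 8))"
          using L TB by (intro mult_right_mono Q1) auto
        finally show "U powr h \<le> Q * (c\<^sup>2 * (TB * X powr (h / 2) * L ^ 8))" .
      qed
    qed
    \<comment> \<open>Now U goes up to Y, but the threshold is larger by T^B. Since Y^G is the
      product of Y^(h / 2) and Y^(D / 2), it suffices that Y^(D / 2) \<ge> T^B L^10, which holds
      because Y \<ge> X.\<close>
    have Sc: "real (card Sc) \<le> C1 * L ^ 8 * Q"
    proof (rule shifted[OF _ X XY _ _ _ _ nm])
      show "Sc \<subseteq> S" by (auto simp: Sc_def)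
      show "Y \<le> T powr (4 * \<kappa>)" using YY4 Y4 by linarith
      show "0 \<le> \<sigma>\<^sub>0" "\<sigma>\<^sub>0 \<le> 3" using sigma0_props by linarith+
      show "F1 \<subseteq> {M. X \<le> g M \<and> g M \<le> Y}" by (auto simp: F1_def)
      show "0 < c * W / L" using c W L by simp
      show "\<forall>s\<in>Sc. \<exists>t. \<bar>t - Im s\<bar> \<le> L \<and> c * W / L
            \<le> norm (\<Sum>M\<in>F1. mcoeff X M * dterm M (Complex \<sigma>\<^sub>0 t))" by (simp add: Sc_def)
      have V2: "(c * W / L)\<^sup>2 = c\<^sup>2 * Y powr G / L\<^sup>2"
        unfolding power_divide power_mult_distrib W2 ..
      show "\<forall>U. 1 \<le> U \<and> X \<le> exp 1 * U \<and> U \<le> Y \<longrightarrow>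
        C1 * L ^ 7 * (U powr (1 - 2 * \<sigma>\<^sub>0 + \<sigma>\<^sub>0) * T powr B) \<le> (c * W / L)\<^sup>2
        \<and> U powr (2 - 2 * \<sigma>\<^sub>0) \<le> Q * (c * W / L)\<^sup>2"
        unfolding TB_def[symmetric] e0 V2
      proof (intro allI impI conjI)
        fix U assume U: "1 \<le> U \<and> X \<le> exp 1 * U \<and> U \<le> Y"
        have GD: "G = h / 2 + D / 2" by (simp add: G_def h_def D_def field_simps)
        have "C1 * (L ^ 7 * (U powr (h / 2) * TB)) \<le> (c\<^sup>2 * L) * (L ^ 7 * (Y powr (h / 2) * TB))"
          using U LR(3) L TB h C1(1) by (intro mult_mono powr_mono2 order_refl) auto
        also have "\<dots> = c\<^sup>2 * (Y powr (h / 2) * (TB * L ^ 10)) / L\<^sup>2"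
          unfolding L10(1) L10(3) using L by simp
        also have "\<dots> \<le> c\<^sup>2 * (Y powr (h / 2) * Y powr (D / 2)) / L\<^sup>2"
          using YD by (intro divide_right_mono mult_left_mono) auto
        finally show "C1 * L ^ 7 * (U powr (h / 2) * TB) \<le> c\<^sup>2 * Y powr G / L\<^sup>2"
          unfolding GD powr_add by (simp only: mult.assoc)
        have "U powr h \<le> Y powr h" using U h by (intro powr_mono2) auto
        also have "Y powr h = 1 / c\<^sup>2 * L\<^sup>2 * Ya * (c\<^sup>2 * Y powr G / L\<^sup>2)"
        proof -
          have "(2 - 2 * \<alpha>) + G = h" by (simp add: h_def G_def)
          then have "Y powr h = Ya * Y powr G" unfolding Ya_def powr_add[symmetric] by simp
          then show ?thesis using c L by simp
        qed
        also have "\<dots> \<le> 1 / c\<^sup>2 * L ^ 10 * Ya * (c\<^sup>2 * Y powr G / L\<^sup>2)"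
          using L Ya by (intro mult_right_mono mult_left_mono power_increasing) auto
        also have "\<dots> \<le> Q * (c\<^sup>2 * Y powr G / L\<^sup>2)" by (intro mult_right_mono Q1) simp
        finally show "U powr h \<le> Q * (c\<^sup>2 * Y powr G / L\<^sup>2)" .
      qed
    qed
    \<comment> \<open>On Re s = 3 all powers of U decrease, so the lower end Y decides; there the
      off-diagonal condition again reduces to Y^(D / 2) \<ge> T^B L^10.\<close>
    have Sd: "real (card Sd) \<le> C1 * L ^ 8 * Q"
    proof (rule shifted[OF _ Y YY4 Y4 _ _ _ nm])
      show "Sd \<subseteq> S" by (auto simp: Sd_def)
      show "(0 :: real) \<le> 3" "(3 :: real) \<le> 3" by auto
      show "F2 \<subseteq> {M. Y \<le> g M \<and> g M \<le> Y ^ 4}" by (auto simp: F2_def)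
      show "0 < c * Y powr (\<alpha> - 3) / L" using c Y L by simp
      show "\<forall>s\<in>Sd. \<exists>t. \<bar>t - Im s\<bar> \<le> L \<and> c * Y powr (\<alpha> - 3) / L
            \<le> norm (\<Sum>M\<in>F2. mcoeff X M * dterm M (Complex 3 t))" by (simp add: Sd_def)
      define P where "P = Y powr (2 * \<alpha> - 6)"
      have P: "0 < P" using Y by (simp add: P_def)
      have V2: "(c * Y powr (\<alpha> - 3) / L)\<^sup>2 = c\<^sup>2 * P / L\<^sup>2"
        unfolding power_divide power_mult_distrib P_def
        unfolding power2_eq_square[of "Y powr (\<alpha> - 3)"] powr_add[symmetric] by simp
      show "\<forall>U. 1 \<le> U \<and> Y \<le> exp 1 * U \<and> U \<le> Y ^ 4 \<longrightarrow>
        C1 * L ^ 7 * (U powr (1 - 2 * 3 + \<sigma>\<^sub>0) * T powr B) \<le> (c * Y powr (\<alpha> - 3) / L)\<^sup>2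
        \<and> U powr (2 - 2 * 3) \<le> Q * (c * Y powr (\<alpha> - 3) / L)\<^sup>2"
        unfolding TB_def[symmetric] V2
      proof (intro allI impI conjI)
        fix U assume U: "1 \<le> U \<and> Y \<le> exp 1 * U \<and> U \<le> Y ^ 4"
        have m: "1 - 2 * 3 + \<sigma>\<^sub>0 = - (5 - \<sigma>\<^sub>0)" by simp
        have PD: "P = Y powr - (5 - \<sigma>\<^sub>0) * Y powr (D / 2)"
        proof -
          have "- (5 - \<sigma>\<^sub>0) + D / 2 = 2 * \<alpha> - 6" by (simp add: D_def field_simps)
          then show ?thesis unfolding P_def powr_add[symmetric] by (simp only:)
        qed
        have dU: "U powr - (5 - \<sigma>\<^sub>0) \<le> exp 5 * Y powr - (5 - \<sigma>\<^sub>0)"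
          using U Y sigma0_props by (intro down) linarith+
        have "C1 * (L ^ 7 * (U powr - (5 - \<sigma>\<^sub>0) * TB)) \<le> C1 * (L ^ 7 * ((exp 5 * Y powr - (5 - \<sigma>\<^sub>0)) * TB))"
          using C1(1) L TB by (intro mult_left_mono mult_right_mono dU) auto
        also have "\<dots> = (C1 * exp 5) * (L ^ 7 * (Y powr - (5 - \<sigma>\<^sub>0) * TB))" by (simp only: mult_ac)
        also have "\<dots> \<le> (c\<^sup>2 * L) * (L ^ 7 * (Y powr - (5 - \<sigma>\<^sub>0) * TB))"
          using LR(2) L TB by (intro mult_right_mono) auto
        also have "\<dots> = c\<^sup>2 * (Y powr - (5 - \<sigma>\<^sub>0) * (TB * L ^ 10)) / L\<^sup>2"
          unfolding L10(1) L10(3) using L by simp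
        also have "\<dots> \<le> c\<^sup>2 * P / L\<^sup>2"
          unfolding PD using YD by (intro divide_right_mono mult_left_mono) auto
        finally show "C1 * L ^ 7 * (U powr (1 - 2 * 3 + \<sigma>\<^sub>0) * TB) \<le> c\<^sup>2 * P / L\<^sup>2"
          unfolding m by (simp only: mult.assoc)
        have YP: "Y powr - 4 = Ya * P" unfolding Ya_def P_def powr_add[symmetric] by simp
        have "U powr - 4 \<le> exp 5 * Y powr - 4" using U Y by (intro down) auto
        also have "\<dots> = exp 5 / c\<^sup>2 * L\<^sup>2 * Ya * (c\<^sup>2 * P / L\<^sup>2)" unfolding YP using c L by simp
        also have "\<dots> \<le> exp 5 / c\<^sup>2 * L ^ 10 * Ya * (c\<^sup>2 * P / L\<^sup>2)"
          using L Ya P by (intro mult_right_mono mult_left_mono power_increasing) auto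
        also have "\<dots> \<le> Q * (c\<^sup>2 * P / L\<^sup>2)" using P by (intro mult_right_mono Q5) simp
        finally show "U powr (2 - 2 * 3) \<le> Q * (c\<^sup>2 * P / L\<^sup>2)" by simp
      qed
    qed
    have "card S \<le> card (Sa \<union> (Sb \<union> (Sc \<union> Sd)))"
      using finS by (intro card_mono cover) (auto simp: Sa_def Sb_def Sc_def Sd_def)
    also have "\<dots> \<le> card Sa + (card Sb + (card Sc + card Sd))"
      by (intro order_trans[OF card_Un_le] add_mono order_refl)
    finally have "real (card S) \<le> real (card Sa) + (real (card Sb) + (real (card Sc) + real (card Sd)))"
      by linarith
    also have "\<dots> \<le> 4 * (C1 * L ^ 8 * Q)" using Sa Sb Sc Sd by linarith
    also have "\<dots> = 4 * C1 * C5 * Ya * (L ^ 8 * L ^ 10)" unfolding Q_def by (simp only: mult_ac)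
    also have "\<dots> \<le> 4 * C1 * C5 * (T powr E * L powr k) * (L ^ 8 * L ^ 10)"
      using YE C1 C5 L by (intro mult_right_mono mult_left_mono) (auto simp: Ya_def)
    also have "\<dots> = 4 * C1 * C5 * T powr E * (L powr k * (L ^ 8 * L ^ 10))" by (simp only: mult_ac)
    also have "L powr k * (L ^ 8 * L ^ 10) = L powr (k + 18)"
      using L by (simp add: powr_add flip: power_add)
    finally show "real (card S) \<le> 4 * C1 * C5 * T powr (8 * B * (3 * \<alpha> - 2 - \<theta>) * (1 - \<alpha>)
            / ((2 * \<alpha> - 1 - \<theta>) * (4 * \<alpha> - 3 - \<theta>))) * ln T powr (k + 18)"
      unfolding E_def D_def G_def L_def .
  qed (use C1 C5 \<kappa> in auto)
qed

text \<open>The large value argument is uniform only at distance at least \<eta> / 4 from the left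
  end; closer to it the first estimate takes over. At \<alpha> = (3 + \<theta>) / 4 itself a
  denominator of the exponent vanishes, so the end point is left out.\<close>

lemma zero_density_2:
  obtains C K where "0 < C"
    "\<And>T \<alpha>. 2 \<le> T \<Longrightarrow> (3 + \<theta>) / 4 < \<alpha> \<Longrightarrow> real (\<Sum>\<rho>\<in>zeta_zeros p \<theta> \<alpha> T. mult \<rho>)
        \<le> C * T powr (8 * B * (3 * \<alpha> - 2 - \<theta>) * (1 - \<alpha>)
            / ((2 * \<alpha> - 1 - \<theta>) * (4 * \<alpha> - 3 - \<theta>))) * ln T powr K"
proof -
  define E where "E \<alpha> = 8 * B * (3 * \<alpha> - 2 - \<theta>) * (1 - \<alpha>) / ((2 * \<alpha> - 1 - \<theta>) * (4 * \<alpha> - 3 - \<theta>))" for \<alpha>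
  \<comment> \<open>\<eta> solves B / \<eta> = (1 + 2 B) / h, so that for 4 \<alpha> - 3 - \<theta>
    \<le> \<eta> the second exponent is at least the first.\<close>
  define h \<eta> where "h = 1 - \<theta>" and "\<eta> = B * h / (1 + 2 * B)"
  have h: "0 < h" using theta_less_1 by (simp add: h_def)
  have \<eta>: "0 < \<eta>" using h B_pos by (simp add: \<eta>_def)
  have E0: "0 \<le> E \<alpha>" if "\<alpha> \<le> 1" "(3 + \<theta>) / 4 < \<alpha>" for \<alpha>
    using that B_pos theta_less_1 unfolding E_def
    by (intro divide_nonneg_nonneg mult_nonneg_nonneg) (auto simp: field_simps)
  (* Near the left end of the range the factor 1 / (4 alpha - 3 - theta) makes the first estimate the better one. *)
  have E1: "2 * (1 + 2 * B) * (1 - \<alpha>) / (1 - \<theta>) \<le> E \<alpha>"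
    if \<alpha>: "\<alpha> \<le> 1" "(3 + \<theta>) / 4 < \<alpha>" "\<alpha> < (3 + \<theta> + \<eta>) / 4" for \<alpha>
  proof -
    define D where "D = 4 * \<alpha> - 3 - \<theta>"
    have D: "0 < D" "D \<le> \<eta>" using \<alpha> by (auto simp: D_def field_simps)
    have "(1 + 2 * B) / h = B / \<eta>" using h B_pos by (simp add: \<eta>_def)
    also have "\<dots> \<le> B / D" using D B_pos by (intro divide_left_mono) auto
    also have "\<dots> \<le> B / D * ((3 * D + h) / (D + h))" using D h B_pos mult_left_mono[of 1 "(3 * D + h) / (D + h)" "B / D"]
      by simp
    finally have *: "(1 + 2 * B) / h \<le> B / D * ((3 * D + h) / (D + h))" .
    have "2 * (1 + 2 * B) * (1 - \<alpha>) / (1 - \<theta>) = 2 * (1 - \<alpha>) * ((1 + 2 * B) / h)"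
      unfolding h_def by (simp only: times_divide_eq_right mult_ac)
    also have "\<dots> \<le> 2 * (1 - \<alpha>) * (B / D * ((3 * D + h) / (D + h)))"
      using \<alpha> by (intro mult_left_mono *) auto
    also have "\<dots> \<le> 4 * (1 - \<alpha>) * (B / D * ((3 * D + h) / (D + h)))"
      using \<alpha> D h B_pos by (intro mult_right_mono) auto
    also have "\<dots> = E \<alpha>"
    proof -
      have e: "2 * \<alpha> - 1 - \<theta> = (D + h) / 2" "3 * \<alpha> - 2 - \<theta> = (3 * D + h) / 4"
        by (simp_all add: D_def h_def field_simps)
      have "4 * b * (B / D * (x / z)) = 8 * B * (x / 4) * b / (z / 2 * D)" for b x z :: real
        by (simp add: mult_ac)
      then show ?thesis unfolding E_def D_def[symmetric] e .
    qed
    finally show ?thesis .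
  qed
  obtain C1 where C1: "0 < C1"
    "\<And>T \<alpha>. 2 \<le> T \<Longrightarrow> \<sigma>\<^sub>0 \<le> \<alpha> \<Longrightarrow> real (\<Sum>\<rho>\<in>zeta_zeros p \<theta> \<alpha> T. mult \<rho>)
        \<le> C1 * T powr (2 * (1 + 2 * B) * (1 - \<alpha>) / (1 - \<theta>)) * ln T ^ 9"
    by (rule zero_density_1) (rule that)
  obtain C2 where C2: "0 < C2"
    "\<And>T \<alpha>. 64 \<le> T \<Longrightarrow> \<sigma>\<^sub>0 \<le> \<alpha> \<Longrightarrow> \<exists>S. finite S \<and>
      S \<subseteq> {\<rho>. Z \<rho> = 0 \<and> \<alpha> \<le> Re \<rho> \<and> Re \<rho> \<le> 1 \<and> ln T + 2 \<le> \<bar>Im \<rho>\<bar> \<and> \<bar>Im \<rho>\<bar> \<le> T} \<and>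
      (\<forall>s\<in>S. \<forall>s'\<in>S. s \<noteq> s' \<longrightarrow> 4 * ln T \<le> \<bar>Im s - Im s'\<bar>) \<and>
      real (\<Sum>\<rho>\<in>zeta_zeros p \<theta> \<alpha> T. mult \<rho>) \<le> C2 * (ln T)\<^sup>2 * (1 + real (card S))"
    by (rule zero_count_split) (rule that)
  obtain C3 T0 k where C3: "0 < C3" "64 \<le> T0" "0 \<le> k"
    "\<And>T \<alpha> S. T0 \<le> T \<Longrightarrow> (3 + \<theta> + \<eta>) / 4 \<le> \<alpha> \<Longrightarrow> \<alpha> \<le> 1 \<Longrightarrow> finite S \<Longrightarrow>
      S \<subseteq> {\<rho>. Z \<rho> = 0 \<and> \<alpha> \<le> Re \<rho> \<and> Re \<rho> \<le> 1 \<and> ln T + 2 \<le> \<bar>Im \<rho>\<bar> \<and> \<bar>Im \<rho>\<bar> \<le> T} \<Longrightarrow>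
      \<forall>s\<in>S. \<forall>s'\<in>S. s \<noteq> s' \<longrightarrow> 4 * ln T \<le> \<bar>Im s - Im s'\<bar> \<Longrightarrow>
      real (card S) \<le> C3 * T powr (8 * B * (3 * \<alpha> - 2 - \<theta>) * (1 - \<alpha>)
            / ((2 * \<alpha> - 1 - \<theta>) * (4 * \<alpha> - 3 - \<theta>))) * ln T powr k"
    by (rule separated_zeros_bound_large_values[OF \<eta>]) (rule that)
  define N where "N \<alpha> T = real (\<Sum>\<rho>\<in>zeta_zeros p \<theta> \<alpha> T. mult \<rho>)" for \<alpha> T
  \<comment> \<open>Leaves room both for the power 9 of the first estimate and for the power k + 2
    of the large value argument.\<close>
  define K where "K = k + 9"
  define C0 where "C0 = N \<sigma>\<^sub>0 T0 / ln 2 powr K"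
  define C where "C = C0 + C1 + C2 * (1 + C3)"
  have C0: "0 \<le> C0" by (simp add: C0_def N_def sum_nonneg)
  have C23: "0 < C2 * (1 + C3)" using C2 C3 by simp
  have C: "0 < C" "C0 \<le> C" "C1 \<le> C" "C2 * (1 + C3) \<le> C"
    using C0 C1 C23 by (auto simp: C_def)
  show ?thesis
  proof (rule that[OF C(1)])
    fix T \<alpha> :: real assume T: "2 \<le> T" and \<alpha>: "(3 + \<theta>) / 4 < \<alpha>"
    have \<alpha>0: "\<sigma>\<^sub>0 \<le> \<alpha>" using \<alpha> theta_less_1 by (simp add: field_simps)
    consider "1 < \<alpha>" | "\<alpha> \<le> 1" "T < T0" | "\<alpha> \<le> 1" "T0 \<le> T" "\<alpha> < (3 + \<theta> + \<eta>) / 4"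
      | "\<alpha> \<le> 1" "T0 \<le> T" "(3 + \<theta> + \<eta>) / 4 \<le> \<alpha>" by linarith
    then have "N \<alpha> T \<le> C * T powr E \<alpha> * ln T powr K"
    proof cases
      case 1
      have "zeta_zeros p \<theta> \<alpha> T \<subseteq> {\<rho>. \<rho> \<noteq> 1 \<and> Z \<rho> = 0 \<and> \<alpha> \<le> Re \<rho> \<and> Re \<rho> \<le> 1 \<and> \<bar>Im \<rho>\<bar> \<le> T}"
        using \<alpha>0 sigma0_props by (intro zeta_zeros_subset) linarith
      then have "zeta_zeros p \<theta> \<alpha> T = {}" using 1 by force
      then show ?thesis using C(1) by (simp add: N_def)
    next
      case 2
      have "finite (zeta_zeros p \<theta> \<sigma>\<^sub>0 T0)" using sigma0_props by (intro finite_zeta_zeros)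
      moreover have "zeta_zeros p \<theta> \<alpha> T \<subseteq> zeta_zeros p \<theta> \<sigma>\<^sub>0 T0"
        using \<alpha>0 2 unfolding zeta_zeros_def by auto
      ultimately have "N \<alpha> T \<le> N \<sigma>\<^sub>0 T0"
        unfolding N_def by (intro of_nat_mono sum_mono2) auto
      also have "\<dots> = C0 * 1 * ln 2 powr K" by (simp add: C0_def)
      also have "\<dots> \<le> C * T powr E \<alpha> * ln T powr K"
        using C C0 T C3(3) E0[OF 2(1) \<alpha>]
        by (intro mult_mono powr_mono2 ln_mono) (auto simp: ge_one_powr_ge_zero K_def)
      finally show ?thesis .
    next
      case 3
      have T64: "64 \<le> T" using 3 C3(2) by simp
      note L = ln_square_large[OF T64]
      have "N \<alpha> T \<le> C1 * T powr (2 * (1 + 2 * B) * (1 - \<alpha>) / (1 - \<theta>)) * ln T ^ 9"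
        unfolding N_def by (rule C1(2)[OF T \<alpha>0])
      also have "\<dots> \<le> C * T powr E \<alpha> * ln T powr K"
      proof (intro mult_mono C powr_mono E1[OF 3(1) \<alpha> 3(3)])
        have "ln T ^ 9 = ln T powr 9" using L by simp
        also have "\<dots> \<le> ln T powr K" using L C3(3) by (intro powr_mono) (auto simp: K_def)
        finally show "ln T ^ 9 \<le> ln T powr K" .
      qed (use C T64 L in auto)
      finally show ?thesis .
    next
      case 4
      have T64: "64 \<le> T" using 4 C3(2) by simp
      define L where "L = ln T"
      have L: "1 \<le> L" using ln_square_large[OF T64] by (simp add: L_def)
      obtain S where S: "finite S"
        "S \<subseteq> {\<rho>. Z \<rho> = 0 \<and> \<alpha> \<le> Re \<rho> \<and> Re \<rho> \<le> 1 \<and> ln T + 2 \<le> \<bar>Im \<rho>\<bar> \<and> \<bar>Im \<rho>\<bar> \<le> T}"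
        "\<forall>s\<in>S. \<forall>s'\<in>S. s \<noteq> s' \<longrightarrow> 4 * ln T \<le> \<bar>Im s - Im s'\<bar>"
        "real (\<Sum>\<rho>\<in>zeta_zeros p \<theta> \<alpha> T. mult \<rho>) \<le> C2 * (ln T)\<^sup>2 * (1 + real (card S))"
        using C2(2)[OF T64 \<alpha>0] by (elim exE conjE)
      have S3: "real (card S) \<le> C3 * T powr E \<alpha> * L powr k"
        unfolding E_def L_def by (rule C3(4)[OF 4(2,3,1) S(1-3)])
      have "1 * 1 \<le> T powr E \<alpha> * L powr k"
        using L T E0[OF 4(1) \<alpha>] C3(3) by (intro mult_mono) (auto simp: ge_one_powr_ge_zero)
      then have "1 + real (card S) \<le> (1 + C3) * (T powr E \<alpha> * L powr k)"
        using S3 by (simp add: algebra_simps)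
      then have "C2 * L\<^sup>2 * (1 + real (card S)) \<le> C2 * L\<^sup>2 * ((1 + C3) * (T powr E \<alpha> * L powr k))"
        using C2(1) by (intro mult_left_mono) auto
      then have "N \<alpha> T \<le> C2 * L\<^sup>2 * ((1 + C3) * (T powr E \<alpha> * L powr k))"
        using S(4) unfolding N_def L_def by linarith
      also have "\<dots> = C2 * (1 + C3) * T powr E \<alpha> * (L\<^sup>2 * L powr k)" by (simp only: mult_ac)
      also have "\<dots> \<le> C * T powr E \<alpha> * L powr K"
      proof (intro mult_mono C order_refl)
        have "L\<^sup>2 * L powr k = L powr (2 + k)" using L by (simp add: powr_add)
        also have "\<dots> \<le> L powr K" using L by (intro powr_mono) (auto simp: K_def)
        finally show "L\<^sup>2 * L powr k \<le> L powr K" .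
      qed (use C L in auto)
      finally show ?thesis by (simp add: L_def)
    qed
    then show "real (\<Sum>\<rho>\<in>zeta_zeros p \<theta> \<alpha> T. mult \<rho>)
        \<le> C * T powr (8 * B * (3 * \<alpha> - 2 - \<theta>) * (1 - \<alpha>)
            / ((2 * \<alpha> - 1 - \<theta>) * (4 * \<alpha> - 3 - \<theta>))) * ln T powr K"
      by (simp add: N_def E_def)
  qed
qed

end

theorem theorem5p2:
  fixes p :: "nat \<Rightarrow> real" and A \<theta> B :: real
  assumes "beurling_primes p"
    and "0 < A" and "0 \<le> \<theta>" and "\<theta> < 1"
    and "(\<lambda>x. real (gen_int_count p x) - A * x) \<in> O[at_top](\<lambda>x. x powr \<theta>)"
    and "0 < B" and "B < 1 / 2"
    and "\<exists>C. \<forall>t. 1 \<le> \<bar>t\<bar> \<longrightarrow>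
           norm (beurling_zeta p \<theta> (Complex ((1 + \<theta>) / 2) t)) \<le> C * \<bar>t\<bar> powr B"
  shows "(\<exists>C. \<forall>T\<ge>2. \<forall>\<alpha>\<ge>(1 + \<theta>) / 2.
            finite (zeta_zeros p \<theta> \<alpha> T) \<and>
            real (zeta_zero_count p \<theta> \<alpha> T)
              \<le> C * T powr (2 * (1 + 2 * B) * (1 - \<alpha>) / (1 - \<theta>)) * ln T ^ 9) \<and>
         (\<exists>C K. \<forall>T\<ge>2. \<forall>\<alpha>>(3 + \<theta>) / 4.
            real (zeta_zero_count p \<theta> \<alpha> T)
              \<le> C * T powr (8 * B * (3 * \<alpha> - 2 - \<theta>) * (1 - \<alpha>)
                            / ((2 * \<alpha> - 1 - \<theta>) * (4 * \<alpha> - 3 - \<theta>))) * ln T powr K)"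
proof -
  obtain C0 where C0: "0 < C0" "\<And>x. 0 < x \<Longrightarrow> \<bar>real (gen_int_count p x) - A * x\<bar> \<le> C0 * x powr \<theta>"
    by (rule gen_int_count_bound_all[OF assms(1-5)]) (rule that)
  obtain C where C: "\<And>t. 1 \<le> \<bar>t\<bar> \<Longrightarrow>
      norm (beurling_zeta p \<theta> (Complex ((1 + \<theta>) / 2) t)) \<le> C * \<bar>t\<bar> powr B"
    using assms(8) by blast
  have K0: "norm (beurling_zeta p \<theta> (Complex ((1 + \<theta>) / 2) t)) \<le> max 1 C * \<bar>t\<bar> powr B" if "1 \<le> \<bar>t\<bar>" for t
  proof -
    have "C * \<bar>t\<bar> powr B \<le> max 1 C * \<bar>t\<bar> powr B" by (intro mult_right_mono) auto
    then show ?thesis using C[OF that] by linarith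
  qed
  interpret beurling_subconvex p A \<theta> C0 B "max 1 C"
    by unfold_locales (use assms(1-4,6) C0 K0 in auto)
  have count: "zeta_zero_count p \<theta> \<alpha> T = (\<Sum>\<rho>\<in>zeta_zeros p \<theta> \<alpha> T. mult \<rho>)" for \<alpha> T
    by (simp add: zeta_zero_count_def mult_def)
  obtain D1 where D1: "\<And>T \<alpha>. 2 \<le> T \<Longrightarrow> \<sigma>\<^sub>0 \<le> \<alpha> \<Longrightarrow> real (\<Sum>\<rho>\<in>zeta_zeros p \<theta> \<alpha> T. mult \<rho>)
      \<le> D1 * T powr (2 * (1 + 2 * B) * (1 - \<alpha>) / (1 - \<theta>)) * ln T ^ 9"
    by (rule zero_density_1) (rule that)
  obtain D2 K where D2: "\<And>T \<alpha>. 2 \<le> T \<Longrightarrow> (3 + \<theta>) / 4 < \<alpha> \<Longrightarrow> real (\<Sum>\<rho>\<in>zeta_zeros p \<theta> \<alpha> T. mult \<rho>)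
      \<le> D2 * T powr (8 * B * (3 * \<alpha> - 2 - \<theta>) * (1 - \<alpha>)
            / ((2 * \<alpha> - 1 - \<theta>) * (4 * \<alpha> - 3 - \<theta>))) * ln T powr K"
    by (rule zero_density_2) (rule that)
  have fin: "finite (zeta_zeros p \<theta> \<alpha> T)" if "\<sigma>\<^sub>0 \<le> \<alpha>" for \<alpha> T
    using that sigma0_props by (intro finite_zeta_zeros) linarith
  show ?thesis
  proof (intro conjI exI allI impI)
    show "finite (zeta_zeros p \<theta> \<alpha> T)" if "2 \<le> T" "(1 + \<theta>) / 2 \<le> \<alpha>" for T \<alpha>
      by (rule fin[OF that(2)])
    show "real (zeta_zero_count p \<theta> \<alpha> T) \<le> D1 * T powr (2 * (1 + 2 * B) * (1 - \<alpha>) / (1 - \<theta>)) * ln T ^ 9"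
      if "2 \<le> T" "(1 + \<theta>) / 2 \<le> \<alpha>" for T \<alpha>
      unfolding count by (rule D1[OF that])
    show "real (zeta_zero_count p \<theta> \<alpha> T) \<le> D2 * T powr (8 * B * (3 * \<alpha> - 2 - \<theta>) * (1 - \<alpha>)
            / ((2 * \<alpha> - 1 - \<theta>) * (4 * \<alpha> - 3 - \<theta>))) * ln T powr K"
      if "2 \<le> T" "(3 + \<theta>) / 4 < \<alpha>" for T \<alpha>
      unfolding count by (rule D2[OF that])
  qed
qed

end
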